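(* Let $S\subset\mathbb{CP}_4$ be a Segre surface whose Segre symbol is one of $[111(11)]$, $[12(11)]$, $[11(12)]$, $[1(13)]$, $[(11)3]$, $[(12)2]$, $[(14)]$. Then the cuspidal locus in the dual variety $S^*$ is an irreducible surface, and it is birational to $S$.
   Context: A Segre surface is a non-degenerate irreducible 2-dimensional subvariety $S\subset\mathbb{CP}_4$ of degree four which is neither a cone over a quartic curve in $\mathbb{CP}_3$ nor a projection of a quartic surface in $\mathbb{CP}_5$. (Every Segre surface is a complete intersection of two quadrics, its singularities are finitely many rational double points, and it contains only finitely many straight lines.) $S_{\rm reg}$ denotes the smooth locus. Segre symbol: write $S=\{{}^tXPX={}^tXQX=0\}$ with symmetric $5\times5$ matrices $P,Q$, the generators of the pencil of quadrics being chosen with $Q$ invertible. The Segre symbol lists the sizes of the Jordan blocks of $Q^{-1}P$, with the sizes of blocks belonging to the same eigenvalue grouped in parentheses when there is more than one block; the order of entries is irrelevant. The sixteen symbols that occur for Segre surfaces are $[11111]$, $[1112]$, $[111(11)]$, $[12(11)]$, $[1(11)(11)]$, $[113]$, $[122]$, $[11(12)]$, $[14]$, $[1(13)]$, $[(11)3]$, $[(12)2]$, $[(11)(12)]$, $[(14)]$, $[23]$, $[5]$. Tangent planes $T_pS$, $p\in S_{\rm reg}$, are regarded as projective 2-planes in $\mathbb{CP}_4$. The incidence variety $I(S)\subset\mathbb{CP}_4\times\mathbb{CP}_4^*$ is the closure of the set of pairs $(p,H)$ with $p\in S_{\rm reg}$ and $H$ a hyperplane containing $T_pS$; $\pi_1:I(S)\to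 S$ and $\pi_2:I(S)\to\mathbb{CP}_4^*$ are the projections, and the dual variety is $S^*=\pi_2(I(S))$. Let $S^*_{\rm cusp}\subset S^*$ be the image under $\pi_2$ of the closure in $I(S)$ of the set of $(p,H)\in I(S)$ such that $p\in S_{\rm reg}$ and the singularity of $H|_S$ at $p$ is not an ordinary node. The cuspidal locus in $S^*$ is the union of those irreducible components of $S^*_{\rm cusp}$ whose generic point corresponds to a hyperplane section having an ordinary cusp at a smooth point of $S$. *)

theory Defs
  imports
    "HOL-Analysis.Analysis"
    "HOL-Library.Multiset"
    "HOL-Library.Numeral_Type"
    "Jordan_Normal_Form.Jordan_Normal_Form"
begin

no_notation Matrix.vec_index (infixl "$" 100)

section \<open>Complex projective space and its Zariski topology\<close>

text \<open>The points of \<open>'n cp\<close> are the lines through the origin of \<open>complex ^ 'n\<close>, so \<open>5 cp\<close> is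
  \<open>CP\<^sub>4\<close>. The dual space is represented by the same type: \<open>H :: 5 cp\<close>, spanned by \<open>h\<close>, stands for
  the hyperplane given by the linear form \<open>dpair h\<close>.\<close>

typedef 'n cp = "{L :: (complex ^ 'n::finite) set. vec.subspace L \<and> vec.dim L = 1}"
  morphisms line_of cp_of_line
proof -
  have "vec.dim (vec.span {axis undefined 1 :: complex ^ 'n}) = 1"
    by (simp add: vec.dim_span vec.dim_eq_card_independent)
  then show ?thesis
    using vec.subspace_span by blast
qed

definition pt :: "complex ^ 'n::finite \<Rightarrow> 'n cp" where
  "pt x = cp_of_line (vec.span {x})"

definition dpair :: "complex ^ 'n::finite \<Rightarrow> complex ^ 'n \<Rightarrow> complex" where
  "dpair h x = (\<Sum>i\<in>UNIV. h $ i * x $ i)"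

definition lies_on :: "'n::finite cp \<Rightarrow> 'n cp \<Rightarrow> bool" where
  "lies_on p H \<longleftrightarrow> (\<forall>x\<in>line_of p. \<forall>h\<in>line_of H. dpair h x = 0)"

text \<open>Polynomial functions in a given set of coordinate functions. Over the infinite field of
  complex numbers polynomials may be identified with the functions they define.\<close>

inductive_set poly_fun :: "('a \<Rightarrow> complex) set \<Rightarrow> ('a \<Rightarrow> complex) set"
  for C :: "('a \<Rightarrow> complex) set" where
  const: "(\<lambda>_. c) \<in> poly_fun C"
| coord: "f \<in> C \<Longrightarrow> f \<in> poly_fun C"
| add: "f \<in> poly_fun C \<Longrightarrow> g \<in> poly_fun C \<Longrightarrow> (\<lambda>x. f x + g x) \<in> poly_fun C"
| mult: "f \<in> poly_fun C \<Longrightarrow> g \<in> poly_fun C \<Longrightarrow> (\<lambda>x. f x * g x) \<in> poly_fun C"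

definition hpoly :: "nat \<Rightarrow> (complex ^ 'n::finite \<Rightarrow> complex) set" where
  "hpoly d = {f \<in> poly_fun (range (\<lambda>i x. x $ i)). \<forall>c x. f (c *s x) = c ^ d * f x}"

definition bihpoly ::
  "nat \<Rightarrow> nat \<Rightarrow> ((complex ^ 'n::finite) \<times> (complex ^ 'm::finite) \<Rightarrow> complex) set" where
  "bihpoly d e =
     {f \<in> poly_fun (range (\<lambda>i z. fst z $ i) \<union> range (\<lambda>i z. snd z $ i)).
        \<forall>a b x y. f (a *s x, b *s y) = a ^ d * b ^ e * f (x, y)}"

definition zariski :: "'n::finite cp topology" where
  "zariski = topology_generated_by
     {{p. \<exists>x\<in>line_of p. f x \<noteq> 0} | f d. f \<in> hpoly d}"

text \<open>This is the Zariski topology of the product variety, which is finer than the product of the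
  two Zariski topologies.\<close>

definition zariski_prod :: "('n::finite cp \<times> 'm::finite cp) topology" where
  "zariski_prod = topology_generated_by
     {{(p, q). \<exists>x\<in>line_of p. \<exists>y\<in>line_of q. f (x, y) \<noteq> 0} | f d e. f \<in> bihpoly d e}"

section \<open>Irreducibility, dimension and degree\<close>

definition irred_in :: "'a topology \<Rightarrow> 'a set \<Rightarrow> bool" where
  "irred_in T X \<longleftrightarrow> X \<subseteq> topspace T \<and> X \<noteq> {} \<and>
     (\<forall>A B. closedin T A \<and> closedin T B \<and> X \<subseteq> A \<union> B \<longrightarrow> X \<subseteq> A \<or> X \<subseteq> B)"

definition irred_components :: "'a topology \<Rightarrow> 'a set \<Rightarrow> 'a set set" where
  "irred_components T X =
     {Z. Z \<subseteq> X \<and> irred_in T Z \<and> (\<forall>Z'. Z \<subseteq> Z' \<and> Z' \<subseteq> X \<and> irred_in T Z' \<longrightarrow> Z' = Z)}"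

definition irred_chain :: "'a topology \<Rightarrow> 'a set \<Rightarrow> nat \<Rightarrow> bool" where
  "irred_chain T X n \<longleftrightarrow> (\<exists>Z :: nat \<Rightarrow> 'a set.
     (\<forall>i\<le>n. closedin T (Z i) \<and> irred_in T (Z i) \<and> Z i \<subseteq> X) \<and> (\<forall>i<n. Z i \<subset> Z (Suc i)))"

text \<open>Krull dimension of a closed set.\<close>

definition has_dim :: "'a topology \<Rightarrow> 'a set \<Rightarrow> nat \<Rightarrow> bool" where
  "has_dim T X n \<longleftrightarrow> irred_chain T X n \<and> \<not> irred_chain T X (Suc n)"

definition irreducible_variety :: "'n::finite cp set \<Rightarrow> nat \<Rightarrow> bool" where
  "irreducible_variety X d \<longleftrightarrow> closedin zariski X \<and> irred_in zariski X \<and> has_dim zariski X d"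

definition nondegenerate :: "'n::finite cp set \<Rightarrow> bool" where
  "nondegenerate X \<longleftrightarrow> \<not> (\<exists>H. \<forall>p\<in>X. lies_on p H)"

text \<open>Degree of a \<open>d\<close>-dimensional variety: the number of its common points with \<open>d\<close> general
  hyperplanes \<open>h 0, \<dots>, h (d - 1)\<close>; the polynomial \<open>D\<close> cuts out the exceptional choices.\<close>

definition has_degree :: "'n::finite cp set \<Rightarrow> nat \<Rightarrow> nat \<Rightarrow> bool" where
  "has_degree X d e \<longleftrightarrow>
     (\<exists>D \<in> poly_fun {(\<lambda>h :: nat \<Rightarrow> complex ^ 'n. h j $ i) | j i. j < d}.
        (\<exists>h. D h \<noteq> 0) \<and>
        (\<forall>h. D h \<noteq> 0 \<longrightarrow>
           finite {p \<in> X. \<forall>j<d. \<forall>x\<in>line_of p. dpair (h j) x = 0} \<and>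
           card {p \<in> X. \<forall>j<d. \<forall>x\<in>line_of p. dpair (h j) x = 0} = e))"

section \<open>Segre surfaces and Segre symbols\<close>

text \<open>\<open>CP\<^sub>3\<close> is embedded as a hyperplane by \<open>A\<close>, and \<open>v\<close> spans the vertex, which lies off that
  hyperplane.\<close>

definition cone_over_quartic_curve :: "5 cp set \<Rightarrow> bool" where
  "cone_over_quartic_curve S \<longleftrightarrow>
     (\<exists>(C :: 4 cp set) (A :: complex ^ 4 ^ 5) (v :: complex ^ 5).
        irreducible_variety C 1 \<and> has_degree C 1 4 \<and>
        inj ((*v) A) \<and> v \<notin> range ((*v) A) \<and>
        S = {pt (s *s v + A *v x) | s x p. p \<in> C \<and> x \<in> line_of p \<and> s *s v + A *v x \<noteq> 0})"

text \<open>The surface in \<open>CP\<^sub>5\<close> has to be non-degenerate, since any surface in \<open>CP\<^sub>4\<close> is a projection of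
  itself placed in a hyperplane of \<open>CP\<^sub>5\<close>. The centre, spanned by the kernel of \<open>B\<close>, lies off the
  surface.\<close>

definition projected_quartic_surface :: "5 cp set \<Rightarrow> bool" where
  "projected_quartic_surface S \<longleftrightarrow>
     (\<exists>(T :: 6 cp set) (B :: complex ^ 6 ^ 5).
        irreducible_variety T 2 \<and> nondegenerate T \<and> has_degree T 2 4 \<and>
        surj ((*v) B) \<and> (\<forall>p\<in>T. \<forall>x\<in>line_of p. x \<noteq> 0 \<longrightarrow> B *v x \<noteq> 0) \<and>
        S = {pt (B *v x) | x p. p \<in> T \<and> x \<in> line_of p \<and> x \<noteq> 0})"

definition segre_surface :: "5 cp set \<Rightarrow> bool" where
  "segre_surface S \<longleftrightarrow>
     irreducible_variety S 2 \<and> nondegenerate S \<and> has_degree S 2 4 \<and>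
     \<not> cone_over_quartic_curve S \<and> \<not> projected_quartic_surface S"

definition mat_of :: "complex ^ 5 ^ 5 \<Rightarrow> complex Matrix.mat" where
  "mat_of A = Matrix.mat 5 5 (\<lambda>(i, j). A $ of_nat i $ of_nat j)"

text \<open>From a list of Jordan blocks (size, eigenvalue): for each eigenvalue the multiset of the sizes
  of its blocks.\<close>

definition jordan_symbol :: "(nat \<times> complex) list \<Rightarrow> nat multiset multiset" where
  "jordan_symbol bs =
     image_mset (\<lambda>a. mset (map fst (filter (\<lambda>b. snd b = a) bs))) (mset_set (snd ` set bs))"

definition has_segre_symbol :: "5 cp set \<Rightarrow> nat multiset multiset \<Rightarrow> bool" where
  "has_segre_symbol S \<sigma> \<longleftrightarrow>
     (\<exists>P Q :: complex ^ 5 ^ 5.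
        transpose P = P \<and> transpose Q = Q \<and> invertible Q \<and>
        S = {p. \<forall>x\<in>line_of p. dpair x (P *v x) = 0 \<and> dpair x (Q *v x) = 0} \<and>
        (\<exists>bs. jordan_nf (mat_of (matrix_inv Q ** P)) bs \<and> jordan_symbol bs = \<sigma>))"

text \<open>For instance \<open>segre_symbol [[1], [1], [1], [1, 1]]\<close> is the symbol [111(11)].\<close>

definition segre_symbol :: "nat list list \<Rightarrow> nat multiset multiset" where
  "segre_symbol xss = mset (map mset xss)"

section \<open>Tangent planes, the dual variety and the cuspidal locus\<close>

text \<open>The linear space over the embedded projective tangent space of \<open>X\<close> at \<open>p\<close>; the derivative
  is that of \<open>f\<close> at \<open>x\<close> in direction \<open>v\<close>.\<close>

definition tangent_cone :: "'n::finite cp set \<Rightarrow> 'n cp \<Rightarrow> (complex ^ 'n) set" where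
  "tangent_cone X p =
     {v. \<forall>d. \<forall>f\<in>hpoly d. (\<forall>q\<in>X. \<forall>y\<in>line_of q. f y = 0) \<longrightarrow>
           (\<forall>x\<in>line_of p. deriv (\<lambda>t. f (x + t *s v)) 0 = 0)}"

definition smooth_locus :: "'n::finite cp set \<Rightarrow> 'n cp set" where
  "smooth_locus X = {p \<in> X. \<exists>d. has_dim zariski X d \<and> vec.dim (tangent_cone X p) = d + 1}"

definition tangent_hyperplane :: "'n::finite cp set \<Rightarrow> 'n cp \<Rightarrow> 'n cp \<Rightarrow> bool" where
  "tangent_hyperplane X p H \<longleftrightarrow> (\<forall>v\<in>tangent_cone X p. \<forall>h\<in>line_of H. dpair h v = 0)"

definition incidence_variety :: "'n::finite cp set \<Rightarrow> ('n cp \<times> 'n cp) set" where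
  "incidence_variety X =
     zariski_prod closure_of {(p, H). p \<in> smooth_locus X \<and> tangent_hyperplane X p H}"

definition dual_variety :: "'n::finite cp set \<Rightarrow> 'n cp set" where
  "dual_variety X = snd ` incidence_variety X"

text \<open>Let \<open>p\<close> be a smooth point of the surface \<open>S\<close>. A local holomorphic coordinate system at \<open>p\<close> is
  given by its inverse, lifted to \<open>complex ^ 5\<close>: a holomorphic map \<open>\<phi>\<close> on a neighbourhood of 0 that
  represents points of \<open>S\<close>, represents \<open>p\<close> at 0, and is immersive at 0 as a map to \<open>CP\<^sub>4\<close>, i.e.
  \<open>\<phi> 0\<close> and the two partial derivatives there are linearly independent. As \<open>S\<close> is a
  two-dimensional complex manifold near \<open>p\<close>, such a map is locally biholomorphic onto a
  neighbourhood of \<open>p\<close> in \<open>S\<close>.\<close>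

definition holomorphic2_on ::
  "(complex \<times> complex \<Rightarrow> complex ^ 'n::finite) \<Rightarrow> (complex \<times> complex) set \<Rightarrow> bool" where
  "holomorphic2_on \<phi> W \<longleftrightarrow>
     (\<forall>w\<in>W. \<exists>a b. (\<phi> has_derivative (\<lambda>(s, t). s *s a + t *s b)) (at w))"

definition local_chart ::
  "'n::finite cp set \<Rightarrow> 'n cp \<Rightarrow> (complex \<times> complex) set \<Rightarrow>
   (complex \<times> complex \<Rightarrow> complex ^ 'n) \<Rightarrow> bool" where
  "local_chart S p W \<phi> \<longleftrightarrow>
     open W \<and> 0 \<in> W \<and> holomorphic2_on \<phi> W \<and>
     (\<forall>w\<in>W. \<phi> w \<noteq> 0 \<and> pt (\<phi> w) \<in> S) \<and> pt (\<phi> 0) = p \<and>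
     (\<exists>a b. (\<phi> has_derivative (\<lambda>(s, t). s *s a + t *s b)) (at 0) \<and> vec.dim {\<phi> 0, a, b} = 3)"

text \<open>In suitable local holomorphic coordinates at \<open>p\<close>, the hyperplane section \<open>H|\<^sub>S\<close> has the local
  equation \<open>g = 0\<close>. A local equation is determined up to a non-vanishing holomorphic factor, and
  so is the lift \<open>\<phi>\<close> of a chart; hence the factor can be absorbed into \<open>\<phi>\<close>.\<close>

definition section_has_local_equation ::
  "'n::finite cp set \<Rightarrow> 'n cp \<Rightarrow> 'n cp \<Rightarrow> (complex \<Rightarrow> complex \<Rightarrow> complex) \<Rightarrow> bool" where
  "section_has_local_equation S p H g \<longleftrightarrow>
     (\<exists>W \<phi>. \<exists>h\<in>line_of H. h \<noteq> 0 \<and> local_chart S p W \<phi> \<and>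
        (\<forall>(u, v)\<in>W. dpair h (\<phi> (u, v)) = g u v))"

definition ordinary_node_at :: "'n::finite cp set \<Rightarrow> 'n cp \<Rightarrow> 'n cp \<Rightarrow> bool" where
  "ordinary_node_at S p H \<longleftrightarrow> section_has_local_equation S p H (\<lambda>u v. u * v)"

definition ordinary_cusp_at :: "'n::finite cp set \<Rightarrow> 'n cp \<Rightarrow> 'n cp \<Rightarrow> bool" where
  "ordinary_cusp_at S p H \<longleftrightarrow> section_has_local_equation S p H (\<lambda>u v. u ^ 2 - v ^ 3)"

definition dual_cusp :: "'n::finite cp set \<Rightarrow> 'n cp set" where
  "dual_cusp S = snd `
     (subtopology zariski_prod (incidence_variety S) closure_of
        {(p, H) \<in> incidence_variety S. p \<in> smooth_locus S \<and> \<not> ordinary_node_at S p H})"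

text \<open>A property holds at the generic point of an irreducible component \<open>Z\<close> if it holds on a
  non-empty Zariski open subset \<open>U\<close> of \<open>Z\<close>.\<close>

definition cuspidal_locus :: "'n::finite cp set \<Rightarrow> 'n cp set" where
  "cuspidal_locus S =
     \<Union> {Z \<in> irred_components zariski (dual_cusp S).
          \<exists>U. openin (subtopology zariski Z) U \<and> U \<noteq> {} \<and>
              (\<forall>H\<in>U. \<exists>p\<in>smooth_locus S. ordinary_cusp_at S p H)}"

section \<open>Birational equivalence\<close>

definition homogeneous_map :: "(complex ^ 'n::finite \<Rightarrow> complex ^ 'm::finite) \<Rightarrow> bool" where
  "homogeneous_map F \<longleftrightarrow> (\<exists>d. \<forall>i. (\<lambda>x. F x $ i) \<in> hpoly d)"

text \<open>For irreducible varieties \<open>X\<close> and \<open>Y\<close>: non-empty open subsets \<open>U\<close> and \<open>V\<close> are isomorphic via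
  mutually inverse rational maps \<open>F\<close> and \<open>G\<close>. A rational map to a projective space is represented
  by a tuple of homogeneous polynomials of equal degree, defined where these do not all vanish.\<close>

definition birational :: "'n::finite cp set \<Rightarrow> 'm::finite cp set \<Rightarrow> bool" where
  "birational X Y \<longleftrightarrow>
     (\<exists>U V F G. openin (subtopology zariski X) U \<and> U \<noteq> {} \<and>
        openin (subtopology zariski Y) V \<and> V \<noteq> {} \<and>
        homogeneous_map F \<and> homogeneous_map G \<and>
        (\<forall>p\<in>U. \<forall>x\<in>line_of p. x \<noteq> 0 \<longrightarrow> F x \<noteq> 0 \<and> pt (F x) \<in> V \<and> pt (G (F x)) = p) \<and>
        (\<forall>q\<in>V. \<forall>y\<in>line_of q. y \<noteq> 0 \<longrightarrow> G y \<noteq> 0 \<and> pt (G y) \<in> U \<and> pt (F (G y)) = q))"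

end

theory Submission
 imports Defs "HOL-Complex_Analysis.Complex_Analysis" "Jordan_Normal_Form.Jordan_Normal_Form_Uniqueness"
begin

no_notation Matrix.vec_index (infixl "$" 100)
no_notation fps_nth (infixl "$" 75)

lemmas pow_simps3 = power2_eq_square power3_eq_cube
lemmas pow_simps4 = pow_simps3 power4_eq_xxxx
lemmas alg_simps2 = algebra_simps power2_eq_square
lemmas alg_simps3 = algebra_simps pow_simps3
lemmas alg_simps4 = algebra_simps pow_simps4
lemmas fld_simps4 = field_simps pow_simps4
lemmas cvec_eq_iff = Finite_Cartesian_Product.vec_eq_iff
lemmas matrix_linear = matrix_vector_right_distrib vector_scalar_commute

text \<open>The seven symbols are those for which one member of the pencil has rank 3: \<open>S\<close> is then
  \<open>y\<^sub>0 y\<^sub>2 = y\<^sub>1\<^sup>2\<close>, \<open>w\<^sub>2 (b w\<^sub>1 + g(y)) = a w\<^sub>1\<^sup>2 + f(y)\<close>, a conic bundle with affine coordinates \<open>s = y\<^sub>1 / y\<^sub>2\<close>,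
  \<open>w = w\<^sub>1 / y\<^sub>2\<close>. A hyperplane section is \<open>\<kappa> w\<^sup>2 + B(s) w + C(s) = 0\<close>; where it is singular, its
  discriminant \<open>D(s)\<close> has a multiple root, and completing the square shows that a double root gives
  a node and a triple root a cusp. The condition of a triple root at a given point determines the
  hyperplane, as a rational function of the point, and conversely the point is recovered from the
  Hessian covariant of the binary quartic \<open>D\<close>. All other hyperplanes in the closure of the non-nodal ones lie in
  the hyperplanes \<open>\<kappa> = 0\<close> and \<open>k\<^sub>4 = 0\<close> of the dual space, and none of these has a cusp at a smooth point.\<close>

section \<open>Polynomial functions\<close>

text \<open>The Jordan blocks enter in two ways. A pair of blocks {1, k} for an eigenvalue l gives P
  - l Q a two-dimensional kernel, hence rank 3, and the block of size 1 keeps Q from vanishing on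
  that kernel; the rank 2 or 1 of Q there separates a = 0 from a = 1. Single blocks for the other
  eigenvalues exclude that f is a square (a = 0) or divisible by g (a = 1), which keeps the generic
  triple root from being a quadruple one. The definitions shape the rest. The dual locus is the
  image of a closure: conditions on it must be written as bihomogeneous equations, which survive
  closure, and the projection has to be shown closed. Smoothness is defined by the dimension of the
  tangent space, cusps by holomorphic charts: at the points with y = 0 the argument shows that a
  point of \<open>smooth_locus\<close> would admit no chart, which suffices to exclude cusps there.
  Krull dimension is defined by chains; it is bounded above by counting forms modulo powers of an
  equation, and below by an explicit chain.\<close>

abbreviation coords :: "(complex ^ 'n::finite => complex) set" where
 "coords \<equiv> range (%i x. x $ i)"

abbreviation bicoords :: "((complex ^ 'n::finite) \<times> (complex ^ 'm::finite) => complex) set" where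
 "bicoords \<equiv> range (%i z. fst z $ i) \<union> range (%i z. snd z $ i)"

lemma poly_fun_cmult: "f \<in> poly_fun C ==> (%x. c * f x) \<in> poly_fun C"
 using poly_fun.mult[OF poly_fun.const] by blast

lemma poly_fun_uminus: "f \<in> poly_fun C ==> (%x. - f x) \<in> poly_fun C"
 using poly_fun_cmult[of f C "-1"] by simp

lemma poly_fun_diff: "f \<in> poly_fun C ==> g \<in> poly_fun C ==> (%x. f x - g x) \<in> poly_fun C"
 using poly_fun.add[OF _ poly_fun_uminus, of f C g] by simp

lemma poly_fun_power: "f \<in> poly_fun C ==> (%x. f x ^ n) \<in> poly_fun C"
 by (induction n) (auto intro: poly_fun.const poly_fun.mult)

lemma poly_fun_sum: "(!!i. i \<in> I ==> f i \<in> poly_fun C) ==> (%x. \<Sum>i\<in>I. f i x) \<in> poly_fun C"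
 by (induction I rule: infinite_finite_induct) (auto intro: poly_fun.const poly_fun.add)

lemma poly_fun_prod: "(!!i. i \<in> I ==> f i \<in> poly_fun C) ==> (%x. \<Prod>i\<in>I. f i x) \<in> poly_fun C"
 by (induction I rule: infinite_finite_induct) (auto intro: poly_fun.const poly_fun.mult)

lemma poly_fun_compose:
 assumes "f \<in> poly_fun C" and "!!c. c \<in> C ==> (%x. c (T x)) \<in> poly_fun C'"
 shows "(%x. f (T x)) \<in> poly_fun C'"
 using assms(1) by induction (auto intro: poly_fun.const poly_fun.add poly_fun.mult assms(2))

lemma poly_fun_coord: "(%x. x $ i) \<in> poly_fun coords"
 by (rule poly_fun.coord) auto

lemmas poly_fun_intros = poly_fun.const poly_fun.add poly_fun.mult poly_fun_uminus poly_fun_diff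
 poly_fun_power poly_fun_sum poly_fun_coord

text \<open>Substituting a one-parameter family of points turns a polynomial function into a polynomial
  in the parameter whose coefficients are again polynomial functions.\<close>

lemma poly_fun_expand:
 fixes T :: "'b => complex => 'a" and p :: "('a => complex) => 'b => complex poly"
 assumes "f \<in> poly_fun C"
  and T: "!!c z t. c \<in> C ==> c (T z t) = poly (p c z) t"
  and p: "!!c i. c \<in> C ==> (%z. coeff (p c z) i) \<in> poly_fun C'"
  and deg: "!!c z. c \<in> C ==> degree (p c z) \<le> k"
 shows "EX P N. (ALL z t. f (T z t) = poly (P z) t) & (ALL i. (%z. coeff (P z) i) \<in> poly_fun C') &
  (ALL z. degree (P z) \<le> N)"
 using assms(1)
proof induction
 case (const c)
 show ?case
 proof (intro exI conjI allI)
  show "c = poly [:c:] t" for t by simp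
  show "(%z. coeff [:c:] i) \<in> poly_fun C'" for i by (rule poly_fun.const)
  show "degree [:c:] \<le> 0" by simp
 qed
next
 case (coord c)
 then show ?case using T p deg by blast
next
 case (add f g)
 then obtain P N Q M where
  "!!z t. f (T z t) = poly (P z) t" "!!i. (%z. coeff (P z) i) \<in> poly_fun C'" "!!z. degree (P z) \<le> N"
  "!!z t. g (T z t) = poly (Q z) t" "!!i. (%z. coeff (Q z) i) \<in> poly_fun C'" "!!z. degree (Q z) \<le> M"
  by blast
 then have "(ALL z t. f (T z t) + g (T z t) = poly (P z + Q z) t) &
  (ALL i. (%z. coeff (P z + Q z) i) \<in> poly_fun C') & (ALL z. degree (P z + Q z) \<le> max N M)"
  by (auto intro: poly_fun.add intro!: degree_add_le intro: max.coboundedI1 max.coboundedI2)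
 then show ?case by (intro exI) assumption
next
 case (mult f g)
 then obtain P N Q M where *:
  "!!z t. f (T z t) = poly (P z) t" "!!i. (%z. coeff (P z) i) \<in> poly_fun C'" "!!z. degree (P z) \<le> N"
  "!!z t. g (T z t) = poly (Q z) t" "!!i. (%z. coeff (Q z) i) \<in> poly_fun C'" "!!z. degree (Q z) \<le> M"
  by blast
 have "degree (P z * Q z) \<le> N + M" for z
  using *(3,6)[of z] degree_mult_le[of "P z" "Q z"] by linarith
 with * have "(ALL z t. f (T z t) * g (T z t) = poly (P z * Q z) t) &
  (ALL i. (%z. coeff (P z * Q z) i) \<in> poly_fun C') & (ALL z. degree (P z * Q z) \<le> N + M)"
  by (auto simp: coeff_mult intro!: poly_fun_sum poly_fun.mult)
 then show ?case by (intro exI) assumption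
qed

subsection \<open>Homogeneous polynomials\<close>

lemma hpolyD: "f \<in> hpoly d ==> f (c *s x) = c ^ d * f x"
 by (simp add: hpoly_def)

lemma hpoly_poly_fun: "f \<in> hpoly d ==> f \<in> poly_fun coords"
 by (simp add: hpoly_def)

lemma hpoly_const: "(%_. c) \<in> hpoly 0"
 by (simp add: hpoly_def poly_fun.const)

lemma hpoly_coord: "(%x. x $ i) \<in> hpoly 1"
 by (simp add: hpoly_def poly_fun_coord)

lemma hpoly_add: "f \<in> hpoly d ==> g \<in> hpoly d ==> (%x. f x + g x) \<in> hpoly d"
 by (auto simp: hpoly_def algebra_simps intro: poly_fun.add)

lemma hpoly_mult: "f \<in> hpoly d ==> g \<in> hpoly e ==> (%x. f x * g x) \<in> hpoly (d + e)"
 by (auto simp: hpoly_def algebra_simps power_add intro: poly_fun.mult)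

lemma hpoly_zero: "(%_. 0) \<in> hpoly d"
 by (simp add: hpoly_def poly_fun.const)

lemma hpoly_cmult: "f \<in> hpoly d ==> (%x. c * f x) \<in> hpoly d"
 using hpoly_mult[OF hpoly_const, of f d c] by simp

lemma hpoly_diff: "f \<in> hpoly d ==> g \<in> hpoly d ==> (%x. f x - g x) \<in> hpoly d"
 using hpoly_add[OF _ hpoly_cmult, of f d g "-1"] by simp

lemma hpoly_sum: "(!!i. i \<in> I ==> f i \<in> hpoly d) ==> (%x. \<Sum>i\<in>I. f i x) \<in> hpoly d"
 by (induction I rule: infinite_finite_induct) (auto intro: hpoly_zero hpoly_add)

lemma hpoly_power: "f \<in> hpoly d ==> (%x. f x ^ k) \<in> hpoly (k * d)"
 by (auto simp: hpoly_def power_mult_distrib power_mult[symmetric] mult.commute intro: poly_fun_power)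

lemma hpoly_compose:
 assumes f: "f \<in> hpoly k" and F: "!!i. (%x. F x $ i) \<in> hpoly d"
 shows "(%x. f (F x)) \<in> hpoly (k * d)"
proof -
 have "F (c *s x) = c ^ d *s F x" for c x
  using F hpolyD[OF F] by (simp add: cvec_eq_iff)
 moreover have "(%x. f (F x)) \<in> poly_fun coords"
  by (rule poly_fun_compose[OF hpoly_poly_fun[OF f]]) (auto intro: hpoly_poly_fun[OF F])
 ultimately show ?thesis
  using hpolyD[OF f] by (auto simp: hpoly_def power_mult[symmetric] mult.commute)
qed

lemma hpoly_matrix: "(%x. (A *v x) $ i) \<in> hpoly 1"
 unfolding matrix_vector_mult_def vec_lambda_beta by (intro hpoly_sum hpoly_cmult hpoly_coord)

lemma hpoly_at_0: "f \<in> hpoly d ==> 0 < d ==> f 0 = 0"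
 using hpolyD[of f d 0 0] by (simp add: zero_power)

section \<open>Points of projective space\<close>

lemma line_of_pt:
 assumes "x ~= 0"
 shows "line_of (pt x) = range (%c. c *s x)"
proof -
 have "vec.independent {x}" using assms by simp
 then have "vec.dim (vec.span {x}) = 1"
  by (simp add: vec.dim_span vec.dim_eq_card_independent)
 then have "line_of (pt x) = vec.span {x}"
  unfolding pt_def by (intro cp_of_line_inverse) (auto intro: vec.subspace_span)
 then show ?thesis by (auto simp: vec.span_singleton)
qed

lemma pt_exhaust:
 obtains x where "x ~= 0" "p = pt x"
proof -
 have L: "vec.subspace (line_of p)" "vec.dim (line_of p) = 1"
  using line_of[of p] by auto
 obtain B where B: "B \<subseteq> line_of p" "vec.independent B" "line_of p \<subseteq> vec.span B" "card B = 1"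
  using vec.basis_exists[of "line_of p"] L(2) by metis
 obtain x where x: "B = {x}" using B(4) by (auto simp: card_1_singleton_iff)
 have "x ~= 0" using B(2) x by (auto simp: vec.dependent_zero)
 moreover have "line_of p = vec.span {x}"
  using B x L(1) by (metis subset_antisym vec.span_minimal)
 then have "p = pt x" unfolding pt_def by (metis line_of_inverse)
 ultimately show ?thesis using that by blast
qed

lemma pt_eq_iff:
 assumes "x ~= 0" "y ~= 0"
 shows "pt x = pt y \<longleftrightarrow> (EX c. c ~= 0 & y = c *s x)"
proof
 assume "pt x = pt y"
 then have "y \<in> range (%c. c *s x)"
  using line_of_pt assms by (metis rangeI vector_smult_lid)
 then show "EX c. c ~= 0 & y = c *s x" using assms by auto
next
 assume "EX c. c ~= 0 & y = c *s x"
 then obtain c where c: "c ~= 0" "y = c *s x" by blast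
 have "range (%d. d *s x) = range (%d. d *s y)"
 proof safe
  fix d show "d *s x \<in> range (%d. d *s y)"
   using c by (intro image_eqI[of _ _ "d / c"]) auto
 next
  fix d show "d *s y \<in> range (%d. d *s x)"
   using c by (intro image_eqI[of _ _ "d * c"]) auto
 qed
 then show "pt x = pt y" using line_of_pt assms line_of_inject by metis
qed

lemma pt_scale: "x ~= 0 ==> c ~= 0 ==> pt (c *s x) = pt x"
 using pt_eq_iff[of x "c *s x"] by (auto simp: vector_mul_eq_0)

lemma hpoly_line:
 assumes "f \<in> hpoly d" "x ~= 0"
 shows "(EX z:line_of (pt x). f z ~= 0) \<longleftrightarrow> f x ~= 0"
proof
 show "f x ~= 0" if "EX z:line_of (pt x). f z ~= 0"
  using that assms by (auto simp: line_of_pt hpolyD)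
 show "EX z:line_of (pt x). f z ~= 0" if "f x ~= 0"
  using that assms by (auto simp: line_of_pt intro!: exI[of _ 1])
qed

text \<open>Conditions on points become conditions on nonzero representatives, at which forms can be
  evaluated; the set is stable under nonzero scaling.\<close>

definition acone :: "'n::finite cp set => (complex ^ 'n) set" where
 "acone X = {x. x ~= 0 & pt x \<in> X}"

definition bicone :: "('n::finite cp \<times> 'm::finite cp) set => ((complex ^ 'n) \<times> (complex ^ 'm)) set" where
 "bicone W = {(x, y). x ~= 0 & y ~= 0 & (pt x, pt y) \<in> W}"

lemma ball_acone: "(ALL p:U. Q p) \<longleftrightarrow> (ALL x:acone U. Q (pt x))"
proof safe
 fix p assume *: "ALL x:acone U. Q (pt x)" "p \<in> U"
 obtain x where "x ~= 0" "p = pt x" by (rule pt_exhaust)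
 then show "Q p" using * by (simp add: acone_def)
qed (simp add: acone_def)

lemma ball_bicone: "(ALL z:W. Q z) \<longleftrightarrow> (ALL (x, y):bicone W. Q (pt x, pt y))"
proof safe
 fix p q assume *: "ALL (x, y):bicone W. Q (pt x, pt y)" "(p, q) \<in> W"
 obtain x where "x ~= 0" "p = pt x" by (rule pt_exhaust)
 moreover obtain y where "y ~= 0" "q = pt y" by (rule pt_exhaust)
 ultimately show "Q (p, q)" using * by (simp add: bicone_def)
qed (simp add: bicone_def)

section \<open>The Zariski topologies\<close>

text \<open>If the generating family is closed under binary intersection, the finite intersections
  formed in the generation process stay inside it.\<close>

lemma openin_generated_by_base:
 assumes base: "!!A B. A \<in> \<B> ==> B \<in> \<B> ==> A \<inter> B \<in> \<B>"
 shows "openin (topology_generated_by \<B>) U \<longleftrightarrow> (ALL x:U. EX B:\<B>. x \<in> B & B \<subseteq> U)"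
proof
 assume "openin (topology_generated_by \<B>) U"
 then have "generate_topology_on \<B> U" by (simp add: openin_topology_generated_by_iff)
 then show "ALL x:U. EX B:\<B>. x \<in> B & B \<subseteq> U"
 proof induction
  case (Int a b)
  show ?case
  proof
   fix x assume "x \<in> a \<inter> b"
   then obtain A B where "A \<in> \<B>" "x \<in> A" "A \<subseteq> a" "B \<in> \<B>" "x \<in> B" "B \<subseteq> b"
    using Int.IH by blast
   then show "EX B:\<B>. x \<in> B & B \<subseteq> a \<inter> b" using base by (intro bexI[of _ "A \<inter> B"]) auto
  qed
 next
  case (UN K)
  show ?case
  proof
   fix x assume "x \<in> \<Union> K"
   then obtain k where k: "k \<in> K" "x \<in> k" by blast
   then obtain B where "B \<in> \<B>" "x \<in> B" "B \<subseteq> k" using UN.IH[of k] by blast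
   then show "EX B:\<B>. x \<in> B & B \<subseteq> \<Union> K" using k by blast
  qed
 next
  case (Basis s)
  then show ?case by blast
 qed simp
next
 assume *: "ALL x:U. EX B:\<B>. x \<in> B & B \<subseteq> U"
 then have "U = \<Union> {B \<in> \<B>. B \<subseteq> U}" by blast
 moreover have "openin (topology_generated_by \<B>) (\<Union> {B \<in> \<B>. B \<subseteq> U})"
  by (intro openin_Union) (auto intro: topology_generated_by_Basis)
 ultimately show "openin (topology_generated_by \<B>) U" by simp
qed

lemma openin_zariski:
 "openin zariski U \<longleftrightarrow> (ALL x:acone U. EX d. EX f:hpoly d. f x ~= 0 & (ALL y. y ~= 0 --> f y ~= 0 --> pt y \<in> U))"
proof -
 define S where "S f = {p. EX x:line_of p. f x ~= 0}" for f :: "complex ^ 'a => complex"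
 define \<B> where "\<B> = {S f | f d. f \<in> hpoly d}"
 have pt: "pt x \<in> S f \<longleftrightarrow> f x ~= 0" if "f \<in> hpoly d" "x ~= 0" for f d x
  using hpoly_line[OF that] by (simp add: S_def)
 have ex: "EX x. x ~= 0 & p = pt x" for p :: "'a cp"
  by (metis pt_exhaust)
 have eq: "\<B> = {{p. EX x:line_of p. f x ~= 0} | f d. f \<in> hpoly d}"
  unfolding \<B>_def S_def by simp
 have "A \<inter> B \<in> \<B>" if AB: "A \<in> \<B>" "B \<in> \<B>" for A B
 proof -
  obtain f d g e where fg: "f \<in> hpoly d" "A = S f" "g \<in> hpoly e" "B = S g"
   using AB unfolding \<B>_def by blast
  \<comment> \<open>The product of two forms is a form that is nonzero exactly where both are, so
    basic open sets meet in a basic open set.\<close>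
  have "p \<in> A \<inter> B \<longleftrightarrow> p \<in> S (%x. f x * g x)" for p
   using ex[of p] fg pt[OF fg(1)] pt[OF fg(3)] pt[OF hpoly_mult[OF fg(1,3)]] by auto
  then have "A \<inter> B = S (%x. f x * g x)" by blast
  then show ?thesis using hpoly_mult[OF fg(1,3)] unfolding \<B>_def by blast
 qed
 then have "openin zariski U \<longleftrightarrow> (ALL p:U. EX B:\<B>. p \<in> B & B \<subseteq> U)"
  unfolding zariski_def eq[symmetric] by (rule openin_generated_by_base)
 also have "\<dots> \<longleftrightarrow> (ALL x:acone U. EX B:\<B>. pt x \<in> B & B \<subseteq> U)"
  by (rule ball_acone)
 also have "\<dots> \<longleftrightarrow> (ALL x:acone U. EX d. EX f:hpoly d. f x ~= 0 & (ALL y. y ~= 0 --> f y ~= 0 --> pt y \<in> U))"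
 proof (rule ball_cong[OF refl])
  fix x assume "x \<in> acone U"
  then have x: "x ~= 0" by (simp add: acone_def)
  show "(EX B:\<B>. pt x \<in> B & B \<subseteq> U) \<longleftrightarrow>
   (EX d. EX f:hpoly d. f x ~= 0 & (ALL y. y ~= 0 --> f y ~= 0 --> pt y \<in> U))" (is "?L = ?R")
  proof
   assume ?L
   then obtain f d where f: "f \<in> hpoly d" "pt x \<in> S f" "S f \<subseteq> U" unfolding \<B>_def by blast
   then have "f x ~= 0" "ALL y. y ~= 0 --> f y ~= 0 --> pt y \<in> U"
    using pt[OF f(1)] x by blast+
   then show ?R using f(1) by blast
  next
   assume ?R
   then obtain d f where f: "f \<in> hpoly d" "f x ~= 0" "!!y. y ~= 0 ==> f y ~= 0 ==> pt y \<in> U"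
    by blast
   have "S f \<subseteq> U"
   proof
    fix p assume "p \<in> S f"
    then show "p \<in> U" using ex[of p] f(3) pt[OF f(1)] by blast
   qed
   then show ?L using f(1) pt[OF f(1) x] f(2) unfolding \<B>_def by blast
  qed
 qed
 finally show ?thesis .
qed

lemma topspace_zariski [simp]: "topspace zariski = UNIV"
proof -
 have "openin zariski (UNIV :: 'n::finite cp set)"
  unfolding openin_zariski using hpoly_const[of 1] by fastforce
 then show ?thesis by (metis openin_subset top.extremum_uniqueI)
qed

text \<open>Non-vanishing sets of single forms are a base, so a single form separates a point from a
  set in whose closure it does not lie. Later arguments on closures all use this
  description.\<close>

lemma zariski_closure_pt:
 assumes "x ~= 0"
 shows "pt x \<in> zariski closure_of X \<longleftrightarrow>
  (ALL d. ALL f:hpoly d. (ALL y:acone X. f y = 0) --> f x = 0)" (is "_ \<longleftrightarrow> ?R")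
proof
 assume *: "pt x \<in> zariski closure_of X"
 show ?R
 proof (intro allI ballI impI, rule ccontr)
  fix d f assume f: "f \<in> hpoly d" "ALL y:acone X. f y = 0" "f x ~= 0"
  define U where "U = {p. EX y. y ~= 0 & p = pt y & f y ~= 0}"
  have U: "pt y \<in> U \<longleftrightarrow> f y ~= 0" if "y ~= 0" for y
   using that f(1) unfolding U_def by (auto simp: pt_eq_iff hpolyD)
  have "openin zariski U"
   unfolding openin_zariski using f(1) U by (auto simp: acone_def)
  moreover have "pt x \<in> U" using f(3) assms U by blast
  ultimately obtain p where "p \<in> X" "p \<in> U"
   using * unfolding in_closure_of by blast
  then show False using f(2) U unfolding U_def acone_def by blast
 qed
next
 assume R: ?R
 show "pt x \<in> zariski closure_of X"
  unfolding in_closure_of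
 proof (intro conjI allI impI)
  fix U assume "pt x \<in> U & openin zariski U"
  then obtain d f where f: "f \<in> hpoly d" "f x ~= 0" "!!y. y ~= 0 ==> f y ~= 0 ==> pt y \<in> U"
   using assms unfolding openin_zariski acone_def by blast
  then obtain y where "y \<in> acone X" "f y ~= 0" using R by blast
  then show "EX y. y \<in> X & y \<in> U" using f(3) unfolding acone_def by blast
 qed simp
qed

lemma closedin_zariski:
 "closedin zariski X \<longleftrightarrow>
  (ALL x. x ~= 0 --> (ALL d. ALL f:hpoly d. (ALL y:acone X. f y = 0) --> f x = 0) --> pt x \<in> X)"
proof -
 have "closedin zariski X \<longleftrightarrow> zariski closure_of X \<subseteq> X"
  using closure_of_subset_eq[of X zariski] by simp
 also have "\<dots> \<longleftrightarrow> (ALL x. x ~= 0 --> pt x \<in> zariski closure_of X --> pt x \<in> X)"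
  unfolding subset_eq ball_acone[of "zariski closure_of X"] by (auto simp: acone_def)
 also have "\<dots> \<longleftrightarrow> (ALL x. x ~= 0 --> (ALL d. ALL f:hpoly d. (ALL y:acone X. f y = 0) --> f x = 0) --> pt x \<in> X)"
 proof (rule iff_allI, rule imp_cong[OF refl])
  fix x :: "complex ^ 'a" assume "x ~= 0"
  from zariski_closure_pt[OF this, of X]
  show "(pt x \<in> zariski closure_of X --> pt x \<in> X) \<longleftrightarrow>
   ((ALL d. ALL f:hpoly d. (ALL y:acone X. f y = 0) --> f x = 0) --> pt x \<in> X)" by (simp only:)
 qed
 finally show ?thesis .
qed

lemma closedin_zariskiE:
 assumes "closedin zariski X" "x ~= 0" "pt x \<notin> X"
 obtains d f where "f \<in> hpoly d" "!!y. y \<in> acone X ==> f y = 0" "f x ~= 0"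
 using assms unfolding closedin_zariski by blast

lemma closedin_zero_set:
 assumes "!!f. f \<in> F ==> EX d. f \<in> hpoly d"
 shows "closedin zariski {p. ALL f:F. ALL x:line_of p. f x = 0}"
proof -
 have *: "pt x \<in> {p. ALL f:F. ALL x:line_of p. f x = 0} \<longleftrightarrow> (ALL f:F. f x = 0)" if "x ~= 0" for x
  using assms hpoly_line[OF _ that] by blast
 show ?thesis
  unfolding closedin_zariski
 proof (intro allI impI)
  fix x :: "complex ^ 'a"
  assume x: "x ~= 0" "ALL d. ALL f:hpoly d. (ALL y:acone {p. ALL f:F. ALL x:line_of p. f x = 0}. f y = 0) --> f x = 0"
  have "f x = 0" if fF: "f \<in> F" for f
  proof -
   obtain d where "f \<in> hpoly d" using assms fF by blast
   moreover have "ALL y:acone {p. ALL f:F. ALL x:line_of p. f x = 0}. f y = 0"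
    using * fF unfolding acone_def by blast
   ultimately show ?thesis using x(2) by blast
  qed
  then show "pt x \<in> {p. ALL f:F. ALL x:line_of p. f x = 0}" using *[OF x(1)] by blast
 qed
qed

text \<open>Primality of the homogeneous vanishing ideal: the zero sets of two forms whose product
  vanishes cover X, and two closed sets that cover X without containing it yield such forms.\<close>

lemma irred_in_zariski:
 "irred_in zariski X \<longleftrightarrow> X ~= {} &
  (ALL d e. ALL f:hpoly d. ALL g:hpoly e. (ALL x:acone X. f x * g x = 0) -->
   (ALL x:acone X. f x = 0) | (ALL x:acone X. g x = 0))" (is "_ \<longleftrightarrow> _ & ?R")
proof -
 have "(ALL A B. closedin zariski A & closedin zariski B & X \<subseteq> A \<union> B --> X \<subseteq> A | X \<subseteq> B) \<longleftrightarrow> ?R"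
  (is "?L \<longleftrightarrow> _")
 proof
  assume L: ?L
  show ?R
  proof (intro allI ballI impI)
   fix d e and f g :: "complex ^ 'a => complex"
   assume fg: "f \<in> hpoly d" "g \<in> hpoly e" "ALL x:acone X. f x * g x = 0"
   define Zs where "Zs f = {p. ALL f:{f}. ALL x:line_of p. f x = (0::complex)}" for f :: "complex ^ 'a => complex"
   have c: "closedin zariski (Zs f)" "closedin zariski (Zs g)"
    unfolding Zs_def using fg by (intro closedin_zero_set; auto)+
   have z: "pt x \<in> Zs u \<longleftrightarrow> u x = 0" if "u \<in> hpoly k" "x ~= 0" for u k x
    using hpoly_line[OF that] unfolding Zs_def by auto
   have "X \<subseteq> Zs f \<union> Zs g"
   proof
    fix p assume "p \<in> X"
    obtain x where "x ~= 0" "p = pt x" by (rule pt_exhaust)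
    then show "p \<in> Zs f \<union> Zs g" using \<open>p \<in> X\<close> fg(3) z[OF fg(1)] z[OF fg(2)] by (auto simp: acone_def)
   qed
   then have "X \<subseteq> Zs f | X \<subseteq> Zs g" using L c by blast
   then show "(ALL x:acone X. f x = 0) | (ALL x:acone X. g x = 0)"
    using z[OF fg(1)] z[OF fg(2)] unfolding acone_def by blast
  qed
 next
  assume R: ?R
  show ?L
  proof (intro allI impI, rule ccontr)
   fix A B assume *: "closedin zariski A & closedin zariski B & X \<subseteq> A \<union> B" "\<not> (X \<subseteq> A | X \<subseteq> B)"
   then obtain x y where xy: "x \<in> acone X" "pt x \<notin> A" "y \<in> acone X" "pt y \<notin> B"
    unfolding subset_eq ball_acone[of X] by blast
   then have "x ~= 0" "y ~= 0" by (auto simp: acone_def)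
   then obtain d f e g where f: "f \<in> hpoly d" "ALL z:acone A. f z = 0" "f x ~= 0"
    and g: "g \<in> hpoly e" "ALL z:acone B. g z = 0" "g y ~= 0"
    using *(1) xy(2,4) closedin_zariskiE[of A x] closedin_zariskiE[of B y] by metis
   have "ALL z:acone X. f z * g z = 0" using *(1) f(2) g(2) by (auto simp: acone_def)
   then show False using R f g xy by blast
  qed
 qed
 then show ?thesis unfolding irred_in_def by simp
qed

text \<open>The density principle of all generic arguments below: an equation g = 0 needs checking
  only where some form f, not identically zero on X, does not vanish.\<close>

lemma irred_in_zariskiD:
 assumes "irred_in zariski X" "f \<in> hpoly d" "g \<in> hpoly e" "!!x. x \<in> acone X ==> f x ~= 0 ==> g x = 0"
  "y \<in> acone X" "f y ~= 0" "x \<in> acone X"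
 shows "g x = 0"
proof -
 have "ALL x:acone X. f x * g x = 0" using assms(4) by auto
 then have "(ALL x:acone X. f x = 0) | (ALL x:acone X. g x = 0)"
  using assms(1-3) unfolding irred_in_zariski by blast
 then show ?thesis using assms(5-7) by blast
qed

lemma vanish_closure:
 assumes "f \<in> hpoly d" "!!y. y \<in> acone X ==> f y = 0" "x \<in> acone (zariski closure_of X)"
 shows "f x = 0"
 using assms zariski_closure_pt[of x X] by (auto simp: acone_def)

lemma irred_in_closure:
 assumes "irred_in zariski X"
 shows "irred_in zariski (zariski closure_of X)"
proof -
 have sub: "X \<subseteq> zariski closure_of X" by (simp add: closure_of_subset)
 then have c: "acone X \<subseteq> acone (zariski closure_of X)" by (auto simp: acone_def)
 show ?thesis
  using assms sub unfolding irred_in_zariski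
 proof (intro conjI allI ballI impI)
  fix d e f g assume a: "X ~= {} & (ALL d e. ALL f:hpoly d. ALL g:hpoly e.
     (ALL x:acone X. f x * g x = 0) --> (ALL x:acone X. f x = 0) | (ALL x:acone X. g x = 0))"
   and f: "f \<in> hpoly d" and g: "g \<in> hpoly e" and "ALL x:acone (zariski closure_of X). f x * g x = 0"
  then have "(ALL x:acone X. f x = 0) | (ALL x:acone X. g x = 0)" using c by blast
  then show "(ALL x:acone (zariski closure_of X). f x = 0) | (ALL x:acone (zariski closure_of X). g x = 0)"
   using vanish_closure[OF f] vanish_closure[OF g] by metis
 qed blast
qed

lemma closedin_point: "closedin zariski {p}"
proof -
 obtain x where x: "x ~= 0" "p = pt x" by (rule pt_exhaust)
 obtain i where i: "x $ i ~= 0" using x(1) by (auto simp: cvec_eq_iff)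
 show ?thesis
  unfolding closedin_zariski
 proof (intro allI impI)
  fix y :: "complex ^ 'a"
  assume y: "y ~= 0" "ALL d. ALL f:hpoly d. (ALL z:acone {p}. f z = 0) --> f y = 0"
  \<comment> \<open>The 2 by 2 minors against a fixed nonzero coordinate i are linear forms that cut
    out the point.\<close>
  have "x $ i * y $ j - x $ j * y $ i = 0" for j
  proof -
   have "(%y. x $ i * y $ j - x $ j * y $ i) \<in> hpoly 1"
    by (intro hpoly_diff hpoly_cmult hpoly_coord)
   moreover have "ALL z:acone {p}. x $ i * z $ j - x $ j * z $ i = 0"
    using x by (auto simp: acone_def pt_eq_iff[OF x(1)] eq_commute[of "pt _" "pt x"])
   ultimately show ?thesis using y(2) by (metis (mono_tags, lifting))
  qed
  then have *: "y $ j = (y $ i / x $ i) * x $ j" for j using i by (simp add: field_simps)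
  then have "y = (y $ i / x $ i) *s x" unfolding cvec_eq_iff vector_smult_component by blast
  then have "pt y = pt x"
   using y(1) x(1) by (metis pt_scale vector_mul_eq_0)
  then show "pt y \<in> {p}" using x by simp
 qed
qed

lemma irred_in_point: "irred_in zariski {p}"
 unfolding irred_in_def by auto

subsection \<open>The product topology\<close>

lemma bihpolyD: "f \<in> bihpoly d e ==> f (a *s x, b *s y) = a ^ d * b ^ e * f (x, y)"
 by (simp add: bihpoly_def)

lemma bihpoly_mult: "f \<in> bihpoly d e ==> g \<in> bihpoly d' e' ==> (%x. f x * g x) \<in> bihpoly (d + d') (e + e')"
 by (auto simp: bihpoly_def algebra_simps power_add intro: poly_fun.mult)

lemma bihpoly_line:
 assumes "f \<in> bihpoly d e" "x ~= 0" "y ~= 0"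
 shows "(EX u:line_of (pt x). EX v:line_of (pt y). f (u, v) ~= 0) \<longleftrightarrow> f (x, y) ~= 0"
proof
 show "f (x, y) ~= 0" if "EX u:line_of (pt x). EX v:line_of (pt y). f (u, v) ~= 0"
  using that assms by (auto simp: line_of_pt bihpolyD)
 show "EX u:line_of (pt x). EX v:line_of (pt y). f (u, v) ~= 0" if "f (x, y) ~= 0"
  using that assms by (intro bexI[of _ x] bexI[of _ y]) (auto simp: line_of_pt intro!: image_eqI[of _ _ 1])
qed

lemma openin_zariski_prod:
 "openin zariski_prod U \<longleftrightarrow> (ALL z:bicone U. EX d e. EX f:bihpoly d e. f z ~= 0 &
  (ALL x y. x ~= 0 --> y ~= 0 --> f (x, y) ~= 0 --> (pt x, pt y) \<in> U))"
proof -
 define S where "S f = {(p, q). EX x:line_of p. EX y:line_of q. f (x, y) ~= 0}"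
  for f :: "(complex ^ 'a) \<times> (complex ^ 'b) => complex"
 define \<B> where "\<B> = {S f | f d e. f \<in> bihpoly d e}"
 have pt: "(pt x, pt y) \<in> S f \<longleftrightarrow> f (x, y) ~= 0" if "f \<in> bihpoly d e" "x ~= 0" "y ~= 0" for f d e x y
  using bihpoly_line[OF that] by (simp add: S_def)
 have ex: "EX x y. x ~= 0 & y ~= 0 & z = (pt x, pt y)" for z :: "'a cp \<times> 'b cp"
  by (metis pt_exhaust surj_pair)
 have eq: "\<B> = {{(p, q). EX x:line_of p. EX y:line_of q. f (x, y) ~= 0} | f d e. f \<in> bihpoly d e}"
  unfolding \<B>_def S_def by simp
 have "A \<inter> B \<in> \<B>" if AB: "A \<in> \<B>" "B \<in> \<B>" for A B
 proof -
  obtain f d e g d' e' where fg: "f \<in> bihpoly d e" "A = S f" "g \<in> bihpoly d' e'" "B = S g"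
   using AB unfolding \<B>_def by blast
  have "z \<in> A \<inter> B \<longleftrightarrow> z \<in> S (%x. f x * g x)" for z
   using ex[of z] fg pt[OF fg(1)] pt[OF fg(3)] pt[OF bihpoly_mult[OF fg(1,3)]] by auto
  then have "A \<inter> B = S (%x. f x * g x)" by blast
  then show ?thesis using bihpoly_mult[OF fg(1,3)] unfolding \<B>_def by blast
 qed
 then have "openin zariski_prod U \<longleftrightarrow> (ALL p:U. EX B:\<B>. p \<in> B & B \<subseteq> U)"
  unfolding zariski_prod_def eq[symmetric] by (rule openin_generated_by_base)
 also have "\<dots> \<longleftrightarrow> (ALL (x, y):bicone U. EX B:\<B>. (pt x, pt y) \<in> B & B \<subseteq> U)"
  by (rule ball_bicone)
 also have "\<dots> \<longleftrightarrow> (ALL z:bicone U. EX d e. EX f:bihpoly d e. f z ~= 0 &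
  (ALL x y. x ~= 0 --> y ~= 0 --> f (x, y) ~= 0 --> (pt x, pt y) \<in> U))"
 proof (rule ball_cong[OF refl], clarify)
  fix x y assume "(x, y) \<in> bicone U"
  then have x: "x ~= 0" "y ~= 0" by (auto simp: bicone_def)
  show "(EX B:\<B>. (pt x, pt y) \<in> B & B \<subseteq> U) \<longleftrightarrow>
   (EX d e. EX f:bihpoly d e. f (x, y) ~= 0 &
    (ALL x y. x ~= 0 --> y ~= 0 --> f (x, y) ~= 0 --> (pt x, pt y) \<in> U))" (is "?L = ?R")
  proof
   assume ?L
   then obtain f d e where f: "f \<in> bihpoly d e" "(pt x, pt y) \<in> S f" "S f \<subseteq> U"
    unfolding \<B>_def by blast
   then have "f (x, y) ~= 0" "ALL x y. x ~= 0 --> y ~= 0 --> f (x, y) ~= 0 --> (pt x, pt y) \<in> U"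
    using pt[OF f(1)] x by blast+
   then show ?R using f(1) by blast
  next
   assume ?R
   then obtain d e f where f: "f \<in> bihpoly d e" "f (x, y) ~= 0"
    "!!x y. x ~= 0 ==> y ~= 0 ==> f (x, y) ~= 0 ==> (pt x, pt y) \<in> U" by blast
   have "S f \<subseteq> U"
   proof
    fix z assume "z \<in> S f"
    then show "z \<in> U" using ex[of z] f(3) pt[OF f(1)] by blast
   qed
   then show ?L using f(1) pt[OF f(1) x] f(2) unfolding \<B>_def by blast
  qed
 qed
 finally show ?thesis .
qed

lemma topspace_zariski_prod [simp]: "topspace zariski_prod = UNIV"
proof -
 have "(%_. 1) \<in> bihpoly 0 0" by (simp add: bihpoly_def poly_fun.const)
 then have "openin zariski_prod (UNIV :: ('n::finite cp \<times> 'm::finite cp) set)"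
  unfolding openin_zariski_prod by fastforce
 then show ?thesis by (metis openin_subset top.extremum_uniqueI)
qed

lemma zariski_prod_closure_pt:
 assumes "x ~= 0" "y ~= 0"
 shows "(pt x, pt y) \<in> zariski_prod closure_of W \<longleftrightarrow>
  (ALL d e. ALL f:bihpoly d e. (ALL z:bicone W. f z = 0) --> f (x, y) = 0)" (is "_ \<longleftrightarrow> ?R")
proof
 assume *: "(pt x, pt y) \<in> zariski_prod closure_of W"
 show ?R
 proof (intro allI ballI impI, rule ccontr)
  fix d e f assume f: "f \<in> bihpoly d e" "ALL z:bicone W. f z = 0" "f (x, y) ~= 0"
  define U where "U = {(p, q). EX x y. x ~= 0 & y ~= 0 & p = pt x & q = pt y & f (x, y) ~= 0}"
  have U: "(pt x, pt y) \<in> U \<longleftrightarrow> f (x, y) ~= 0" if "x ~= 0" "y ~= 0" for x y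
   using that f(1) unfolding U_def by (auto simp: pt_eq_iff bihpolyD)
  have "openin zariski_prod U"
   unfolding openin_zariski_prod
  proof
   fix z assume "z \<in> bicone U"
   then have "f z ~= 0" using U by (auto simp: bicone_def)
   then show "EX d e. EX f:bihpoly d e. f z ~= 0 &
    (ALL x y. x ~= 0 --> y ~= 0 --> f (x, y) ~= 0 --> (pt x, pt y) \<in> U)"
    using U by (intro exI[of _ d] exI[of _ e] bexI[OF _ f(1)]) auto
  qed
  moreover have "(pt x, pt y) \<in> U" using f(3) U[OF assms] by simp
  ultimately have "EX z. z \<in> W & z \<in> U"
   using * unfolding in_closure_of by blast
  then obtain u v where "u ~= 0" "v ~= 0" "(pt u, pt v) \<in> W" "f (u, v) ~= 0"
   unfolding U_def by auto
  then show False using f(2) by (auto simp: bicone_def)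
 qed
next
 assume R: ?R
 show "(pt x, pt y) \<in> zariski_prod closure_of W"
  unfolding in_closure_of
 proof (intro conjI allI impI)
  fix U assume U: "(pt x, pt y) \<in> U & openin zariski_prod U"
  then have "(x, y) \<in> bicone U" using assms by (simp add: bicone_def)
  then have "EX d e. EX f:bihpoly d e. f (x, y) ~= 0 &
   (ALL x y. x ~= 0 --> y ~= 0 --> f (x, y) ~= 0 --> (pt x, pt y) \<in> U)"
   using U unfolding openin_zariski_prod by (elim conjE) (drule (1) bspec)
  then obtain d e f where f: "f \<in> bihpoly d e" "f (x, y) ~= 0"
   "!!x y. x ~= 0 ==> y ~= 0 ==> f (x, y) ~= 0 ==> (pt x, pt y) \<in> U"
   by blast
  have "EX z:bicone W. f z ~= 0" using R[rule_format, OF f(1)] f(2) by blast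
  then obtain u v where "u ~= 0" "v ~= 0" "(pt u, pt v) \<in> W" "f (u, v) ~= 0"
   by (auto simp: bicone_def)
  then show "EX y. y \<in> W & y \<in> U" using f(3) by blast
 qed simp
qed

lemma closedin_zariski_prod:
 "closedin zariski_prod W \<longleftrightarrow>
  (ALL x y. x ~= 0 --> y ~= 0 -->
   (ALL d e. ALL f:bihpoly d e. (ALL z:bicone W. f z = 0) --> f (x, y) = 0) --> (pt x, pt y) \<in> W)"
proof -
 have "closedin zariski_prod W \<longleftrightarrow> zariski_prod closure_of W \<subseteq> W"
  using closure_of_subset_eq[of W zariski_prod] by simp
 also have "\<dots> \<longleftrightarrow> (ALL x y. x ~= 0 --> y ~= 0 --> (pt x, pt y) \<in> zariski_prod closure_of W --> (pt x, pt y) \<in> W)"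
  unfolding subset_eq ball_bicone[of "zariski_prod closure_of W"] by (auto simp: bicone_def)
 also have "\<dots> \<longleftrightarrow> (ALL x y. x ~= 0 --> y ~= 0 -->
   (ALL d e. ALL f:bihpoly d e. (ALL z:bicone W. f z = 0) --> f (x, y) = 0) --> (pt x, pt y) \<in> W)"
 proof (rule iff_allI, rule iff_allI, rule imp_cong[OF refl], rule imp_cong[OF refl])
  fix x :: "complex ^ 'a" and y :: "complex ^ 'b" assume "x ~= 0" "y ~= 0"
  from zariski_prod_closure_pt[OF this, of W]
  show "((pt x, pt y) \<in> zariski_prod closure_of W --> (pt x, pt y) \<in> W) \<longleftrightarrow>
   ((ALL d e. ALL f:bihpoly d e. (ALL z:bicone W. f z = 0) --> f (x, y) = 0) --> (pt x, pt y) \<in> W)"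
   by (simp only:)
 qed
 finally show ?thesis .
qed

section \<open>Images of irreducible sets\<close>

lemma homogeneous_map_scale:
 assumes "!!i. (%x. F x $ i) \<in> hpoly d"
 shows "F (c *s x) = c ^ d *s F x"
 using hpolyD[OF assms] by (simp add: cvec_eq_iff)

lemma vec_nonzero: "(x :: complex ^ 'n::finite) ~= 0 ==> EX i. x $ i ~= 0"
 by (auto simp: cvec_eq_iff)

text \<open>Forms on the image pull back along F to forms on X. The extra factors
  \<open>F x $ i\<close> and \<open>F x $ j\<close> kill the base locus F = 0, where F defines no
  point and a constant form need not vanish.\<close>

lemma irred_in_image:
 assumes X: "irred_in zariski X" and F: "!!i. (%x. F x $ i) \<in> hpoly d"
  and ne: "x0 \<in> acone X" "F x0 ~= 0"
 shows "irred_in zariski {pt (F x) | x. x \<in> acone X & F x ~= 0}" (is "irred_in _ ?Y")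
proof -
 have inY: "F x \<in> acone ?Y" if "x \<in> acone X" "F x ~= 0" for x
  using that by (auto simp: acone_def)
 have "(ALL y:acone ?Y. f y = 0) | (ALL y:acone ?Y. g y = 0)"
  if f: "f \<in> hpoly k" and g: "g \<in> hpoly l" and fg: "ALL y:acone ?Y. f y * g y = 0" for k l f g
 proof (rule ccontr)
  assume "\<not> ?thesis"
  then obtain y z where y: "y \<in> acone ?Y" "f y ~= 0" and z: "z \<in> acone ?Y" "g z ~= 0" by blast
  have ex: "EX x:acone X. F x ~= 0 & u (F x) ~= 0" if uy: "u \<in> hpoly j" "y \<in> acone ?Y" "u y ~= 0" for u j y
  proof -
   obtain x where x: "x \<in> acone X" "F x ~= 0" "pt y = pt (F x)" "y ~= 0"
    using uy by (auto simp: acone_def)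
   then obtain c where "F x = c *s y" "c ~= 0" using pt_eq_iff[of y "F x"] by auto
   moreover have "u (F x) = c ^ j * u y" using hpolyD[OF uy(1)] \<open>F x = c *s y\<close> by simp
   ultimately show ?thesis using x(1,2) uy(3) by (intro bexI[of _ x]) auto
  qed
  obtain a where a: "a \<in> acone X" "F a ~= 0" "f (F a) ~= 0" using ex[OF f y] by blast
  obtain b where b: "b \<in> acone X" "F b ~= 0" "g (F b) ~= 0" using ex[OF g z] by blast
  obtain i where i: "F a $ i ~= 0" using vec_nonzero[OF a(2)] by blast
  obtain j where j: "F b $ j ~= 0" using vec_nonzero[OF b(2)] by blast
  have "(%x. f (F x) * F x $ i) \<in> hpoly (k * d + d)"
   by (intro hpoly_mult hpoly_compose f F)
  moreover have "(%x. g (F x) * F x $ j) \<in> hpoly (l * d + d)"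
   by (intro hpoly_mult hpoly_compose g F)
  moreover have "g (F x) * F x $ j = 0" if "x \<in> acone X" "f (F x) * F x $ i ~= 0" for x
  proof -
   have "F x ~= 0" using that(2) by auto
   then show ?thesis using fg inY[OF that(1)] that(2) by auto
  qed
  ultimately have "g (F b) * F b $ j = 0"
   by (rule irred_in_zariskiD[OF X _ _ _ a(1) _ b(1)]) (use a i in auto)
  then show False using b j by simp
 qed
 moreover have "?Y ~= {}" using ne by blast
 ultimately show ?thesis unfolding irred_in_zariski by blast
qed

lemma poly_fun_param:
 assumes "f \<in> poly_fun C" and "!!c. c \<in> C ==> EX p. ALL t. c (\<theta> t) = poly p t"
 shows "EX p. ALL t. f (\<theta> t) = poly p t"
 using assms(1)
proof induction
 case (const c)
 show ?case by (rule exI[of _ "[:c:]"]) simp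
next
 case (add f g)
 then show ?case by (metis poly_add)
next
 case (mult f g)
 then show ?case by (metis poly_mult)
qed (rule assms(2))

text \<open>A form restricted to the curve is a polynomial in the parameter. A product of two such
  polynomials with infinitely many zeros is zero, hence one of the factors is.\<close>

lemma irred_in_param_curve:
 fixes \<theta> :: "complex => complex ^ 'n::finite"
 assumes \<theta>: "!!i. EX p. ALL t. \<theta> t $ i = poly p t" and T: "infinite T" "!!t. t \<in> T ==> \<theta> t ~= 0"
 shows "irred_in zariski {pt (\<theta> t) | t. t \<in> T}" (is "irred_in _ ?Y")
proof -
 have "(ALL y:acone ?Y. f y = 0) | (ALL y:acone ?Y. g y = 0)"
  if f: "f \<in> hpoly k" and g: "g \<in> hpoly l" and fg: "ALL y:acone ?Y. f y * g y = 0" for k l f g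
 proof -
  obtain p where p: "!!t. f (\<theta> t) = poly p t"
   using poly_fun_param[OF hpoly_poly_fun[OF f], of \<theta>] \<theta> by auto
  obtain q where q: "!!t. g (\<theta> t) = poly q t"
   using poly_fun_param[OF hpoly_poly_fun[OF g], of \<theta>] \<theta> by auto
  have "poly (p * q) t = 0" if "t \<in> T" for t
   using fg T(2)[OF that] that p q by (auto simp: acone_def)
  then have "p * q = 0"
   using T(1) poly_roots_finite[of "p * q"] finite_subset[of T "{x. poly (p * q) x = 0}"] by blast
  then have "(ALL t. f (\<theta> t) = 0) | (ALL t. g (\<theta> t) = 0)" using p q by auto
  moreover have "EX t:T. EX c. c ~= 0 & \<theta> t = c *s y" if y: "y \<in> acone ?Y" for y
  proof -
   obtain t where t: "t \<in> T" "pt y = pt (\<theta> t)" "y ~= 0" using y by (auto simp: acone_def)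
   then show ?thesis using pt_eq_iff[of y "\<theta> t"] T(2) by blast
  qed
  moreover have "u y = 0" if "u \<in> hpoly j" "ALL t. u (\<theta> t) = 0" "c ~= 0" "\<theta> t = c *s y" for u j c t y
  proof -
   have "c ^ j * u y = 0" using that(2) hpolyD[OF that(1), of c y] that(4) by metis
   then show ?thesis using that(3) by simp
  qed
  ultimately show ?thesis using f g by blast
 qed
 moreover have "?Y ~= {}" using T(1) by (auto dest: infinite_imp_nonempty)
 ultimately show ?thesis unfolding irred_in_zariski by blast
qed

section \<open>Bounding the Krull dimension\<close>

text \<open>Dimension is controlled by the growth of the number of linearly independent forms of degree
  \<open>k\<close> on a variety.\<close>

definition indep_on :: "'a set => (nat => 'a => complex) => nat => bool" where
 "indep_on A u n \<longleftrightarrow> (ALL c. (ALL x:A. (\<Sum>i<n. c i * u i x) = 0) --> (ALL i<n. c i = 0))"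

lemma indep_onD: "indep_on A u n ==> (!!x. x \<in> A ==> (\<Sum>i<n. c i * u i x) = 0) ==> i < n ==> c i = 0"
 unfolding indep_on_def by blast

lemma sum_lessThan_add:
 fixes f :: "nat => 'a::comm_monoid_add"
 shows "(\<Sum>i<n + m. f i) = (\<Sum>i<n. f i) + (\<Sum>i<m. f (n + i))"
 by (induction m) (simp_all add: add.assoc)

text \<open>Primality again: multiplication by a form that is not zero on X is injective on the
  forms restricted to X.\<close>

lemma indep_on_times:
 assumes X: "irred_in zariski X" and f: "f \<in> hpoly e" "x0 \<in> acone X" "f x0 ~= 0"
  and u: "!!i. i < n ==> u i \<in> hpoly k" "indep_on (acone X) u n"
 shows "indep_on (acone X) (%i x. f x * u i x) n"
 unfolding indep_on_def
proof (intro allI impI)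
 fix c i assume c: "ALL x:acone X. (\<Sum>i<n. c i * (f x * u i x)) = 0" and i: "i < n"
 have *: "(\<Sum>i<n. c i * (f x * u i x)) = f x * (\<Sum>i<n. c i * u i x)" for x
  by (simp add: sum_distrib_left mult_ac)
 have h: "(%x. \<Sum>i<n. c i * u i x) \<in> hpoly k"
  using u(1) by (intro hpoly_sum hpoly_cmult) auto
 have "(\<Sum>i<n. c i * u i x) = 0" if "x \<in> acone X" for x
  by (rule irred_in_zariskiD[OF X f(1) h _ f(2,3) that]) (use c * in auto)
 then show "c i = 0" using indep_onD[OF u(2)] i by blast
qed

text \<open>On Y the multiples of f drop out, so the coefficients of the v vanish first; what
  remains is f times a relation among the u.\<close>

lemma indep_on_append:
 assumes X: "irred_in zariski X" and Y: "acone Y \<subseteq> acone X"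
  and f: "f \<in> hpoly e" "x0 \<in> acone X" "f x0 ~= 0" "!!y. y \<in> acone Y ==> f y = 0"
  and u: "!!i. i < n ==> u i \<in> hpoly k" "indep_on (acone X) u n"
  and v: "indep_on (acone Y) v m"
 shows "indep_on (acone X) (%i x. if i < n then f x * u i x else v (i - n) x) (n + m)"
 unfolding indep_on_def
proof (intro allI impI)
 fix c i
 let ?w = "%i x. if i < n then f x * u i x else v (i - n) x"
 assume c: "ALL x:acone X. (\<Sum>i<n + m. c i * ?w i x) = 0" and i: "i < n + m"
 have *: "(\<Sum>i<n + m. c i * ?w i x) = (\<Sum>i<n. c i * (f x * u i x)) + (\<Sum>i<m. c (n + i) * v i x)" for x
  by (simp add: sum_lessThan_add)
 have "(\<Sum>i<m. c (n + i) * v i y) = 0" if "y \<in> acone Y" for y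
 proof -
  have "(\<Sum>i<n. c i * (f y * u i y)) + (\<Sum>i<m. c (n + i) * v i y) = 0"
   using c that Y unfolding * by blast
  then show ?thesis using f(4)[OF that] by simp
 qed
 then have 2: "c (n + j) = 0" if "j < m" for j
  using indep_onD[OF v, of "%i. c (n + i)"] that by blast
 then have "(\<Sum>i<n. c i * (f x * u i x)) = 0" if "x \<in> acone X" for x
  using c * that by auto
 then have "c j = 0" if "j < n" for j
  using indep_onD[OF indep_on_times[OF X f(1-3) u]] that by blast
 then show "c i = 0" using 2[of "i - n"] i by (cases "i < n") auto
qed

text \<open>A bound of order m for the Hilbert function, uniform in the degree k; it expresses that
  the dimension is at most m.\<close>

definition forms_bound :: "'n::finite cp set => nat => nat => bool" where
 "forms_bound X m C \<longleftrightarrow> (ALL k n u. (ALL i<n. u i \<in> hpoly k) --> indep_on (acone X) u n --> n \<le> C * (k + 1) ^ m)"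

lemma forms_bound_subset:
 assumes "forms_bound X m C" "Y \<subseteq> X"
 shows "forms_bound Y m C"
proof -
 have "indep_on (acone X) u n" if "indep_on (acone Y) u n" for u n
  using that assms(2) unfolding indep_on_def acone_def by blast
 then show ?thesis using assms(1) unfolding forms_bound_def by blast
qed

text \<open>For f vanishing on Y but not on X, each step of the filtration of the forms on X by
  powers of f contains a copy of the forms on Y. Thus J + 1 steps give J + 1 times as many
  independent forms, while the degree grows by J e, where e is the degree of f.\<close>

lemma forms_bound_drop_aux:
 assumes X: "irred_in zariski X" and Y: "irred_in zariski Y" "closedin zariski Y" "Y \<subset> X"
 shows "EX e. ALL k n u J. (ALL i<n. u i \<in> hpoly k) --> indep_on (acone Y) u n -->
  (EX v. (ALL i<(J + 1) * n. v i \<in> hpoly (k + J * e)) & indep_on (acone X) v ((J + 1) * n))"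
proof -
 have YX: "acone Y \<subseteq> acone X" using Y(3) by (auto simp: acone_def)
 obtain p where p: "p \<in> X" "p \<notin> Y" using Y(3) by blast
 obtain x0 where "x0 ~= 0" "p = pt x0" by (rule pt_exhaust)
 then have x0: "x0 \<in> acone X" "x0 ~= 0" "pt x0 \<notin> Y" using p by (auto simp: acone_def)
 obtain e f where f: "f \<in> hpoly e" "!!y. y \<in> acone Y ==> f y = 0" "f x0 ~= 0"
  using closedin_zariskiE[OF Y(2) x0(2,3)] by blast
 obtain q where "q \<in> Y" using Y(1) unfolding irred_in_def by blast
 moreover obtain y0 where "y0 ~= 0" "q = pt y0" by (rule pt_exhaust)
 ultimately have y0: "y0 \<in> acone Y" "y0 ~= 0" by (auto simp: acone_def)
 obtain l where l: "y0 $ l ~= 0" using vec_nonzero[OF y0(2)] by blast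
 have lin: "(%x. (x $ l) ^ r) \<in> hpoly r" for r
  using hpoly_power[OF hpoly_coord[of l], of r] by simp
 have "EX v. (ALL i<(J + 1) * n. v i \<in> hpoly (k + J * e)) & indep_on (acone X) v ((J + 1) * n)"
  if u: "ALL i<n. u i \<in> hpoly k" "indep_on (acone Y) u n" for k n u J
 proof (induction J)
  case 0
  have "indep_on (acone X) u n" using u(2) YX unfolding indep_on_def by blast
  then show ?case using u(1) by (intro exI[of _ u]) auto
 next
  case (Suc J)
  then obtain v where v: "!!i. i < (J + 1) * n ==> v i \<in> hpoly (k + J * e)"
   "indep_on (acone X) v ((J + 1) * n)" by blast
  \<comment> \<open>The new copy is lifted to the common degree by a power of a coordinate that is
    not identically zero on Y, which preserves its independence there.\<close>
  define w where "w i x = (x $ l) ^ (Suc J * e) * u i x" for i x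
  have w: "w i \<in> hpoly (k + Suc J * e)" if "i < n" for i
   using hpoly_mult[OF lin, of "u i" k "Suc J * e"] u(1) that unfolding w_def by (simp add: add_ac)
  have wi: "indep_on (acone Y) w n"
   unfolding w_def using u l y0 by (intro indep_on_times[OF Y(1) lin y0(1)]) auto
  let ?v = "%i x. if i < (J + 1) * n then f x * v i x else w (i - (J + 1) * n) x"
  have "indep_on (acone X) ?v ((J + 1) * n + n)"
   by (rule indep_on_append[OF X YX f(1) x0(1) f(3) f(2) v wi])
  moreover have "(J + 1) * n + n = (Suc J + 1) * n" by simp
  ultimately have "indep_on (acone X) ?v ((Suc J + 1) * n)" by (simp only:)
  moreover have "(%x. if i < (J + 1) * n then f x * v i x else w (i - (J + 1) * n) x) \<in> hpoly (k + Suc J * e)"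
   if "i < (Suc J + 1) * n" for i
  proof (cases "i < (J + 1) * n")
   case True
   then show ?thesis using hpoly_mult[OF f(1) v(1)[OF True]] by (simp add: add_ac)
  next
   case False
   then show ?thesis using w[of "i - (J + 1) * n"] that by auto
  qed
  ultimately show ?case by (intro exI[of _ ?v]) blast
 qed
 then show ?thesis by blast
qed

text \<open>With J = k there are k + 1 copies in a degree still linear in k, so the bound for X is
  divided by k + 1 and the exponent drops by one.\<close>

lemma forms_bound_drop:
 assumes "irred_in zariski X" "irred_in zariski Y" "closedin zariski Y" "Y \<subset> X"
  and "forms_bound X (Suc m) C"
 shows "EX C'. forms_bound Y m C'"
proof -
 obtain e where e: "!!k n u J. (ALL i<n. u i \<in> hpoly k) ==> indep_on (acone Y) u n ==>
  (EX v. (ALL i<(J + 1) * n. v i \<in> hpoly (k + J * e)) & indep_on (acone X) v ((J + 1) * n))"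
  using forms_bound_drop_aux[OF assms(1-4)] by blast
 have "n \<le> C * (e + 1) ^ Suc m * (k + 1) ^ m"
  if u: "ALL i<n. u i \<in> hpoly k" "indep_on (acone Y) u n" for k n u
 proof -
  obtain v where "ALL i<(k + 1) * n. v i \<in> hpoly (k + k * e)" "indep_on (acone X) v ((k + 1) * n)"
   using e[OF u, of k] by blast
  then have "(k + 1) * n \<le> C * (k + k * e + 1) ^ Suc m"
   using assms(5) unfolding forms_bound_def by blast
  also have "\<dots> \<le> C * ((k + 1) * (e + 1)) ^ Suc m"
   by (intro mult_le_mono2 power_mono) (auto simp: algebra_simps)
  also have "\<dots> = (k + 1) * (C * (e + 1) ^ Suc m * (k + 1) ^ m)"
   unfolding power_mult_distrib power_Suc[of "k + 1"] by (simp only: mult_ac)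
  finally show ?thesis by (simp only: nat_mult_le_cancel1 zero_less_Suc Suc_eq_plus1[symmetric])
 qed
 then have "forms_bound Y m (C * (e + 1) ^ Suc m)" unfolding forms_bound_def by blast
 then show ?thesis by blast
qed

text \<open>Already the constant form 1 on Y produces C + 1 independent forms on X, more than the
  constant bound C.\<close>

lemma forms_bound_0:
 assumes "irred_in zariski X" "irred_in zariski Y" "closedin zariski Y" "Y \<subset> X"
 shows "\<not> forms_bound X 0 C"
proof
 assume b: "forms_bound X 0 C"
 obtain e where e: "!!k n u J. (ALL i<n. u i \<in> hpoly k) ==> indep_on (acone Y) u n ==>
  (EX v. (ALL i<(J + 1) * n. v i \<in> hpoly (k + J * e)) & indep_on (acone X) v ((J + 1) * n))"
  using forms_bound_drop_aux[OF assms(1-4)] by blast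
 obtain q where "q \<in> Y" using assms(2) unfolding irred_in_def by blast
 moreover obtain y where "y ~= 0" "q = pt y" by (rule pt_exhaust)
 ultimately have "y \<in> acone Y" by (auto simp: acone_def)
 then have "indep_on (acone Y) (%_ _. 1) 1" unfolding indep_on_def by auto
 then obtain v where "ALL i<(C + 1) * 1. v i \<in> hpoly (0 + C * e)" "indep_on (acone X) v ((C + 1) * 1)"
  using e[of 1 "%_ _. 1" 0 C] hpoly_const[of 1] by blast
 then have "(C + 1) * 1 \<le> C * (0 + C * e + 1) ^ 0" using b unfolding forms_bound_def by blast
 then show False by simp
qed

text \<open>Going down from \<open>Z 3\<close> to \<open>Z 1\<close> lowers the exponent from 2 to
  0, and exponent 0 leaves no room for \<open>Z 0\<close> below \<open>Z 1\<close>.\<close>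

lemma no_irred_chain_3:
 assumes "forms_bound X 2 C"
 shows "\<not> irred_chain zariski X (Suc 2)"
proof
 assume "irred_chain zariski X (Suc 2)"
 then obtain Z where Z: "!!i. i \<le> 3 ==> closedin zariski (Z i)" "!!i. i \<le> 3 ==> irred_in zariski (Z i)"
  "!!i. i \<le> 3 ==> Z i \<subseteq> X" "!!i. i < 3 ==> Z i \<subset> Z (Suc i)"
  unfolding irred_chain_def by (auto simp: numeral_eq_Suc)
 have Z4: "Z 2 \<subset> Z 3" "Z 1 \<subset> Z 2" "Z 0 \<subset> Z 1"
  using Z(4)[of 2] Z(4)[of 1] Z(4)[of 0] by (simp_all add: numeral_eq_Suc)
 have "forms_bound (Z 3) (Suc (Suc 0)) C"
  using forms_bound_subset[OF assms Z(3)[of 3]] by (simp add: numeral_2_eq_2)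
 then obtain C1 where C1: "forms_bound (Z 2) (Suc 0) C1"
  using forms_bound_drop[OF Z(2)[of 3] Z(2)[of 2] Z(1)[of 2] Z4(1)] by auto
 then obtain C0 where "forms_bound (Z 1) 0 C0"
  using forms_bound_drop[OF Z(2)[of 2] Z(2)[of 1] Z(1)[of 1] Z4(2)] by auto
 then show False
  using forms_bound_0[OF Z(2)[of 1] Z(2)[of 0] Z(1)[of 0] Z4(3)] by auto
qed

subsection \<open>Varieties with a two-parameter polynomial parametrization\<close>

text \<open>\<open>hpoly\<close> speaks only of scaling. Substituting a parametrization needs the
  build-up of a form from d linear factors, so that degrees in the parameters can be counted by
  induction.\<close>

inductive graded :: "nat => (complex ^ 'n::finite => complex) => bool" where
 const: "graded 0 (%_. c)"
| coord: "graded d f ==> graded (Suc d) (%x. x $ i * f x)"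
| add: "graded d f ==> graded d g ==> graded d (%x. f x + g x)"

lemma graded_zero: "graded d (%_. 0)"
proof (induction d)
 case (Suc d)
 from graded.coord[OF this] show ?case by simp
qed (rule graded.const)

lemma graded_cmult: "graded d f ==> graded d (%x. c * f x)"
proof (induction rule: graded.induct)
 case (coord d f i)
 from graded.coord[OF coord.IH, of i] show ?case by (simp add: mult_ac)
qed (auto simp: algebra_simps intro: graded.const graded.add)

lemma graded_mult: "graded d f ==> graded e g ==> graded (d + e) (%x. f x * g x)"
proof (induction rule: graded.induct)
 case (const c)
 then show ?case using graded_cmult[of e g c] by simp
next
 case (coord d f i)
 from graded.coord[OF coord.IH[OF coord.prems], of i] show ?case by (simp add: mult_ac)
next
 case (add d f1 f2)
 from graded.add[OF add.IH(1)[OF add.prems] add.IH(2)[OF add.prems]] show ?case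
  by (simp add: algebra_simps)
qed

lemma graded_sum: "(!!i. i \<in> I ==> graded d (f i)) ==> graded d (%x. \<Sum>i\<in>I. f i x)"
 by (induction I rule: infinite_finite_induct) (auto intro: graded_zero graded.add)

text \<open>In the expansion of \<open>f (a *s x)\<close> in powers of a, the i-th coefficient is
  graded of degree i. Homogeneity leaves only the d-th one, which is f itself.\<close>

lemma hpoly_graded:
 assumes "f \<in> hpoly d"
 shows "graded d f"
proof -
 have "EX P. (ALL x a. f (a *s x) = poly (P x) a) & (ALL i. graded i (%x. coeff (P x) i))"
  using hpoly_poly_fun[OF assms]
 proof induction
  case (const c)
  have "graded i (%x. coeff [:c:] i)" for i
   using graded.const[of c] graded_zero[of i] by (cases i) auto
  then show ?case by (intro exI[of _ "%_. [:c:]"]) auto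
 next
  case (coord c)
  then obtain j where j: "c = (%x. x $ j)" by blast
  have "graded i (%x. coeff [:0, x $ j:] i)" for i
  proof -
   have 1: "graded (Suc 0) (%x. x $ j)" using graded.coord[OF graded.const[of 1], of j] by simp
   consider "i = 0" | "i = 1" | k where "i = Suc (Suc k)" by (metis One_nat_def not0_implies_Suc)
   then show ?thesis using 1 graded_zero by cases (auto simp: graded_zero)
  qed
  then show ?case using j by (intro exI[of _ "%x. [:0, x $ j:]"]) auto
 next
  case (add f g)
  then obtain P Q where *: "!!x a. f (a *s x) = poly (P x) a" "!!i. graded i (%x. coeff (P x) i)"
   "!!x a. g (a *s x) = poly (Q x) a" "!!i. graded i (%x. coeff (Q x) i)" by blast
  show ?case
   by (rule exI[of _ "%x. P x + Q x"]) (auto simp: * intro: graded.add)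
 next
  case (mult f g)
  then obtain P Q where *: "!!x a. f (a *s x) = poly (P x) a" "!!i. graded i (%x. coeff (P x) i)"
   "!!x a. g (a *s x) = poly (Q x) a" "!!i. graded i (%x. coeff (Q x) i)" by blast
  have "graded i (%x. coeff (P x) j * coeff (Q x) (i - j))" if "j \<le> i" for i j
   using graded_mult[OF *(2)[of j] *(4)[of "i - j"]] that by simp
  then have "graded i (%x. coeff (P x * Q x) i)" for i
   unfolding coeff_mult by (intro graded_sum) auto
  then show ?case
   by (intro exI[of _ "%x. P x * Q x"]) (auto simp: *)
 qed
 then obtain P where P: "!!x a. f (a *s x) = poly (P x) a" "!!i. graded i (%x. coeff (P x) i)" by blast
 have "P x = monom (f x) d" for x
 proof -
  have "poly (P x) = poly (monom (f x) d)"
   using P(1)[where x=x] hpolyD[OF assms, of _ x] by (auto simp: poly_monom fun_eq_iff mult_ac)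
  then show ?thesis by (simp only: poly_eq_poly_eq_iff)
 qed
 then have "(%x. coeff (P x) d) = f" by (simp add: fun_eq_iff)
 then show ?thesis using P(2)[of d] by simp
qed

text \<open>N bounds the degree in each variable separately, which leaves (N + 1)^2 monomials; this
  is the source of the exponent 2 in the bound for parametrized surfaces.\<close>

definition bipoly :: "nat => (complex \<times> complex => complex) => bool" where
 "bipoly N u \<longleftrightarrow> (EX c. ALL s w. u (s, w) = (\<Sum>(i, j)\<in>{..N} \<times> {..N}. c i j * s ^ i * w ^ j))"

lemma bipoly_monomial:
 assumes "i \<le> N" "j \<le> N"
 shows "bipoly N (%(s, w). c * s ^ i * w ^ j)"
 unfolding bipoly_def
proof (intro exI allI)
 fix s w :: complex
 have "(\<Sum>(k, l)\<in>{..N} \<times> {..N}. (if k = i & l = j then c else 0) * s ^ k * w ^ l) =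
  (\<Sum>z\<in>{..N} \<times> {..N}. if z = (i, j) then c * s ^ i * w ^ j else 0)"
  by (intro sum.cong) (auto split: if_splits)
 also have "\<dots> = c * s ^ i * w ^ j" using assms by (simp add: sum.delta)
 finally show "(case (s, w) of (s, w) => c * s ^ i * w ^ j) =
  (\<Sum>(k, l)\<in>{..N} \<times> {..N}. (if k = i & l = j then c else 0) * s ^ k * w ^ l)" by simp
qed

lemma bipoly_add:
 assumes "bipoly N u" "bipoly N v"
 shows "bipoly N (%z. u z + v z)"
proof -
 obtain c d where *: "!!s w. u (s, w) = (\<Sum>(i, j)\<in>{..N} \<times> {..N}. c i j * s ^ i * w ^ j)"
  "!!s w. v (s, w) = (\<Sum>(i, j)\<in>{..N} \<times> {..N}. d i j * s ^ i * w ^ j)"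
  using assms unfolding bipoly_def by blast
 have e: "(\<Sum>(i, j)\<in>{..N} \<times> {..N}. c i j * s ^ i * w ^ j) + (\<Sum>(i, j)\<in>{..N} \<times> {..N}. d i j * s ^ i * w ^ j)
  = (\<Sum>(i, j)\<in>{..N} \<times> {..N}. (c i j + d i j) * s ^ i * w ^ j)" for s w
  unfolding sum.distrib[symmetric] by (rule sum.cong[OF refl]) (auto simp: distrib_right)
 show ?thesis unfolding bipoly_def * by (intro exI[of _ "%i j. c i j + d i j"] allI e)
qed

lemma bipoly_sum: "(!!i. i \<in> I ==> bipoly N (u i)) ==> bipoly N (%z. \<Sum>i\<in>I. u i z)"
proof (induction I rule: infinite_finite_induct)
 case (insert x F)
 then show ?case using bipoly_add[of N "u x"] by auto
qed (use bipoly_monomial[of 0 N 0 0] in \<open>auto simp: case_prod_unfold\<close>)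

lemma bipoly_mult:
 assumes "bipoly N u" "bipoly M v"
 shows "bipoly (N + M) (%z. u z * v z)"
proof -
 obtain c d where *: "!!s w. u (s, w) = (\<Sum>(i, j)\<in>{..N} \<times> {..N}. c i j * s ^ i * w ^ j)"
  "!!s w. v (s, w) = (\<Sum>(i, j)\<in>{..M} \<times> {..M}. d i j * s ^ i * w ^ j)"
  using assms unfolding bipoly_def by blast
 have "(%z. u z * v z) = (%z. \<Sum>(p, q)\<in>({..N} \<times> {..N}) \<times> ({..M} \<times> {..M}).
  (%(s, w). (c (fst p) (snd p) * d (fst q) (snd q)) * s ^ (fst p + fst q) * w ^ (snd p + snd q)) z)"
  by (auto simp: fun_eq_iff * sum_product sum.cartesian_product split_beta power_add mult_ac intro!: sum.cong)
 moreover have "bipoly (N + M) \<dots>"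
  unfolding split_beta by (intro bipoly_sum bipoly_monomial[unfolded split_beta]) auto
 ultimately show ?thesis by simp
qed

lemma graded_bipoly:
 assumes "graded d f" and \<Xi>: "!!i. bipoly D (%z. \<Xi> z $ i)"
 shows "bipoly (d * D) (%z. f (\<Xi> z))"
 using assms(1)
proof induction
 case (const c)
 show ?case using bipoly_monomial[of 0 0 0 c] by (simp add: case_prod_unfold)
next
 case (coord d f i)
 from bipoly_mult[OF \<Xi>[of i] coord.IH] show ?case by (simp add: add_ac)
next
 case (add d f g)
 then show ?case using bipoly_add by simp
qed

text \<open>Induction on the number of equations: an unknown k with nonzero coefficient in the last
  equation is eliminated, and \<sigma> enumerates the other unknowns.\<close>

lemma homogeneous_system_solution:
 fixes a :: "nat => nat => complex"
 assumes "N < n"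
 shows "EX x. (ALL i<N. (\<Sum>j<n. a i j * x j) = 0) & (EX j<n. x j ~= 0)"
 using assms
proof (induction N arbitrary: n a)
 case 0
 then show ?case by (intro exI[of _ "%_. 1"]) auto
next
 case (Suc N)
 then obtain m where n: "n = Suc m" "N < m" by (cases n) auto
 show ?case
 proof (cases "ALL j<n. a N j = 0")
  case True
  obtain x where "ALL i<N. (\<Sum>j<n. a i j * x j) = 0" "EX j<n. x j ~= 0"
   using Suc.IH[of n a] Suc.prems by auto
  then show ?thesis using True by (intro exI[of _ x]) (auto simp: less_Suc_eq)
 next
  case False
  then obtain k where k: "k < n" "a N k ~= 0" by blast
  define \<sigma> where "\<sigma> j = (if j < k then j else Suc j)" for j
  have inj: "inj_on \<sigma> {..<m}" by (auto simp: \<sigma>_def inj_on_def split: if_splits)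
  have img: "{..<n} = insert k (\<sigma> ` {..<m})"
  proof safe
   fix x assume "x < n" "x \<notin> \<sigma> ` {..<m}"
   show "x = k"
   proof (rule ccontr)
    assume "x ~= k"
    then have "x = \<sigma> (if x < k then x else x - 1)" "(if x < k then x else x - 1) < m"
     using \<open>x < n\<close> n k by (auto simp: \<sigma>_def)
    then show False using \<open>x \<notin> \<sigma> ` {..<m}\<close> by blast
   qed
  qed (use n k in \<open>auto simp: \<sigma>_def\<close>)
  have notin: "k \<notin> \<sigma> ` {..<m}" by (auto simp: \<sigma>_def split: if_splits)
  have split: "(\<Sum>j<n. g j) = g k + (\<Sum>j<m. g (\<sigma> j))" for g :: "nat => complex"
   unfolding img using notin inj by (simp add: sum.reindex)
  obtain y where y: "!!i. i < N ==> (\<Sum>j<m. (a i (\<sigma> j) - a i k / a N k * a N (\<sigma> j)) * y j) = 0"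
   "EX j<m. y j ~= 0"
   using Suc.IH[of m "%i j. a i (\<sigma> j) - a i k / a N k * a N (\<sigma> j)"] n by blast
  define x where "x i = (if i = k then - (\<Sum>j<m. a N (\<sigma> j) * y j) / a N k else y (inv_into {..<m} \<sigma> i))" for i
  have xs: "x (\<sigma> j) = y j" if "j < m" for j
   using that inj notin by (auto simp: x_def)
  have "(\<Sum>j<n. a i j * x j) = 0" if "i < Suc N" for i
  proof -
   have "(\<Sum>j<n. a i j * x j) = a i k * x k + (\<Sum>j<m. a i (\<sigma> j) * y j)"
    unfolding split by (simp add: xs)
   also have "\<dots> = (\<Sum>j<m. (a i (\<sigma> j) - a i k / a N k * a N (\<sigma> j)) * y j)"
    by (simp add: x_def sum_subtractf algebra_simps sum_distrib_left sum_divide_distrib)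
   also have "\<dots> = 0" using y(1) k(2) that by (cases "i = N") (auto simp: less_Suc_eq)
   finally show ?thesis .
  qed
  moreover have "EX j<n. x j ~= 0"
  proof -
   obtain j where j: "j < m" "y j ~= 0" using y(2) by blast
   then have "\<sigma> j < n" using n by (auto simp: \<sigma>_def)
   then show ?thesis using xs j by metis
  qed
  ultimately show ?thesis by blast
 qed
qed

text \<open>More functions than monomials force a linear relation between the coefficient vectors; b
  enumerates the monomials.\<close>

lemma bipoly_independent_bound:
 assumes u: "!!i. i < n ==> bipoly N (u i)" and ind: "indep_on A u n"
 shows "n \<le> (N + 1) ^ 2"
proof (rule ccontr)
 assume "\<not> n \<le> (N + 1) ^ 2"
 then have n: "(N + 1) ^ 2 < n" by simp
 have "ALL i. EX c. i < n --> (ALL s w. u i (s, w) = (\<Sum>(k, l)\<in>{..N} \<times> {..N}. c k l * s ^ k * w ^ l))"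
  using u unfolding bipoly_def by blast
 from choice[OF this] obtain c where c: "!!i s w. i < n ==> u i (s, w) = (\<Sum>(k, l)\<in>{..N} \<times> {..N}. c i k l * s ^ k * w ^ l)"
  by blast
 have "card ({..N} \<times> {..N}) = (N + 1) ^ 2" by (simp add: card_cartesian_product power2_eq_square)
 moreover obtain b where "bij_betw b {0..<card ({..N} \<times> {..N})} ({..N} \<times> {..N})"
  using ex_bij_betw_nat_finite[of "{..N} \<times> {..N}"] by auto
 ultimately have b: "bij_betw b {..<(N + 1) ^ 2} ({..N} \<times> {..N})"
  by (simp only: lessThan_atLeast0)
 obtain x where x: "ALL i<(N + 1) ^ 2. (\<Sum>j<n. c j (fst (b i)) (snd (b i)) * x j) = 0" "EX j<n. x j ~= 0"
  using homogeneous_system_solution[OF n, of "%i j. c j (fst (b i)) (snd (b i))"] by blast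
 have *: "(\<Sum>j<n. c j k l * x j) = 0" if kl: "k \<le> N" "l \<le> N" for k l
 proof -
  have "(k, l) \<in> b ` {..<(N + 1) ^ 2}" using b kl by (simp add: bij_betw_def)
  then obtain i where "i < (N + 1) ^ 2" "b i = (k, l)" by force
  then show ?thesis using x(1) by auto
 qed
 have "(\<Sum>j<n. x j * u j z) = 0" for z
 proof -
  obtain s w where z: "z = (s, w)" by (cases z)
  have "(\<Sum>j<n. x j * u j z) = (\<Sum>j<n. \<Sum>(k, l)\<in>{..N} \<times> {..N}. c j k l * x j * (s ^ k * w ^ l))"
   unfolding z by (intro sum.cong refl) (simp add: c sum_distrib_left split_beta mult_ac)
  also have "\<dots> = (\<Sum>(k, l)\<in>{..N} \<times> {..N}. (\<Sum>j<n. c j k l * x j) * (s ^ k * w ^ l))"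
   by (subst sum.swap) (simp add: sum_distrib_right split_beta)
  also have "\<dots> = 0" by (rule sum.neutral) (auto simp: *)
  finally show ?thesis .
 qed
 then show False using indep_onD[OF ind, of x] x(2) by blast
qed

text \<open>Pulling back along \<Xi> preserves independence, because a form vanishing along \<Xi>
  vanishes on X, and it turns forms of degree k into polynomials of degree at most k D in each
  parameter.\<close>

lemma forms_bound_parametrized:
 fixes \<Xi> :: "complex \<times> complex => complex ^ 'n::finite"
 assumes \<Xi>: "!!i. bipoly D (%z. \<Xi> z $ i)"
  and X: "!!d f x. f \<in> hpoly d ==> (!!z. f (\<Xi> z) = 0) ==> x \<in> acone X ==> f x = 0"
 shows "forms_bound X 2 ((D + 1) ^ 2)"
 unfolding forms_bound_def
proof (intro allI impI)
 fix k n u assume u: "ALL i<n. u i \<in> hpoly k" "indep_on (acone X) u n"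
 have "indep_on UNIV (%i z. u i (\<Xi> z)) n"
  unfolding indep_on_def
 proof (intro allI impI)
  fix c i assume c: "ALL z:UNIV. (\<Sum>i<n. c i * u i (\<Xi> z)) = 0" and i: "i < n"
  have h: "(%x. \<Sum>i<n. c i * u i x) \<in> hpoly k" using u(1) by (intro hpoly_sum hpoly_cmult) auto
  then show "c i = 0" using indep_onD[OF u(2) X[OF h] i] c by blast
 qed
 moreover have "bipoly (k * D) (%z. u i (\<Xi> z))" if "i < n" for i
  using graded_bipoly[OF hpoly_graded \<Xi>] u(1) that by blast
 ultimately have "n \<le> (k * D + 1) ^ 2" by (rule bipoly_independent_bound[rotated])
 also have "\<dots> \<le> ((D + 1) * (k + 1)) ^ 2" by (intro power_mono) auto
 finally show "n \<le> (D + 1) ^ 2 * (k + 1) ^ 2" unfolding power_mult_distrib .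
qed

section \<open>Projections of closed sets are closed\<close>

definition upd :: "complex ^ 'n::finite => 'n => complex => complex ^ 'n" where
 "upd x j t = (\<chi> i. if i = j then t else x $ i)"

lemma upd_nth [simp]: "upd x j t $ i = (if i = j then t else x $ i)"
 by (simp add: upd_def)

lemma upd_upd [simp]: "upd (upd x j s) j t = upd x j t"
 by (simp add: cvec_eq_iff)

lemma upd_self [simp]: "upd x j (x $ j) = x"
 by (simp add: cvec_eq_iff)

lemma upd_scale: "a *s upd x j t = upd (a *s x) j (a * t)"
 by (simp add: cvec_eq_iff)

lemma coeff_linear: "coeff [:a, b:] i = (if i = 0 then a else if i = 1 then b else 0)"
 by (auto simp: coeff_pCons split: nat.splits)

lemma poly_fun_if: "f \<in> poly_fun C ==> g \<in> poly_fun C ==> (%z. if b then f z else g z) \<in> poly_fun C"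
 by (cases b) auto

lemma bicoords_cases:
 assumes "c \<in> bicoords"
 obtains i where "c = (%z. fst z $ i)" | i where "c = (%z. snd z $ i)"
 using assms by blast

lemma poly_fun_fst: "(%z. fst z $ i) \<in> poly_fun bicoords"
 by (rule poly_fun.coord) auto

lemma poly_fun_snd: "(%z. snd z $ i) \<in> poly_fun bicoords"
 by (rule poly_fun.coord) auto

lemma poly_fun_fst_scale:
 fixes f :: "(complex ^ 'n::finite) \<times> (complex ^ 'm::finite) => complex"
 assumes "f \<in> poly_fun bicoords"
 obtains P where "!!x y a. f (a *s x, y) = poly (P (x, y)) a" "!!i. (%z. coeff (P z) i) \<in> poly_fun bicoords"
proof -
 have "EX P N. (ALL z t. f (t *s fst z, snd z) = poly (P z) t) & (ALL i. (%z. coeff (P z) i) \<in> poly_fun bicoords) &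
  (ALL z. degree (P z) \<le> N)"
 \<comment> \<open>A coordinate of the first block is linear in the scaling factor and one of the
   second block is constant; evaluating c with the other block set to 0 yields both coefficients
   without a case distinction.\<close>
 proof (rule poly_fun_expand[OF assms, where p = "%c z. [:c (0, snd z), c (fst z, 0):]" and k = 1])
  fix c :: "(complex ^ 'n) \<times> (complex ^ 'm) => complex" and z t i
  assume c: "c \<in> bicoords"
  then show "c (t *s fst z, snd z) = poly [:c (0, snd z), c (fst z, 0):] t"
   by (rule bicoords_cases) auto
  show "(%z. coeff [:c (0, snd z), c (fst z, 0):] i) \<in> poly_fun bicoords"
   using c unfolding coeff_linear
   by (rule bicoords_cases) (auto intro!: poly_fun_if poly_fun.const poly_fun_fst poly_fun_snd)
  show "degree [:c (0, snd z), c (fst z, 0):] \<le> 1" by simp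
 qed
 then show ?thesis using that by (metis fst_conv snd_conv)
qed

lemma poly_fun_snd_scale:
 fixes f :: "(complex ^ 'n::finite) \<times> (complex ^ 'm::finite) => complex"
 assumes "f \<in> poly_fun bicoords"
 obtains P where "!!x y a. f (x, a *s y) = poly (P (x, y)) a" "!!i. (%z. coeff (P z) i) \<in> poly_fun bicoords"
proof -
 have "EX P N. (ALL z t. f (fst z, t *s snd z) = poly (P z) t) & (ALL i. (%z. coeff (P z) i) \<in> poly_fun bicoords) &
  (ALL z. degree (P z) \<le> N)"
 proof (rule poly_fun_expand[OF assms, where p = "%c z. [:c (fst z, 0), c (0, snd z):]" and k = 1])
  fix c :: "(complex ^ 'n) \<times> (complex ^ 'm) => complex" and z t i
  assume c: "c \<in> bicoords"
  then show "c (fst z, t *s snd z) = poly [:c (fst z, 0), c (0, snd z):] t"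
   by (rule bicoords_cases) auto
  show "(%z. coeff [:c (fst z, 0), c (0, snd z):] i) \<in> poly_fun bicoords"
   using c unfolding coeff_linear
   by (rule bicoords_cases) (auto intro!: poly_fun_if poly_fun.const poly_fun_fst poly_fun_snd)
  show "degree [:c (fst z, 0), c (0, snd z):] \<le> 1" by simp
 qed
 then show ?thesis using that by (metis fst_conv snd_conv)
qed

lemma poly_eq_scale:
 fixes p q :: "complex poly"
 assumes "!!t. poly p t = poly q (a * t)"
 shows "coeff p i = a ^ i * coeff q i"
proof -
 have "poly p = poly (pcompose q [:0, a:])"
  using assms by (auto simp: poly_pcompose mult_ac)
 then have "p = pcompose q [:0, a:]" by (simp only: poly_eq_poly_eq_iff)
 then show ?thesis by (simp add: coeff_pcompose_linear)
qed

lemma poly_zero_all: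
 fixes p :: "complex poly"
 assumes "!!t. poly p t = 0" shows "p = 0"
 using assms poly_all_0_iff_0 by blast

lemma poly_same:
 fixes p q :: "complex poly"
 assumes "!!t. poly p t = poly q t" shows "p = q"
 using assms by (metis ext poly_eq_poly_eq_iff)

text \<open>Coefficient extraction in the scalings of x and then of y. Some coefficient survives at
  (x0, y0), and every coefficient inherits independence of \<open>x $ j\<close> and vanishes where
  all rescalings of f vanish.\<close>

lemma bihomogeneous_component:
 fixes f :: "(complex ^ 'n::finite) \<times> (complex ^ 'm::finite) => complex"
 assumes f: "f \<in> poly_fun bicoords" "f (x0, y0) ~= 0" and ind: "!!x y t. f (upd x j t, y) = f (x, y)"
 shows "EX d e. EX g:bihpoly d e. g (x0, y0) ~= 0 & (ALL x y t. g (upd x j t, y) = g (x, y)) &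
  (ALL x y. (ALL a b. f (a *s x, b *s y) = 0) --> g (x, y) = 0)"
proof -
 obtain P where P: "!!x y a. f (a *s x, y) = poly (P (x, y)) a"
  "!!i. (%z. coeff (P z) i) \<in> poly_fun bicoords" using poly_fun_fst_scale[OF f(1)] by blast
 have "poly (P (x0, y0)) 1 ~= 0" using P(1)[of 1 x0 y0] f(2) by simp
 then have "P (x0, y0) ~= 0" by auto
 then obtain d where d: "coeff (P (x0, y0)) d ~= 0" by (auto simp: poly_eq_iff)
 define u where "u z = coeff (P z) d" for z
 have u: "u \<in> poly_fun bicoords" using P(2)[of d] unfolding u_def .
 have u_hom: "u (a *s x, y) = a ^ d * u (x, y)" for a x y
  unfolding u_def
 proof (rule poly_eq_scale)
  fix t show "poly (P (a *s x, y)) t = poly (P (x, y)) (a * t)"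
   using P(1)[of t "a *s x" y] P(1)[of "a * t" x y] by (simp add: mult_ac)
 qed
 have u_ind: "u (upd x j t, y) = u (x, y)" for x y t
 proof -
  have "P (upd x j t, y) = P (x, y)"
  proof (rule poly_same)
   fix a show "poly (P (upd x j t, y)) a = poly (P (x, y)) a"
    using P(1)[of a "upd x j t" y] P(1)[of a x y] ind[of "a *s x" "a * t" y] by (simp add: upd_scale)
  qed
  then show ?thesis by (simp add: u_def)
 qed
 have u_van: "u (x, b *s y) = 0" if "!!a b. f (a *s x, b *s y) = 0" for x y b
 proof -
  have "P (x, b *s y) = 0" using P(1)[of _ x "b *s y"] that by (intro poly_zero_all) simp
  then show ?thesis by (simp add: u_def)
 qed
 obtain Q where Q: "!!x y a. u (x, a *s y) = poly (Q (x, y)) a"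
  "!!i. (%z. coeff (Q z) i) \<in> poly_fun bicoords" using poly_fun_snd_scale[OF u] by blast
 have "poly (Q (x0, y0)) 1 ~= 0" using Q(1)[of x0 1 y0] d by (simp add: u_def)
 then have "Q (x0, y0) ~= 0" by auto
 then obtain e where e: "coeff (Q (x0, y0)) e ~= 0" by (auto simp: poly_eq_iff)
 define g where "g z = coeff (Q z) e" for z
 have g1: "g (a *s x, y) = a ^ d * g (x, y)" for a x y
 proof -
  have "Q (a *s x, y) = Polynomial.smult (a ^ d) (Q (x, y))"
  proof (rule poly_same)
   fix t show "poly (Q (a *s x, y)) t = poly (Polynomial.smult (a ^ d) (Q (x, y))) t"
    using Q(1)[of "a *s x" t y] Q(1)[of x t y] u_hom[of a x "t *s y"] by simp
  qed
  then show ?thesis by (simp add: g_def)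
 qed
 have g2: "g (x, b *s y) = b ^ e * g (x, y)" for b x y
  unfolding g_def
 proof (rule poly_eq_scale)
  fix t show "poly (Q (x, b *s y)) t = poly (Q (x, y)) (b * t)"
   using Q(1)[of x t "b *s y"] Q(1)[of x "b * t" y] by (simp add: mult_ac)
 qed
 have "g \<in> poly_fun bicoords" using Q(2)[of e] unfolding g_def .
 then have "g \<in> bihpoly d e" by (simp add: bihpoly_def g1 g2)
 moreover have "g (x0, y0) ~= 0" using e by (simp add: g_def)
 moreover have "g (upd x j t, y) = g (x, y)" for x y t
 proof -
  have "Q (upd x j t, y) = Q (x, y)"
   by (rule poly_same) (metis Q(1) u_ind)
  then show ?thesis by (simp add: g_def)
 qed
 moreover have "g (x, y) = 0" if "ALL a b. f (a *s x, b *s y) = 0" for x y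
 proof -
  have "Q (x, y) = 0" using Q(1)[of x _ y] u_van[of x y] that by (intro poly_zero_all) simp
  then show ?thesis by (simp add: g_def)
 qed
 ultimately show ?thesis by (intro exI[of _ d] exI[of _ e] bexI[of _ g]) simp_all
qed

lemma poly_fun_upd:
 fixes f :: "(complex ^ 'n::finite) \<times> (complex ^ 'm::finite) => complex"
 assumes "f \<in> poly_fun bicoords"
 obtains P N where "!!x y t. f (upd x j t, y) = poly (P (x, y)) t"
  "!!i. (%z. coeff (P z) i) \<in> poly_fun bicoords" "!!z. degree (P z) \<le> N"
proof -
 have "EX P N. (ALL z t. f (upd (fst z) j t, snd z) = poly (P z) t) & (ALL i. (%z. coeff (P z) i) \<in> poly_fun bicoords) &
  (ALL z. degree (P z) \<le> N)"
 proof (rule poly_fun_expand[OF assms, where p = "%c z. [:c (upd (fst z) j 0, snd z), c (axis j 1, 0):]" and k = 1])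
  fix c :: "(complex ^ 'n) \<times> (complex ^ 'm) => complex" and z t i
  assume c: "c \<in> bicoords"
  then show "c (upd (fst z) j t, snd z) = poly [:c (upd (fst z) j 0, snd z), c (axis j 1, 0):] t"
   by (rule bicoords_cases) (auto simp: axis_def)
  have "(%z. c (upd (fst z) j 0, snd z)) \<in> poly_fun bicoords"
   using c
  proof (rule bicoords_cases)
   fix i assume "c = (%z. fst z $ i)"
   then show ?thesis by (cases "i = j") (auto intro: poly_fun.const poly_fun_fst)
  next
   fix i assume "c = (%z. snd z $ i)"
   then show ?thesis by (auto intro: poly_fun_snd)
  qed
  then show "(%z. coeff [:c (upd (fst z) j 0, snd z), c (axis j 1, 0):] i) \<in> poly_fun bicoords"
   unfolding coeff_linear by (intro poly_fun_if poly_fun.const)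
  show "degree [:c (upd (fst z) j 0, snd z), c (axis j 1, 0):] \<le> 1" by simp
 qed
 then obtain P N where *: "!!z t. f (upd (fst z) j t, snd z) = poly (P z) t"
  "!!i. (%z. coeff (P z) i) \<in> poly_fun bicoords" "!!z. degree (P z) \<le> N" by blast
 show ?thesis by (rule that[of P N]) (use *(1)[of "(_, _)"] *(2,3) in auto)
qed

text \<open>In the variable \<open>x $ j\<close> a form of degree \<open>m\<close> has degree at most \<open>m\<close>, and its leading
  coefficient is its value at the \<open>j\<close>-th coordinate point.\<close>

lemma bihpoly_upd_degree:
 fixes f :: "(complex ^ 'n::finite) \<times> (complex ^ 'm::finite) => complex"
 assumes f: "f \<in> bihpoly m e" and P: "!!x y t. f (upd x j t, y) = poly (P (x, y)) t"
  "!!i. (%z. coeff (P z) i) \<in> poly_fun bicoords"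
 shows "degree (P (x, y)) \<le> m" and "coeff (P (x, y)) m = f (axis j 1, y)"
proof -
 \<comment> \<open>The i-th coefficient in \<open>x $ j\<close> is homogeneous of degree m - i in x.
   Multiplying by a^i instead of subtracting i also covers i > m, where it forces the coefficient to
   vanish.\<close>
 have key: "a ^ i * coeff (P (a *s x, y)) i = a ^ m * coeff (P (x, y)) i" for a i
 proof -
  have "coeff (Polynomial.smult (a ^ m) (P (x, y))) i = a ^ i * coeff (P (a *s x, y)) i"
  proof (rule poly_eq_scale)
   fix t
   have "f (upd (a *s x) j (a * t), y) = a ^ m * f (upd x j t, y)"
    using bihpolyD[OF f, of a "upd x j t" 1 y] by (simp add: upd_scale)
   then show "poly (Polynomial.smult (a ^ m) (P (x, y))) t = poly (P (a *s x, y)) (a * t)"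
    using P(1) by simp
  qed
  then show ?thesis by simp
 qed
 have "EX q. ALL a. coeff (P (a *s x, y)) i = poly q a" for i
 proof -
  have cc: "EX p. ALL t. c (t *s x, y) = poly p t" if "c \<in> bicoords" for c
   using that
  proof (rule bicoords_cases)
   fix i assume "c = (%z. fst z $ i)"
   then show ?thesis by (intro exI[of _ "[:0, x $ i:]"]) auto
  next
   fix i assume "c = (%z. snd z $ i)"
   then show ?thesis by (intro exI[of _ "[:y $ i:]"]) auto
  qed
  from P(2)[of i] show ?thesis
  proof induction
   case (const c)
   show ?case by (rule exI[of _ "[:c:]"]) simp
  next
   case (coord c)
   then show ?case by (rule cc)
  next
   case (add f g)
   then obtain p q where "ALL a. f (a *s x, y) = poly p a" "ALL a. g (a *s x, y) = poly q a" by blast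
   then show ?case by (intro exI[of _ "p + q"]) simp
  next
   case (mult f g)
   then obtain p q where "ALL a. f (a *s x, y) = poly p a" "ALL a. g (a *s x, y) = poly q a" by blast
   then show ?case by (intro exI[of _ "p * q"]) simp
  qed
 qed
 then obtain q where q: "!!i a. coeff (P (a *s x, y)) i = poly (q i) a" by metis
 have eq: "monom 1 i * q i = monom (coeff (P (x, y)) i) m" for i
  by (rule poly_same) (use key[of _ i] in \<open>simp add: poly_monom q mult_ac\<close>)
 have "coeff (P (x, y)) i = 0" if "m < i" for i
 proof -
  have "coeff (monom 1 i * q i) m = 0" using that by (simp add: coeff_monom_mult)
  then show ?thesis using eq[of i] by simp
 qed
 then show "degree (P (x, y)) \<le> m" by (intro degree_le) auto
 \<comment> \<open>For i = m the coefficient is constant along the ray through x, so it can be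
   computed at x = 0.\<close>
 have "monom 1 m * q m = monom 1 m * [:coeff (P (x, y)) m:]"
  using eq[of m] by (simp add: smult_monom)
 then have "q m = [:coeff (P (x, y)) m:]" by (subst (asm) mult_left_cancel) auto
 then have "coeff (P (x, y)) m = coeff (P (0, y)) m" using q[of 0 m] by simp
 also have "P (0, y) = monom (f (axis j 1, y)) m"
 proof (rule poly_same)
  fix t
  have "upd 0 j t = t *s (axis j 1 :: complex ^ 'n)" by (simp add: cvec_eq_iff axis_def)
  then have "f (upd 0 j t, y) = t ^ m * f (axis j 1, y)"
   using bihpolyD[OF f, of t "axis j 1" 1 y] by simp
  then show "poly (P (0, y)) t = poly (monom (f (axis j 1, y)) m) t"
   using P(1)[of 0 t y] by (simp add: poly_monom mult_ac)
 qed
 finally show "coeff (P (x, y)) m = f (axis j 1, y)" by simp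
qed

section \<open>Resultants by Sylvester matrices\<close>

lemma sum_shifted_coeffs:
 fixes p :: "complex poly"
 assumes "degree p \<le> k" "r + k < N"
 shows "(\<Sum>c<N. (if r \<le> c then coeff p (c - r) else 0) * t ^ c) = t ^ r * poly p t"
proof -
 have "poly p t = (\<Sum>i\<le>k. coeff p i * t ^ i)"
  unfolding poly_altdef using assms(1) by (intro sum.mono_neutral_left) (auto simp: coeff_eq_0)
 then have "t ^ r * poly p t = (\<Sum>i\<le>k. coeff p i * t ^ (r + i))"
  by (simp add: sum_distrib_left power_add mult_ac)
 also have "\<dots> = (\<Sum>c\<in>(%i. r + i) ` {..k}. coeff p (c - r) * t ^ c)"
  by (subst sum.reindex) auto
 also have "\<dots> = (\<Sum>c<N. (if r \<le> c then coeff p (c - r) else 0) * t ^ c)"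
 proof (rule sum.mono_neutral_cong_left)
  show "(%i. r + i) ` {..k} \<subseteq> {..<N}" using assms(2) by auto
  show "ALL c:{..<N} - (%i. r + i) ` {..k}. (if r \<le> c then coeff p (c - r) else 0) * t ^ c = 0"
  proof
   fix c assume c: "c \<in> {..<N} - (%i. r + i) ` {..k}"
   have "k < c - r" if "r \<le> c"
   proof (rule ccontr)
    assume "\<not> k < c - r"
    then have "c = r + (c - r)" "c - r \<in> {..k}" using that by auto
    then show False using c by blast
   qed
   then show "(if r \<le> c then coeff p (c - r) else 0) * t ^ c = 0"
    using assms(1) by (auto simp: coeff_eq_0)
  qed
 qed auto
 finally show ?thesis ..
qed

text \<open>Formal degrees m of p and n of q are prescribed, so that the determinant is a polynomial
  in the coefficients even where leading coefficients vanish. Coefficients run in ascending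
  order.\<close>

definition sylv :: "nat => nat => complex poly => complex poly => complex Matrix.mat" where
 "sylv m n p q = Matrix.mat (m + n) (m + n) (%(r, c).
  if r < m then (if r \<le> c then coeff q (c - r) else 0)
  else (if r - m \<le> c then coeff p (c - (r - m)) else 0))"

lemma sylv_carrier: "sylv m n p q \<in> carrier_mat (m + n) (m + n)"
 by (simp add: sylv_def)

text \<open>The vector (1, t, t^2, ...) of powers of the common root is a nonzero element of the
  kernel.\<close>

lemma det_sylv_common_root:
 assumes "degree p \<le> m" "degree q \<le> n" "0 < m + n" "poly p t = 0" "poly q t = 0"
 shows "Determinant.det (sylv m n p q) = 0"
proof -
 define v where "v = Matrix.vec (m + n) (%c. t ^ c)"
 have "Matrix.vec_index v 0 = 1" using assms(3) by (simp add: v_def)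
 then have "v ~= 0\<^sub>v (m + n)" using assms(3) by auto
 moreover have "sylv m n p q *\<^sub>v v = 0\<^sub>v (m + n)"
 proof (rule eq_vecI)
  fix r assume "r < dim_vec (0\<^sub>v (m + n) :: complex Matrix.vec)"
  then have r: "r < m + n" by simp
  show "Matrix.vec_index (sylv m n p q *\<^sub>v v) r = Matrix.vec_index (0\<^sub>v (m + n)) r"
  proof (cases "r < m")
   case True
   have "Matrix.vec_index (sylv m n p q *\<^sub>v v) r = (\<Sum>c<m + n. (if r \<le> c then coeff q (c - r) else 0) * t ^ c)"
    using r True by (simp add: sylv_def v_def scalar_prod_def lessThan_atLeast0)
   then show ?thesis using sum_shifted_coeffs[OF assms(2), of r "m + n" t] True r assms(5) by simp
  next
   case False
   have "Matrix.vec_index (sylv m n p q *\<^sub>v v) r = (\<Sum>c<m + n. (if r - m \<le> c then coeff p (c - (r - m)) else 0) * t ^ c)"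
    using r False by (simp add: sylv_def v_def scalar_prod_def lessThan_atLeast0)
   then show ?thesis using sum_shifted_coeffs[OF assms(1), of "r - m" "m + n" t] False r assms(4) by simp
  qed
 qed (simp add: sylv_def)
 moreover have "v \<in> carrier_vec (m + n)" by (simp add: v_def)
 ultimately show ?thesis
  unfolding det_0_iff_vec_prod_zero[OF sylv_carrier] by blast
qed

text \<open>For q = 1 the matrix is lower triangular; its diagonal entries are 1 and
  \<open>coeff p m\<close>.\<close>

lemma det_sylv_const:
 assumes "degree p \<le> m" "coeff p m ~= 0"
 shows "Determinant.det (sylv m n p [:1:]) ~= 0"
proof -
 have c1: "coeff [:1::complex:] k = (if k = 0 then 1 else 0)" for k
  by (auto simp: coeff_pCons split: nat.splits)
 have "Determinant.det (sylv m n p [:1:]) = prod_list (diag_mat (sylv m n p [:1:]))"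
 proof (rule det_lower_triangular[OF _ sylv_carrier])
  fix i j assume "i < j" "j < m + n"
  then show "sylv m n p [:1:] $$ (i, j) = 0"
   using assms(1) by (auto simp: sylv_def c1 coeff_eq_0)
 qed
 also have "\<dots> = (\<Prod>i = 0..<m + n. sylv m n p [:1:] $$ (i, i))"
  using sylv_carrier[of m n p "[:1:]"] by (simp add: prod_list_diag_prod)
 also have "\<dots> ~= 0"
  using assms(2) by (auto simp: sylv_def c1)
 finally show ?thesis .
qed

lemma poly_fun_det_sylv:
 assumes "!!i. (%z. coeff (P z) i) \<in> poly_fun C" "!!i. (%z. coeff (Q z) i) \<in> poly_fun C"
 shows "(%z. Determinant.det (sylv m n (P z) (Q z))) \<in> poly_fun C"
proof -
 have "(%z. Determinant.det (sylv m n (P z) (Q z))) = (%z. \<Sum>p\<in>{p. p permutes {0..<m + n}}.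
   signof p * (\<Prod>i = 0..<m + n. sylv m n (P z) (Q z) $$ (i, p i)))"
  by (rule ext, rule det_def'[OF sylv_carrier])
 also have "\<dots> \<in> poly_fun C"
 proof (intro poly_fun_sum poly_fun_cmult poly_fun_prod)
  fix p i assume "p \<in> {p. p permutes {0..<m + n}}" "i \<in> {0..<m + n}"
  then have "i < m + n" "p i < m + n" using permutes_in_image[of p "{0..<m + n}" i] by auto
  then show "(%z. sylv m n (P z) (Q z) $$ (i, p i)) \<in> poly_fun C"
   using assms by (auto simp: sylv_def intro!: poly_fun_if poly_fun.const)
 qed
 finally show ?thesis .
qed

text \<open>The ideal of univariate polynomials is principal, so it contains 1 if it has no common root.\<close>

lemma ideal_no_root:
 fixes I :: "complex poly set"
 assumes add: "!!p q. p \<in> I ==> q \<in> I ==> p + q \<in> I" and mult: "!!p q. p \<in> I ==> q * p \<in> I"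
  and root: "!!t. EX p:I. poly p t ~= 0"
 shows "[:1:] \<in> I"
proof -
 obtain p0 where "p0 \<in> I" "poly p0 0 ~= 0" using root by blast
 then have "p0 \<in> I & p0 ~= 0" by auto
 then have "EX p. (p \<in> I & p ~= 0) & (ALL q. q \<in> I & q ~= 0 --> degree p \<le> degree q)"
  by (rule ex_has_least_nat)
 then obtain p where p: "p \<in> I" "p ~= 0" "!!q. q \<in> I ==> q ~= 0 ==> degree p \<le> degree q" by blast
 have dvd: "p dvd q" if "q \<in> I" for q
 proof (rule ccontr)
  assume "\<not> p dvd q"
  then have nz: "q mod p ~= 0" by (simp add: dvd_eq_mod_eq_0)
  have "q + (- (q div p)) * p = q mod p" by (simp add: minus_div_mult_eq_mod[symmetric])
  then have "q mod p \<in> I" using add[OF that mult[OF p(1), of "- (q div p)"]] by (simp only:)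
  then have "degree p \<le> degree (q mod p)" using p(3) nz by blast
  then show False using degree_mod_less_degree[OF p(2) \<open>\<not> p dvd q\<close>] by simp
 qed
 have "degree p = 0"
 proof (rule ccontr)
  assume "degree p ~= 0"
  then have "EX t. poly p t = 0" by (intro alg_closed_imp_poly_has_root) simp
  then obtain t where t: "poly p t = 0" by blast
  obtain q where "q \<in> I" "poly q t ~= 0" using root by blast
  then show False using dvd[of q] t by (auto simp: dvd_def)
 qed
 then obtain c where c: "p = [:c:]" using degree_eq_zeroE by blast
 then have "[:1 / c:] * p = [:1:]" using p(2) by auto
 then show ?thesis using mult[OF p(1), of "[:1 / c:]"] by simp
qed

section \<open>Elimination of the variables of the first factor\<close>

lemma closedin_zariski_prodE:
 assumes "closedin zariski_prod W" "x ~= 0" "y ~= 0" "(pt x, pt y) \<notin> W"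
 obtains d e f where "f \<in> bihpoly d e" "!!z. z \<in> bicone W ==> f z = 0" "f (x, y) ~= 0"
proof -
 have "\<not> (ALL d e. ALL f:bihpoly d e. (ALL z:bicone W. f z = 0) --> f (x, y) = 0)"
  using assms(1)[unfolded closedin_zariski_prod, rule_format, OF assms(2,3)] assms(4) by blast
 then show ?thesis using that by blast
qed

text \<open>J holds the coordinates that are still to be eliminated; the induction removes them one
  at a time.\<close>

definition supp_in :: "'n set => complex ^ 'n::finite => bool" where
 "supp_in J x \<longleftrightarrow> (ALL i. i \<notin> J --> x $ i = 0)"

text \<open>Over y0 the equations of W have no common zero on the line through a in direction j, so
  some combination g of them is 1 on that line. The resultant of f and g in \<open>x $ j\<close>
  does not involve this variable and vanishes on W. At (a, y0) it is nonzero because f has exact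
  degree m there.\<close>

lemma elimination_step:
 fixes W :: "('n::finite cp \<times> 'm::finite cp) set"
 assumes W: "closedin zariski_prod W" and j: "j \<notin> J" and y0: "y0 ~= 0"
  and none: "!!x. x ~= 0 ==> supp_in (insert j J) x ==> (pt x, pt y0) \<notin> W"
  and f: "f \<in> bihpoly m e" "!!z. z \<in> bicone W ==> f z = 0" "f (axis j 1, y0) ~= 0"
  and a: "a ~= 0" "supp_in J a"
 shows "EX d e. EX D:bihpoly d e. D (a, y0) ~= 0 & (ALL x y t. D (upd x j t, y) = D (x, y)) &
  (ALL (x, y):bicone W. D (x, y) = 0)"
proof -
 \<comment> \<open>The combination g is not bihomogeneous. Requiring that it vanish on all
   rescalings of representatives of W makes the bihomogeneous components of the resultant vanish on
   W.\<close>
 define V where "V = {(s *s x, r *s y) | s r x y. (x, y) \<in> bicone W}"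
 define I where "I = {p. EX g:poly_fun bicoords. (ALL z:V. g z = 0) & (ALL t. g (upd a j t, y0) = poly p t)}"
 have van: "u z = 0" if u: "u \<in> bihpoly k l" "!!z. z \<in> bicone W ==> u z = 0" and z: "z \<in> V" for u k l z
 proof -
  obtain s r x y where "z = (s *s x, r *s y)" "(x, y) \<in> bicone W" using z unfolding V_def by blast
  then show ?thesis using u bihpolyD[OF u(1)] by simp
 qed
 have "[:1:] \<in> I"
 proof (rule ideal_no_root)
  fix p q assume "p \<in> I" "q \<in> I"
  then obtain g h where *: "g \<in> poly_fun bicoords" "ALL z:V. g z = 0" "ALL t. g (upd a j t, y0) = poly p t"
   "h \<in> poly_fun bicoords" "ALL z:V. h z = 0" "ALL t. h (upd a j t, y0) = poly q t"
   unfolding I_def by blast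
  show "p + q \<in> I"
   unfolding I_def mem_Collect_eq
   by (rule bexI[OF _ poly_fun.add[OF *(1,4)]]) (use * in simp)
 next
  fix p q assume "p \<in> I"
  then obtain g where *: "g \<in> poly_fun bicoords" "ALL z:V. g z = 0" "ALL t. g (upd a j t, y0) = poly p t"
   unfolding I_def by blast
  have "(%z. poly q (fst z $ j)) \<in> poly_fun bicoords"
   unfolding poly_altdef by (intro poly_fun_sum poly_fun_cmult poly_fun_power poly_fun_fst)
  then have "(%z. poly q (fst z $ j) * g z) \<in> poly_fun bicoords" using *(1) by (rule poly_fun.mult)
  then show "q * p \<in> I"
   unfolding I_def mem_Collect_eq by (rule bexI[rotated]) (use * in simp)
 next
  fix t
  let ?x = "upd a j t"
  obtain i where i: "a $ i ~= 0" using a(1) by (auto simp: cvec_eq_iff)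
  then have "i ~= j" using a(2) j by (auto simp: supp_in_def)
  then have "?x $ i ~= 0" using i by simp
  then have "?x ~= 0" by (metis Finite_Cartesian_Product.zero_index)
  moreover have "supp_in (insert j J) ?x" using a(2) by (auto simp: supp_in_def)
  ultimately have "(pt ?x, pt y0) \<notin> W" using none by blast
  then obtain k l g where g: "g \<in> bihpoly k l" "ALL z:bicone W. g z = 0" "g (?x, y0) ~= 0"
   using closedin_zariski_prodE[OF W \<open>?x ~= 0\<close> y0] by metis
  have gp: "g \<in> poly_fun bicoords" using g(1) by (simp add: bihpoly_def)
  obtain P N where P: "!!x y t. g (upd x j t, y) = poly (P (x, y)) t"
   "!!i. (%z. coeff (P z) i) \<in> poly_fun bicoords" "!!z. degree (P z) \<le> N"
   by (rule poly_fun_upd[OF gp, of j], rule that)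
  have "P (a, y0) \<in> I"
   unfolding I_def mem_Collect_eq by (rule bexI[OF _ gp]) (use van[OF g(1)] g(2) P(1) in simp)
  then show "EX p:I. poly p t ~= 0" using P(1)[of a t y0] g(3) by (intro bexI[of _ "P (a, y0)"]) auto
 qed
 then obtain g where g: "g \<in> poly_fun bicoords" "!!z. z \<in> V ==> g z = 0" "!!t. g (upd a j t, y0) = 1"
  unfolding I_def by auto
 have fp: "f \<in> poly_fun bicoords" using f(1) by (simp add: bihpoly_def)
 obtain P N where P: "!!x y t. f (upd x j t, y) = poly (P (x, y)) t"
  "!!i. (%z. coeff (P z) i) \<in> poly_fun bicoords" "!!z. degree (P z) \<le> N"
  by (rule poly_fun_upd[OF fp, of j], rule that)
 obtain Q n where Q: "!!x y t. g (upd x j t, y) = poly (Q (x, y)) t"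
  "!!i. (%z. coeff (Q z) i) \<in> poly_fun bicoords" "!!z. degree (Q z) \<le> n"
  by (rule poly_fun_upd[OF g(1), of j], rule that)
 note Pdeg = bihpoly_upd_degree[OF f(1) P(1,2)]
 \<comment> \<open>The formal degree of g is taken to be \<open>Suc n\<close>, so that the matrix is
   not empty even for m = n = 0.\<close>
 define D where "D z = Determinant.det (sylv m (Suc n) (P z) (Q z))" for z
 have Dp: "D \<in> poly_fun bicoords"
  unfolding D_def by (rule poly_fun_det_sylv[OF P(2) Q(2)])
 have "Q (a, y0) = [:1:]" by (rule poly_same) (use Q(1)[of a _ y0] g(3) in simp)
 moreover have "coeff (P (a, y0)) m ~= 0" using Pdeg(2)[of a y0] f(3) by simp
 ultimately have D0: "D (a, y0) ~= 0"
  using det_sylv_const[OF Pdeg(1)[of a y0], of "Suc n"] by (simp add: D_def)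
 have Dind: "D (upd x j t, y) = D (x, y)" for x y t
 proof -
  have "P (upd x j t, y) = P (x, y)"
   by (rule poly_same) (use P(1)[of "upd x j t" _ y] P(1)[of x _ y] in simp)
  moreover have "Q (upd x j t, y) = Q (x, y)"
   by (rule poly_same) (use Q(1)[of "upd x j t" _ y] Q(1)[of x _ y] in simp)
  ultimately show ?thesis by (simp add: D_def)
 qed
 have DV: "D (x, y) = 0" if "(x, y) \<in> V" for x y
  unfolding D_def
 proof (rule det_sylv_common_root[OF Pdeg(1)])
  show "degree (Q (x, y)) \<le> Suc n" using Q(3)[of "(x, y)"] by simp
  show "poly (P (x, y)) (x $ j) = 0" using P(1)[of x "x $ j" y] van[OF f(1,2) that] by simp
  show "poly (Q (x, y)) (x $ j) = 0" using Q(1)[of x "x $ j" y] g(2)[OF that] by simp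
 qed simp
 obtain d l E where E: "E \<in> bihpoly d l" "E (a, y0) ~= 0" "ALL x y t. E (upd x j t, y) = E (x, y)"
  "ALL x y. (ALL s r. D (s *s x, r *s y) = 0) --> E (x, y) = 0"
  using bihomogeneous_component[OF Dp D0 Dind] by blast
 have "E (x, y) = 0" if xy: "(x, y) \<in> bicone W" for x y
 proof -
  have "D (s *s x, r *s y) = 0" for s r by (rule DV) (use xy in \<open>auto simp: V_def\<close>)
  then show ?thesis using E(4) by simp
 qed
 then show ?thesis
  using E(1-3) by (intro exI[of _ d] exI[of _ l] bexI[of _ E]) auto
qed

text \<open>W is projected from the j-th coordinate point: \<open>W'\<close> is cut out by those
  equations of W that do not involve \<open>x $ j\<close>. Fibres that contain the centre of
  projection are taken care of by the factor \<open>f (axis j 1, y)\<close>.\<close>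

lemma elimination:
 fixes W :: "('n::finite cp \<times> 'm::finite cp) set"
 assumes "finite J" "closedin zariski_prod W"
 shows "closedin zariski {q. EX x. x ~= 0 & supp_in J x & (pt x, q) \<in> W}"
 using assms
proof (induction J arbitrary: W rule: finite_induct)
 case empty
 have "x = 0" if "supp_in {} x" for x :: "complex ^ 'n"
  using that by (simp add: supp_in_def cvec_eq_iff)
 then have "{q. EX x. x ~= 0 & supp_in {} x & (pt x, q) \<in> W} = {}" by blast
 then show ?case by (simp only: closedin_empty)
next
 case (insert j J)
 let ?C = "{q. EX x. x ~= 0 & supp_in (insert j J) x & (pt x, q) \<in> W}"
 show ?case
  unfolding closedin_zariski
 proof (intro allI impI, rule ccontr)
  fix y0 :: "complex ^ 'm"
  assume y0: "y0 ~= 0" "ALL d. ALL f:hpoly d. (ALL y:acone ?C. f y = 0) --> f y0 = 0" "pt y0 \<notin> ?C"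
  have none: "(pt x, pt y0) \<notin> W" if "x ~= 0" "supp_in (insert j J) x" for x
   using y0(3) that by blast
  have ax: "axis j 1 ~= (0 :: complex ^ 'n)" by (simp add: axis_eq_0_iff)
  have "supp_in (insert j J) (axis j (1::complex))" by (auto simp: supp_in_def axis_def)
  then have "(pt (axis j 1), pt y0) \<notin> W" using none ax by blast
  then obtain m e f where f: "f \<in> bihpoly m e" "!!z. z \<in> bicone W ==> f z = 0" "f (axis j 1, y0) ~= 0"
   using closedin_zariski_prodE[OF insert.prems ax y0(1)] by metis
  define good where "good z \<longleftrightarrow> (ALL d e. ALL D:bihpoly d e. (ALL x y t. D (upd x j t, y) = D (x, y)) -->
   (ALL (x, y):bicone W. D (x, y) = 0) --> D z = 0)" for z :: "(complex ^ 'n) \<times> (complex ^ 'm)"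
  define W' where "W' = {(pt x, pt y) | x y. x ~= 0 & y ~= 0 & good (x, y)}"
  have W': "good (x, y)" if xy: "(x, y) \<in> bicone W'" for x y
  proof -
   obtain u v where *: "x ~= 0" "y ~= 0" "u ~= 0" "v ~= 0" "pt u = pt x" "pt v = pt y" "good (u, v)"
    using xy by (auto simp: bicone_def W'_def)
   obtain r where "x = r *s u" using pt_eq_iff[OF *(3,1)] *(5) by blast
   moreover obtain s where "y = s *s v" using pt_eq_iff[OF *(4,2)] *(6) by blast
   ultimately show ?thesis using *(7) unfolding good_def by (simp add: bihpolyD)
  qed
  have cW': "closedin zariski_prod W'"
   unfolding closedin_zariski_prod
  proof (intro allI impI)
   fix x :: "complex ^ 'n" and y :: "complex ^ 'm"
   assume xy: "x ~= 0" "y ~= 0" "ALL d e. ALL f:bihpoly d e. (ALL z:bicone W'. f z = 0) --> f (x, y) = 0"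
   have "good (x, y)"
    unfolding good_def
   proof (intro allI ballI impI)
    fix d e D assume D: "D \<in> bihpoly d e" "ALL x y t. D (upd x j t, y) = D (x, y)" "ALL (x, y):bicone W. D (x, y) = 0"
    have "ALL z:bicone W'. D z = 0"
    proof
     fix z assume z: "z \<in> bicone W'"
     obtain u v where uv: "z = (u, v)" by (cases z)
     have "good (u, v)" using W' z uv by blast
     then show "D z = 0" using D uv unfolding good_def by blast
    qed
    then show "D (x, y) = 0" using xy(3) D(1) by blast
   qed
   then show "(pt x, pt y) \<in> W'" using xy unfolding W'_def by blast
  qed
  define C' where "C' = {q. EX x. x ~= 0 & supp_in J x & (pt x, q) \<in> W'}"
  have C': "closedin zariski C'" unfolding C'_def by (rule insert.IH[OF cW'])
  have "pt y0 \<notin> C'"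
  proof
   assume "pt y0 \<in> C'"
   then obtain a where a: "a ~= 0" "supp_in J a" "(pt a, pt y0) \<in> W'" unfolding C'_def by blast
   obtain d l D where D: "D \<in> bihpoly d l" "D (a, y0) ~= 0"
    "ALL x y t. D (upd x j t, y) = D (x, y)" "ALL (x, y):bicone W. D (x, y) = 0"
    using elimination_step[OF insert.prems insert.hyps(2) y0(1) none f a(1,2)] by blast
   have "good (a, y0)" by (rule W') (use a y0(1) in \<open>simp add: bicone_def\<close>)
   then have "D (a, y0) = 0" unfolding good_def using D by blast
   then show False using D(2) by simp
  qed
  then obtain k u where u: "u \<in> hpoly k" "!!y. y \<in> acone C' ==> u y = 0" "u y0 ~= 0"
   using closedin_zariskiE[OF C' y0(1)] by blast
  \<comment> \<open>If \<open>v y\<close> is nonzero, the j-th coordinate point is not in the fibre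
    over y, so setting the j-th coordinate of a point of the fibre to 0 leaves a nonzero
    vector.\<close>
  define v where "v y = f (axis j 1, y)" for y
  have v: "v \<in> hpoly e"
  proof -
   have "f \<in> poly_fun bicoords" using f(1) by (simp add: bihpoly_def)
   then have "(%y. f (axis j 1, y)) \<in> poly_fun coords"
   proof (rule poly_fun_compose)
    fix c :: "(complex ^ 'n) \<times> (complex ^ 'm) => complex" assume "c \<in> bicoords"
    then show "(%y. c (axis j 1, y)) \<in> poly_fun coords"
     by (rule bicoords_cases) (auto intro: poly_fun.const poly_fun_coord)
   qed
   then show ?thesis using bihpolyD[OF f(1), of 1] by (simp add: v_def[abs_def] hpoly_def)
  qed
  have "u y * v y = 0" if y: "y \<in> acone ?C" for y
  proof (rule ccontr)
   assume nz: "u y * v y ~= 0"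
   obtain x where x: "x ~= 0" "supp_in (insert j J) x" "(pt x, pt y) \<in> W" and y': "y ~= 0"
    using y by (auto simp: acone_def)
   have bx: "(x, y) \<in> bicone W" using x y' by (simp add: bicone_def)
   let ?x = "upd x j 0"
   have "?x ~= 0"
   proof
    assume 0: "?x = 0"
    have "x = (x $ j) *s axis j 1"
     unfolding cvec_eq_iff
    proof
     fix i
     have "?x $ i = 0" using 0 by (simp only: Finite_Cartesian_Product.zero_index)
     then show "x $ i = ((x $ j) *s axis j 1) $ i" by (auto simp: axis_def split: if_splits)
    qed
    then have "f (x, y) = (x $ j) ^ m * v y" "x $ j ~= 0"
     using bihpolyD[OF f(1), of "x $ j" "axis j 1" 1 y] x(1) by (auto simp: v_def)
    then show False using f(2)[OF bx] nz by simp
   qed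
   moreover have "supp_in J ?x" using x(2) by (auto simp: supp_in_def)
   moreover have "good (?x, y)"
    unfolding good_def
   proof (intro allI ballI impI)
    fix d e D assume "D \<in> bihpoly d e" "ALL x y t. D (upd x j t, y) = D (x, y)" "ALL (x, y):bicone W. D (x, y) = 0"
    then show "D (?x, y) = 0" using bx by auto
   qed
   ultimately have "pt y \<in> C'" using y' unfolding C'_def W'_def by blast
   then show False using u(2)[of y] y' nz by (simp add: acone_def)
  qed
  then have "u y0 * v y0 = 0" using y0(2)[rule_format, OF hpoly_mult[OF u(1) v]] by blast
  then show False using u(3) f(3) by (simp add: v_def)
 qed
qed

text \<open>Completeness of projective space. It makes \<open>dual_cusp S\<close> closed, so that a
  closure of cuspidal hyperplanes stays inside it.\<close>

theorem closedin_snd_image: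
 fixes W :: "('n::finite cp \<times> 'm::finite cp) set"
 assumes "closedin zariski_prod W"
 shows "closedin zariski (snd ` W)"
proof -
 have "snd ` W = {q. EX x. x ~= 0 & supp_in UNIV x & (pt x, q) \<in> W}"
 proof safe
  fix p q assume "(p, q) \<in> W"
  moreover obtain x where "x ~= 0" "p = pt x" by (rule pt_exhaust)
  ultimately show "EX x. x ~= 0 & supp_in UNIV x & (pt x, snd (p, q)) \<in> W"
   by (auto simp: supp_in_def)
 qed force
 then show ?thesis using elimination[OF _ assms, of UNIV] by simp
qed

section \<open>Holomorphic functions of two variables\<close>

text \<open>The derivative is the real one; prescribing the shape s a + t b makes it complex linear,
  with partial derivatives a and b.\<close>

definition cdiff2 :: "(complex \<times> complex => complex) => complex \<times> complex => complex => complex => bool" where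
 "cdiff2 f z a b \<longleftrightarrow> (f has_derivative (%(s, t). s * a + t * b)) (at z)"

definition holo2 :: "(complex \<times> complex => complex) => (complex \<times> complex) set => bool" where
 "holo2 f W \<longleftrightarrow> (ALL z:W. EX a b. cdiff2 f z a b)"

lemma cdiff2_const: "cdiff2 (%_. c) z 0 0"
 unfolding cdiff2_def by (auto intro!: derivative_eq_intros)

lemma cdiff2_fst: "cdiff2 fst z 1 0"
 unfolding cdiff2_def by (auto intro!: derivative_eq_intros)

lemma cdiff2_snd: "cdiff2 snd z 0 1"
 unfolding cdiff2_def by (auto intro!: derivative_eq_intros)

lemma cdiff2_add: "cdiff2 f z a b ==> cdiff2 g z c d ==> cdiff2 (%w. f w + g w) z (a + c) (b + d)"
 unfolding cdiff2_def
 by (rule has_derivative_eq_rhs[OF has_derivative_add]) (auto simp: fun_eq_iff algebra_simps)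

lemma cdiff2_diff: "cdiff2 f z a b ==> cdiff2 g z c d ==> cdiff2 (%w. f w - g w) z (a - c) (b - d)"
 unfolding cdiff2_def
 by (rule has_derivative_eq_rhs[OF has_derivative_diff]) (auto simp: fun_eq_iff algebra_simps)

lemma cdiff2_mult:
 "cdiff2 f z a b ==> cdiff2 g z c d ==> cdiff2 (%w. f w * g w) z (a * g z + f z * c) (b * g z + f z * d)"
 unfolding cdiff2_def
 by (rule has_derivative_eq_rhs[OF has_derivative_mult]) (auto simp: fun_eq_iff algebra_simps)

lemma cdiff2_compose:
 assumes "cdiff2 f z a b" "(F has_field_derivative F') (at (f z))"
 shows "cdiff2 (%w. F (f w)) z (F' * a) (F' * b)"
 unfolding cdiff2_def
 by (rule has_derivative_eq_rhs[OF has_derivative_compose[OF assms(1)[unfolded cdiff2_def]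
    assms(2)[unfolded has_field_derivative_def]]]) (auto simp: fun_eq_iff algebra_simps)

lemma cdiff2_inverse: "cdiff2 f z a b ==> f z ~= 0 ==>
 cdiff2 (%w. inverse (f w)) z (- (inverse (f z) ^ 2) * a) (- (inverse (f z) ^ 2) * b)"
 by (rule cdiff2_compose) (auto intro!: derivative_eq_intros simp: power2_eq_square)

lemma holo2I: "(!!z. z \<in> W ==> cdiff2 f z (a z) (b z)) ==> holo2 f W"
 unfolding holo2_def by blast

lemma holo2_const: "holo2 (%_. c) W"
 by (rule holo2I[OF cdiff2_const])

lemma holo2_fst: "holo2 fst W" and holo2_snd: "holo2 snd W"
 by (rule holo2I[OF cdiff2_fst], rule holo2I[OF cdiff2_snd])

lemma holo2_add: "holo2 f W ==> holo2 g W ==> holo2 (%w. f w + g w) W"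
 unfolding holo2_def by (intro ballI, (drule (1) bspec)+, elim exE, intro exI, rule cdiff2_add)

lemma holo2_diff: "holo2 f W ==> holo2 g W ==> holo2 (%w. f w - g w) W"
 unfolding holo2_def by (intro ballI, (drule (1) bspec)+, elim exE, intro exI, rule cdiff2_diff)

lemma holo2_mult: "holo2 f W ==> holo2 g W ==> holo2 (%w. f w * g w) W"
 unfolding holo2_def by (intro ballI, (drule (1) bspec)+, elim exE, intro exI, rule cdiff2_mult)

lemma holo2_inverse: "holo2 f W ==> (!!z. z \<in> W ==> f z ~= 0) ==> holo2 (%w. inverse (f w)) W"
proof -
 assume f: "holo2 f W" and nz: "!!z. z \<in> W ==> f z ~= 0"
 show "holo2 (%w. inverse (f w)) W"
  unfolding holo2_def
 proof
  fix z assume z: "z \<in> W"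
  then obtain a b where "cdiff2 f z a b" using f unfolding holo2_def by blast
  from cdiff2_inverse[OF this nz[OF z]] show "EX a b. cdiff2 (%w. inverse (f w)) z a b" by blast
 qed
qed

lemma holo2_divide: "holo2 f W ==> holo2 g W ==> (!!z. z \<in> W ==> g z ~= 0) ==> holo2 (%w. f w / g w) W"
 unfolding divide_inverse by (intro holo2_mult holo2_inverse)

lemma holo2_power: "holo2 f W ==> holo2 (%w. f w ^ n) W"
 by (induction n) (auto intro: holo2_const holo2_mult)

lemma holo2_compose:
 assumes "holo2 f W" "F holomorphic_on U" "open U" "!!z. z \<in> W ==> f z \<in> U"
 shows "holo2 (%w. F (f w)) W"
 unfolding holo2_def
proof
 fix z assume z: "z \<in> W"
 then obtain a b where "cdiff2 f z a b" using assms(1) unfolding holo2_def by blast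
 moreover have "(F has_field_derivative deriv F (f z)) (at (f z))"
  using assms(2,3) assms(4)[OF z] by (rule holomorphic_derivI)
 ultimately show "EX a b. cdiff2 (%w. F (f w)) z a b" using cdiff2_compose by blast
qed

lemmas holo2_intros = holo2_const holo2_fst holo2_snd holo2_add holo2_diff holo2_mult holo2_power

lemma holo2_subset: "holo2 f W ==> V \<subseteq> W ==> holo2 f V"
 unfolding holo2_def by blast

lemma cdiff2_continuous: "cdiff2 f z a b ==> isCont f z"
 unfolding cdiff2_def by (rule has_derivative_continuous)

lemma holo2_continuous_on: "holo2 f W ==> continuous_on W f"
 by (rule continuous_at_imp_continuous_on) (auto simp: holo2_def intro: cdiff2_continuous)

text \<open>Orders of vanishing at 0 are read off from restrictions to complex lines through 0,
  which reduces them to one variable.\<close>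

lemma cdiff2_line:
 assumes "cdiff2 f (\<tau> * \<alpha>, \<tau> * \<beta>) a b"
 shows "((%\<tau>. f (\<tau> * \<alpha>, \<tau> * \<beta>)) has_field_derivative \<alpha> * a + \<beta> * b) (at \<tau>)"
proof -
 have "((%\<tau>. (\<tau> * \<alpha>, \<tau> * \<beta>)) has_derivative (%h. (h * \<alpha>, h * \<beta>))) (at \<tau>)"
  by (auto intro!: derivative_eq_intros)
 from has_derivative_compose[OF this assms[unfolded cdiff2_def]]
 show ?thesis unfolding has_field_derivative_def
  by (rule has_derivative_eq_rhs) (auto simp: fun_eq_iff algebra_simps)
qed

lemma cdiff2_unique:
 assumes "cdiff2 f z a b" "cdiff2 f z c d"
 shows "a = c" "b = d"
proof -
 have "(%(s, t). s * a + t * b) = (%(s, t). s * c + t * d)"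
  using assms unfolding cdiff2_def by (rule has_derivative_unique)
 from fun_cong[OF this, of "(1, 0)"] fun_cong[OF this, of "(0, 1)"] show "a = c" "b = d" by auto
qed

lemma cdiff2_cong:
 assumes "cdiff2 f z a b" "open W" "z \<in> W" "!!w. w \<in> W ==> f w = g w"
 shows "cdiff2 g z a b"
 using assms unfolding cdiff2_def by (metis (no_types, lifting) has_derivative_transform_within_open)

lemma line_in_open:
 assumes "open W" "0 \<in> W"
 shows "EX r>0. ALL \<tau>:ball 0 r. (\<tau> * \<alpha>, \<tau> * \<beta>) \<in> (W :: (complex \<times> complex) set)"
proof -
 have "open ((%\<tau>. (\<tau> * \<alpha>, \<tau> * \<beta>)) -` W)"
  by (intro open_vimage assms continuous_intros)
 moreover have "0 \<in> (%\<tau>. (\<tau> * \<alpha>, \<tau> * \<beta>)) -` W" using assms by (simp add: zero_prod_def)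
 ultimately obtain r where "r > 0" "ball 0 r \<subseteq> (%\<tau>. (\<tau> * \<alpha>, \<tau> * \<beta>)) -` W"
  by (meson open_contains_ball)
 then show ?thesis by (intro exI[of _ r]) auto
qed

lemma holo2_line:
 assumes "open W" "0 \<in> W" "holo2 f W"
 obtains r where "r > 0" "!!\<tau>. \<tau> \<in> ball 0 r ==> (\<tau> * \<alpha>, \<tau> * \<beta>) \<in> W"
  "(%\<tau>. f (\<tau> * \<alpha>, \<tau> * \<beta>)) holomorphic_on ball 0 r"
proof -
 obtain r where r: "r > 0" "ALL \<tau>:ball 0 r. (\<tau> * \<alpha>, \<tau> * \<beta>) \<in> W" using line_in_open[OF assms(1,2)] by blast
 have "(%\<tau>. f (\<tau> * \<alpha>, \<tau> * \<beta>)) field_differentiable at \<tau>" if \<tau>: "\<tau> \<in> ball 0 r" for \<tau>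
 proof -
  obtain a b where "cdiff2 f (\<tau> * \<alpha>, \<tau> * \<beta>) a b" using assms(3) r(2) \<tau> unfolding holo2_def by blast
  from cdiff2_line[OF this] show ?thesis unfolding field_differentiable_def by blast
 qed
 then have "(%\<tau>. f (\<tau> * \<alpha>, \<tau> * \<beta>)) holomorphic_on ball 0 r"
  by (simp add: holomorphic_on_open field_differentiable_def)
 then show ?thesis using that r by blast
qed

lemma line_tendsto:
 assumes "cdiff2 f 0 a b" "f 0 = 0"
 shows "((%\<tau>. f (\<tau> * \<alpha>, \<tau> * \<beta>) / \<tau>) \<longlongrightarrow> \<alpha> * a + \<beta> * b) (at 0)"
proof -
 have "cdiff2 f (0 * \<alpha>, 0 * \<beta>) a b" using assms(1) by (simp add: zero_prod_def)
 from cdiff2_line[OF this] show ?thesis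
  using assms(2) by (simp add: has_field_derivative_iff zero_prod_def)
qed

lemma holomorphic_double_zero:
 assumes "f holomorphic_on ball 0 r" "r > 0" "f 0 = 0" "(f has_field_derivative 0) (at 0)"
 shows "EX L. ((%\<tau>. f \<tau> / \<tau> ^ 2) \<longlongrightarrow> L) (at (0::complex))"
proof -
 define g where "g z = (if z = 0 then deriv f 0 else f z / z)" for z
 have "g holomorphic_on ball 0 r"
  by (rule pole_theorem_0[OF assms(1), of 0]) (use assms in \<open>auto simp: g_def\<close>)
 then have "(g has_field_derivative deriv g 0) (at 0)"
  by (rule holomorphic_derivI) (use assms in auto)
 moreover have "g 0 = 0" using DERIV_imp_deriv[OF assms(4)] by (simp add: g_def)
 ultimately have "((%\<tau>. g \<tau> / \<tau>) \<longlongrightarrow> deriv g 0) (at 0)"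
  by (simp add: has_field_derivative_iff)
 moreover have "\<forall>\<^sub>F \<tau> in at 0. g \<tau> / \<tau> = f \<tau> / \<tau> ^ 2"
  by (auto simp: eventually_at_filter g_def power2_eq_square)
 ultimately have "((%\<tau>. f \<tau> / \<tau> ^ 2) \<longlongrightarrow> deriv g 0) (at 0)" by (rule Lim_transform_eventually)
 then show ?thesis by (rule exI)
qed

lemma eventually_line:
 assumes "open W" "0 \<in> W" "!!z. z \<in> W ==> P z"
 shows "\<forall>\<^sub>F \<tau> in at 0. P (\<tau> * \<alpha>, \<tau> * \<beta> :: complex)"
proof -
 obtain r where r: "r > 0" "ALL \<tau>:ball 0 r. (\<tau> * \<alpha>, \<tau> * \<beta>) \<in> W" using line_in_open[OF assms(1,2)] by blast
 have "\<forall>\<^sub>F \<tau> in at 0. \<tau> \<in> ball (0::complex) r"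
  using r(1) by (intro eventually_at_in_open') auto
 then show ?thesis by (rule eventually_mono) (use r assms(3) in blast)
qed

lemma continuous_line:
 assumes "isCont f (0 :: complex \<times> complex)"
 shows "((%\<tau>. f (\<tau> * \<alpha>, \<tau> * \<beta>)) \<longlongrightarrow> (f 0 :: complex)) (at 0)"
proof -
 have "isCont (%\<tau>. (\<tau> * \<alpha>, \<tau> * \<beta>)) 0" by (intro continuous_intros)
 then have "isCont (%\<tau>. f (\<tau> * \<alpha>, \<tau> * \<beta>)) 0"
  by (rule continuous_at_compose[unfolded o_def]) (use assms in \<open>simp add: zero_prod_def\<close>)
 then show ?thesis by (simp add: isCont_def zero_prod_def)
qed

text \<open>An ordinary cusp is irreducible: its equation is not a product of two functions one of which
  vanishes to first order.\<close>

lemma cusp_not_product: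
 assumes W: "open W" "0 \<in> W" and holo: "holo2 \<sigma> W" "holo2 k W" "holo2 c W"
  and c0: "c 0 ~= 0" and eq: "!!u v. (u, v) \<in> W ==> c (u, v) * (u ^ 2 - v ^ 3) = \<sigma> (u, v) * k (u, v)"
  and \<sigma>: "\<sigma> 0 = 0" "cdiff2 \<sigma> 0 a b" "a ~= 0 | b ~= 0"
 shows False
proof -
 obtain a' b' where k: "cdiff2 k 0 a' b'" using holo(2) W(2) unfolding holo2_def by blast
 obtain ca cb where c: "cdiff2 c 0 ca cb" using holo(3) W(2) unfolding holo2_def by blast
 have cont: "isCont c 0" by (rule cdiff2_continuous[OF c])
 \<comment> \<open>Second-order comparison along the line in direction (\<alpha>, \<beta>): the
   cubic term contributes \<tau> \<beta>^3 and disappears in the limit.\<close>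
 have lim: "((%\<tau>. \<sigma> (\<tau> * \<alpha>, \<tau> * \<beta>) * k (\<tau> * \<alpha>, \<tau> * \<beta>) / \<tau> ^ 2) \<longlongrightarrow> c 0 * \<alpha> ^ 2) (at 0)" for \<alpha> \<beta>
 proof -
  have lim0: "((%\<tau>. c (\<tau> * \<alpha>, \<tau> * \<beta>) * (\<alpha> ^ 2 - \<tau> * \<beta> ^ 3)) \<longlongrightarrow> c 0 * (\<alpha> ^ 2 - 0 * \<beta> ^ 3)) (at 0)"
   by (intro tendsto_intros continuous_line cont)
  have "\<forall>\<^sub>F \<tau> in at 0. c (\<tau> * \<alpha>, \<tau> * \<beta>) * ((\<tau> * \<alpha>) ^ 2 - (\<tau> * \<beta>) ^ 3) = \<sigma> (\<tau> * \<alpha>, \<tau> * \<beta>) * k (\<tau> * \<alpha>, \<tau> * \<beta>)"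
   using eventually_line[OF W, of "%z. c z * (fst z ^ 2 - snd z ^ 3) = \<sigma> z * k z"] eq by auto
  moreover have "\<forall>\<^sub>F \<tau> in at 0. \<tau> ~= (0::complex)" by (rule eventually_neq_at_within)
  ultimately have "\<forall>\<^sub>F \<tau> in at 0. c (\<tau> * \<alpha>, \<tau> * \<beta>) * (\<alpha> ^ 2 - \<tau> * \<beta> ^ 3) = \<sigma> (\<tau> * \<alpha>, \<tau> * \<beta>) * k (\<tau> * \<alpha>, \<tau> * \<beta>) / \<tau> ^ 2"
  proof eventually_elim
   fix \<tau> :: complex
   assume "c (\<tau> * \<alpha>, \<tau> * \<beta>) * ((\<tau> * \<alpha>) ^ 2 - (\<tau> * \<beta>) ^ 3) = \<sigma> (\<tau> * \<alpha>, \<tau> * \<beta>) * k (\<tau> * \<alpha>, \<tau> * \<beta>)" "\<tau> ~= 0"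
   moreover have "(\<tau> * \<alpha>) ^ 2 - (\<tau> * \<beta>) ^ 3 = \<tau> ^ 2 * (\<alpha> ^ 2 - \<tau> * \<beta> ^ 3)"
    by (simp add: pow_simps3 algebra_simps)
   ultimately have "c (\<tau> * \<alpha>, \<tau> * \<beta>) * (\<tau> ^ 2 * (\<alpha> ^ 2 - \<tau> * \<beta> ^ 3)) = \<sigma> (\<tau> * \<alpha>, \<tau> * \<beta>) * k (\<tau> * \<alpha>, \<tau> * \<beta>)"
    by (simp only:)
   then have "c (\<tau> * \<alpha>, \<tau> * \<beta>) * (\<alpha> ^ 2 - \<tau> * \<beta> ^ 3) * \<tau> ^ 2 = \<sigma> (\<tau> * \<alpha>, \<tau> * \<beta>) * k (\<tau> * \<alpha>, \<tau> * \<beta>)"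
    by (simp only: mult_ac)
   then show "c (\<tau> * \<alpha>, \<tau> * \<beta>) * (\<alpha> ^ 2 - \<tau> * \<beta> ^ 3) = \<sigma> (\<tau> * \<alpha>, \<tau> * \<beta>) * k (\<tau> * \<alpha>, \<tau> * \<beta>) / \<tau> ^ 2"
    using \<open>\<tau> ~= 0\<close> by (simp add: eq_divide_eq)
  qed
  from tendsto_cong[OF this] lim0 show ?thesis by simp
 qed
 \<comment> \<open>The product vanishes to second order but \<sigma> only to first order, so k
   vanishes as well.\<close>
 have k0: "k 0 = 0"
 proof -
  have z: "\<alpha> * (a * k 0) + \<beta> * (b * k 0) = 0" for \<alpha> \<beta>
  proof -
   have "cdiff2 (%z. \<sigma> z * k z) 0 (a * k 0) (b * k 0)"
    using cdiff2_mult[OF \<sigma>(2) k] \<sigma>(1) by simp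
   from line_tendsto[OF this, of \<alpha> \<beta>] \<sigma>(1)
   have 1: "((%\<tau>. \<sigma> (\<tau> * \<alpha>, \<tau> * \<beta>) * k (\<tau> * \<alpha>, \<tau> * \<beta>) / \<tau>) \<longlongrightarrow> \<alpha> * (a * k 0) + \<beta> * (b * k 0)) (at 0)" by simp
   have "((%\<tau>. \<sigma> (\<tau> * \<alpha>, \<tau> * \<beta>) * k (\<tau> * \<alpha>, \<tau> * \<beta>) / \<tau> ^ 2 * \<tau>) \<longlongrightarrow> c 0 * \<alpha> ^ 2 * 0) (at 0)"
    by (intro tendsto_intros lim)
   moreover have "\<forall>\<^sub>F \<tau> in at 0. \<sigma> (\<tau> * \<alpha>, \<tau> * \<beta>) * k (\<tau> * \<alpha>, \<tau> * \<beta>) / \<tau> ^ 2 * \<tau> = \<sigma> (\<tau> * \<alpha>, \<tau> * \<beta>) * k (\<tau> * \<alpha>, \<tau> * \<beta>) / \<tau>"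
    by (auto simp: eventually_at_filter power2_eq_square)
   ultimately have "((%\<tau>. \<sigma> (\<tau> * \<alpha>, \<tau> * \<beta>) * k (\<tau> * \<alpha>, \<tau> * \<beta>) / \<tau>) \<longlongrightarrow> c 0 * \<alpha> ^ 2 * 0) (at 0)"
    by (rule Lim_transform_eventually)
   then have "((%\<tau>. \<sigma> (\<tau> * \<alpha>, \<tau> * \<beta>) * k (\<tau> * \<alpha>, \<tau> * \<beta>) / \<tau>) \<longlongrightarrow> 0) (at 0)" by simp
   with 1 show ?thesis using tendsto_unique[OF trivial_limit_at] by blast
  qed
  from z[of 1 0] z[of 0 1] \<sigma>(3) show ?thesis by auto
 qed
 \<comment> \<open>The product of the two linear parts is a nonzero multiple of \<alpha>^2, so both
   are multiples of \<alpha>.\<close>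
 have prod: "(\<alpha> * a + \<beta> * b) * (\<alpha> * a' + \<beta> * b') = c 0 * \<alpha> ^ 2" for \<alpha> \<beta>
 proof -
  have "((%\<tau>. \<sigma> (\<tau> * \<alpha>, \<tau> * \<beta>) / \<tau> * (k (\<tau> * \<alpha>, \<tau> * \<beta>) / \<tau>)) \<longlongrightarrow> (\<alpha> * a + \<beta> * b) * (\<alpha> * a' + \<beta> * b')) (at 0)"
   by (intro tendsto_intros line_tendsto \<sigma> k k0)
  then have "((%\<tau>. \<sigma> (\<tau> * \<alpha>, \<tau> * \<beta>) * k (\<tau> * \<alpha>, \<tau> * \<beta>) / \<tau> ^ 2) \<longlongrightarrow> (\<alpha> * a + \<beta> * b) * (\<alpha> * a' + \<beta> * b')) (at 0)"
   by (simp add: power2_eq_square)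
  then show ?thesis using lim[of \<alpha> \<beta>] tendsto_unique[OF trivial_limit_at] by blast
 qed
 have 1: "a * a' = c 0" using prod[of 1 0] by simp
 have 2: "b * b' = 0" using prod[of 0 1] by simp
 have 3: "a * b' + b * a' = 0" using prod[of 1 1] 1 2 by (simp add: algebra_simps)
 have b: "b = 0" "b' = 0" using 1 2 3 c0 by auto
 \<comment> \<open>On the line u = 0 both factors now vanish to second order, hence their product to
   fourth order, whereas - v^3 has order three.\<close>
 have fin: "EX L. ((%\<tau>. q (0, \<tau>) / \<tau> ^ 2) \<longlongrightarrow> L) (at 0)"
  if q: "holo2 q W" "q 0 = 0" "cdiff2 q 0 d 0" for q d
 proof -
  obtain r where r: "r > 0" "(%\<tau>. q (\<tau> * 0, \<tau> * 1)) holomorphic_on ball 0 r"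
   using holo2_line[OF W q(1)] by metis
  have "cdiff2 q (0 * 0, 0 * 1) d 0" using q(3) by (simp add: zero_prod_def)
  from cdiff2_line[OF this] have "((%\<tau>. q (\<tau> * 0, \<tau> * 1)) has_field_derivative 0) (at 0)" by simp
  then show ?thesis using holomorphic_double_zero[OF r(2,1)] q(2) by (simp add: zero_prod_def)
 qed
 obtain L where L: "((%\<tau>. \<sigma> (0, \<tau>) / \<tau> ^ 2) \<longlongrightarrow> L) (at 0)" using fin[OF holo(1) \<sigma>(1)] \<sigma>(2) b by blast
 obtain M where M: "((%\<tau>. k (0, \<tau>) / \<tau> ^ 2) \<longlongrightarrow> M) (at 0)" using fin[OF holo(2) k0] k b by blast
 have "((%\<tau>. \<sigma> (0, \<tau>) / \<tau> ^ 2 * (k (0, \<tau>) / \<tau> ^ 2) * \<tau>) \<longlongrightarrow> L * M * 0) (at 0)"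
  by (intro tendsto_intros L M)
 moreover have "\<forall>\<^sub>F \<tau> in at 0. \<sigma> (0, \<tau>) / \<tau> ^ 2 * (k (0, \<tau>) / \<tau> ^ 2) * \<tau> = - c (\<tau> * 0, \<tau> * 1)"
 proof -
  have "\<forall>\<^sub>F \<tau> in at 0. c (\<tau> * 0, \<tau> * 1) * (- (\<tau> ^ 3)) = \<sigma> (\<tau> * 0, \<tau> * 1) * k (\<tau> * 0, \<tau> * 1)"
   using eventually_line[OF W, of "%z. c z * (fst z ^ 2 - snd z ^ 3) = \<sigma> z * k z" 0 1] eq by auto
  moreover have "\<forall>\<^sub>F \<tau> in at 0. \<tau> ~= (0::complex)" by (rule eventually_neq_at_within)
  ultimately show ?thesis
  proof eventually_elim
   fix \<tau> :: complex
   assume "c (\<tau> * 0, \<tau> * 1) * (- (\<tau> ^ 3)) = \<sigma> (\<tau> * 0, \<tau> * 1) * k (\<tau> * 0, \<tau> * 1)" and nz: "\<tau> ~= 0"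
   then have "\<sigma> (0, \<tau>) * k (0, \<tau>) = - c (0, \<tau>) * \<tau> ^ 3" by simp
   then have "\<sigma> (0, \<tau>) / \<tau> ^ 2 * (k (0, \<tau>) / \<tau> ^ 2) * \<tau> = - c (0, \<tau>) * \<tau> ^ 3 / \<tau> ^ 4 * \<tau>"
    by (simp add: power2_eq_square power4_eq_xxxx)
   also have "\<dots> = - c (0, \<tau>)" using nz by (simp add: power3_eq_cube power4_eq_xxxx)
   finally show "\<sigma> (0, \<tau>) / \<tau> ^ 2 * (k (0, \<tau>) / \<tau> ^ 2) * \<tau> = - c (\<tau> * 0, \<tau> * 1)" by simp
  qed
 qed
 ultimately have "((%\<tau>. - c (\<tau> * 0, \<tau> * 1)) \<longlongrightarrow> L * M * 0) (at 0)"
  by (rule Lim_transform_eventually)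
 then have "((%\<tau>. - c (\<tau> * 0, \<tau> * 1)) \<longlongrightarrow> 0) (at 0)" by simp
 moreover have "((%\<tau>. - c (\<tau> * 0, \<tau> * 1)) \<longlongrightarrow> - c 0) (at 0)"
  by (intro tendsto_intros continuous_line cont)
 ultimately have "0 = - c 0" using tendsto_unique[OF trivial_limit_at] by blast
 then show False using c0 by simp
qed

text \<open>The tangent cone of a node is a pair of distinct lines, that of \<open>X\<^sup>2 - Y\<^sup>3 e\<close> is a double line.\<close>

lemma node_not_cusp:
 assumes W: "open W" "0 \<in> W" and d: "cdiff2 X 0 a b" "cdiff2 Y 0 a' b'" "isCont c 0" "isCont e 0"
  and c0: "c 0 ~= 0" "X 0 = 0" "Y 0 = 0"
  and eq: "!!u v. (u, v) \<in> W ==> c (u, v) * (u * v) = X (u, v) ^ 2 - Y (u, v) ^ 3 * e (u, v)"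
 shows False
proof -
 \<comment> \<open>Second-order terms on lines: the square of a linear form would be a nonzero
   multiple of \<alpha> \<beta>, which is impossible.\<close>
 have key: "(\<alpha> * a + \<beta> * b) ^ 2 = c 0 * (\<alpha> * \<beta>)" for \<alpha> \<beta>
 proof -
  let ?l = "%f \<tau>. f (\<tau> * \<alpha>, \<tau> * \<beta>)"
  have lim0: "((%\<tau>. (?l X \<tau> / \<tau>) ^ 2 - (?l Y \<tau> / \<tau>) ^ 3 * \<tau> * ?l e \<tau>) \<longlongrightarrow>
    (\<alpha> * a + \<beta> * b) ^ 2 - (\<alpha> * a' + \<beta> * b') ^ 3 * 0 * e 0) (at 0)"
   by (intro tendsto_intros line_tendsto d c0 continuous_line)
  have "\<forall>\<^sub>F \<tau> in at 0. ?l c \<tau> * ((\<tau> * \<alpha>) * (\<tau> * \<beta>)) = ?l X \<tau> ^ 2 - ?l Y \<tau> ^ 3 * ?l e \<tau>"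
   using eventually_line[OF W, of "%z. c z * (fst z * snd z) = X z ^ 2 - Y z ^ 3 * e z"] eq by auto
  moreover have "\<forall>\<^sub>F \<tau> in at 0. \<tau> ~= (0::complex)" by (rule eventually_neq_at_within)
  ultimately have "\<forall>\<^sub>F \<tau> in at 0. (?l X \<tau> / \<tau>) ^ 2 - (?l Y \<tau> / \<tau>) ^ 3 * \<tau> * ?l e \<tau> = ?l c \<tau> * (\<alpha> * \<beta>)"
  proof eventually_elim
   fix \<tau> :: complex
   assume *: "?l c \<tau> * ((\<tau> * \<alpha>) * (\<tau> * \<beta>)) = ?l X \<tau> ^ 2 - ?l Y \<tau> ^ 3 * ?l e \<tau>" and nz: "\<tau> ~= 0"
   have "((?l X \<tau> / \<tau>) ^ 2 - (?l Y \<tau> / \<tau>) ^ 3 * \<tau> * ?l e \<tau>) * \<tau> ^ 2 = ?l X \<tau> ^ 2 - ?l Y \<tau> ^ 3 * ?l e \<tau>"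
    using nz by (simp add: field_simps pow_simps3)
   also have "\<dots> = ?l c \<tau> * (\<alpha> * \<beta>) * \<tau> ^ 2" using * nz by (simp add: power2_eq_square mult_ac)
   finally show "(?l X \<tau> / \<tau>) ^ 2 - (?l Y \<tau> / \<tau>) ^ 3 * \<tau> * ?l e \<tau> = ?l c \<tau> * (\<alpha> * \<beta>)" using nz by simp
  qed
  from tendsto_cong[OF this] lim0
  have "((%\<tau>. ?l c \<tau> * (\<alpha> * \<beta>)) \<longlongrightarrow> (\<alpha> * a + \<beta> * b) ^ 2) (at 0)" by simp
  moreover have "((%\<tau>. ?l c \<tau> * (\<alpha> * \<beta>)) \<longlongrightarrow> c 0 * (\<alpha> * \<beta>)) (at 0)"
   by (intro tendsto_intros continuous_line d)
  ultimately show ?thesis using tendsto_unique[OF trivial_limit_at] by blast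
 qed
 from key[of 1 0] key[of 0 1] key[of 1 1] c0(1) show False by auto
qed

text \<open>Division by \<open>e s0\<close> moves the values near 1, away from the cut of the
  principal logarithm.\<close>

lemma local_root:
 fixes e :: "complex => complex"
 assumes e: "e holomorphic_on UNIV" "e s0 ~= 0" and k: "0 < k"
 obtains U \<rho> where "open U" "s0 \<in> U" "\<rho> holomorphic_on U" "!!s. s \<in> U ==> \<rho> s ^ k = e s"
proof -
 have ce: "continuous_on UNIV (%s. e s / e s0)"
  using e by (intro continuous_intros holomorphic_on_imp_continuous_on) auto
 define U where "U = (%s. e s / e s0) -` (- \<real>\<^sub>\<le>\<^sub>0)"
 have "open U"
  unfolding U_def using ce by (intro open_vimage) (auto intro: closed_nonpos_Reals_complex)
 moreover have "s0 \<in> U" using e(2) by (auto simp: U_def)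
 moreover define \<rho> where "\<rho> s = exp (Ln (e s0) / of_nat k) * exp (Ln (e s / e s0) / of_nat k)" for s
 have "\<rho> holomorphic_on U"
  unfolding \<rho>_def using e k
  by (intro holomorphic_intros holomorphic_on_subset[OF e(1)]) (auto simp: U_def)
 moreover have "\<rho> s ^ k = e s" if "s \<in> U" for s
 proof -
  have "e s ~= 0" using that by (auto simp: U_def)
  then show ?thesis using e(2) k by (simp add: \<rho>_def power_mult_distrib exp_of_nat_mult[symmetric])
 qed
 ultimately show ?thesis using that by blast
qed

text \<open>With \<rho>^k = e, the function (s - s0) \<rho>(s) has the nonzero derivative \<rho>(s0)
  at s0; \<zeta> is its local inverse.\<close>

lemma local_root_coordinate:
 fixes e :: "complex => complex"
 assumes e: "e holomorphic_on UNIV" "e s0 ~= 0" and k: "0 < k" and V: "open V" "s0 \<in> V"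
 obtains \<zeta> r where "0 < r" "\<zeta> holomorphic_on ball 0 r" "\<zeta> 0 = s0" "deriv \<zeta> 0 ~= 0"
  "!!\<tau>. \<tau> \<in> ball 0 r ==> \<zeta> \<tau> \<in> V & (\<zeta> \<tau> - s0) ^ k * e (\<zeta> \<tau>) = \<tau> ^ k"
proof -
 obtain U0 \<rho> where U0: "open U0" "s0 \<in> U0" "\<rho> holomorphic_on U0" "!!s. s \<in> U0 ==> \<rho> s ^ k = e s"
  using local_root[OF e k] by blast
 define U where "U = V \<inter> U0"
 have U: "open U" "s0 \<in> U" using V U0 by (auto simp: U_def)
 have \<rho>: "\<rho> holomorphic_on U" by (rule holomorphic_on_subset[OF U0(3)]) (simp add: U_def)
 have \<rho>k: "\<rho> s ^ k = e s" if "s \<in> U" for s using U0(4) that by (simp add: U_def)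
 have \<rho>0: "\<rho> s0 ~= 0" using \<rho>k[OF U(2)] e(2) k by (metis zero_power)
 define T where "T s = (s - s0) * \<rho> s" for s
 have T: "T holomorphic_on U" unfolding T_def by (intro holomorphic_intros \<rho>)
 have "(\<rho> has_field_derivative deriv \<rho> s0) (at s0)" by (rule holomorphic_derivI[OF \<rho> U])
 then have "(T has_field_derivative \<rho> s0) (at s0)"
  unfolding T_def by (auto intro!: derivative_eq_intros)
 then have dT: "deriv T s0 ~= 0" using \<rho>0 by (simp add: DERIV_imp_deriv)
 obtain r where r: "r > 0" "ball s0 r \<subseteq> U" "open (T ` ball s0 r)" "inj_on T (ball s0 r)"
  using has_complex_derivative_locally_invertible[OF T U(2) U(1) dT] by blast
 obtain \<zeta> where \<zeta>: "\<zeta> holomorphic_on T ` ball s0 r"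
  "!!z. z \<in> ball s0 r ==> deriv T z * deriv \<zeta> (T z) = 1" "!!z. z \<in> ball s0 r ==> \<zeta> (T z) = z"
  using holomorphic_has_inverse[OF holomorphic_on_subset[OF T r(2)] open_ball r(4)] by metis
 have s0: "s0 \<in> ball s0 r" "T s0 = 0" using r(1) by (auto simp: T_def)
 then have "0 \<in> T ` ball s0 r" by force
 then obtain \<epsilon> where \<epsilon>: "\<epsilon> > 0" "ball 0 \<epsilon> \<subseteq> T ` ball s0 r" using r(3) by (meson open_contains_ball)
 show ?thesis
 proof (rule that)
  show "0 < \<epsilon>" by (rule \<epsilon>)
  show "\<zeta> holomorphic_on ball 0 \<epsilon>" using \<zeta>(1) \<epsilon>(2) by (rule holomorphic_on_subset)
  show "\<zeta> 0 = s0" using \<zeta>(3)[OF s0(1)] s0(2) by simp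
  show "deriv \<zeta> 0 ~= 0" using \<zeta>(2)[OF s0(1)] s0(2) by auto
  show "\<zeta> \<tau> \<in> V & (\<zeta> \<tau> - s0) ^ k * e (\<zeta> \<tau>) = \<tau> ^ k" if \<tau>: "\<tau> \<in> ball 0 \<epsilon>" for \<tau>
  proof -
   obtain z where z: "z \<in> ball s0 r" "\<tau> = T z" using \<epsilon>(2) \<tau> by blast
   then have "\<zeta> \<tau> = z" "z \<in> U" using \<zeta>(3) r(2) by auto
   then show ?thesis using z \<rho>k[of z] by (auto simp: T_def power_mult_distrib U_def)
  qed
 qed
qed

section \<open>Vector-valued maps\<close>

lemma bounded_linear_smult_vec: "bounded_linear (%z::complex. z *s (v :: complex ^ 'n::finite))"
 unfolding linear_conv_bounded_linear[symmetric]
 by (rule linearI) (auto simp: cvec_eq_iff algebra_simps)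

lemma bounded_linear_matrix: "bounded_linear (%x. (A :: complex ^ 'n::finite ^ 'm::finite) *v x)"
 unfolding linear_conv_bounded_linear[symmetric]
 by (rule linearI) (auto simp: cvec_eq_iff matrix_vector_mult_def algebra_simps
   scaleR_sum_right sum.distrib)

lemma has_derivative_components:
 fixes \<phi> :: "complex \<times> complex => complex ^ 'n::finite"
 assumes "!!i. cdiff2 (%w. \<phi> w $ i) z (a $ i) (b $ i)"
 shows "(\<phi> has_derivative (%(s, t). s *s a + t *s b)) (at z)"
proof -
 have "((%w. \<Sum>i\<in>UNIV. (\<phi> w $ i) *s axis i (1::complex)) has_derivative
  (%h. \<Sum>i\<in>UNIV. (case h of (s, t) => s * a $ i + t * b $ i) *s axis i 1)) (at z)"
  using assms unfolding cdiff2_def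
  by (intro has_derivative_sum bounded_linear.has_derivative[OF bounded_linear_smult_vec])
 moreover have sum_axis: "(\<Sum>i\<in>UNIV. (x $ i) *s axis i (1::complex)) = x" for x :: "complex ^ 'n"
  by (rule basis_expansion)
 moreover have "(\<Sum>i\<in>UNIV. (case h of (s, t) => s * a $ i + t * b $ i) *s axis i 1) = (case h of (s, t) => s *s a + t *s b)" for h
  using sum_axis[of "case h of (s, t) => s *s a + t *s b"] by (cases h) simp
 ultimately show ?thesis by simp
qed

lemma has_derivative_nth:
 fixes \<phi> :: "complex \<times> complex => complex ^ 'n::finite"
 assumes "(\<phi> has_derivative (%(s, t). s *s a + t *s b)) (at z)"
 shows "cdiff2 (%w. \<phi> w $ i) z (a $ i) (b $ i)"
 unfolding cdiff2_def
 by (rule has_derivative_eq_rhs[OF bounded_linear.has_derivative[OF bounded_linear_vec_nth assms]]) auto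

lemma has_derivative_matrix:
 fixes \<phi> :: "complex \<times> complex => complex ^ 'n::finite" and A :: "complex ^ 'n ^ 'm::finite"
 assumes "(\<phi> has_derivative (%(s, t). s *s a + t *s b)) (at z)"
 shows "((%w. A *v \<phi> w) has_derivative (%(s, t). s *s (A *v a) + t *s (A *v b))) (at z)"
 by (rule has_derivative_eq_rhs[OF bounded_linear.has_derivative[OF bounded_linear_matrix assms]])
  (auto simp: fun_eq_iff cvec_eq_iff matrix_vector_mult_def algebra_simps sum.distrib sum_distrib_left)

lemma dim3_iff:
 fixes x a b :: "complex ^ 'n::finite"
 shows "vec.dim {x, a, b} = 3 \<longleftrightarrow> (ALL \<alpha> \<beta> \<gamma>. \<alpha> *s x + \<beta> *s a + \<gamma> *s b = 0 --> \<alpha> = 0 & \<beta> = 0 & \<gamma> = 0)"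
proof
 assume d: "vec.dim {x, a, b} = 3"
 have "vec.dim {x, a, b} \<le> card {x, a, b}" by (rule vec.dim_le_card') simp
 then have card: "card {x, a, b} = 3" using d by (simp add: card_insert_if split: if_splits)
 then have dist: "x ~= a" "x ~= b" "a ~= b" by (auto simp: card_insert_if split: if_splits)
 have ind: "vec.independent {x, a, b}"
  by (rule vec.card_le_dim_spanning[of _ "{x, a, b}"]) (use d card in \<open>auto intro: vec.span_superset[THEN subsetD]\<close>)
 show "ALL \<alpha> \<beta> \<gamma>. \<alpha> *s x + \<beta> *s a + \<gamma> *s b = 0 --> \<alpha> = 0 & \<beta> = 0 & \<gamma> = 0"
 proof (intro allI impI)
  fix \<alpha> \<beta> \<gamma> assume 0: "\<alpha> *s x + \<beta> *s a + \<gamma> *s b = 0"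
  define u where "u v = (if v = x then \<alpha> else if v = a then \<beta> else \<gamma>)" for v
  have "(\<Sum>v\<in>{x, a, b}. u v *s v) = 0" using 0 dist by (simp add: u_def add_ac)
  then have "u v = 0" if "v \<in> {x, a, b}" for v
   using vec.independentD[OF ind _ subset_refl _ that] by simp
  from this[of x] this[of a] this[of b] show "\<alpha> = 0 & \<beta> = 0 & \<gamma> = 0"
   using dist by (auto simp: u_def)
 qed
next
 assume ind: "ALL \<alpha> \<beta> \<gamma>. \<alpha> *s x + \<beta> *s a + \<gamma> *s b = 0 --> \<alpha> = 0 & \<beta> = 0 & \<gamma> = 0"
 have dist: "x ~= a" "x ~= b" "a ~= b"
  using ind[rule_format, of 1 "-1" 0] ind[rule_format, of 1 0 "-1"] ind[rule_format, of 0 1 "-1"] by auto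
 have "vec.independent {x, a, b}"
 proof (rule vec.independent_if_scalars_zero)
  fix u v assume "(\<Sum>v\<in>{x, a, b}. u v *s v) = 0" "v \<in> {x, a, b}"
  then show "u v = 0" using ind[rule_format, of "u x" "u a" "u b"] dist by (auto simp: add_ac)
 qed simp
 then have "vec.dim {x, a, b} = card {x, a, b}" by (rule vec.dim_eq_card_independent)
 then show "vec.dim {x, a, b} = 3" using dist by simp
qed

section \<open>Linear algebra in \<open>complex ^ 5\<close>\<close>

lemma UNIV_5: "(UNIV :: 5 set) = {0, 1, 2, 3, 4}"
proof -
 have "x \<in> {0, 1, 2, 3, 4}" for x :: 5
 proof (cases x)
  case (of_int z)
  then have "z = 0 | z = 1 | z = 2 | z = 3 | z = 4" by auto
  then show ?thesis using of_int by auto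
 qed
 then show ?thesis by blast
qed

lemma sum_5: "(\<Sum>i\<in>UNIV. f (i :: 5)) = f 0 + f 1 + f 2 + f 3 + f 4"
 unfolding UNIV_5 by (simp add: add_ac)

lemma forall_5: "(ALL i :: 5. P i) \<longleftrightarrow> P 0 & P 1 & P 2 & P 3 & P 4"
proof -
 have "(ALL i :: 5. P i) \<longleftrightarrow> (ALL i:{0, 1, 2, 3, 4}. P i)" unfolding UNIV_5[symmetric] by simp
 then show ?thesis by simp
qed

definition vec5 :: "complex => complex => complex => complex => complex => complex ^ 5" where
 "vec5 a b c d e = (\<chi> i. if i = 0 then a else if i = 1 then b else if i = 2 then c else if i = 3 then d else e)"

lemma vec5_nth [simp]:
 "vec5 a b c d e $ 0 = a" "vec5 a b c d e $ 1 = b" "vec5 a b c d e $ 2 = c"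
 "vec5 a b c d e $ 3 = d" "vec5 a b c d e $ 4 = e"
 by (simp_all add: vec5_def)

lemma vec5_eq_iff: "(x :: complex ^ 5) = y \<longleftrightarrow> x $ 0 = y $ 0 & x $ 1 = y $ 1 & x $ 2 = y $ 2 & x $ 3 = y $ 3 & x $ 4 = y $ 4"
 unfolding cvec_eq_iff forall_5 ..

definition cols5 :: "complex ^ 5 => complex ^ 5 => complex ^ 5 => complex ^ 5 => complex ^ 5 => complex ^ 5 ^ 5" where
 "cols5 a b c d e = (\<chi> i. vec5 (a $ i) (b $ i) (c $ i) (d $ i) (e $ i))"

lemma cols5_mult: "cols5 a b c d e *v z = z $ 0 *s a + z $ 1 *s b + z $ 2 *s c + z $ 3 *s d + z $ 4 *s e"
 by (simp add: cvec_eq_iff matrix_vector_mult_def cols5_def sum_5 mult_ac)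

subsection \<open>Kernels of the two matrix libraries\<close>

lemma less_5: "(i::nat) < 5 \<longleftrightarrow> i = 0 | i = 1 | i = 2 | i = 3 | i = 4"
 by auto

lemma sum_lessThan_5: "(\<Sum>i = 0..<5. f (i::nat)) = f 0 + f 1 + f 2 + f 3 + f 4"
 by (simp add: eval_nat_numeral)

definition to_vec :: "complex ^ 5 => complex Matrix.vec" where
 "to_vec x = Matrix.vec 5 (%i. x $ of_nat i)"

definition from_vec :: "complex Matrix.vec => complex ^ 5" where
 "from_vec v = vec5 (vec_index v 0) (vec_index v 1) (vec_index v 2) (vec_index v 3) (vec_index v 4)"

lemma to_vec_carrier: "to_vec x \<in> carrier_vec 5"
 by (simp add: to_vec_def)

lemma from_to_vec: "from_vec (to_vec x) = x"
 by (simp add: vec5_eq_iff from_vec_def to_vec_def)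

lemma to_from_vec: "v \<in> carrier_vec 5 ==> to_vec (from_vec v) = v"
 by (rule eq_vecI) (auto simp: from_vec_def to_vec_def less_5)

lemma mat_of_carrier: "mat_of A \<in> carrier_mat 5 5"
 by (simp add: mat_of_def)

lemma mat_of_mult_vec: "mat_of A *\<^sub>v to_vec x = to_vec (A *v x)"
 by (rule eq_vecI)
  (auto simp: mat_of_def to_vec_def scalar_prod_def matrix_vector_mult_def sum_5 sum_lessThan_5)

lemma mat_of_mult: "mat_of A * mat_of B = mat_of (A ** B)"
 by (rule eq_matI)
  (auto simp: mat_of_def scalar_prod_def matrix_matrix_mult_def sum_5 sum_lessThan_5)

lemma to_vec_eq_0: "to_vec x = 0\<^sub>v 5 \<longleftrightarrow> x = 0"
proof
 assume "to_vec x = 0\<^sub>v 5"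
 then have "from_vec (to_vec x) = from_vec (0\<^sub>v 5)" by simp
 then show "x = 0" by (simp only: from_to_vec) (simp add: vec5_eq_iff from_vec_def)
qed (auto simp: to_vec_def)

text \<open>Jordan blocks are counted for one matrix type, while eigenvectors are handled in the
  other; a basis of the kernel is carried across by \<open>from_vec\<close>.\<close>

lemma dim_kernel_mat_of: "vec.dim {x. A *v x = 0} = kernel_dim (mat_of A)"
proof -
 interpret K: kernel 5 5 "mat_of A" by standard (rule mat_of_carrier)
 obtain B where B: "finite B" "K.basis B"
  using kernel_basis_exists[OF mat_of_carrier, of A] by blast
 have Bc: "B \<subseteq> mat_kernel (mat_of A)" using B(2) unfolding K.Ker.basis_def by simp
 have Bc5: "B \<subseteq> carrier_vec 5" using Bc mat_kernel_carrier[OF mat_of_carrier] by blast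
 have inj: "inj_on from_vec B" by (rule inj_on_inverseI[of _ to_vec]) (use Bc5 to_from_vec in auto)
 have ker: "A *v from_vec v = 0 \<longleftrightarrow> v \<in> mat_kernel (mat_of A)" if "v \<in> carrier_vec 5" for v
 proof -
  have "mat_of A *\<^sub>v v = to_vec (A *v from_vec v)"
   using mat_of_mult_vec[of A "from_vec v"] to_from_vec[OF that] by simp
  then show ?thesis using that to_vec_eq_0 by (simp add: mat_kernel[OF mat_of_carrier])
 qed
 have comb: "from_vec (K.lincomb a B) = (\<Sum>v\<in>B. a v *s from_vec v)" for a
 proof -
  have "vec_index (K.lincomb a B) i = (\<Sum>v\<in>B. a v * vec_index v i)" if "i < 5" for i
   by (rule K.lincomb_index[OF that Bc])
  then show ?thesis
   by (simp add: vec5_eq_iff from_vec_def)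
 qed
 have lc: "K.lincomb a B \<in> carrier_vec 5" for a
 proof -
  have "K.lincomb a B \<in> mat_kernel (mat_of A)"
   using K.Ker.lincomb_closed[of B a] Bc by (simp add: class_field_def)
  then show ?thesis using mat_kernel_carrier[OF mat_of_carrier] by blast
 qed
 have "vec.dim {x. A *v x = 0} = card (from_vec ` B)"
 proof (rule vec.dim_unique)
  show "from_vec ` B \<subseteq> {x. A *v x = 0}" using ker Bc Bc5 by blast
  show "{x. A *v x = 0} \<subseteq> vec.span (from_vec ` B)"
  proof
   fix x assume "x \<in> {x. A *v x = 0}"
   then have "to_vec x \<in> mat_kernel (mat_of A)"
    using ker[OF to_vec_carrier, of x] by (simp add: from_to_vec)
   then have "to_vec x \<in> K.span B" using B(2) unfolding K.Ker.basis_def by simp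
   then have "EX a. K.lincomb a B = to_vec x"
    using K.Ker.finite_in_span[OF B(1), of "to_vec x"] Bc by auto
   then obtain a where "to_vec x = K.lincomb a B" by metis
   then have "x = (\<Sum>v\<in>B. a v *s from_vec v)" using comb[of a] from_to_vec[of x] by simp
   also have "\<dots> \<in> vec.span (from_vec ` B)"
    by (intro vec.span_sum vec.span_scale vec.span_base imageI)
   finally show "x \<in> vec.span (from_vec ` B)" .
  qed
  show "vec.independent (from_vec ` B)"
  proof (rule vec.independent_if_scalars_zero)
   fix u x assume u: "(\<Sum>x\<in>from_vec ` B. u x *s x) = 0" and x: "x \<in> from_vec ` B"
   obtain v where v: "v \<in> B" "x = from_vec v" using x by blast
   have "from_vec (K.lincomb (%v. u (from_vec v)) B) = 0"
    using u by (simp add: comb sum.reindex[OF inj])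
   then have "to_vec (from_vec (K.lincomb (%v. u (from_vec v)) B)) = to_vec 0" by simp
   then have "K.lincomb (%v. u (from_vec v)) B = 0\<^sub>v 5"
    using to_vec_eq_0[of 0] by (simp only: to_from_vec[OF lc])
   then show "u x = 0"
    using K.Ker.lin_dep_crit[OF B(1) subset_refl, of "%v. u (from_vec v)" v] v B(2)
    unfolding K.Ker.basis_def by (auto simp: class_field_def)
  qed (use B in simp)
 qed simp
 also have "\<dots> = card B" by (rule card_image[OF inj])
 also have "\<dots> = K.dim" using K.Ker.dim_basis[OF B] by simp
 finally show ?thesis by simp
qed

definition shifted :: "complex ^ 5 ^ 5 => complex => complex ^ 5 ^ 5" where
 "shifted A e = (\<chi> i j. A $ i $ j - (if i = j then e else 0))"

lemma shifted_mult: "shifted A e *v x = A *v x - e *s x"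
proof -
 have "(\<Sum>j\<in>UNIV. (if i = j then e else 0) * x $ j) = e * x $ i" for i :: 5
  by (simp add: if_distrib[of "%y. y * _"] cong: if_cong)
 then show ?thesis
  by (simp add: cvec_eq_iff matrix_vector_mult_def shifted_def algebra_simps sum_subtractf)
qed

lemma char_matrix_mat_of: "char_matrix (mat_of A) e = mat_of (shifted A e)"
 by (rule eq_matI) (auto simp: char_matrix_def mat_of_def shifted_def less_5)

lemma dim_gen_eigenspace_mat_of:
 "dim_gen_eigenspace (mat_of A) e 1 = vec.dim {x. A *v x = e *s x}"
 "dim_gen_eigenspace (mat_of A) e 2 = vec.dim {x. shifted A e *v (shifted A e *v x) = 0}"
proof -
 have c: "mat_of B \<in> carrier_mat 5 5" for B by (rule mat_of_carrier)
 have "char_matrix (mat_of A) e ^\<^sub>m 1 = mat_of (shifted A e)"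
  using c[of "shifted A e"] by (simp add: char_matrix_mat_of)
 then have "dim_gen_eigenspace (mat_of A) e 1 = kernel_dim (mat_of (shifted A e))"
  by (simp add: dim_gen_eigenspace_def)
 also have "\<dots> = vec.dim {x. A *v x = e *s x}"
  unfolding dim_kernel_mat_of[symmetric] shifted_mult by simp
 finally show "dim_gen_eigenspace (mat_of A) e 1 = vec.dim {x. A *v x = e *s x}" .
 have "char_matrix (mat_of A) e ^\<^sub>m 2 = mat_of (shifted A e) * mat_of (shifted A e)"
  using c[of "shifted A e"] by (simp add: char_matrix_mat_of numeral_2_eq_2)
 then have "dim_gen_eigenspace (mat_of A) e 2 = kernel_dim (mat_of (shifted A e ** shifted A e))"
  by (simp add: dim_gen_eigenspace_def mat_of_mult)
 also have "\<dots> = vec.dim {x. shifted A e *v (shifted A e *v x) = 0}"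
  unfolding dim_kernel_mat_of[symmetric] by (simp add: matrix_vector_mul_assoc)
 finally show "dim_gen_eigenspace (mat_of A) e 2 = vec.dim {x. shifted A e *v (shifted A e *v x) = 0}" .
qed

text \<open>All seven symbols say that one eigenvalue has two Jordan blocks, one of them of size 1, and
  every other eigenvalue has a single block.\<close>

lemma eigenspace_dims:
 assumes jnf: "jordan_nf (mat_of A) bs" and sym: "jordan_symbol bs = add_mset {#1, k#} \<sigma>"
  and k: "1 \<le> k" and \<sigma>: "!!\<tau>. \<tau> \<in># \<sigma> ==> size \<tau> = 1"
 obtains l where "vec.dim {x. A *v x = l *s x} = 2"
  "vec.dim {x. shifted A l *v (shifted A l *v x) = 0} \<le> 3"
  "ALL e. e ~= l --> vec.dim {x. A *v x = e *s x} \<le> 1"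
proof -
 define F where "F e = mset (map fst (filter (%b. snd b = e) bs))" for e
 let ?E = "snd ` set bs"
 have "jordan_symbol bs = image_mset F (mset_set ?E)"
  unfolding jordan_symbol_def F_def[abs_def] ..
 then have eq: "image_mset F (mset_set ?E) = add_mset {#1, k#} \<sigma>" using sym by simp
 have "{#1, k#} \<in># image_mset F (mset_set ?E)" by (simp add: eq)
 then have "{#1, k#} \<in> F ` ?E" by (simp only: set_image_mset finite_set_mset_mset_set finite_imageI List.finite_set)
 then obtain l where l: "l \<in> ?E" "F l = {#1, k#}" by (metis imageE)
 have "mset_set ?E = add_mset l (mset_set (?E - {l}))"
  using l(1) by (metis List.finite_set finite_imageI mset_set.remove)
 then have rest: "image_mset F (mset_set (?E - {l})) = \<sigma>" using eq l(2) by simp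
 \<comment> \<open>A block of size n for e contributes min j n to the kernel of the j-th power of A
   - e.\<close>
 have g: "dim_gen_eigenspace (mat_of A) e j = (\<Sum>n\<in>#F e. min j n)" for e j
 proof -
  have "dim_gen_eigenspace (mat_of A) e j = (\<Sum>n\<leftarrow>map fst (filter (%b. snd b = e) bs). min j n)"
   unfolding dim_gen_eigenspace[OF jnf] by (simp add: case_prod_unfold)
  then show ?thesis unfolding F_def by (metis mset_map sum_mset_sum_list)
 qed
 show ?thesis
 proof (rule that)
  show "vec.dim {x. A *v x = l *s x} = 2"
   unfolding dim_gen_eigenspace_mat_of(1)[symmetric] g l(2) using k by simp
  \<comment> \<open>min 2 1 + min 2 k is at most 3; two blocks of size at least 2 would give
    4.\<close>
  show "vec.dim {x. shifted A l *v (shifted A l *v x) = 0} \<le> 3"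
   unfolding dim_gen_eigenspace_mat_of(2)[symmetric] g l(2) by simp
  have "(\<Sum>n\<in>#F e. min 1 n) \<le> 1" if "e ~= l" for e
  proof (cases "e \<in> ?E")
   case True
   then have "e \<in> ?E - {l}" using that by blast
   then have "F e \<in> F ` (?E - {l})" by (rule imageI)
   then have "F e \<in># \<sigma>" unfolding rest[symmetric] by simp
   then obtain n where "F e = {#n#}" using \<sigma> size_1_singleton_mset by blast
   then show "(\<Sum>n\<in>#F e. min 1 n) \<le> 1" by simp
  next
   case False
   then have "filter (%b. snd b = e) bs = []" by (auto simp: filter_empty_conv)
   then have "F e = {#}" by (simp add: F_def)
   then show "(\<Sum>n\<in>#F e. min 1 n) \<le> 1" by simp
  qed
  then show "ALL e. e ~= l --> vec.dim {x. A *v x = e *s x} \<le> 1"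
   unfolding dim_gen_eigenspace_mat_of(1)[symmetric] g by blast
 qed
qed

subsection \<open>Symmetric bilinear forms\<close>

lemma dpair_commute: "dpair x y = dpair y x"
 by (simp add: dpair_def mult.commute)

lemma dpair_add: "dpair x (y + z) = dpair x y + dpair x z" "dpair (x + y) z = dpair x z + dpair y z"
 by (simp_all add: dpair_def algebra_simps sum.distrib)

lemma dpair_diff: "dpair x (y - z) = dpair x y - dpair x z" "dpair (x - y) z = dpair x z - dpair y z"
 by (simp_all add: dpair_def algebra_simps sum_subtractf)

lemma dpair_smult: "dpair x (c *s y) = c * dpair x y" "dpair (c *s x) y = c * dpair x y"
 by (simp_all add: dpair_def sum_distrib_left mult_ac)

lemma dpair_zero [simp]: "dpair x 0 = 0" "dpair 0 x = 0"
 by (simp_all add: dpair_def)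

lemma dpair_nondegenerate: "(!!x. dpair x y = 0) ==> y = 0"
proof -
 assume *: "!!x. dpair x y = 0"
 have "dpair (axis i 1) y = y $ i" for i
  by (simp add: dpair_def axis_def if_distrib[of "%u. u * _"] cong: if_cong)
 then show "y = 0" using * by (simp add: cvec_eq_iff)
qed

lemma dpair_matrix_transpose: "dpair x (A *v y) = dpair (transpose A *v x) y"
 unfolding dpair_def matrix_vector_mult_def transpose_def
 by (simp add: sum_distrib_left sum_distrib_right mult_ac) (rule sum.swap)

definition bil :: "complex ^ 'n::finite ^ 'n => complex ^ 'n => complex ^ 'n => complex" where
 "bil A x y = dpair x (A *v y)"

lemma bil_add: "bil A x (y + z) = bil A x y + bil A x z" "bil A (x + y) z = bil A x z + bil A y z"
 by (simp_all add: bil_def dpair_add matrix_vector_right_distrib)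

lemma bil_diff: "bil A x (y - z) = bil A x y - bil A x z" "bil A (x - y) z = bil A x z - bil A y z"
 by (simp_all add: bil_def dpair_diff matrix_vector_mult_diff_distrib)

lemma bil_smult: "bil A x (c *s y) = c * bil A x y" "bil A (c *s x) y = c * bil A x y"
 by (simp_all add: bil_def dpair_smult matrix_vector_mult_scaleR vector_scalar_commute)

lemma bil_commute: "transpose A = A ==> bil A x y = bil A y x"
 using dpair_matrix_transpose[of x A y] by (simp add: bil_def dpair_commute)

lemma bil_zero [simp]: "bil A x 0 = 0" "bil A 0 x = 0"
 by (simp_all add: bil_def)

lemma bil_sum: "bil A x (\<Sum>i\<in>I. f i) = (\<Sum>i\<in>I. bil A x (f i))"
 by (induction I rule: infinite_finite_induct) (auto simp: bil_add)

lemmas bil_expand = bil_add bil_diff bil_smult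

lemma bil_kernel: "transpose A = A ==> A *v x = 0 ==> bil A x y = 0" "A *v x = 0 ==> bil A y x = 0"
 by (simp add: bil_commute[of A x y], simp_all add: bil_def)

lemma bil_polarization: "transpose A = A ==> bil A (x + y) (x + y) = bil A x x + 2 * bil A x y + bil A y y"
 using bil_commute[of A x y] by (simp add: bil_expand)

lemma span_card_5:
 assumes "finite B" "vec.span B = (UNIV :: (complex ^ 5) set)"
 shows "5 \<le> card B"
proof -
 have "vec.dim (UNIV :: (complex ^ 5) set) \<le> card B"
  by (rule vec.dim_le_card) (use assms in auto)
 moreover have "vec.dim (UNIV :: (complex ^ 5) set) = 5" by (simp add: vec.dim_UNIV card_cart_basis)
 ultimately show ?thesis by simp
qed

lemma dim2_basis:
 fixes V :: "(complex ^ 5) set"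
 assumes "vec.dim V = 2" "vec.subspace V"
 obtains k l where "k \<in> V" "l \<in> V" "!!x. x \<in> V ==> EX \<alpha> \<beta>. x = \<alpha> *s k + \<beta> *s l"
  "!!\<alpha> \<beta>. \<alpha> *s k + \<beta> *s l = 0 ==> \<alpha> = 0 & \<beta> = 0"
proof -
 obtain B where B: "B \<subseteq> V" "vec.independent B" "V \<subseteq> vec.span B" "card B = 2"
  using vec.basis_exists[of V] assms(1) by metis
 obtain k l where kl: "B = {k, l}" "k ~= l" using B(4) by (auto simp: card_2_iff)
 show ?thesis
 proof (rule that)
  show "k \<in> V" "l \<in> V" using B kl by auto
  show "EX \<alpha> \<beta>. x = \<alpha> *s k + \<beta> *s l" if "x \<in> V" for x
  proof -
   have "x \<in> vec.span {k, l}" using B(3) kl(1) that by auto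
   then obtain \<alpha> where "x - \<alpha> *s k \<in> vec.span {l}" by (auto simp: vec.span_breakdown_eq)
   then obtain \<beta> where "x - \<alpha> *s k = \<beta> *s l" by (auto simp: vec.span_singleton)
   then have "x = \<alpha> *s k + \<beta> *s l" by (simp add: algebra_simps)
   then show ?thesis by blast
  qed
  show "\<alpha> = 0 & \<beta> = 0" if 0: "\<alpha> *s k + \<beta> *s l = 0" for \<alpha> \<beta>
  proof -
   define u where "u v = (if v = k then \<alpha> else \<beta>)" for v
   have "(\<Sum>v\<in>{k, l}. u v *s v) = 0" using 0 kl(2) by (simp add: u_def)
   then have "u v = 0" if "v \<in> {k, l}" for v
    using vec.independentD[OF B(2)[unfolded kl(1)] _ subset_refl _ that] by simp
   from this[of k] this[of l] show ?thesis using kl(2) by (auto simp: u_def)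
  qed
 qed
qed

text \<open>Gram--Schmidt: an orthonormal system of size at most 2 can be extended if the kernel is
  two-dimensional.\<close>

lemma extend_orthonormal:
 fixes R :: "complex ^ 5 ^ 5"
 assumes R: "transpose R = R" and K: "!!x. R *v x = 0 ==> x \<in> vec.span {k, l}"
  and U: "finite U" "card U \<le> 2" "!!u v. u \<in> U ==> v \<in> U ==> bil R u v = (if u = v then 1 else 0)"
 obtains u where "bil R u u = 1" "!!v. v \<in> U ==> bil R v u = 0"
proof -
 define \<pi> where "\<pi> x = x - (\<Sum>u\<in>U. bil R u x *s u)" for x
 have \<pi>: "bil R v (\<pi> x) = 0" if "v \<in> U" for v x
 proof -
  have "bil R v (\<Sum>u\<in>U. bil R u x *s u) = (\<Sum>u\<in>U. if u = v then bil R v x else 0)"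
   unfolding bil_sum by (intro sum.cong) (auto simp: bil_smult U(3)[OF that])
  then show ?thesis using U(1) that by (simp add: \<pi>_def bil_diff)
 qed
 \<comment> \<open>If the form vanished on the orthogonal complement of U, every projection
   \<open>\<pi> x\<close> would lie in the kernel of R, and U with k and l would span: at most four
   vectors in dimension five.\<close>
 have "EX x. (ALL v:U. bil R v x = 0) & bil R x x ~= 0"
 proof (rule ccontr)
  assume "\<not> ?thesis"
  then have iso: "bil R x x = 0" if "ALL v:U. bil R v x = 0" for x using that by blast
  have z: "bil R x y = 0" if "ALL v:U. bil R v x = 0" "ALL v:U. bil R v y = 0" for x y
  proof -
   have "ALL v:U. bil R v (x + y) = 0" using that by (simp add: bil_add)
   from iso[OF this] bil_polarization[OF R, of x y] iso[OF that(1)] iso[OF that(2)] show ?thesis by simp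
  qed
  have "x \<in> vec.span (U \<union> {k, l})" for x
  proof -
   have "bil R (\<pi> x) y = 0" for y
   proof -
    have y: "y = \<pi> y + (\<Sum>u\<in>U. bil R u y *s u)" by (simp add: \<pi>_def)
    have "bil R (\<pi> x) u = 0" if "u \<in> U" for u using \<pi>[OF that, of x] bil_commute[OF R, of "\<pi> x" u] by simp
    then have "bil R (\<pi> x) (\<Sum>u\<in>U. bil R u y *s u) = 0" by (simp add: bil_sum bil_smult)
    moreover have "bil R (\<pi> x) (\<pi> y) = 0" using z \<pi> by blast
    ultimately show ?thesis
     using bil_add(1)[of R "\<pi> x" "\<pi> y" "\<Sum>u\<in>U. bil R u y *s u"] unfolding y[symmetric] by simp
   qed
   then have "dpair y (R *v \<pi> x) = 0" for y
    using bil_commute[OF R, of y "\<pi> x"] by (simp add: bil_def)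
   then have "R *v \<pi> x = 0" by (rule dpair_nondegenerate)
   then have "\<pi> x \<in> vec.span (U \<union> {k, l})" using K vec.span_mono[of "{k, l}" "U \<union> {k, l}"] by blast
   moreover have "(\<Sum>u\<in>U. bil R u x *s u) \<in> vec.span (U \<union> {k, l})"
    by (intro vec.span_sum vec.span_scale vec.span_base) auto
   ultimately have "\<pi> x + (\<Sum>u\<in>U. bil R u x *s u) \<in> vec.span (U \<union> {k, l})" by (rule vec.span_add)
   then show ?thesis by (simp add: \<pi>_def)
  qed
  then have "vec.span (U \<union> {k, l}) = UNIV" by blast
  then have "5 \<le> card (U \<union> {k, l})" using span_card_5 U(1) by simp
  moreover have "card (U \<union> {k, l}) \<le> card U + card {k, l}" by (rule card_Un_le)
  moreover have "card {k, l} \<le> 2" by (cases "k = l") auto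
  ultimately show False using U(2) by linarith
 qed
 then obtain x where x: "ALL v:U. bil R v x = 0" "bil R x x ~= 0" by blast
 define c where "c = 1 / csqrt (bil R x x)"
 have "c ^ 2 * bil R x x = 1" using x(2) by (simp add: c_def power_divide)
 then have "bil R (c *s x) (c *s x) = 1" by (simp add: bil_smult power2_eq_square mult_ac)
 moreover have "bil R v (c *s x) = 0" if "v \<in> U" for v using x(1) that by (simp add: bil_smult)
 ultimately show ?thesis using that by blast
qed

lemma orthonormal_triple:
 fixes R :: "complex ^ 5 ^ 5"
 assumes R: "transpose R = R" and K: "!!x. R *v x = 0 ==> x \<in> vec.span {k, l}"
 obtains u v w where "bil R u u = 1" "bil R v v = 1" "bil R w w = 1"
  "bil R u v = 0" "bil R u w = 0" "bil R v w = 0"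
proof -
 obtain u where u: "bil R u u = 1"
  using extend_orthonormal[OF R K, of "{}"] by auto
 obtain v where v: "bil R v v = 1" "bil R u v = 0"
  using extend_orthonormal[OF R K, of "{u}"] u by auto
 have uv: "u ~= v" "bil R v u = 0" using u v bil_commute[OF R, of u v] by auto
 obtain w where w: "bil R w w = 1" "bil R u w = 0" "bil R v w = 0"
  by (rule extend_orthonormal[OF R K, of "{u, v}"]) (use u v uv in \<open>auto simp: card_insert_if\<close>)
 show ?thesis using that u v w by blast
qed

section \<open>Normal form of the pencil\<close>

definition conic_form :: "complex ^ 5 => complex" where
 "conic_form z = z $ 0 * z $ 2 - z $ 1 ^ 2"

definition bundle_form ::
 "complex => complex => (nat => complex) => (nat => complex) => complex ^ 5 => complex" where
 "bundle_form a b f g z = z $ 4 * (b * z $ 3 + g 0 * z $ 0 + g 1 * z $ 1 + g 2 * z $ 2) - a * z $ 3 ^ 2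
  - (f 0 * z $ 0 ^ 2 + f 1 * z $ 0 * z $ 1 + f 2 * z $ 1 ^ 2 + f 3 * z $ 1 * z $ 2 + f 4 * z $ 2 ^ 2)"

text \<open>On the conic (s^2, s, 1) the ternary quadric f becomes a quartic in s with the same five
  coefficients. The equations compare it with the square of p s^2 + q s + r.\<close>

definition square_quartic :: "(nat => complex) => bool" where
 "square_quartic f \<longleftrightarrow> (EX p q r. f 0 = p ^ 2 & f 1 = 2 * p * q & f 2 = q ^ 2 + 2 * p * r & f 3 = 2 * q * r & f 4 = r ^ 2)"

text \<open>Comparison of coefficients in f = g (p s^2 + q s + r) as polynomials in s.\<close>

definition quadric_divides :: "(nat => complex) => (nat => complex) => bool" where
 "quadric_divides g f \<longleftrightarrow> (EX p q r. f 0 = g 0 * p & f 1 = g 0 * q + g 1 * p & f 2 = g 0 * r + g 1 * q + g 2 * p &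
   f 3 = g 1 * r + g 2 * q & f 4 = g 2 * r)"

text \<open>In suitable coordinates \<open>z = (y, w)\<close> the quadric of rank 3 in the pencil is the cone over a
  conic, which makes \<open>S\<close> a conic bundle over that conic. The case \<open>a = 0\<close> is that of a block pair
  \<open>(11)\<close>, the case \<open>a = 1\<close> that of a pair \<open>(1k)\<close> with \<open>k > 1\<close>; the last conditions say that no
  other quadric of the pencil has a kernel of dimension greater than 1.\<close>

locale segre_form =
 fixes S :: "5 cp set" and M :: "complex ^ 5 ^ 5" and a b :: complex and f g :: "nat => complex"
 assumes M_inj: "M *v z = 0 ==> z = 0"
  and type: "a = 0 & b = 1 & g = (%_. 0) | a = 1 & b = 0"
  and mem: "z ~= 0 ==> pt (M *v z) \<in> S \<longleftrightarrow> conic_form z = 0 & bundle_form a b f g z = 0"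
  and not_square: "a = 0 ==> \<not> square_quartic f"
  and not_divides: "a = 1 ==> \<not> quadric_divides g f"
  and g_nonzero: "a = 1 ==> g 0 ~= 0 | g 1 ~= 0 | g 2 ~= 0"

lemma linear_form_kernel:
 fixes p q r :: complex
 obtains y0 y1 y2 z0 z1 z2 where "p * y0 + q * y1 + r * y2 = 0" "p * z0 + q * z1 + r * z2 = 0"
  "ALL \<alpha> \<beta>. \<alpha> * y0 + \<beta> * z0 = 0 --> \<alpha> * y1 + \<beta> * z1 = 0 --> \<alpha> * y2 + \<beta> * z2 = 0 --> \<alpha> = 0 & \<beta> = 0"
proof -
 consider "p ~= 0" | "p = 0" "q ~= 0" | "p = 0" "q = 0" by blast
 then show ?thesis
 proof cases
  case 1
  show ?thesis by (rule that[of q "- p" 0 r 0 "- p"]) (use 1 in auto)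
 next
  case 2
  show ?thesis by (rule that[of 1 0 0 0 r "- q"]) (use 2 in auto)
 next
  case 3
  show ?thesis by (rule that[of 1 0 0 0 1 0]) (use 3 in auto)
 qed
qed

lemma four_independent:
 fixes x y z w :: "complex ^ 'n::finite"
 assumes V: "x \<in> V" "y \<in> V" "z \<in> V" "w \<in> V"
  and ind: "!!\<alpha> \<beta> \<gamma> \<delta>. \<alpha> *s x + \<beta> *s y + \<gamma> *s z + \<delta> *s w = 0 ==> \<alpha> = 0 & \<beta> = 0 & \<gamma> = 0 & \<delta> = 0"
 shows "4 \<le> vec.dim V"
proof -
 have d: "x ~= y" "x ~= z" "x ~= w" "y ~= z" "y ~= w" "z ~= w"
  using ind[of 1 "-1" 0 0] ind[of 1 0 "-1" 0] ind[of 1 0 0 "-1"] ind[of 0 1 "-1" 0]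
   ind[of 0 1 0 "-1"] ind[of 0 0 1 "-1"] by auto
 have "vec.independent {x, y, z, w}"
 proof (rule vec.independent_if_scalars_zero)
  fix u v assume "(\<Sum>v\<in>{x, y, z, w}. u v *s v) = 0" "v \<in> {x, y, z, w}"
  then show "u v = 0" using ind[of "u x" "u y" "u z" "u w"] d by (auto simp: add_ac)
 qed simp
 then have "card {x, y, z, w} \<le> vec.dim V" using V by (intro vec.independent_card_le_dim) auto
 then show ?thesis using d by simp
qed

lemma injective_matrix_inverse:
 fixes M :: "complex ^ 'n::finite ^ 'n"
 assumes "!!z. M *v z = 0 ==> z = 0"
 obtains N where "M ** N = Finite_Cartesian_Product.mat 1" "N ** M = Finite_Cartesian_Product.mat 1"
proof -
 have "inj ((*v) M)"
 proof (rule injI)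
  fix x y assume "M *v x = M *v y"
  then have "M *v (x - y) = 0" by (simp add: matrix_vector_mult_diff_distrib)
  then show "x = y" using assms by fastforce
 qed
 then obtain N where N: "N ** M = Finite_Cartesian_Product.mat 1" using matrix_left_invertible_injective[of M] by blast
 then have "M ** N = Finite_Cartesian_Product.mat 1" using matrix_left_right_inverse by blast
 then show ?thesis using N that by blast
qed

text \<open>The range of a symmetric matrix is the orthogonal complement of its kernel; the preimage
  is written down in the orthonormal vectors.\<close>

lemma range_kernel_complement:
 fixes R :: "complex ^ 5 ^ 5"
 assumes R: "transpose R = R" and uvw: "bil R u u = 1" "bil R v v = 1" "bil R w w = 1"
  "bil R u v = 0" "bil R u w = 0" "bil R v w = 0"
  and kl: "R *v k = 0" "R *v l = 0" "!!\<alpha> \<beta>. \<alpha> *s k + \<beta> *s l = 0 ==> \<alpha> = 0 & \<beta> = 0"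
  and y: "dpair k y = 0" "dpair l y = 0"
 obtains x where "R *v x = y"
proof -
 have vuw: "bil R v u = 0" "bil R w u = 0" "bil R w v = 0" using uvw bil_commute[OF R, of v u] bil_commute[OF R, of w u] bil_commute[OF R, of w v] by simp_all
 note ker = bil_kernel(1)[OF R kl(1)] bil_kernel(1)[OF R kl(2)] bil_kernel(2)[OF kl(1)] bil_kernel(2)[OF kl(2)]
 have inj: "z = 0" if "cols5 u v w k l *v z = 0" for z
 proof -
  have c: "z $ 0 *s u + z $ 1 *s v + z $ 2 *s w + z $ 3 *s k + z $ 4 *s l = 0"
   using that by (simp add: cols5_mult)
  have "bil R t (z $ 0 *s u + z $ 1 *s v + z $ 2 *s w + z $ 3 *s k + z $ 4 *s l) = 0" for t
   by (simp add: c)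
  from this[of u] this[of v] this[of w] have "z $ 0 = 0" "z $ 1 = 0" "z $ 2 = 0"
   by (simp_all add: bil_expand uvw vuw ker)
  then show ?thesis using c kl(3)[of "z $ 3" "z $ 4"] by (simp add: vec5_eq_iff)
 qed
 obtain N where N: "cols5 u v w k l ** N = Finite_Cartesian_Product.mat 1" using injective_matrix_inverse[of "cols5 u v w k l"] inj by blast
 define x where "x = dpair u y *s u + dpair v y *s v + dpair w y *s w"
 have "dpair t (R *v x - y) = 0" for t
 proof -
  have "t = cols5 u v w k l *v (N *v t)" using N by (simp add: matrix_vector_mul_assoc)
  then obtain z :: "complex ^ 5" where t: "t = z $ 0 *s u + z $ 1 *s v + z $ 2 *s w + z $ 3 *s k + z $ 4 *s l"
   unfolding cols5_mult by blast
  have "dpair t (R *v x) = z $ 0 * dpair u y + z $ 1 * dpair v y + z $ 2 * dpair w y"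
   unfolding bil_def[symmetric] t x_def by (simp add: bil_expand uvw vuw ker)
  moreover have "dpair t y = z $ 0 * dpair u y + z $ 1 * dpair v y + z $ 2 * dpair w y"
   unfolding t by (simp add: dpair_add dpair_smult y)
  ultimately show ?thesis by (simp add: dpair_diff)
 qed
 then have "R *v x - y = 0" by (rule dpair_nondegenerate)
 then show ?thesis using that[of x] by simp
qed

text \<open>R is the member of rank 3 and N the inverse of Q times R. The columns of M are vectors
  m0, m1, m2, on which R becomes the conic, and a basis e4, e5 of the kernel of R adapted to Q; c
  collects a multiple of the conic contained in Q.\<close>

lemma pencil_normal_form:
 fixes R Q :: "complex ^ 5 ^ 5"
 assumes R: "transpose R = R" and Q: "transpose Q = Q" and Q0: "ALL x. Q *v x = 0 --> x = 0"
  and dimK: "vec.dim {x. R *v x = 0} = 2"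
  and N: "!!x. Q *v (N *v x) = R *v x" "vec.dim {x. N *v (N *v x) = 0} \<le> 3"
  and other: "ALL \<mu> x y. Q *v x + \<mu> *s (R *v x) = 0 --> Q *v y + \<mu> *s (R *v y) = 0 -->
   (EX \<alpha> \<beta>. (\<alpha> ~= 0 | \<beta> ~= 0) & \<alpha> *s x + \<beta> *s y = 0)"
 shows "EX M a b f g c. (ALL z. M *v z = 0 --> z = 0) & (a = 0 & b = 1 & g = (%_. 0) | a = 1 & b = 0) &
  (ALL z. bil R (M *v z) (M *v z) = conic_form z) &
  (ALL z. bil Q (M *v z) (M *v z) = bundle_form a b f g z + c * conic_form z) &
  (a = 0 --> \<not> square_quartic f) & (a = 1 --> \<not> quadric_divides g f & (g 0 ~= 0 | g 1 ~= 0 | g 2 ~= 0))"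
proof -
 have "vec.subspace {x. R *v x = 0}"
  by (auto simp: vec.subspace_def matrix_linear)
 then obtain k l where kl: "R *v k = 0" "R *v l = 0" "!!x. R *v x = 0 ==> EX \<alpha> \<beta>. x = \<alpha> *s k + \<beta> *s l"
  "!!\<alpha> \<beta>. \<alpha> *s k + \<beta> *s l = 0 ==> \<alpha> = 0 & \<beta> = 0"
  by (rule dim2_basis[OF dimK]) auto
 have span: "x \<in> vec.span {k, l}" if x: "R *v x = 0" for x
 proof -
  obtain \<alpha> \<beta> where "x = \<alpha> *s k + \<beta> *s l" using kl(3)[OF x] by blast
  moreover have "\<alpha> *s k \<in> vec.span {k, l}" "\<beta> *s l \<in> vec.span {k, l}"
   by (intro vec.span_scale vec.span_base; simp)+
  ultimately show ?thesis by (simp add: vec.span_add)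
 qed
 obtain u v w where uvw: "bil R u u = 1" "bil R v v = 1" "bil R w w = 1"
  "bil R u v = 0" "bil R u w = 0" "bil R v w = 0"
  by (rule orthonormal_triple[OF R span], assumption, rule that)
 \<comment> \<open>If Q vanished on the kernel of R, then Q k and Q l would lie in the range of R.
   Preimages x, y would satisfy N x = k and N y = l, so the kernel of N^2 would contain the
   independent vectors k, l, x, y.\<close>
 have QK: "\<not> (bil Q k k = 0 & bil Q k l = 0 & bil Q l l = 0)"
 proof
  assume z: "bil Q k k = 0 & bil Q k l = 0 & bil Q l l = 0"
  then have z': "bil Q l k = 0" using bil_commute[OF Q, of l k] by simp
  obtain x where x: "R *v x = Q *v k"
   by (rule range_kernel_complement[OF R uvw kl(1,2,4), of "Q *v k"]) (use z z' in \<open>simp_all add: bil_def\<close>)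
  obtain y where y: "R *v y = Q *v l"
   by (rule range_kernel_complement[OF R uvw kl(1,2,4), of "Q *v l"]) (use z z' in \<open>simp_all add: bil_def\<close>)
  have Qi: "x = y" if "Q *v x = Q *v y" for x y
  proof -
   have "Q *v (x - y) = 0" using that by (simp add: matrix_vector_mult_diff_distrib)
   then show ?thesis using Q0 by fastforce
  qed
  have Nk: "N *v k = 0" "N *v l = 0" using N(1)[of k] N(1)[of l] kl Q0 by auto
  have Nx: "N *v x = k" "N *v y = l" using N(1)[of x] N(1)[of y] x y Qi by auto
  have "4 \<le> vec.dim {x. N *v (N *v x) = 0}"
  proof (rule four_independent)
   fix \<alpha> \<beta> \<gamma> \<delta> assume 0: "\<alpha> *s k + \<beta> *s l + \<gamma> *s x + \<delta> *s y = 0"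
   have "N *v (\<alpha> *s k + \<beta> *s l + \<gamma> *s x + \<delta> *s y) = \<gamma> *s k + \<delta> *s l"
    by (simp add: matrix_linear Nk Nx)
   then have "\<gamma> = 0 & \<delta> = 0" using kl(4) 0 by simp
   moreover from this have "\<alpha> = 0 & \<beta> = 0" using kl(4) 0 by simp
   ultimately show "\<alpha> = 0 & \<beta> = 0 & \<gamma> = 0 & \<delta> = 0" by simp
  qed (use Nk Nx in auto)
  then show False using N(2) by simp
 qed
 \<comment> \<open>A binary quadratic form over the complex numbers has an isotropic vector: l
   itself, or k + t l with t a root of the quadratic equation.\<close>
 have "EX e v. R *v e = 0 & R *v v = 0 & bil Q e e = 0 & (ALL \<alpha> \<beta>. \<alpha> *s e + \<beta> *s v = 0 --> \<alpha> = 0 & \<beta> = 0) &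
  \<not> (bil Q e v = 0 & bil Q v v = 0)"
 proof (cases "bil Q l l = 0")
  case True
  have "\<alpha> = 0 & \<beta> = 0" if "\<alpha> *s l + \<beta> *s k = 0" for \<alpha> \<beta> using kl(4)[of \<beta> \<alpha>] that by (simp add: add.commute)
  then show ?thesis using True kl QK bil_commute[OF Q, of l k] by (intro exI[of _ l] exI[of _ k]) auto
 next
  case False
  define d where "d = csqrt (bil Q k l ^ 2 - bil Q l l * bil Q k k)"
  define t where "t = (- bil Q k l + d) / bil Q l l"
  have d: "d ^ 2 = bil Q k l ^ 2 - bil Q l l * bil Q k k" by (simp add: d_def)
  have "t * bil Q l l + bil Q k l = d" using False by (simp add: t_def)
  moreover have "bil Q l l * (bil Q k k + 2 * t * bil Q k l + t ^ 2 * bil Q l l)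
   = (t * bil Q l l + bil Q k l) ^ 2 - (bil Q k l ^ 2 - bil Q l l * bil Q k k)"
   by (simp add: power2_eq_square algebra_simps)
  ultimately have "bil Q l l * (bil Q k k + 2 * t * bil Q k l + t ^ 2 * bil Q l l) = 0" by (simp add: d)
  then have "bil Q k k + 2 * t * bil Q k l + t ^ 2 * bil Q l l = 0"
   using False by (simp only: mult_eq_0_iff simp_thms)
  then have "bil Q (k + t *s l) (k + t *s l) = 0"
   using bil_commute[OF Q, of l k] by (simp add: bil_expand power2_eq_square algebra_simps)
  moreover have "\<alpha> = 0 & \<beta> = 0" if "\<alpha> *s (k + t *s l) + \<beta> *s l = 0" for \<alpha> \<beta>
  proof -
   have "\<alpha> *s k + (\<alpha> * t + \<beta>) *s l = 0"
    using that by (simp add: vector_add_ldistrib vector_sadd_rdistrib add_ac)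
   from kl(4)[OF this] have "\<alpha> = 0" "\<alpha> * t + \<beta> = 0" by blast+
   then show ?thesis by simp
  qed
  moreover have "R *v (k + t *s l) = 0" using kl by (simp add: matrix_linear)
  ultimately show ?thesis using False kl(2) by (intro exI[of _ "k + t *s l"] exI[of _ l]) auto
 qed
 then obtain e5 v4 where e5: "R *v e5 = 0" "R *v v4 = 0" "bil Q e5 e5 = 0"
  "!!\<alpha> \<beta>. \<alpha> *s e5 + \<beta> *s v4 = 0 ==> \<alpha> = 0 & \<beta> = 0" "\<not> (bil Q e5 v4 = 0 & bil Q v4 v4 = 0)" by blast
 have e50: "e5 ~= 0" using e5(4)[of 1 0] by auto
 \<comment> \<open>If e5 pairs nontrivially with v4, the two can be changed into a hyperbolic pair
   (a = 0, b = 1). Otherwise e5 spans the radical of Q on the kernel, and v4 is scaled to the value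
   - 1 (a = 1, b = 0).\<close>
 have "EX a b e4. (a = 0 & b = 1 | a = 1 & b = 0) & R *v e4 = 0 & bil Q e4 e4 = - a & bil Q e4 e5 = b / 2"
 proof (cases "bil Q e5 v4 = 0")
  case False
  define v' where "v' = (1 / (2 * bil Q e5 v4)) *s v4"
  define e4 where "e4 = v' - bil Q v' v' *s e5"
  have 1: "bil Q e5 v' = 1 / 2" using False by (simp add: v'_def bil_smult)
  then have 2: "bil Q v' e5 = 1 / 2" using bil_commute[OF Q, of v' e5] by simp
  have "bil Q e4 e4 = 0" by (simp add: e4_def bil_expand 1 2 e5(3))
  moreover have "bil Q e4 e5 = 1 / 2" by (simp add: e4_def bil_expand 2 e5(3))
  moreover have "R *v e4 = 0"
   using e5 by (simp add: e4_def v'_def matrix_vector_mult_diff_distrib vector_scalar_commute)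
  ultimately show ?thesis by (intro exI[of _ 0] exI[of _ 1] exI[of _ e4]) simp
 next
  case True
  define e4 where "e4 = (\<i> / csqrt (bil Q v4 v4)) *s v4"
  have nz: "bil Q v4 v4 ~= 0" using True e5(5) by simp
  have "(\<i> / csqrt (bil Q v4 v4)) ^ 2 * bil Q v4 v4 = - 1" using nz by (simp add: power_divide)
  then have "bil Q e4 e4 = - 1" by (simp add: e4_def bil_smult power2_eq_square mult_ac)
  moreover have "bil Q e4 e5 = 0" using True bil_commute[OF Q, of e5 v4] by (simp add: e4_def bil_smult)
  moreover have "R *v e4 = 0" using e5 by (simp add: e4_def vector_scalar_commute)
  ultimately show ?thesis by (intro exI[of _ 1] exI[of _ 0] exI[of _ e4]) simp
 qed
 then obtain a b e4 where ab: "a = 0 & b = 1 | a = 1 & b = 0"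
  and e4: "R *v e4 = 0" "bil Q e4 e4 = - a" "bil Q e4 e5 = b / 2" by blast
 have e54: "bil Q e5 e4 = b / 2" using e4(3) bil_commute[OF Q, of e5 e4] by simp
 \<comment> \<open>Kernel vectors may be added without changing R. For a = 0 this removes both mixed
   terms; for a = 1 the pairing with the radical vector e5 stays fixed and becomes g.\<close>
 have adj: "EX m. R *v m = R *v m' & bil Q m e4 = 0 & (a = 0 --> bil Q m e5 = 0)" for m'
 proof (cases "a = 0")
  case True
  then have b: "b = 1" using ab by auto
  let ?m = "m' - (2 * bil Q m' e5) *s e4 - (2 * bil Q m' e4) *s e5"
  have "R *v ?m = R *v m'"
   using e4(1) e5(1) by (simp add: matrix_vector_mult_diff_distrib vector_scalar_commute)
  moreover have "bil Q ?m e4 = 0" "bil Q ?m e5 = 0"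
   using True b by (simp_all add: bil_expand e4 e54 e5(3))
  ultimately show ?thesis by blast
 next
  case False
  then have a: "a = 1" using ab by auto
  let ?m = "m' + bil Q m' e4 *s e4"
  have "R *v ?m = R *v m'"
   using e4(1) by (simp add: matrix_linear)
  moreover have "bil Q ?m e4 = 0" using a by (simp add: bil_expand e4)
  ultimately show ?thesis using False by blast
 qed
 \<comment> \<open>The vectors (u + \<i> v) / 2, \<i> w and (u - \<i> v) / 2 turn the sum of three
   squares into y0 y2 - y1^2; adjusting them by the kernel keeps this.\<close>
 obtain m0 where m0: "R *v m0 = R *v ((1 / 2) *s (u + \<i> *s v))" "bil Q m0 e4 = 0" "a = 0 --> bil Q m0 e5 = 0"
  using adj by blast
 obtain m2 where m2: "R *v m2 = R *v ((1 / 2) *s (u - \<i> *s v))" "bil Q m2 e4 = 0" "a = 0 --> bil Q m2 e5 = 0"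
  using adj by blast
 obtain m1 where m1: "R *v m1 = R *v (\<i> *s w)" "bil Q m1 e4 = 0" "a = 0 --> bil Q m1 e5 = 0"
  using adj by blast
 have br: "bil R x y = bil R x' y'" if "R *v x = R *v x'" "R *v y = R *v y'" for x x' y y'
 proof -
  have "bil R x y = bil R x y'" using that(2) by (simp add: bil_def)
  also have "\<dots> = bil R y' x" by (rule bil_commute[OF R])
  also have "\<dots> = bil R y' x'" using that(1) by (simp add: bil_def)
  also have "\<dots> = bil R x' y'" by (rule bil_commute[OF R])
  finally show ?thesis .
 qed
 have vuw: "bil R v u = 0" "bil R w u = 0" "bil R w v = 0" using uvw bil_commute[OF R, of v u] bil_commute[OF R, of w u] bil_commute[OF R, of w v] by simp_all
 have Rm: "bil R m0 m0 = 0" "bil R m0 m1 = 0" "bil R m0 m2 = 1 / 2" "bil R m1 m0 = 0" "bil R m1 m1 = - 1"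
  "bil R m1 m2 = 0" "bil R m2 m0 = 1 / 2" "bil R m2 m1 = 0" "bil R m2 m2 = 0"
  unfolding br[OF m0(1) m0(1)] br[OF m0(1) m1(1)] br[OF m0(1) m2(1)] br[OF m1(1) m0(1)] br[OF m1(1) m1(1)]
   br[OF m1(1) m2(1)] br[OF m2(1) m0(1)] br[OF m2(1) m1(1)] br[OF m2(1) m2(1)]
  by (simp_all add: bil_expand uvw vuw)
 note ker = bil_kernel(1)[OF R e4(1)] bil_kernel(1)[OF R e5(1)] bil_kernel(2)[OF e4(1)] bil_kernel(2)[OF e5(1)]
 define M where "M = cols5 m0 m1 m2 e4 e5"
 have Minj: "z = 0" if "M *v z = 0" for z
 proof -
  have c: "z $ 0 *s m0 + z $ 1 *s m1 + z $ 2 *s m2 + z $ 3 *s e4 + z $ 4 *s e5 = 0"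
   using that by (simp add: M_def cols5_mult)
  have "bil R t (z $ 0 *s m0 + z $ 1 *s m1 + z $ 2 *s m2 + z $ 3 *s e4 + z $ 4 *s e5) = 0" for t
   by (simp add: c)
  from this[of m0] this[of m1] this[of m2] have z: "z $ 0 = 0" "z $ 1 = 0" "z $ 2 = 0"
   by (simp_all add: bil_expand Rm ker)
  then have c': "z $ 3 *s e4 + z $ 4 *s e5 = 0" using c by simp
  then have "bil Q t (z $ 3 *s e4 + z $ 4 *s e5) = 0" for t by simp
  from this[of e4] this[of e5] have "z $ 3 = 0" using ab
   by (auto simp: bil_expand e4 e54 e5(3))
  then have "z $ 3 = 0" "z $ 4 = 0" using c' e50 by (auto simp: vector_mul_eq_0)
  then show ?thesis using z by (simp add: vec5_eq_iff)
 qed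
 obtain Mi where Mi: "M ** Mi = Finite_Cartesian_Product.mat 1" using injective_matrix_inverse[of M] Minj by blast
 have Msurj: "EX z. t = M *v z" for t
  using Mi by (intro exI[of _ "Mi *v t"]) (simp add: matrix_vector_mul_assoc)
 define g where "g = (%i::nat. if a = 0 then 0 else 2 * (if i = 0 then bil Q m0 e5 else if i = 1 then bil Q m1 e5 else bil Q m2 e5))"
 define f where "f = (%i::nat. if i = 0 then - bil Q m0 m0 else if i = 1 then - 2 * bil Q m0 m1
  else if i = 2 then - (bil Q m1 m1 + 2 * bil Q m0 m2) else if i = 3 then - 2 * bil Q m1 m2 else - bil Q m2 m2)"
 \<comment> \<open>The term in y0 y2 is traded for one in y1^2 at the cost of a multiple of the
   conic, whence the summand 2 Q(m0, m2) in \<open>f 2\<close>.\<close>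
 define c where "c = 2 * bil Q m0 m2"
 have Qs: "bil Q m1 m0 = bil Q m0 m1" "bil Q m2 m0 = bil Q m0 m2" "bil Q m2 m1 = bil Q m1 m2"
  "bil Q e4 m0 = 0" "bil Q e4 m1 = 0" "bil Q e4 m2 = 0"
  "bil Q e5 m0 = bil Q m0 e5" "bil Q e5 m1 = bil Q m1 e5" "bil Q e5 m2 = bil Q m2 e5"
  using m0(2) m1(2) m2(2) bil_commute[OF Q, of m1 m0] bil_commute[OF Q, of m2 m0] bil_commute[OF Q, of m2 m1]
   bil_commute[OF Q, of e4 m0] bil_commute[OF Q, of e4 m1] bil_commute[OF Q, of e4 m2]
   bil_commute[OF Q, of e5 m0] bil_commute[OF Q, of e5 m1] bil_commute[OF Q, of e5 m2] by simp_all
 have gm: "g 0 = 2 * bil Q m0 e5" "g 1 = 2 * bil Q m1 e5" "g 2 = 2 * bil Q m2 e5"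
  using m0(3) m1(3) m2(3) by (auto simp: g_def)
 have rform: "bil R (M *v z) (M *v z) = conic_form z" for z
  unfolding M_def cols5_mult
  by (simp add: bil_expand Rm ker conic_form_def power2_eq_square)
 have qform: "bil Q (M *v z) (M *v z) = bundle_form a b f g z + c * conic_form z" for z
 proof -
  have "bil Q (M *v z) (M *v z) = z $ 4 * (b * z $ 3 + (2 * bil Q m0 e5) * z $ 0 + (2 * bil Q m1 e5) * z $ 1 + (2 * bil Q m2 e5) * z $ 2)
   - a * z $ 3 ^ 2 + bil Q m0 m0 * z $ 0 ^ 2 + 2 * bil Q m0 m1 * z $ 0 * z $ 1 + (bil Q m1 m1 + 2 * bil Q m0 m2) * z $ 1 ^ 2
   + 2 * bil Q m1 m2 * z $ 1 * z $ 2 + bil Q m2 m2 * z $ 2 ^ 2 + 2 * bil Q m0 m2 * (z $ 0 * z $ 2 - z $ 1 ^ 2)"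
   unfolding M_def cols5_mult
   by (simp add: bil_expand Qs m0(2) m1(2) m2(2) e4 e54 e5(3) power2_eq_square) (simp add: algebra_simps)
  also have "\<dots> = bundle_form a b f g z + c * conic_form z"
   unfolding bundle_form_def conic_form_def gm[symmetric] by (simp add: f_def c_def algebra_simps)
  finally show ?thesis .
 qed
 \<comment> \<open>By polarization, a vector along which the quadratic form of Q + \<mu> R is
   translation invariant lies in the kernel of that matrix.\<close>
 have null: "Q *v (M *v z0) + \<mu> *s (R *v (M *v z0)) = 0"
  if "!!z. bundle_form a b f g (z0 + z) + (c + \<mu>) * conic_form (z0 + z) = bundle_form a b f g z + (c + \<mu>) * conic_form z" for z0 \<mu>
 proof (rule dpair_nondegenerate)
  fix t
  obtain z where t: "t = M *v z" using Msurj by blast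
  define \<Psi> where "\<Psi> x = bil Q x x + \<mu> * bil R x x" for x
  have \<Psi>: "\<Psi> (M *v z) = bundle_form a b f g z + (c + \<mu>) * conic_form z" for z
   unfolding \<Psi>_def rform qform by (simp add: algebra_simps)
  have inv: "\<Psi> (M *v z0 + M *v z) = \<Psi> (M *v z)" for z
   using \<Psi>[of "z0 + z"] \<Psi>[of z] that[of z] by (simp add: matrix_vector_right_distrib)
  have "\<Psi> (M *v z0) = 0" using inv[of 0] by (simp add: \<Psi>_def)
  moreover have "\<Psi> (M *v z0 + t) = \<Psi> (M *v z0) + 2 * (bil Q t (M *v z0) + \<mu> * bil R t (M *v z0)) + \<Psi> t"
   unfolding \<Psi>_def bil_polarization[OF Q] bil_polarization[OF R]
   using bil_commute[OF Q, of t "M *v z0"] bil_commute[OF R, of t "M *v z0"] by (simp add: algebra_simps)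
  ultimately have "2 * (bil Q t (M *v z0) + \<mu> * bil R t (M *v z0)) = 0" using inv[of z] unfolding t by simp
  then have "bil Q t (M *v z0) + \<mu> * bil R t (M *v z0) = 0" by (simp only: mult_eq_0_iff) simp
  then show "dpair t (Q *v (M *v z0) + \<mu> *s (R *v (M *v z0))) = 0"
   by (simp add: bil_def dpair_add dpair_smult)
 qed
 have dep: False if z1: "!!z. bundle_form a b f g (z1 + z) + (c + \<mu>) * conic_form (z1 + z) = bundle_form a b f g z + (c + \<mu>) * conic_form z"
  and z2: "!!z. bundle_form a b f g (z2 + z) + (c + \<mu>) * conic_form (z2 + z) = bundle_form a b f g z + (c + \<mu>) * conic_form z"
  and ind: "!!\<alpha> \<beta>. \<alpha> *s z1 + \<beta> *s z2 = 0 ==> \<alpha> = 0 & \<beta> = 0" for z1 z2 \<mu>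
 proof -
  obtain \<alpha> \<beta> where *: "\<alpha> ~= 0 | \<beta> ~= 0" "\<alpha> *s (M *v z1) + \<beta> *s (M *v z2) = 0"
   using other[rule_format, OF null[OF z1] null[OF z2]] by blast
  have "M *v (\<alpha> *s z1 + \<beta> *s z2) = 0"
   using *(2) by (simp add: matrix_linear)
  then show False using Minj ind *(1) by blast
 qed
 \<comment> \<open>For \<mu> = - 2 p r - c the form becomes w1 w2 minus the square of a linear form
   in y. Its two-dimensional kernel contradicts the single Jordan blocks of the other
   eigenvalues.\<close>
 have ND1: "\<not> square_quartic f" if a: "a = 0"
  unfolding square_quartic_def
 proof
  assume "EX p q r. f 0 = p ^ 2 & f 1 = 2 * p * q & f 2 = q ^ 2 + 2 * p * r & f 3 = 2 * q * r & f 4 = r ^ 2"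
  then obtain p q r where f: "f 0 = p ^ 2" "f 1 = 2 * p * q" "f 2 = q ^ 2 + 2 * p * r" "f 3 = 2 * q * r" "f 4 = r ^ 2" by blast
  have b: "b = 1" and g0: "g i = 0" for i using a ab by (auto simp: g_def)
  obtain y0 y1 y2 z0 z1 z2 where yz: "p * y0 + q * y1 + r * y2 = 0" "p * z0 + q * z1 + r * z2 = 0"
   "ALL \<alpha> \<beta>. \<alpha> * y0 + \<beta> * z0 = 0 --> \<alpha> * y1 + \<beta> * z1 = 0 --> \<alpha> * y2 + \<beta> * z2 = 0 --> \<alpha> = 0 & \<beta> = 0"
   by (rule linear_form_kernel[of p q r], rule that)
  have form: "bundle_form a b f g z + (c + (- 2 * p * r - c)) * conic_form z = z $ 4 * z $ 3 - (p * z $ 0 + q * z $ 1 + r * z $ 2) ^ 2" for z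
   unfolding bundle_form_def conic_form_def f a b g0 by (simp add: alg_simps2)
  have inv: "z' $ 4 * z' $ 3 - (p * z' $ 0 + q * z' $ 1 + r * z' $ 2) ^ 2 = z $ 4 * z $ 3 - (p * z $ 0 + q * z $ 1 + r * z $ 2) ^ 2"
   if "z' = vec5 x0 x1 x2 0 0 + z" "p * x0 + q * x1 + r * x2 = 0" for z z' x0 x1 x2
  proof -
   have "p * z' $ 0 + q * z' $ 1 + r * z' $ 2 = (p * x0 + q * x1 + r * x2) + (p * z $ 0 + q * z $ 1 + r * z $ 2)"
    unfolding that(1) by (simp add: algebra_simps)
   then show ?thesis using that by simp
  qed
  show False
  proof (rule dep[of "vec5 y0 y1 y2 0 0" "- 2 * p * r - c" "vec5 z0 z1 z2 0 0"])
   show "\<alpha> = 0 & \<beta> = 0" if "\<alpha> *s vec5 y0 y1 y2 0 0 + \<beta> *s vec5 z0 z1 z2 0 0 = 0" for \<alpha> \<beta>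
    using that yz(3)[rule_format, of \<alpha> \<beta>] by (simp add: vec5_eq_iff)
  qed (simp_all only: form inv[OF refl yz(1)] inv[OF refl yz(2)])
 qed
 \<comment> \<open>With g = 0 the vector e5 would be orthogonal to everything under Q.\<close>
 have ND3: "g 0 ~= 0 | g 1 ~= 0 | g 2 ~= 0" if a: "a = 1"
 proof (rule ccontr)
  assume "\<not> ?thesis"
  then have z: "bil Q m0 e5 = 0" "bil Q m1 e5 = 0" "bil Q m2 e5 = 0" using gm by auto
  have b: "b = 0" using ab a by auto
  have "dpair t (Q *v e5) = 0" for t
  proof -
   obtain z where t: "t = M *v z" using Msurj by blast
   have "bil Q t e5 = 0" unfolding t M_def cols5_mult by (simp add: bil_expand z e4 e5(3) b)
   then show ?thesis by (simp add: bil_def)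
  qed
  then have "Q *v e5 = 0" by (rule dpair_nondegenerate)
  then show False using Q0 e50 by blast
 qed
 \<comment> \<open>If g divides f, a suitable \<mu> makes the form g(y) (w2 - p y0 - q y1 - r y2) -
   w1^2, again with a two-dimensional kernel.\<close>
 have ND2: "\<not> quadric_divides g f" if a: "a = 1"
  unfolding quadric_divides_def
 proof
  assume "EX p q r. f 0 = g 0 * p & f 1 = g 0 * q + g 1 * p & f 2 = g 0 * r + g 1 * q + g 2 * p &
   f 3 = g 1 * r + g 2 * q & f 4 = g 2 * r"
  then obtain p q r where f: "f 0 = g 0 * p" "f 1 = g 0 * q + g 1 * p" "f 2 = g 0 * r + g 1 * q + g 2 * p"
   "f 3 = g 1 * r + g 2 * q" "f 4 = g 2 * r" by blast
  have b: "b = 0" using a ab by auto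
  obtain y0 y1 y2 z0 z1 z2 where yz: "g 0 * y0 + g 1 * y1 + g 2 * y2 = 0" "g 0 * z0 + g 1 * z1 + g 2 * z2 = 0"
   "ALL \<alpha> \<beta>. \<alpha> * y0 + \<beta> * z0 = 0 --> \<alpha> * y1 + \<beta> * z1 = 0 --> \<alpha> * y2 + \<beta> * z2 = 0 --> \<alpha> = 0 & \<beta> = 0"
   by (rule linear_form_kernel[of "g 0" "g 1" "g 2"], rule that)
  define \<mu> where "\<mu> = - (g 0 * r + g 2 * p) - c"
  have form: "bundle_form a b f g z + (c + \<mu>) * conic_form z =
   (g 0 * z $ 0 + g 1 * z $ 1 + g 2 * z $ 2) * (z $ 4 - (p * z $ 0 + q * z $ 1 + r * z $ 2)) - z $ 3 ^ 2" for z
   unfolding bundle_form_def conic_form_def f a b \<mu>_def by (simp add: alg_simps2)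
  have inv: "(g 0 * z' $ 0 + g 1 * z' $ 1 + g 2 * z' $ 2) * (z' $ 4 - (p * z' $ 0 + q * z' $ 1 + r * z' $ 2)) - z' $ 3 ^ 2
   = (g 0 * z $ 0 + g 1 * z $ 1 + g 2 * z $ 2) * (z $ 4 - (p * z $ 0 + q * z $ 1 + r * z $ 2)) - z $ 3 ^ 2"
   if "z' = vec5 x0 x1 x2 0 (p * x0 + q * x1 + r * x2) + z" "g 0 * x0 + g 1 * x1 + g 2 * x2 = 0" for z z' x0 x1 x2
  proof -
   have "g 0 * z' $ 0 + g 1 * z' $ 1 + g 2 * z' $ 2 = (g 0 * x0 + g 1 * x1 + g 2 * x2) + (g 0 * z $ 0 + g 1 * z $ 1 + g 2 * z $ 2)"
    "z' $ 4 - (p * z' $ 0 + q * z' $ 1 + r * z' $ 2) = z $ 4 - (p * z $ 0 + q * z $ 1 + r * z $ 2)"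
    unfolding that(1) by (simp_all add: algebra_simps)
   then show ?thesis using that by simp
  qed
  show False
  proof (rule dep[of "vec5 y0 y1 y2 0 (p * y0 + q * y1 + r * y2)" \<mu> "vec5 z0 z1 z2 0 (p * z0 + q * z1 + r * z2)"])
   show "\<alpha> = 0 & \<beta> = 0" if "\<alpha> *s vec5 y0 y1 y2 0 (p * y0 + q * y1 + r * y2) + \<beta> *s vec5 z0 z1 z2 0 (p * z0 + q * z1 + r * z2) = 0" for \<alpha> \<beta>
    using that yz(3)[rule_format, of \<alpha> \<beta>] by (simp add: vec5_eq_iff)
  qed (simp_all only: form inv[OF refl yz(1)] inv[OF refl yz(2)])
 qed
 have type: "a = 0 & b = 1 & g = (%_. 0) | a = 1 & b = 0" using ab by (auto simp: g_def)
 show ?thesis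
  by (rule exI[of _ M], rule exI[of _ a], rule exI[of _ b], rule exI[of _ f], rule exI[of _ g], rule exI[of _ c])
   (intro conjI allI impI; fact type Minj rform qform ND1 ND2 ND3 | erule Minj ND1 ND2 ND3)
qed

lemma invertible_kernel:
 fixes Q :: "complex ^ 'n::finite ^ 'n"
 assumes "invertible Q"
 shows "Q *v (matrix_inv Q *v x) = x" and "Q *v x = 0 ==> x = 0"
proof -
 have *: "Q ** matrix_inv Q = Finite_Cartesian_Product.mat 1" "matrix_inv Q ** Q = Finite_Cartesian_Product.mat 1"
  using someI_ex[OF assms[unfolded invertible_def]] unfolding matrix_inv_def by blast+
 show "Q *v (matrix_inv Q *v x) = x" using *(1) by (simp add: matrix_vector_mul_assoc)
 show "x = 0" if "Q *v x = 0"
 proof -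
  have "x = matrix_inv Q *v (Q *v x)" using *(2) by (simp add: matrix_vector_mul_assoc)
  then show ?thesis using that by simp
 qed
qed

lemma dim_le_1_dependent:
 fixes V :: "(complex ^ 'n::finite) set"
 assumes "vec.dim V \<le> 1" "x \<in> V" "y \<in> V"
 shows "EX \<alpha> \<beta>. (\<alpha> ~= 0 | \<beta> ~= 0) & \<alpha> *s x + \<beta> *s y = 0"
proof (rule ccontr)
 assume "\<not> ?thesis"
 then have ind: "\<alpha> = 0 & \<beta> = 0" if "\<alpha> *s x + \<beta> *s y = 0" for \<alpha> \<beta> using that by blast
 have d: "x ~= y" using ind[of 1 "-1"] by auto
 have "vec.independent {x, y}"
 proof (rule vec.independent_if_scalars_zero)
  fix u v assume "(\<Sum>v\<in>{x, y}. u v *s v) = 0" "v \<in> {x, y}"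
  then show "u v = 0" using ind[of "u x" "u y"] d by auto
 qed simp
 then have "card {x, y} \<le> vec.dim V" using assms by (intro vec.independent_card_le_dim) auto
 then show False using assms(1) d by simp
qed

theorem segre_normal_form:
 fixes S :: "5 cp set"
 assumes S: "has_segre_symbol S (add_mset {#1, k#} \<sigma>)" and k: "1 \<le> k"
  and \<sigma>: "!!\<tau>. \<tau> \<in># \<sigma> ==> size \<tau> = 1"
 obtains M a b f g where "segre_form S M a b f g"
proof -
 obtain P Q bs where PQ: "transpose P = P" "transpose Q = Q" "invertible Q"
  "S = {p. ALL x:line_of p. dpair x (P *v x) = 0 & dpair x (Q *v x) = 0}"
  "jordan_nf (mat_of (matrix_inv Q ** P)) bs" "jordan_symbol bs = add_mset {#1, k#} \<sigma>"
  using S unfolding has_segre_symbol_def by blast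
 let ?A = "matrix_inv Q ** P"
 have eig: "?A *v x = e *s x \<longleftrightarrow> P *v x = e *s (Q *v x)" for e x
 proof -
  have "Q *v (?A *v x) = P *v x"
   using invertible_kernel(1)[OF PQ(3)] by (simp add: matrix_vector_mul_assoc[symmetric])
  moreover have "Q *v (e *s x) = e *s (Q *v x)" by (rule vector_scalar_commute)
  moreover have "?A *v x = e *s x \<longleftrightarrow> Q *v (?A *v x) = Q *v (e *s x)"
  proof
   assume "Q *v (?A *v x) = Q *v (e *s x)"
   then have "Q *v (?A *v x - e *s x) = 0" by (simp add: matrix_vector_mult_diff_distrib)
   then have "?A *v x - e *s x = 0" by (rule invertible_kernel(2)[OF PQ(3)])
   then show "?A *v x = e *s x" by simp
  qed simp
  ultimately show ?thesis by simp
 qed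
 obtain l where l: "vec.dim {x. ?A *v x = l *s x} = 2"
  "vec.dim {x. shifted ?A l *v (shifted ?A l *v x) = 0} \<le> 3"
  "ALL e. e ~= l --> vec.dim {x. ?A *v x = e *s x} \<le> 1"
  by (rule eigenspace_dims[OF PQ(5,6) k \<sigma>], assumption, rule that)
 define R where "R = (\<chi> i j. P $ i $ j - l * Q $ i $ j)"
 have Rx: "R *v x = P *v x - l *s (Q *v x)" for x
  by (simp add: cvec_eq_iff R_def matrix_vector_mult_def algebra_simps sum_subtractf sum_distrib_left)
 have "P $ j $ i = P $ i $ j" "Q $ j $ i = Q $ i $ j" for i j
  using arg_cong[OF PQ(1), of "%A. A $ i $ j"] arg_cong[OF PQ(2), of "%A. A $ i $ j"]
  by (simp_all add: Finite_Cartesian_Product.transpose_def)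
 then have R: "transpose R = R"
  by (simp add: cvec_eq_iff Finite_Cartesian_Product.transpose_def R_def)
 have dimK: "vec.dim {x. R *v x = 0} = 2" using l(1) unfolding Rx eig by simp
 have N: "Q *v (shifted ?A l *v x) = R *v x" for x
 proof -
  have "Q *v (?A *v x) = P *v x"
   using invertible_kernel(1)[OF PQ(3)] by (simp add: matrix_vector_mul_assoc[symmetric])
  then show ?thesis by (simp add: shifted_mult Rx matrix_vector_mult_diff_distrib vector_scalar_commute)
 qed
 have other: "EX \<alpha> \<beta>. (\<alpha> ~= 0 | \<beta> ~= 0) & \<alpha> *s x + \<beta> *s y = 0"
  if xy: "Q *v x + \<mu> *s (R *v x) = 0" "Q *v y + \<mu> *s (R *v y) = 0" for \<mu> x y
 proof (cases "\<mu> = 0")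
  case True
  then have "x = 0" using xy(1) invertible_kernel(2)[OF PQ(3)] by simp
  then show ?thesis by (intro exI[of _ 1] exI[of _ 0]) simp
 next
  case False
  \<comment> \<open>Dividing by \<mu> shows that kernel vectors of Q + \<mu> R belong to the
    eigenvalue l - 1 / \<mu>, which differs from l.\<close>
  have e: "P *v z = (l - 1 / \<mu>) *s (Q *v z)" if "Q *v z + \<mu> *s (R *v z) = 0" for z
  proof -
   have "(1 / \<mu>) *s (Q *v z + \<mu> *s (R *v z)) = 0" using that by simp
   then have "(1 / \<mu>) *s (Q *v z) + R *v z = 0" using False by (simp add: vector_add_ldistrib)
   then show ?thesis unfolding Rx by (simp add: vector_ssub_ldistrib vector_sub_rdistrib algebra_simps)
  qed
  have "l - 1 / \<mu> ~= l" using False by simp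
  from dim_le_1_dependent[OF l(3)[rule_format, OF this]] show ?thesis using e[OF xy(1)] e[OF xy(2)] eig by blast
 qed
 have Q0: "ALL x. Q *v x = 0 --> x = 0" using invertible_kernel(2)[OF PQ(3)] by blast
 have other': "ALL \<mu> x y. Q *v x + \<mu> *s (R *v x) = 0 --> Q *v y + \<mu> *s (R *v y) = 0 -->
   (EX \<alpha> \<beta>. (\<alpha> ~= 0 | \<beta> ~= 0) & \<alpha> *s x + \<beta> *s y = 0)"
  using other by blast
 from pencil_normal_form[OF R PQ(2) Q0 dimK N l(2) other'] show ?thesis
 proof (elim exE conjE)
  fix M a b f g c
  assume M: "ALL z. M *v z = 0 --> z = 0"
   "a = 0 & b = 1 & g = (%_. 0) | a = 1 & b = 0"
   "ALL z. bil R (M *v z) (M *v z) = conic_form z"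
   "ALL z. bil Q (M *v z) (M *v z) = bundle_form a b f g z + c * conic_form z"
   "a = 0 --> \<not> square_quartic f"
   "a = 1 --> \<not> quadric_divides g f & (g 0 ~= 0 | g 1 ~= 0 | g 2 ~= 0)"
  have memS: "pt (M *v z) \<in> S \<longleftrightarrow> conic_form z = 0 & bundle_form a b f g z = 0" if "z ~= 0" for z
  proof -
   let ?x = "M *v z"
   have x: "?x ~= 0" using M(1) that by blast
   have sc: "dpair (d *s ?x) (A *v (d *s ?x)) = d ^ 2 * bil A ?x ?x" for d A
    by (simp add: bil_def vector_scalar_commute dpair_smult power2_eq_square mult_ac)
   have "pt ?x \<in> S \<longleftrightarrow> bil P ?x ?x = 0 & bil Q ?x ?x = 0"
    unfolding PQ(4) by (auto simp: line_of_pt[OF x] sc dest: spec[of _ 1])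
   moreover have "bil R ?x ?x = bil P ?x ?x - l * bil Q ?x ?x"
    by (simp add: bil_def Rx dpair_diff dpair_smult)
   ultimately have "pt ?x \<in> S \<longleftrightarrow> bil R ?x ?x = 0 & bil Q ?x ?x = 0" by auto
   then show ?thesis using M(3,4) by auto
  qed
  have "segre_form S M a b f g"
  proof
   show "z = 0" if "M *v z = 0" for z using M(1) that by blast
   show "a = 0 & b = 1 & g = (%_. 0) | a = 1 & b = 0" by (rule M(2))
   show "pt (M *v z) \<in> S \<longleftrightarrow> conic_form z = 0 & bundle_form a b f g z = 0" if "z ~= 0" for z
    using memS that by blast
   show "\<not> square_quartic f" if "a = 0" using M(5) that by blast
   show "\<not> quadric_divides g f" "g 0 ~= 0 | g 1 ~= 0 | g 2 ~= 0" if "a = 1" using M(6) that by blast+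
  qed
  then show ?thesis by (rule that)
 qed
qed

section \<open>Local analysis of hyperplane sections\<close>

lemma poly_root_factor: "poly p s0 = 0 ==> EX q. p = [:- s0, 1:] * (q :: complex poly)"
 by (simp add: poly_eq_0_iff_dvd dvd_def)

lemma poly_double_root:
 fixes p :: "complex poly"
 assumes "poly p s0 = 0" "poly (pderiv p) s0 = 0"
 shows "EX q. p = [:- s0, 1:] ^ 2 * q"
proof -
 obtain q where q: "p = [:- s0, 1:] * q" using poly_root_factor[OF assms(1)] by blast
 have "pderiv p = q + [:- s0, 1:] * pderiv q" unfolding q by (simp only: pderiv_mult pderiv_pCons pderiv_0 pderiv_1) (simp add: algebra_simps)
 then have "poly q s0 = 0" using assms(2) by simp
 then obtain r where "q = [:- s0, 1:] * r" using poly_root_factor by blast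
 then show ?thesis using q by (intro exI[of _ r]) (simp only: power2_eq_square mult.assoc)
qed

lemma holo2_poly: "holo2 f W ==> holo2 (%z. poly p (f z)) W"
 by (rule holo2_compose[of f W "poly p" UNIV]) (auto intro: poly_holomorphic_on)

lemma cdiff2_poly: "cdiff2 f z a b ==> cdiff2 (%w. poly p (f w)) z (poly (pderiv p) (f z) * a) (poly (pderiv p) (f z) * b)"
 by (rule cdiff2_compose[OF _ poly_DERIV])

lemma open_nonzero:
 assumes "open W" "holo2 f W"
 shows "open {z \<in> W. f z ~= 0}"
proof -
 have "open (W \<inter> f -` (- {0}))"
  by (rule continuous_open_preimage[OF holo2_continuous_on[OF assms(2)] assms(1)]) auto
 moreover have "W \<inter> f -` (- {0}) = {z \<in> W. f z ~= 0}" by auto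
 ultimately show ?thesis by simp
qed

lemma det2_nonzero:
 fixes a b c d :: complex
 assumes "!!x y. x * a + y * b = 0 ==> x * c + y * d = 0 ==> x = 0 & y = 0"
 shows "a * d - b * c ~= 0"
proof
 assume z: "a * d - b * c = 0"
 have 1: "b = 0 & - a = 0" using assms[of b "- a"] z by (simp add: algebra_simps)
 have 2: "d = 0 & - c = 0" using assms[of d "- c"] z by (simp add: algebra_simps)
 show False using assms[of 1 0] 1 2 by simp
qed

lemma det2_solve:
 fixes a b c d x y :: complex
 assumes "a * d - b * c ~= 0" "x * a + y * c = 0" "x * b + y * d = 0"
 shows "x = 0" "y = 0"
proof -
 have "x * (a * d - b * c) = (x * a + y * c) * d - (x * b + y * d) * c" by (simp add: algebra_simps)
 then show "x = 0" using assms by simp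
 have "y * (a * d - b * c) = (x * b + y * d) * a - (x * a + y * c) * b" by (simp add: algebra_simps)
 then show "y = 0" using assms by simp
qed

text \<open>The polynomials below describe the restriction of the hyperplane with dual coordinates \<open>k\<close> to the
  conic bundle: multiplied by \<open>m = b w + g(s)\<close> it becomes \<open>\<kappa> w\<^sup>2 + B(s) w + C(s)\<close>, with discriminant \<open>D\<close>.\<close>

definition quarticP :: "(nat => complex) => complex poly" where
 "quarticP f = [:f 4, f 3, f 2, f 1, f 0:]"

definition quadricP :: "(nat => complex) => complex poly" where
 "quadricP g = [:g 2, g 1, g 0:]"

definition baseP :: "complex ^ 5 => complex poly" where
 "baseP k = [:k $ 2, k $ 1, k $ 0:]"

definition kap :: "complex => complex => complex ^ 5 => complex" where
 "kap a b k = b * k $ 3 + a * k $ 4"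

definition polB :: "complex => (nat => complex) => complex ^ 5 => complex poly" where
 "polB b g k = Polynomial.smult b (baseP k) + Polynomial.smult (k $ 3) (quadricP g)"

definition polC :: "(nat => complex) => (nat => complex) => complex ^ 5 => complex poly" where
 "polC f g k = quadricP g * baseP k + Polynomial.smult (k $ 4) (quarticP f)"

definition discP :: "complex => complex => (nat => complex) => (nat => complex) => complex ^ 5 => complex poly" where
 "discP a b f g k = polB b g k ^ 2 - Polynomial.smult (4 * kap a b k) (polC f g k)"

lemma complete_square:
 "4 * kap a b k * (kap a b k * w ^ 2 + poly (polB b g k) s * w + poly (polC f g k) s)
  = (2 * kap a b k * w + poly (polB b g k) s) ^ 2 - poly (discP a b f g k) s"
 by (simp add: discP_def power2_eq_square algebra_simps)

text \<open>The assumptions say that \<kappa> w^2 + B w + C vanishes at (s0, w) together with both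
  partial derivatives. As B = - 2 \<kappa> w there, D' = 2 B B' - 4 \<kappa> C' equals - 4 \<kappa>
  (B' w + C') and vanishes too.\<close>

lemma disc_double_root:
 assumes "kap a b k * w ^ 2 + poly (polB b g k) s0 * w + poly (polC f g k) s0 = 0"
  "2 * kap a b k * w + poly (polB b g k) s0 = 0"
  "poly (pderiv (polB b g k)) s0 * w + poly (pderiv (polC f g k)) s0 = 0"
 shows "EX q. discP a b f g k = [:- s0, 1:] ^ 2 * q"
proof (rule poly_double_root)
 show "poly (discP a b f g k) s0 = 0"
  using complete_square[of a b k w g s0 f] assms(1,2) by simp
 have B: "poly (polB b g k) s0 = - (2 * kap a b k * w)" using assms(2) by (simp add: eq_neg_iff_add_eq_0 add.commute)
 have "poly (pderiv (discP a b f g k)) s0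
   = 2 * poly (polB b g k) s0 * poly (pderiv (polB b g k)) s0 - 4 * kap a b k * poly (pderiv (polC f g k)) s0"
  by (simp add: discP_def pderiv_diff pderiv_smult power2_eq_square pderiv_mult)
 also have "\<dots> = - 4 * kap a b k * (poly (pderiv (polB b g k)) s0 * w + poly (pderiv (polC f g k)) s0)"
  unfolding B by (simp add: algebra_simps)
 finally show "poly (pderiv (discP a b f g k)) s0 = 0" using assms(3) by simp
qed

text \<open>Local coordinates of a surface germ in the affine part of the conic bundle, together with the
  restriction of a hyperplane.\<close>

locale bundle_germ =
 fixes a b :: complex and f g :: "nat => complex" and k :: "complex ^ 5"
  and W :: "(complex \<times> complex) set" and s w1 w2 :: "complex \<times> complex => complex"
  and su sv pu pv qu qv :: complex
 assumes type: "a = 0 & b = 1 & g = (%_. 0) | a = 1 & b = 0"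
  and W: "open W" "0 \<in> W" and holo: "holo2 s W" "holo2 w1 W" "holo2 w2 W"
  and d: "cdiff2 s 0 su sv" "cdiff2 w1 0 pu pv" "cdiff2 w2 0 qu qv"
  and rank: "!!x y. x * su + y * sv = 0 ==> x * pu + y * pv = 0 ==> x * qu + y * qv = 0 ==> x = 0 & y = 0"
  and E: "!!z. z \<in> W ==> w2 z * (b * w1 z + poly (quadricP g) (s z)) = a * w1 z ^ 2 + poly (quarticP f) (s z)"
begin

definition sect :: "complex \<times> complex => complex" where
 "sect z = poly (baseP k) (s z) + k $ 3 * w1 z + k $ 4 * w2 z"

definition mfun :: "complex \<times> complex => complex" where
 "mfun z = b * w1 z + poly (quadricP g) (s z)"

text \<open>The surface equation removes w2 from the product and leaves a polynomial in s and
  w1.\<close>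

lemma sect_mfun: "z \<in> W ==> sect z * mfun z =
 kap a b k * w1 z ^ 2 + poly (polB b g k) (s z) * w1 z + poly (polC f g k) (s z)"
proof -
 assume z: "z \<in> W"
 have "sect z * mfun z = (poly (baseP k) (s z) + k $ 3 * w1 z) * mfun z + k $ 4 * (w2 z * mfun z)"
  by (simp add: sect_def algebra_simps)
 also have "w2 z * mfun z = a * w1 z ^ 2 + poly (quarticP f) (s z)" using E[OF z] by (simp add: mfun_def)
 finally show ?thesis
  by (simp add: mfun_def kap_def polB_def polC_def power2_eq_square algebra_simps)
qed

lemma holo_mfun: "holo2 mfun W"
 unfolding mfun_def by (intro holo2_intros holo2_poly holo)
lemma dE:
 "(w2 0 * poly (pderiv (quadricP g)) (s 0) - poly (pderiv (quarticP f)) (s 0)) * su + (b * w2 0 - 2 * a * w1 0) * pu + mfun 0 * qu = 0"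
 "(w2 0 * poly (pderiv (quadricP g)) (s 0) - poly (pderiv (quarticP f)) (s 0)) * sv + (b * w2 0 - 2 * a * w1 0) * pv + mfun 0 * qv = 0"
proof -
 let ?E = "%z. w2 z * (b * w1 z + poly (quadricP g) (s z)) - (a * (w1 z * w1 z) + poly (quarticP f) (s z))"
 have 0: "cdiff2 ?E 0 0 0"
  by (rule cdiff2_cong[OF cdiff2_const[of 0] W]) (use E in \<open>simp add: power2_eq_square\<close>)
 note 1 = cdiff2_diff[OF cdiff2_mult[OF d(3) cdiff2_add[OF cdiff2_mult[OF cdiff2_const[of b] d(2)] cdiff2_poly[OF d(1)]]]
  cdiff2_add[OF cdiff2_mult[OF cdiff2_const[of a] cdiff2_mult[OF d(2) d(2)]] cdiff2_poly[OF d(1)]]]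
 from cdiff2_unique[OF 0 1[of "quadricP g" "quarticP f"]]
 show "(w2 0 * poly (pderiv (quadricP g)) (s 0) - poly (pderiv (quarticP f)) (s 0)) * su + (b * w2 0 - 2 * a * w1 0) * pu + mfun 0 * qu = 0"
  "(w2 0 * poly (pderiv (quadricP g)) (s 0) - poly (pderiv (quarticP f)) (s 0)) * sv + (b * w2 0 - 2 * a * w1 0) * pv + mfun 0 * qv = 0"
  by (simp_all add: mfun_def algebra_simps)
qed

lemma d_sect: "cdiff2 sect 0 (poly (pderiv (baseP k)) (s 0) * su + k $ 3 * pu + k $ 4 * qu)
 (poly (pderiv (baseP k)) (s 0) * sv + k $ 3 * pv + k $ 4 * qv)"
proof -
 from cdiff2_add[OF cdiff2_add[OF cdiff2_poly[OF d(1), of "baseP k"] cdiff2_mult[OF cdiff2_const[of "k $ 3"] d(2)]]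
   cdiff2_mult[OF cdiff2_const[of "k $ 4"] d(3)]]
 show ?thesis unfolding sect_def[abs_def] by simp
qed

text \<open>Where m is nonzero, the differentiated surface equation expresses dw2 by ds and dw1, so
  s and w1 are local coordinates.\<close>

lemma det_sp:
 assumes "mfun 0 ~= 0"
 shows "su * pv - sv * pu ~= 0"
proof (rule det2_nonzero)
 fix x y assume xy: "x * su + y * sv = 0" "x * pu + y * pv = 0"
 let ?Q = "w2 0 * poly (pderiv (quadricP g)) (s 0) - poly (pderiv (quarticP f)) (s 0)"
 let ?P = "b * w2 0 - 2 * a * w1 0"
 have "mfun 0 * (x * qu + y * qv) = x * (?Q * su + ?P * pu + mfun 0 * qu) + y * (?Q * sv + ?P * pv + mfun 0 * qv)
  - ?Q * (x * su + y * sv) - ?P * (x * pu + y * pv)" by (simp add: algebra_simps)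
 then have "mfun 0 * (x * qu + y * qv) = 0" unfolding dE xy by simp
 then have "x * qu + y * qv = 0" using assms by simp
 then show "x = 0 & y = 0" using rank xy by blast
qed

text \<open>A critical zero of the section is one of its product with m as well; since s and w1 are
  coordinates, both partial derivatives of the resulting polynomial vanish.\<close>

lemma critical:
 assumes m: "mfun 0 ~= 0" and z: "sect 0 = 0" "cdiff2 sect 0 0 0"
 shows "kap a b k * w1 0 ^ 2 + poly (polB b g k) (s 0) * w1 0 + poly (polC f g k) (s 0) = 0"
  "2 * kap a b k * w1 0 + poly (polB b g k) (s 0) = 0"
  "poly (pderiv (polB b g k)) (s 0) * w1 0 + poly (pderiv (polC f g k)) (s 0) = 0"
proof -
 show "kap a b k * w1 0 ^ 2 + poly (polB b g k) (s 0) * w1 0 + poly (polC f g k) (s 0) = 0"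
  using sect_mfun[OF W(2)] z(1) by simp
 obtain mu mv where mm: "cdiff2 mfun 0 mu mv" using holo_mfun W(2) unfolding holo2_def by blast
 have "cdiff2 (%z. sect z * mfun z) 0 0 0" using cdiff2_mult[OF z(2) mm] z(1) by simp
 then have 0: "cdiff2 (%z. kap a b k * (w1 z * w1 z) + poly (polB b g k) (s z) * w1 z + poly (polC f g k) (s z)) 0 0 0"
  by (rule cdiff2_cong[OF _ W]) (simp add: sect_mfun power2_eq_square)
 note 1 = cdiff2_add[OF cdiff2_add[OF cdiff2_mult[OF cdiff2_const[of "kap a b k"] cdiff2_mult[OF d(2) d(2)]]
   cdiff2_mult[OF cdiff2_poly[OF d(1), of "polB b g k"] d(2)]] cdiff2_poly[OF d(1), of "polC f g k"]]
 let ?X = "poly (pderiv (polB b g k)) (s 0) * w1 0 + poly (pderiv (polC f g k)) (s 0)"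
 let ?Y = "2 * kap a b k * w1 0 + poly (polB b g k) (s 0)"
 have "?X * su + ?Y * pu = 0" "?X * sv + ?Y * pv = 0"
  using cdiff2_unique[OF 0 1] by (simp_all add: algebra_simps)
 from det2_solve[OF det_sp[OF m] this] show "?Y = 0" "?X = 0" by auto
qed

text \<open>Where the discriminant has a double root the section is locally reducible, so a cusp forces a
  triple root.\<close>

lemma cusp_triple_root:
 assumes c: "holo2 c W" "c 0 ~= 0" and cusp: "!!u v. (u, v) \<in> W ==> sect (u, v) = c (u, v) * (u ^ 2 - v ^ 3)"
  and m: "mfun 0 ~= 0"
 shows "kap a b k ~= 0" "k $ 4 ~= 0" "2 * kap a b k * w1 0 + poly (polB b g k) (s 0) = 0"
  "[:- s 0, 1:] ^ 3 dvd discP a b f g k"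
proof -
 have d0: "cdiff2 (%z. c z * (fst z * fst z - snd z * (snd z * snd z))) 0 0 0"
 proof -
  obtain cu cv where cc: "cdiff2 c 0 cu cv" using c(1) W(2) unfolding holo2_def by blast
  from cdiff2_mult[OF cc cdiff2_diff[OF cdiff2_mult[OF cdiff2_fst cdiff2_fst] cdiff2_mult[OF cdiff2_snd cdiff2_mult[OF cdiff2_snd cdiff2_snd]]]]
  show ?thesis by simp
 qed
 have z: "sect 0 = 0" using cusp[of 0 0] W(2) by (simp add: zero_prod_def)
 have dz: "cdiff2 sect 0 0 0"
  by (rule cdiff2_cong[OF d0 W]) (use cusp in \<open>auto simp: pow_simps3\<close>)
 note crit = critical[OF m z dz]
 note det = det_sp[OF m]
 have sds: "cdiff2 (%z. s z - s 0) 0 su sv" using cdiff2_diff[OF d(1) cdiff2_const[of "s 0"]] by simp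
 have suv: "su ~= 0 | sv ~= 0" using det by auto
 have hc: "holo2 (%z. c z * mfun z) W" by (intro holo2_mult c holo_mfun)
 \<comment> \<open>If \<kappa> = 0, then B and C vanish at \<open>s 0\<close>, so that s -
   \<open>s 0\<close> splits off the section times m.\<close>
 show kap: "kap a b k ~= 0"
 proof
  assume k0: "kap a b k = 0"
  then have "poly (polB b g k) (s 0) = 0" "poly (polC f g k) (s 0) = 0" using crit by auto
  then obtain B1 C1 where BC: "polB b g k = [:- s 0, 1:] * B1" "polC f g k = [:- s 0, 1:] * C1"
   using poly_root_factor by metis
  show False
  proof (rule cusp_not_product[OF W _ _ hc])
   show "holo2 (%z. s z - s 0) W" "holo2 (%z. poly B1 (s z) * w1 z + poly C1 (s z)) W"
    by (intro holo2_intros holo2_poly holo)+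
   show "c (u, v) * mfun (u, v) * (u ^ 2 - v ^ 3) = (s (u, v) - s 0) * (poly B1 (s (u, v)) * w1 (u, v) + poly C1 (s (u, v)))"
    if "(u, v) \<in> W" for u v
    using sect_mfun[OF that] unfolding cusp[OF that] k0 BC by (simp add: algebra_simps)
  qed (use c(2) m sds suv in auto)
 qed
 \<comment> \<open>With k4 = 0 the section is F(s) + k3 w1, F being the base polynomial, and k3 is
   nonzero because \<kappa> is. Such a function has no critical point in the coordinates s,
   w1.\<close>
 show k4: "k $ 4 ~= 0"
 proof
  assume k4: "k $ 4 = 0"
  then have b: "b ~= 0" "k $ 3 ~= 0" using kap by (auto simp: kap_def)
  have "poly (pderiv (baseP k)) (s 0) * su + k $ 3 * pu = 0" "poly (pderiv (baseP k)) (s 0) * sv + k $ 3 * pv = 0"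
   using cdiff2_unique[OF dz d_sect] k4 by simp_all
  from det2_solve(2)[OF det this] b show False by simp
 qed
 show "2 * kap a b k * w1 0 + poly (polB b g k) (s 0) = 0" by (rule crit)
 obtain q where q: "discP a b f g k = [:- s 0, 1:] ^ 2 * q" using disc_double_root[OF crit] by blast
 \<comment> \<open>Otherwise q has a local square root \<rho>, and the completed square is a
   difference of squares. It splits into two functions, the first of which has a nonzero linear
   part.\<close>
 have "poly q (s 0) = 0"
 proof (rule ccontr)
  assume nz: "poly q (s 0) ~= 0"
  obtain U \<rho> where U: "open U" "s 0 \<in> U" "\<rho> holomorphic_on U" "!!x. x \<in> U ==> \<rho> x ^ 2 = poly q x"
   by (rule local_root[of "poly q" "s 0" 2]) (use nz in \<open>auto intro: poly_holomorphic_on\<close>)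
  define W' where "W' = W \<inter> s -` U"
  have W': "open W'" "0 \<in> W'"
   unfolding W'_def using W U(1,2) continuous_open_preimage[OF holo2_continuous_on[OF holo(1)] W(1) U(1)] by auto
  have h': "holo2 s W'" "holo2 w1 W'" "holo2 (%z. c z * mfun z) W'"
   using holo hc holo2_subset[of _ W W'] by (auto simp: W'_def)
  have h\<rho>: "holo2 (%z. \<rho> (s z)) W'"
   by (rule holo2_compose[OF h'(1) U(3,1)]) (simp add: W'_def)
  let ?X = "%z. 2 * kap a b k * w1 z + poly (polB b g k) (s z)"
  have "(\<rho> has_field_derivative deriv \<rho> (s 0)) (at (s 0))" by (rule holomorphic_derivI[OF U(3,1,2)])
  note d\<rho> = cdiff2_compose[OF d(1) this]
  note dX = cdiff2_add[OF cdiff2_mult[OF cdiff2_const[of "2 * kap a b k"] d(2)] cdiff2_poly[OF d(1), of "polB b g k"]]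
  let ?y = "poly (pderiv (polB b g k)) (s 0) - \<rho> (s 0)"
  have d\<sigma>: "cdiff2 (%z. ?X z - (s z - s 0) * \<rho> (s z)) 0 (2 * kap a b k * pu + ?y * su) (2 * kap a b k * pv + ?y * sv)"
   using cdiff2_diff[OF dX cdiff2_mult[OF sds d\<rho>]] by (simp add: algebra_simps)
  show False
  proof (rule cusp_not_product[OF W' _ _ holo2_mult[OF holo2_const[of "4 * kap a b k"] h'(3)] _ _ _ d\<sigma>])
   show "holo2 (%z. ?X z - (s z - s 0) * \<rho> (s z)) W'" "holo2 (%z. ?X z + (s z - s 0) * \<rho> (s z)) W'"
    by (intro holo2_intros holo2_poly h' h\<rho>)+
   show "4 * kap a b k * (c (u, v) * mfun (u, v)) * (u ^ 2 - v ^ 3) =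
    (?X (u, v) - (s (u, v) - s 0) * \<rho> (s (u, v))) * (?X (u, v) + (s (u, v) - s 0) * \<rho> (s (u, v)))"
    if uv: "(u, v) \<in> W'" for u v
   proof -
    have w: "(u, v) \<in> W" "s (u, v) \<in> U" using uv by (auto simp: W'_def)
    have "4 * kap a b k * (c (u, v) * mfun (u, v)) * (u ^ 2 - v ^ 3) = 4 * kap a b k * (sect (u, v) * mfun (u, v))"
     unfolding cusp[OF w(1)] by (simp add: mult_ac)
    also have "\<dots> = ?X (u, v) ^ 2 - poly (discP a b f g k) (s (u, v))"
     unfolding sect_mfun[OF w(1)] by (rule complete_square)
    also have "poly (discP a b f g k) (s (u, v)) = (s (u, v) - s 0) ^ 2 * \<rho> (s (u, v)) ^ 2"
     unfolding q U(4)[OF w(2)] by simp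
    finally show ?thesis by (simp add: power2_eq_square algebra_simps)
   qed
   show "2 * kap a b k * pu + ?y * su ~= 0 | 2 * kap a b k * pv + ?y * sv ~= 0"
   proof (rule ccontr)
    assume "\<not> ?thesis"
    then have "?y * su + 2 * kap a b k * pu = 0" "?y * sv + 2 * kap a b k * pv = 0" by (simp_all add: add.commute)
    from det2_solve(2)[OF det this] kap show False by simp
   qed
  qed (use kap c(2) m crit(2) in auto)
 qed
 then obtain r where "q = [:- s 0, 1:] * r" using poly_root_factor by blast
 then have "discP a b f g k = [:- s 0, 1:] ^ 3 * r" using q by (simp only: power3_eq_cube power2_eq_square mult.assoc)
 then show "[:- s 0, 1:] ^ 3 dvd discP a b f g k" by (rule dvdI)
qed

text \<open>At m = 0 the remaining partial derivatives of the surface equation are P for w1 and Q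
  for s. If one of them were nonzero, then, up to a unit, s - \<open>s 0\<close> or w1 would split
  off the section, against the irreducibility of the cusp.\<close>

lemma cusp_at_zero_of_m:
 assumes c: "holo2 c W" "c 0 ~= 0" and cusp: "!!u v. (u, v) \<in> W ==> sect (u, v) = c (u, v) * (u ^ 2 - v ^ 3)"
  and m: "mfun 0 = 0"
 shows "b * w2 0 - 2 * a * w1 0 = 0" "w2 0 * poly (pderiv (quadricP g)) (s 0) - poly (pderiv (quarticP f)) (s 0) = 0"
proof -
 define P where "P = b * w2 0 - 2 * a * w1 0"
 define Q where "Q = w2 0 * poly (pderiv (quadricP g)) (s 0) - poly (pderiv (quarticP f)) (s 0)"
 have d0: "cdiff2 (%z. c z * (fst z * fst z - snd z * (snd z * snd z))) 0 0 0"
 proof -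
  obtain cu cv where cc: "cdiff2 c 0 cu cv" using c(1) W(2) unfolding holo2_def by blast
  from cdiff2_mult[OF cc cdiff2_diff[OF cdiff2_mult[OF cdiff2_fst cdiff2_fst] cdiff2_mult[OF cdiff2_snd cdiff2_mult[OF cdiff2_snd cdiff2_snd]]]]
  show ?thesis by simp
 qed
 have z: "sect 0 = 0" using cusp[of 0 0] W(2) by (simp add: zero_prod_def)
 have dz: "cdiff2 sect 0 0 0"
  by (rule cdiff2_cong[OF d0 W]) (use cusp in \<open>auto simp: pow_simps3\<close>)
 have sds: "cdiff2 (%z. s z - s 0) 0 su sv" using cdiff2_diff[OF d(1) cdiff2_const[of "s 0"]] by simp
 have E1: "Q * su + P * pu = 0" "Q * sv + P * pv = 0" using dE m by (simp_all add: P_def Q_def)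
 have S1: "poly (pderiv (baseP k)) (s 0) * su + k $ 3 * pu + k $ 4 * qu = 0"
  "poly (pderiv (baseP k)) (s 0) * sv + k $ 3 * pv + k $ 4 * qv = 0"
  using cdiff2_unique[OF dz d_sect] by simp_all
 have E0: "a * w1 0 ^ 2 + poly (quarticP f) (s 0) = 0" using E[OF W(2)] m by (simp add: mfun_def)
 have P0: "P = 0"
 proof (rule ccontr)
  assume P: "P ~= 0"
  have pu: "pu = - (Q / P) * su" "pv = - (Q / P) * sv" using E1 P by (simp_all add: field_simps eq_neg_iff_add_eq_0)
  have det: "su * qv - sv * qu ~= 0"
  proof (rule det2_nonzero)
   fix x y assume xy: "x * su + y * sv = 0" "x * qu + y * qv = 0"
   have "x * pu + y * pv = - (Q / P) * (x * su + y * sv)" unfolding pu by (simp add: algebra_simps)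
   then show "x = 0 & y = 0" by (intro rank xy) (simp add: xy)
  qed
  have suv: "su ~= 0 | sv ~= 0" using det by auto
  have "(poly (pderiv (baseP k)) (s 0) - k $ 3 * (Q / P)) * su + k $ 4 * qu = 0"
   "(poly (pderiv (baseP k)) (s 0) - k $ 3 * (Q / P)) * sv + k $ 4 * qv = 0"
   using S1 unfolding pu by (simp_all add: algebra_simps)
  from det2_solve(2)[OF det this] have k4: "k $ 4 = 0" .
  have sect: "sect z = poly (baseP k) (s z) + k $ 3 * w1 z" for z by (simp add: sect_def k4)
  show False
  proof (cases "a = 0")
   case True
   then have ab: "b = 1" "g = (%_. 0)" using type by auto
   have g0: "quadricP g = 0" by (simp add: quadricP_def ab)
   have w: "w1 0 = 0" using m unfolding mfun_def by (simp add: ab quadricP_def)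
   have w20: "w2 0 ~= 0" using P by (simp add: P_def ab True)
   have "poly (quarticP f) (s 0) = 0" "poly (baseP k) (s 0) = 0" using E0 z w by (simp_all add: sect)
   \<comment> \<open>Multiplication by the unit w2 replaces w1 by f(s), which like the base
     polynomial is divisible by s - \<open>s 0\<close>.\<close>
   then obtain f1 A1 where fA: "quarticP f = [:- s 0, 1:] * f1" "baseP k = [:- s 0, 1:] * A1"
    using poly_root_factor by metis
   show False
   proof (rule cusp_not_product[OF W _ _ holo2_mult[OF c(1) holo(3)] _ _ _ sds suv])
    show "holo2 (%z. s z - s 0) W" "holo2 (%z. w2 z * poly A1 (s z) + k $ 3 * poly f1 (s z)) W"
     by (intro holo2_intros holo2_poly holo)+
    show "c (u, v) * w2 (u, v) * (u ^ 2 - v ^ 3) = (s (u, v) - s 0) * (w2 (u, v) * poly A1 (s (u, v)) + k $ 3 * poly f1 (s (u, v)))"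
     if uv: "(u, v) \<in> W" for u v
    proof -
     have "c (u, v) * w2 (u, v) * (u ^ 2 - v ^ 3) = w2 (u, v) * sect (u, v)" using cusp[OF uv] by (simp add: mult_ac)
     also have "\<dots> = w2 (u, v) * poly (baseP k) (s (u, v)) + k $ 3 * (w2 (u, v) * w1 (u, v))"
      unfolding sect by (simp add: algebra_simps)
     also have "w2 (u, v) * w1 (u, v) = poly (quarticP f) (s (u, v))" using E[OF uv] by (simp add: ab quadricP_def True)
     finally show ?thesis unfolding fA by (simp add: algebra_simps)
    qed
   qed (use c(2) w20 in auto)
  next
   case False
   then have ab: "a = 1" "b = 0" using type by auto
   have gs: "poly (quadricP g) (s 0) = 0" using m unfolding mfun_def by (simp add: ab)
   have w10: "w1 0 ~= 0" using P by (simp add: P_def ab)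
   have fs: "poly (quarticP f) (s 0) = - (w1 0 ^ 2)" using E0 by (simp add: ab eq_neg_iff_add_eq_0 add.commute)
   show False
   proof (cases "k $ 3 = 0")
    case True
    then have "poly (baseP k) (s 0) = 0" using z by (simp add: sect)
    then obtain A1 where A: "baseP k = [:- s 0, 1:] * A1" using poly_root_factor by blast
    show False
    proof (rule cusp_not_product[OF W _ _ c(1) _ _ _ sds suv])
     show "holo2 (%z. s z - s 0) W" "holo2 (%z. poly A1 (s z)) W"
      by (intro holo2_intros holo2_poly holo)+
     show "c (u, v) * (u ^ 2 - v ^ 3) = (s (u, v) - s 0) * poly A1 (s (u, v))" if "(u, v) \<in> W" for u v
      using cusp[OF that] True unfolding sect A by (simp add: algebra_simps)
    qed (use c(2) in auto)
   next
    case False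
    have F0: "poly (baseP k) (s 0) = - (k $ 3 * w1 0)" using z by (simp add: sect eq_neg_iff_add_eq_0)
    have "poly (baseP k ^ 2 + Polynomial.smult (k $ 3 ^ 2) (quarticP f)) (s 0) = 0"
     by (simp add: F0 fs power2_eq_square algebra_simps)
    then obtain h1 where h1: "baseP k ^ 2 + Polynomial.smult (k $ 3 ^ 2) (quarticP f) = [:- s 0, 1:] * h1" using poly_root_factor by blast
    obtain g1 where g1: "quadricP g = [:- s 0, 1:] * g1" using poly_root_factor gs by blast
    \<comment> \<open>The section is F(s) + k3 w1. Its conjugate F(s) - k3 w1 is a unit here, and
      their product F^2 + k3^2 f - k3^2 w2 g is divisible by s - \<open>s 0\<close>.\<close>
    let ?c = "%z. c z * (poly (baseP k) (s z) - k $ 3 * w1 z)"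
    show False
    proof (rule cusp_not_product[OF W, where c = ?c and \<sigma> = "%z. s z - s 0", OF _ _ _ _ _ _ sds suv])
     show "holo2 (%z. s z - s 0) W" "holo2 (%z. poly h1 (s z) - k $ 3 ^ 2 * poly g1 (s z) * w2 z) W" "holo2 ?c W"
      by (intro holo2_intros holo2_poly holo c)+
     show "?c (u, v) * (u ^ 2 - v ^ 3) = (s (u, v) - s 0) * (poly h1 (s (u, v)) - k $ 3 ^ 2 * poly g1 (s (u, v)) * w2 (u, v))"
      if uv: "(u, v) \<in> W" for u v
     proof -
      have w1: "w1 (u, v) ^ 2 = w2 (u, v) * poly (quadricP g) (s (u, v)) - poly (quarticP f) (s (u, v))"
       using E[OF uv] by (simp add: ab)
      have "?c (u, v) * (u ^ 2 - v ^ 3) = sect (u, v) * (poly (baseP k) (s (u, v)) - k $ 3 * w1 (u, v))"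
       using cusp[OF uv] by (simp add: mult_ac)
      also have "\<dots> = poly (baseP k) (s (u, v)) ^ 2 - k $ 3 ^ 2 * w1 (u, v) ^ 2"
       unfolding sect by (simp add: power2_eq_square algebra_simps)
      also have "\<dots> = poly (baseP k ^ 2 + Polynomial.smult (k $ 3 ^ 2) (quarticP f)) (s (u, v)) - k $ 3 ^ 2 * w2 (u, v) * poly (quadricP g) (s (u, v))"
       unfolding w1 by (simp add: algebra_simps)
      finally show ?thesis unfolding h1 g1 by (simp add: algebra_simps)
     qed
     show "?c 0 ~= 0" using c(2) False w10 by (simp add: F0)
    qed simp
   qed
  qed
 qed
 \<comment> \<open>Now w1 and w2 are coordinates and the section is a polynomial in s alone. Up to a
   unit, s - \<open>s 0\<close> equals w1 w2 (a = 0) or w1^2 (a = 1), so the factor w1 splits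
   off.\<close>
 have Q0: "Q = 0"
 proof (rule ccontr)
  assume Q: "Q ~= 0"
  then have s0: "su = 0" "sv = 0" using E1 P0 by auto
  have det: "pu * qv - pv * qu ~= 0" by (rule det2_nonzero) (rule rank, simp_all add: s0)
  have puv: "pu ~= 0 | pv ~= 0" using det by auto
  have "k $ 3 * pu + k $ 4 * qu = 0" "k $ 3 * pv + k $ 4 * qv = 0" using S1 s0 by simp_all
  from det2_solve[OF det this] have k: "k $ 3 = 0" "k $ 4 = 0" by auto
  have sect: "sect z = poly (baseP k) (s z)" for z by (simp add: sect_def k)
  obtain A1 where A: "baseP k = [:- s 0, 1:] * A1" using z poly_root_factor by (auto simp: sect)
  show False
  proof (cases "a = 0")
   case True
   then have ab: "b = 1" "g = (%_. 0)" using type by auto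
   have g0: "quadricP g = 0" by (simp add: quadricP_def ab)
   have w: "w1 0 = 0" using m unfolding mfun_def by (simp add: ab quadricP_def)
   obtain f1 where f1: "quarticP f = [:- s 0, 1:] * f1" using E0 w poly_root_factor[of "quarticP f" "s 0"] by auto
   have f10: "poly f1 (s 0) ~= 0"
    using Q unfolding Q_def g0 f1 by (auto simp: pderiv_mult pderiv_pCons pderiv_diff pderiv_smult)
   show False
   proof (rule cusp_not_product[OF W _ _ holo2_mult[OF c(1) holo2_poly[OF holo(1), of f1]] _ _ w d(2) puv])
    show "holo2 w1 W" "holo2 (%z. w2 z * poly A1 (s z)) W"
     by (intro holo2_intros holo2_poly holo)+
    show "c (u, v) * poly f1 (s (u, v)) * (u ^ 2 - v ^ 3) = w1 (u, v) * (w2 (u, v) * poly A1 (s (u, v)))"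
     if uv: "(u, v) \<in> W" for u v
    proof -
     have "c (u, v) * poly f1 (s (u, v)) * (u ^ 2 - v ^ 3) = sect (u, v) * poly f1 (s (u, v))" using cusp[OF uv] by (simp add: mult_ac)
     also have "\<dots> = poly (quarticP f) (s (u, v)) * poly A1 (s (u, v))" unfolding sect A f1 by (simp add: algebra_simps)
     also have "poly (quarticP f) (s (u, v)) = w2 (u, v) * w1 (u, v)" using E[OF uv] by (simp add: ab quadricP_def True)
     finally show ?thesis by (simp add: mult_ac)
    qed
   qed (use c(2) f10 in auto)
  next
   case False
   then have ab: "a = 1" "b = 0" using type by auto
   have w: "w1 0 = 0" using P0 by (simp add: P_def ab)
   have gs: "poly (quadricP g) (s 0) = 0" "poly (quarticP f) (s 0) = 0" using m E0 unfolding mfun_def by (simp_all add: ab w)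
   obtain f1 g1 where fg: "quarticP f = [:- s 0, 1:] * f1" "quadricP g = [:- s 0, 1:] * g1" using poly_root_factor gs by metis
   let ?\<mu> = "%z. w2 z * poly g1 (s z) - poly f1 (s z)"
   have \<mu>0: "?\<mu> 0 ~= 0" using Q unfolding Q_def fg by (auto simp: pderiv_mult pderiv_pCons pderiv_diff pderiv_smult)
   have h\<mu>: "holo2 ?\<mu> W" by (intro holo2_intros holo2_poly holo)
   show False
   proof (rule cusp_not_product[OF W _ _ holo2_mult[OF c(1) h\<mu>] _ _ w d(2) puv])
    show "holo2 w1 W" "holo2 (%z. w1 z * poly A1 (s z)) W"
     by (intro holo2_intros holo2_poly holo)+
    show "c (u, v) * ?\<mu> (u, v) * (u ^ 2 - v ^ 3) = w1 (u, v) * (w1 (u, v) * poly A1 (s (u, v)))"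
     if uv: "(u, v) \<in> W" for u v
    proof -
     have "c (u, v) * ?\<mu> (u, v) * (u ^ 2 - v ^ 3) = sect (u, v) * ?\<mu> (u, v)" using cusp[OF uv] by (simp add: mult_ac)
     also have "\<dots> = (w2 (u, v) * poly (quadricP g) (s (u, v)) - poly (quarticP f) (s (u, v))) * poly A1 (s (u, v))"
      unfolding sect A fg by (simp add: algebra_simps)
     also have "w2 (u, v) * poly (quadricP g) (s (u, v)) - poly (quarticP f) (s (u, v)) = w1 (u, v) ^ 2"
      using E[OF uv] by (simp add: ab)
     finally show ?thesis by (simp add: power2_eq_square mult_ac)
    qed
   qed (use c(2) \<mu>0 in auto)
  qed
 qed
 show "b * w2 0 - 2 * a * w1 0 = 0" "w2 0 * poly (pderiv (quadricP g)) (s 0) - poly (pderiv (quarticP f)) (s 0) = 0"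
  using P0 Q0 by (simp_all add: P_def Q_def)
qed

text \<open>Completing the square gives X^2 - (s - \<open>s 0\<close>)^3 q, whose quadratic part is
  a square, unlike that of a node.\<close>

lemma triple_root_not_node:
 assumes c: "holo2 c W" "c 0 ~= 0" and node: "!!u v. (u, v) \<in> W ==> sect (u, v) = c (u, v) * (u * v)"
  and m: "mfun 0 ~= 0" and k: "kap a b k ~= 0" "2 * kap a b k * w1 0 + poly (polB b g k) (s 0) = 0"
  and triple: "[:- s 0, 1:] ^ 3 dvd discP a b f g k"
 shows False
proof -
 obtain q where q: "discP a b f g k = [:- s 0, 1:] ^ 3 * q" using triple by (auto simp: dvd_def)
 let ?X = "%z. 2 * kap a b k * w1 z + poly (polB b g k) (s z)"
 note dX = cdiff2_add[OF cdiff2_mult[OF cdiff2_const[of "2 * kap a b k"] d(2)] cdiff2_poly[OF d(1), of "polB b g k"]]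
 note dY = cdiff2_diff[OF d(1) cdiff2_const[of "s 0"]]
 have hc: "holo2 (%z. 4 * kap a b k * (c z * mfun z)) W" by (intro holo2_intros c holo_mfun)
 have he: "holo2 (%z. poly q (s z)) W" by (intro holo2_poly holo)
 have cont: "isCont F 0" if "holo2 F W" for F
  using that W(2) cdiff2_continuous unfolding holo2_def by blast
 show False
 proof (rule node_not_cusp[OF W dX dY cont[OF hc] cont[OF he]])
  show "4 * kap a b k * (c (u, v) * mfun (u, v)) * (u * v) = ?X (u, v) ^ 2 - (s (u, v) - s 0) ^ 3 * poly q (s (u, v))"
   if uv: "(u, v) \<in> W" for u v
  proof -
   have "4 * kap a b k * (c (u, v) * mfun (u, v)) * (u * v) = 4 * kap a b k * (sect (u, v) * mfun (u, v))"
    unfolding node[OF uv] by (simp add: mult_ac)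
   also have "\<dots> = ?X (u, v) ^ 2 - poly (discP a b f g k) (s (u, v))"
    unfolding sect_mfun[OF uv] by (rule complete_square)
   finally show ?thesis unfolding q by simp
  qed
 qed (use c(2) m k in auto)
qed

end

section \<open>Tangent spaces\<close>

text \<open>D is the formal gradient. One D serves all curves through a point, and its polynomial
  dependence on the point later extends an identity to the zero representative.\<close>

lemma poly_fun_gradient:
 fixes f :: "complex ^ 'n::finite => complex"
 assumes "f \<in> poly_fun coords"
 shows "EX D. (ALL v. (%x. D x v) \<in> poly_fun coords) &
  (ALL \<theta> v. (ALL i. ((%t. \<theta> t $ i) has_field_derivative v $ i) (at 0)) -->
   ((%t. f (\<theta> t)) has_field_derivative D (\<theta> 0) v) (at 0))"
 using assms
proof induction
 case (const c)
 show ?case by (intro exI[of _ "%_ _. 0"]) (auto intro: poly_fun.const)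
next
 case (coord f)
 then obtain i where "f = (%x. x $ i)" by auto
 then show ?case by (intro exI[of _ "%_ v. v $ i"]) (auto intro: poly_fun.const)
next
 case (add f g)
 from add.IH obtain D E where D: "ALL v. (%x. D x v) \<in> poly_fun coords"
  "ALL \<theta> v. (ALL i. ((%t. \<theta> t $ i) has_field_derivative v $ i) (at 0)) --> ((%t. f (\<theta> t)) has_field_derivative D (\<theta> 0) v) (at 0)"
  and E: "ALL v. (%x. E x v) \<in> poly_fun coords"
  "ALL \<theta> v. (ALL i. ((%t. \<theta> t $ i) has_field_derivative v $ i) (at 0)) --> ((%t. g (\<theta> t)) has_field_derivative E (\<theta> 0) v) (at 0)"
  by blast
 show ?case
 proof (intro exI[of _ "%x v. D x v + E x v"] conjI allI impI)
  show "(%x. D x v + E x v) \<in> poly_fun coords" for v using D(1) E(1) by (intro poly_fun.add) auto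
  fix \<theta> :: "complex => complex ^ 'n" and v assume "ALL i. ((%t. \<theta> t $ i) has_field_derivative v $ i) (at 0)"
  then show "((%t. f (\<theta> t) + g (\<theta> t)) has_field_derivative D (\<theta> 0) v + E (\<theta> 0) v) (at 0)"
   using D(2) E(2) by (intro DERIV_add) auto
 qed
next
 case (mult f g)
 from mult.IH obtain D E where D: "ALL v. (%x. D x v) \<in> poly_fun coords"
  "ALL \<theta> v. (ALL i. ((%t. \<theta> t $ i) has_field_derivative v $ i) (at 0)) --> ((%t. f (\<theta> t)) has_field_derivative D (\<theta> 0) v) (at 0)"
  and E: "ALL v. (%x. E x v) \<in> poly_fun coords"
  "ALL \<theta> v. (ALL i. ((%t. \<theta> t $ i) has_field_derivative v $ i) (at 0)) --> ((%t. g (\<theta> t)) has_field_derivative E (\<theta> 0) v) (at 0)"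
  by blast
 show ?case
 proof (intro exI[of _ "%x v. D x v * g x + E x v * f x"] conjI allI impI)
  show "(%x. D x v * g x + E x v * f x) \<in> poly_fun coords" for v
   using D(1) E(1) mult.hyps by (intro poly_fun.add poly_fun.mult) auto
  fix \<theta> :: "complex => complex ^ 'n" and v assume "ALL i. ((%t. \<theta> t $ i) has_field_derivative v $ i) (at 0)"
  then show "((%t. f (\<theta> t) * g (\<theta> t)) has_field_derivative D (\<theta> 0) v * g (\<theta> 0) + E (\<theta> 0) v * f (\<theta> 0)) (at 0)"
   using D(2) E(2) by (intro DERIV_mult) auto
 qed
qed

lemma tangent_coneI:
 fixes \<theta> :: "complex => complex ^ 'n::finite"
 assumes x: "x ~= 0" and \<theta>: "ALL i. ((%t. \<theta> t $ i) has_field_derivative v $ i) (at 0)" "\<theta> 0 = x"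
  and X: "\<forall>\<^sub>F t in nhds 0. \<theta> t \<in> acone X"
 shows "v \<in> tangent_cone X (pt x)"
 unfolding tangent_cone_def
proof (intro CollectI allI ballI impI)
 fix d f y assume f: "f \<in> hpoly d" and van: "ALL q:X. ALL y:line_of q. f y = 0" and "y \<in> line_of (pt x)"
 then obtain c where y: "y = c *s x" using line_of_pt[OF x] by auto
 obtain D where D: "ALL v. (%x. D x v) \<in> poly_fun coords"
  "ALL \<theta> v. (ALL i. ((%t. \<theta> t $ i) has_field_derivative v $ i) (at 0)) --> ((%t. f (\<theta> t)) has_field_derivative D (\<theta> 0) v) (at 0)"
  using poly_fun_gradient[OF hpoly_poly_fun[OF f]] by blast
 have line: "((%t. f (y + t *s v)) has_field_derivative D y v) (at 0)" for y
 proof -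
  have "ALL i. ((%t. (y + t *s v) $ i) has_field_derivative v $ i) (at 0)"
   by (auto intro!: derivative_eq_intros)
  from D(2)[rule_format, of "%t. y + t *s v" v] this show ?thesis by auto
 qed
 have "\<forall>\<^sub>F t in nhds 0. f (\<theta> t) = 0"
  using X
 proof eventually_elim
  case (elim t)
  then have "\<theta> t ~= 0" "pt (\<theta> t) \<in> X" by (auto simp: acone_def)
  moreover have "\<theta> t \<in> line_of (pt (\<theta> t))" using line_of_pt[of "\<theta> t"] \<open>\<theta> t ~= 0\<close> by (auto intro: range_eqI[of _ _ 1])
  ultimately show ?case using van by blast
 qed
 then have "((%t. f (\<theta> t)) has_field_derivative 0) (at 0)"
  using DERIV_cong_ev[OF refl, of "%t. f (\<theta> t)" "%_. 0" 0 0] by (auto intro: DERIV_const)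
 moreover have "((%t. f (\<theta> t)) has_field_derivative D (\<theta> 0) v) (at 0)" using D(2) \<theta>(1) by blast
 ultimately have D0: "D x v = 0" using DERIV_unique \<theta>(2) by metis
 have nz: "D (c *s x) v = 0" if "c ~= 0" for c
 proof -
  have "((%t. f (x + t *s v)) has_field_derivative 0) (at (0 / c))" using line[of x] D0 by simp
  moreover have "((%t. t / c) has_field_derivative 1 / c) (at 0)" by (rule DERIV_cdivide) (rule DERIV_ident)
  ultimately have "((%t. f (x + (t / c) *s v)) has_field_derivative 0 * (1 / c)) (at 0)"
   by (rule DERIV_chain2)
  then have "((%t. f (x + (t / c) *s v)) has_field_derivative 0) (at 0)" by simp
  then have "((%t. c ^ d * f (x + (t / c) *s v)) has_field_derivative c ^ d * 0) (at 0)"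
   by (rule DERIV_cmult)
  moreover have "c ^ d * f (x + (t / c) *s v) = f (c *s x + t *s v)" for t
   using hpolyD[OF f, of c "x + (t / c) *s v"] that by (simp add: vector_add_ldistrib)
  ultimately have "((%t. f (c *s x + t *s v)) has_field_derivative 0) (at 0)" by simp
  then show ?thesis using line DERIV_unique by blast
 qed
 \<comment> \<open>\<open>tangent_cone\<close> tests every element of the line, including 0. Nonzero
   multiples are settled by homogeneity; being polynomial in c, the derivative then vanishes at c =
   0 as well.\<close>
 have "EX p. ALL c. D (c *s x) v = poly p c"
 proof (rule poly_fun_param[OF D(1)[rule_format, of v]])
  fix c :: "complex ^ 'n => complex" assume "c \<in> coords"
  then obtain i where "c = (%x. x $ i)" by auto
  then show "EX p. ALL t. c (t *s x) = poly p t" by (intro exI[of _ "[:0, x $ i:]"]) simp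
 qed
 then obtain p where p: "!!c. D (c *s x) v = poly p c" by blast
 have "p = 0"
 proof (rule ccontr)
  assume "p ~= 0"
  then have "finite {c. poly p c = 0}" by (rule poly_roots_finite)
  moreover have "- {0} \<subseteq> {c. poly p c = 0}" using nz p by auto
  ultimately have "finite (- {0 :: complex})" using finite_subset by blast
  then show False by (simp add: infinite_UNIV_char_0)
 qed
 then have "D y v = 0" using p y by simp
 then show "deriv (%t. f (y + t *s v)) 0 = 0" using line[of y] by (simp add: DERIV_imp_deriv)
qed

lemma tangent_coneD:
 assumes v: "v \<in> tangent_cone X (pt x)" and x: "x ~= 0" and f: "f \<in> hpoly d" "0 < d" "!!y. y \<in> acone X ==> f y = 0"
  and L: "((%t. f (x + t *s v)) has_field_derivative L) (at 0)"
 shows "L = 0"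
proof -
 have "f y = 0" if q: "q \<in> X" "y \<in> line_of q" for q y
 proof (cases "y = 0")
  case True
  then show ?thesis using hpoly_at_0[OF f(1,2)] by simp
 next
  case False
  obtain z where z: "z ~= 0" "q = pt z" using pt_exhaust[of q] by metis
  then obtain c where "y = c *s z" using q(2) line_of_pt[OF z(1)] by auto
  moreover have "c ~= 0" using False calculation by auto
  ultimately have "pt y = q" using pt_scale[OF z(1), of c] z(2) by simp
  then show ?thesis using False q(1) f(3) by (simp add: acone_def)
 qed
 then have "ALL q:X. ALL y:line_of q. f y = 0" by blast
 moreover have "x \<in> line_of (pt x)" using line_of_pt[OF x] by (auto intro: range_eqI[of _ _ 1])
 ultimately have "deriv (%t. f (x + t *s v)) 0 = 0" using v f(1) unfolding tangent_cone_def by blast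
 then show ?thesis using DERIV_imp_deriv[OF L] by simp
qed

lemma line_of_eq_pt: "h \<in> line_of H ==> h ~= 0 ==> H = pt h"
proof -
 assume h: "h \<in> line_of H" "h ~= 0"
 obtain z where z: "z ~= 0" "H = pt z" using pt_exhaust[of H] by metis
 then obtain c where "h = c *s z" using h(1) line_of_pt[OF z(1)] by auto
 moreover have "c ~= 0" using h(2) calculation by auto
 ultimately show ?thesis using pt_scale[OF z(1), of c] z(2) by simp
qed

lemma has_dim_unique:
 assumes "has_dim T X d" "has_dim T X e"
 shows "d = e"
proof -
 have down: "irred_chain T X m" if "irred_chain T X n" "m \<le> n" for m n
  using that unfolding irred_chain_def by (meson le_trans less_le_trans)
 show ?thesis
 proof (rule ccontr)
  assume "d ~= e"
  then consider "Suc d \<le> e" | "Suc e \<le> d" by linarith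
  then show False using assms down unfolding has_dim_def by cases blast+
 qed
qed

lemma poly_quarticP: "poly (quarticP f) s = f 0 * s ^ 4 + f 1 * s ^ 3 + f 2 * s ^ 2 + f 3 * s + f 4"
 by (simp add: quarticP_def alg_simps4)

lemma poly_pderiv_quarticP: "poly (pderiv (quarticP f)) s = 4 * f 0 * s ^ 3 + 3 * f 1 * s ^ 2 + 2 * f 2 * s + f 3"
 by (simp add: quarticP_def pderiv_pCons alg_simps3)

lemma poly_quadricP: "poly (quadricP g) s = g 0 * s ^ 2 + g 1 * s + g 2"
 by (simp add: quadricP_def alg_simps2)

lemma poly_pderiv_quadricP: "poly (pderiv (quadricP g)) s = 2 * g 0 * s + g 1"
 by (simp add: quadricP_def pderiv_pCons algebra_simps)

lemma poly_baseP: "poly (baseP k) s = k $ 0 * s ^ 2 + k $ 1 * s + k $ 2"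
 by (simp add: baseP_def alg_simps2)

lemma eventually_nonzero:
 fixes F :: "complex => complex"
 assumes "isCont F 0" "F 0 ~= 0"
 shows "\<forall>\<^sub>F t in nhds 0. F t ~= 0"
proof -
 have "(F \<longlongrightarrow> F 0) (nhds 0)"
  using assms(1) unfolding isCont_def by (rule tendsto_at_iff_tendsto_nhds[THEN iffD1])
 then have "\<forall>\<^sub>F t in nhds 0. F t \<in> - {0}" by (rule topological_tendstoD) (use assms(2) in auto)
 then show ?thesis by simp
qed

text \<open>Here g is g0 times the square of the linear polynomial with root s, and f has a double
  zero at s, so g divides f; p, q, r are the coefficients of the quotient.\<close>

lemma double_root_quotient:
 fixes f0 f1 f2 f3 f4 g0 g1 g2 s :: complex
 assumes G: "g0 * s ^ 2 + g1 * s + g2 = 0" "2 * g0 * s + g1 = 0"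
  and F: "f0 * s ^ 4 + f1 * s ^ 3 + f2 * s ^ 2 + f3 * s + f4 = 0" "4 * f0 * s ^ 3 + 3 * f1 * s ^ 2 + 2 * f2 * s + f3 = 0"
  and g0: "g0 ~= 0"
 shows "EX p q r. f0 = g0 * p & f1 = g0 * q + g1 * p & f2 = g0 * r + g1 * q + g2 * p & f3 = g1 * r + g2 * q & f4 = g2 * r"
proof -
 have G1: "g1 = - (2 * g0 * s)" using G(2) by (simp add: eq_neg_iff_add_eq_0 add.commute)
 have G2: "g2 = g0 * s ^ 2" using G(1) by (simp add: G1 alg_simps2)
 have F3: "f3 = - (4 * f0 * s ^ 3 + 3 * f1 * s ^ 2 + 2 * f2 * s)" by (rule F(2)[unfolded add_eq_0_iff])
 have F4: "f4 = 3 * f0 * s ^ 4 + 2 * f1 * s ^ 3 + f2 * s ^ 2"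
  using F(1) by (simp add: F3 alg_simps4 add_eq_0_iff)
 show ?thesis
  by (rule exI[of _ "f0 / g0"], rule exI[of _ "(f1 + 2 * s * f0) / g0"], rule exI[of _ "(f2 + 2 * s * f1 + 3 * s ^ 2 * f0) / g0"])
   (use g0 in \<open>simp add: G1 G2 F3 F4 fld_simps4\<close>)
qed

lemma poly_shift_DERIV: "((%t. poly h (s + t)) has_field_derivative poly (pderiv h) s) (at 0)"
proof -
 have "((%t. s + t) has_field_derivative 1) (at 0)" by (auto intro!: derivative_eq_intros)
 moreover have "(poly h has_field_derivative poly (pderiv h) s) (at (s + 0))" using poly_DERIV[of h s] by simp
 ultimately have "((%t. poly h (s + t)) has_field_derivative poly (pderiv h) s * 1) (at 0)"
  by (intro DERIV_chain2)
 then show ?thesis by simp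
qed

section \<open>The affine chart y2 = 1 and the tangent spaces of the surface\<close>

definition aff :: "complex => complex => complex => complex ^ 5" where
 "aff s w v = vec5 (s ^ 2) s 1 w v"

lemma aff_nth [simp]: "aff s w v $ 0 = s ^ 2" "aff s w v $ 1 = s" "aff s w v $ 2 = 1" "aff s w v $ 3 = w" "aff s w v $ 4 = v"
 by (simp_all add: aff_def)

lemma aff_nonzero [simp]: "aff s w v ~= 0"
 by (simp add: vec5_eq_iff)

lemma conic_aff [simp]: "conic_form (aff s w v) = 0"
 by (simp add: conic_form_def)

lemma bundle_aff: "bundle_form a b f g (aff s w v) = v * (b * w + poly (quadricP g) s) - a * w ^ 2 - poly (quarticP f) s"
 by (simp add: bundle_form_def poly_quadricP poly_quarticP alg_simps4)

lemma conic_aff_exhaust: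
 assumes "conic_form z = 0" "z $ 2 ~= 0"
 shows "z = z $ 2 *s aff (z $ 1 / z $ 2) (z $ 3 / z $ 2) (z $ 4 / z $ 2)"
 using assms by (simp add: vec5_eq_iff conic_form_def field_simps power2_eq_square)

lemma conic_form_smult: "conic_form (c *s z) = c ^ 2 * conic_form z"
 by (simp add: conic_form_def alg_simps2)

lemma bundle_form_smult: "bundle_form a b f g (c *s z) = c ^ 2 * bundle_form a b f g z"
 by (simp add: bundle_form_def alg_simps2)

lemma hpoly_conic: "conic_form \<in> hpoly 2"
 unfolding hpoly_def using conic_form_smult
 by (auto intro!: poly_fun_intros simp: conic_form_def[abs_def])

lemma hpoly_bundle: "bundle_form a b f g \<in> hpoly 2"
 unfolding hpoly_def using bundle_form_smult
 by (auto intro!: poly_fun_intros simp: bundle_form_def[abs_def])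

context segre_form
begin

definition N :: "complex ^ 5 ^ 5" where
 "N = (SOME N. M ** N = Finite_Cartesian_Product.mat 1 & N ** M = Finite_Cartesian_Product.mat 1)"

lemma N: "M ** N = Finite_Cartesian_Product.mat 1" "N ** M = Finite_Cartesian_Product.mat 1"
proof -
 obtain N' where "M ** N' = Finite_Cartesian_Product.mat 1" "N' ** M = Finite_Cartesian_Product.mat 1"
  using injective_matrix_inverse[OF M_inj] by blast
 then have "EX N. M ** N = Finite_Cartesian_Product.mat 1 & N ** M = Finite_Cartesian_Product.mat 1" by blast
 from someI_ex[OF this] show "M ** N = Finite_Cartesian_Product.mat 1" "N ** M = Finite_Cartesian_Product.mat 1"
  unfolding N_def by blast+
qed

lemma MN [simp]: "M *v (N *v x) = x" and NM [simp]: "N *v (M *v x) = x"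
 using N by (simp_all add: matrix_vector_mul_assoc)

lemma M_nonzero [simp]: "M *v z = 0 \<longleftrightarrow> z = 0"
 using M_inj by auto

text \<open>Dual coordinates transform contragrediently: for x = M z, the form h has the
  coefficients K h in z, and L is the inverse of K.\<close>

definition K :: "complex ^ 5 => complex ^ 5" where
 "K h = transpose M *v h"

definition L :: "complex ^ 5 => complex ^ 5" where
 "L k = transpose N *v k"

lemma dpair_M: "dpair h (M *v z) = dpair (K h) z"
 by (simp add: K_def dpair_matrix_transpose)

lemma KL [simp]: "K (L k) = k" and LK [simp]: "L (K k) = k"
proof -
 have "transpose M ** transpose N = Finite_Cartesian_Product.mat 1" "transpose N ** transpose M = Finite_Cartesian_Product.mat 1"
  using N by (metis matrix_transpose_mul transpose_mat)+
 then show "K (L k) = k" "L (K k) = k" unfolding K_def L_def by (simp_all only: matrix_vector_mul_assoc matrix_vector_mul_lid)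
qed

lemma L_smult: "L (c *s k) = c *s L k" and K_smult: "K (c *s k) = c *s K k"
 by (simp_all add: L_def K_def vector_scalar_commute)

lemma K_nonzero [simp]: "K h = 0 \<longleftrightarrow> h = 0" and L_nonzero [simp]: "L k = 0 \<longleftrightarrow> k = 0"
 using LK[of h] KL[of k] by (auto simp: K_def L_def)

lemma acone_S: "x \<in> acone S \<longleftrightarrow> x ~= 0 & conic_form (N *v x) = 0 & bundle_form a b f g (N *v x) = 0"
proof (cases "x = 0")
 case False
 then have "N *v x ~= 0" using MN by (metis matrix_vector_mult_0_right)
 from mem[OF this] show ?thesis using False by (simp add: acone_def)
qed (simp add: acone_def)

definition on_S :: "complex => complex => complex => bool" where
 "on_S s w v \<longleftrightarrow> v * (b * w + poly (quadricP g) s) = a * w ^ 2 + poly (quarticP f) s"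

lemma aff_in_S: "pt (M *v aff s w v) \<in> S \<longleftrightarrow> on_S s w v"
 using mem[of "aff s w v"] by (simp add: on_S_def bundle_aff diff_diff_eq)

lemma affine_point:
 assumes "pt (M *v z) \<in> S" "z $ 2 ~= 0"
 shows "z = z $ 2 *s aff (z $ 1 / z $ 2) (z $ 3 / z $ 2) (z $ 4 / z $ 2)"
  "on_S (z $ 1 / z $ 2) (z $ 3 / z $ 2) (z $ 4 / z $ 2)"
  "pt (M *v z) = pt (M *v aff (z $ 1 / z $ 2) (z $ 3 / z $ 2) (z $ 4 / z $ 2))"
proof -
 have z: "z ~= 0" using assms(2) by auto
 show 1: "z = z $ 2 *s aff (z $ 1 / z $ 2) (z $ 3 / z $ 2) (z $ 4 / z $ 2)"
  using mem[OF z] assms by (intro conic_aff_exhaust) auto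
 let ?y = "aff (z $ 1 / z $ 2) (z $ 3 / z $ 2) (z $ 4 / z $ 2)"
 have "M *v z = z $ 2 *s (M *v ?y)" by (subst 1) (rule vector_scalar_commute)
 then show 2: "pt (M *v z) = pt (M *v ?y)" using pt_scale[of "M *v ?y" "z $ 2"] assms(2) by simp
 then show "on_S (z $ 1 / z $ 2) (z $ 3 / z $ 2) (z $ 4 / z $ 2)" using assms(1) aff_in_S by simp
qed

lemma tangent_curve:
 fixes \<theta> :: "complex => complex ^ 5"
 assumes z: "z ~= 0" and \<theta>: "ALL i. ((%t. \<theta> t $ i) has_field_derivative w $ i) (at 0)" "\<theta> 0 = z"
  and S: "\<forall>\<^sub>F t in nhds 0. conic_form (\<theta> t) = 0 & bundle_form a b f g (\<theta> t) = 0"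
 shows "M *v w \<in> tangent_cone S (pt (M *v z))"
proof (rule tangent_coneI[of _ "%t. M *v \<theta> t"])
 show "M *v z ~= 0" using z by simp
 show "ALL i. ((%t. (M *v \<theta> t) $ i) has_field_derivative (M *v w) $ i) (at 0)"
  unfolding matrix_vector_mult_def using \<theta>(1) by (auto intro!: derivative_eq_intros simp: mult.commute)
 show "M *v \<theta> 0 = M *v z" by (simp add: \<theta>)
 obtain i where i: "z $ i ~= 0" using vec_nonzero[OF z] by blast
 have "isCont (%t. \<theta> t $ i) 0" using \<theta>(1) DERIV_isCont by blast
 then have "\<forall>\<^sub>F t in nhds 0. \<theta> t $ i ~= 0" by (rule eventually_nonzero) (simp add: i \<theta>(2))
 with S show "\<forall>\<^sub>F t in nhds 0. M *v \<theta> t \<in> acone S"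
 proof eventually_elim
  case (elim t)
  then have "\<theta> t ~= 0" by auto
  then show ?case using elim by (simp add: acone_S)
 qed
qed

lemma tangent_base: "pt (M *v z) \<in> S ==> z ~= 0 ==> M *v z \<in> tangent_cone S (pt (M *v z))"
proof (rule tangent_curve[of _ "%t. (1 + t) *s z"])
 assume z: "z ~= 0" "pt (M *v z) \<in> S"
 then show "\<forall>\<^sub>F t in nhds 0. conic_form ((1 + t) *s z) = 0 & bundle_form a b f g ((1 + t) *s z) = 0"
  using mem[OF z(1)] z(2) by (simp only: conic_form_smult bundle_form_smult) simp
qed (auto intro!: derivative_eq_intros)

text \<open>At m = 0 the coordinate v drops out of the surface equation, so a whole line in its
  direction lies on S.\<close>

lemma tangent_vertical:
 assumes "on_S s w v" "b * w + poly (quadricP g) s = 0"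
 shows "M *v vec5 0 0 0 0 c \<in> tangent_cone S (pt (M *v aff s w v))"
proof (rule tangent_curve[of _ "%t. aff s w (v + t * c)"])
 show "\<forall>\<^sub>F t in nhds 0. conic_form (aff s w (v + t * c)) = 0 & bundle_form a b f g (aff s w (v + t * c)) = 0"
  using assms by (simp add: bundle_aff on_S_def neg_eq_iff_add_eq_0)
qed (auto simp: forall_5 intro!: derivative_eq_intros)

text \<open>A curve \<open>w = w(t)\<close>, \<open>s = s(t)\<close> lifts to the surface where \<open>m \<noteq> 0\<close>.\<close>

lemma tangent_lift:
 assumes on: "on_S s w v" and m: "m = b * w + poly (quadricP g) s" "m ~= 0"
 shows "M *v vec5 (2 * s * (x * m)) (x * m) 0 (y * m)
  (y * (2 * a * w - b * v) + x * (poly (pderiv (quarticP f)) s - v * poly (pderiv (quadricP g)) s)) \<in> tangent_cone S (pt (M *v aff s w v))"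
proof -
 define S1 where "S1 t = s + t * (x * m)" for t
 define W1 where "W1 t = w + t * (y * m)" for t
 define m1 where "m1 t = b * W1 t + poly (quadricP g) (S1 t)" for t
 define n1 where "n1 t = a * (W1 t * W1 t) + poly (quarticP f) (S1 t)" for t
 have dS: "(S1 has_field_derivative x * m) (at 0)" and dW: "(W1 has_field_derivative y * m) (at 0)"
  unfolding S1_def W1_def by (auto intro!: derivative_eq_intros)
 have 0: "S1 0 = s" "W1 0 = w" "m1 0 = m" by (simp_all add: S1_def W1_def m1_def m)
 have n0: "n1 0 = v * m" using on by (simp add: n1_def 0 on_S_def m power2_eq_square)
 have dm: "(m1 has_field_derivative b * (y * m) + poly (pderiv (quadricP g)) s * (x * m)) (at 0)"
  unfolding m1_def[abs_def] using DERIV_add[OF DERIV_cmult[OF dW, of b] DERIV_chain2[OF poly_DERIV dS]] by (simp add: 0)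
 have dn: "(n1 has_field_derivative a * (y * m * w + y * m * w) + poly (pderiv (quarticP f)) s * (x * m)) (at 0)"
  unfolding n1_def[abs_def] using DERIV_add[OF DERIV_cmult[OF DERIV_mult[OF dW dW], of a] DERIV_chain2[OF poly_DERIV dS]] by (simp add: 0)
 have dq: "((%t. n1 t / m1 t) has_field_derivative
  (y * (2 * a * w - b * v) + x * (poly (pderiv (quarticP f)) s - v * poly (pderiv (quadricP g)) s))) (at 0)"
  by (rule DERIV_cong[OF DERIV_divide[OF dn dm]]) (use m(2) in \<open>simp_all add: 0 n0 field_simps power2_eq_square\<close>)
 have dsq: "((%t. S1 t ^ 2) has_field_derivative 2 * s * (x * m)) (at 0)"
  using DERIV_mult[OF dS dS] by (simp add: power2_eq_square 0 mult_ac)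
 have "isCont m1 0" using dm DERIV_isCont by blast
 then have "\<forall>\<^sub>F t in nhds 0. m1 t ~= 0" by (rule eventually_nonzero) (simp add: 0 m(2))
 then have ev: "\<forall>\<^sub>F t in nhds 0. conic_form (aff (S1 t) (W1 t) (n1 t / m1 t)) = 0 & bundle_form a b f g (aff (S1 t) (W1 t) (n1 t / m1 t)) = 0"
 proof eventually_elim
  case (elim t)
  then have "n1 t / m1 t * (b * W1 t + poly (quadricP g) (S1 t)) = n1 t" by (simp add: m1_def)
  then show ?case unfolding bundle_aff by (simp add: n1_def power2_eq_square)
 qed
 show ?thesis
  by (rule tangent_curve[OF _ _ _ ev]) (use dS dW dq dsq m(2) in \<open>simp_all add: forall_5 0 n0 [abs_def]\<close>)
qed

text \<open>The two expressions are the polar forms of the two quadrics through S.\<close>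

lemma tangent_polar:
 assumes v: "v \<in> tangent_cone S (pt (M *v z))" and z: "z ~= 0" and w: "w = N *v v"
 shows "z $ 0 * w $ 2 + z $ 2 * w $ 0 - 2 * z $ 1 * w $ 1 = 0"
  "w $ 4 * (b * z $ 3 + g 0 * z $ 0 + g 1 * z $ 1 + g 2 * z $ 2) + z $ 4 * (b * w $ 3 + g 0 * w $ 0 + g 1 * w $ 1 + g 2 * w $ 2)
   - 2 * a * z $ 3 * w $ 3 - (2 * f 0 * z $ 0 * w $ 0 + f 1 * (z $ 0 * w $ 1 + z $ 1 * w $ 0) + 2 * f 2 * z $ 1 * w $ 1
   + f 3 * (z $ 1 * w $ 2 + z $ 2 * w $ 1) + 2 * f 4 * z $ 2 * w $ 2) = 0"
proof -
 have x: "M *v z ~= 0" using z by simp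
 have Nl: "N *v (M *v z + t *s v) = z + t *s w" for t
  by (simp add: w matrix_linear)
 have "(%x. conic_form (N *v x)) \<in> hpoly (2 * 1)" "(%x. bundle_form a b f g (N *v x)) \<in> hpoly (2 * 1)"
  by (rule hpoly_compose[OF hpoly_conic hpoly_matrix] hpoly_compose[OF hpoly_bundle hpoly_matrix])+
 note H = this[simplified]
 have "((%t. conic_form (z + t *s w)) has_field_derivative z $ 0 * w $ 2 + z $ 2 * w $ 0 - 2 * z $ 1 * w $ 1) (at 0)"
  unfolding conic_form_def by (auto intro!: derivative_eq_intros simp: algebra_simps)
 from tangent_coneD[OF v x H(1) _ _, of "z $ 0 * w $ 2 + z $ 2 * w $ 0 - 2 * z $ 1 * w $ 1"] this
 show "z $ 0 * w $ 2 + z $ 2 * w $ 0 - 2 * z $ 1 * w $ 1 = 0" by (simp add: Nl acone_S)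
 let ?L = "w $ 4 * (b * z $ 3 + g 0 * z $ 0 + g 1 * z $ 1 + g 2 * z $ 2) + z $ 4 * (b * w $ 3 + g 0 * w $ 0 + g 1 * w $ 1 + g 2 * w $ 2)
   - 2 * a * z $ 3 * w $ 3 - (2 * f 0 * z $ 0 * w $ 0 + f 1 * (z $ 0 * w $ 1 + z $ 1 * w $ 0) + 2 * f 2 * z $ 1 * w $ 1
   + f 3 * (z $ 1 * w $ 2 + z $ 2 * w $ 1) + 2 * f 4 * z $ 2 * w $ 2)"
 have "((%t. bundle_form a b f g (z + t *s w)) has_field_derivative ?L) (at 0)"
  unfolding bundle_form_def by (auto intro!: derivative_eq_intros simp: algebra_simps)
 from tangent_coneD[OF v x H(2) _ _, of ?L] this show "?L = 0" by (simp add: Nl acone_S)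
qed

end

locale segre_surface_form = segre_form +
 assumes irr: "irreducible_variety S 2"
begin

lemma dim_S: "has_dim zariski S 2" and irred_S: "irred_in zariski S" and closed_S: "closedin zariski S"
 using irr by (simp_all add: irreducible_variety_def)

lemma smooth_locus_iff: "p \<in> smooth_locus S \<longleftrightarrow> p \<in> S & vec.dim (tangent_cone S p) = 3"
 proof
 assume "p \<in> smooth_locus S"
 then obtain d where d: "p \<in> S" "has_dim zariski S d" "vec.dim (tangent_cone S p) = d + 1"
  unfolding smooth_locus_def by blast
 then show "p \<in> S & vec.dim (tangent_cone S p) = 3" using has_dim_unique[OF dim_S d(2)] by simp
next
 assume "p \<in> S & vec.dim (tangent_cone S p) = 3"
 then show "p \<in> smooth_locus S" using dim_S unfolding smooth_locus_def by (intro CollectI conjI exI[of _ 2]) auto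
qed

lemma tangent_span:
 assumes on: "on_S s w v" and m: "b * w + poly (quadricP g) s ~= 0"
 shows "tangent_cone S (pt (M *v aff s w v)) \<subseteq> vec.span {M *v aff s w v,
  M *v vec5 (2 * s * (b * w + poly (quadricP g) s)) (b * w + poly (quadricP g) s) 0 0
   (poly (pderiv (quarticP f)) s - v * poly (pderiv (quadricP g)) s),
  M *v vec5 0 0 0 (b * w + poly (quadricP g) s) (2 * a * w - b * v)}"
proof -
 define m' where "m' = b * w + poly (quadricP g) s"
 let ?p = "pt (M *v aff s w v)"
 let ?f1 = "poly (pderiv (quarticP f)) s" and ?g1 = "poly (pderiv (quadricP g)) s"
 let ?x = "M *v aff s w v" and ?u = "M *v vec5 (2 * s * m') m' 0 0 (?f1 - v * ?g1)" and ?y = "M *v vec5 0 0 0 m' (2 * a * w - b * v)"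
 have m0: "m' ~= 0" using m by (simp add: m'_def)
 have "tangent_cone S ?p \<subseteq> vec.span {?x, ?u, ?y}"
 proof
  fix y assume y: "y \<in> tangent_cone S ?p"
  define e where "e = N *v y"
  note P = tangent_polar[OF y aff_nonzero e_def]
  \<comment> \<open>The coordinates 2, 1 and 3 of a tangent vector fix the combination. Coordinate 0
    then follows from the polar form of the conic, coordinate 4 from that of the bundle.\<close>
  define \<alpha> \<beta> \<gamma> where "\<alpha> = e $ 2" and "\<beta> = (e $ 1 - \<alpha> * s) / m'" and "\<gamma> = (e $ 3 - \<alpha> * w) / m'"
  have e2: "e $ 2 = \<alpha>" "e $ 1 = \<alpha> * s + \<beta> * m'" "e $ 3 = \<alpha> * w + \<gamma> * m'" using m0 by (simp_all add: \<alpha>_def \<beta>_def \<gamma>_def)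
  have e0: "e $ 0 = \<alpha> * s ^ 2 + \<beta> * (2 * s * m')" using P(1) by (simp add: e2 alg_simps2)
  have "e $ 4 * m' = (\<alpha> * v + \<beta> * (?f1 - v * ?g1) + \<gamma> * (2 * a * w - b * v)) * m'"
  proof -
   let ?E = "v * m' - a * w ^ 2 - poly (quarticP f) s"
   have "e $ 4 * m' - (\<alpha> * v + \<beta> * (?f1 - v * ?g1) + \<gamma> * (2 * a * w - b * v)) * m'
    = (e $ 4 * (b * w + g 0 * s ^ 2 + g 1 * s + g 2) + v * (b * e $ 3 + g 0 * e $ 0 + g 1 * e $ 1 + g 2 * e $ 2)
     - 2 * a * w * e $ 3 - (2 * f 0 * s ^ 2 * e $ 0 + f 1 * (s ^ 2 * e $ 1 + s * e $ 0) + 2 * f 2 * s * e $ 1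
     + f 3 * (s * e $ 2 + e $ 1) + 2 * f 4 * e $ 2)) - 2 * \<alpha> * ?E"
    unfolding e2 e0 poly_pderiv_quarticP poly_pderiv_quadricP poly_quarticP m'_def poly_quadricP
    by (simp add: alg_simps4)
   also have "?E = 0" using on by (simp add: on_S_def m'_def)
   finally show ?thesis using P(2) by simp
  qed
  then have "e $ 4 = \<alpha> * v + \<beta> * (?f1 - v * ?g1) + \<gamma> * (2 * a * w - b * v)" using m0 by simp
  then have "e = \<alpha> *s aff s w v + \<beta> *s vec5 (2 * s * m') m' 0 0 (?f1 - v * ?g1) + \<gamma> *s vec5 0 0 0 m' (2 * a * w - b * v)"
   using e2 e0 by (simp add: vec5_eq_iff)
  then have "M *v e = \<alpha> *s ?x + \<beta> *s ?u + \<gamma> *s ?y"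
   by (simp add: matrix_linear)
  then have "y = \<alpha> *s ?x + \<beta> *s ?u + \<gamma> *s ?y" by (simp add: e_def)
  also have "\<dots> \<in> vec.span {?x, ?u, ?y}"
   by (intro vec.span_add vec.span_scale vec.span_base) auto
  finally show "y \<in> vec.span {?x, ?u, ?y}" .
 qed
 then show ?thesis by (simp only: m'_def)
qed

lemma smooth_affine:
 assumes on: "on_S s w v" and m: "b * w + poly (quadricP g) s ~= 0"
 shows "pt (M *v aff s w v) \<in> smooth_locus S"
proof -
 define m' where "m' = b * w + poly (quadricP g) s"
 let ?p = "pt (M *v aff s w v)"
 let ?f1 = "poly (pderiv (quarticP f)) s" and ?g1 = "poly (pderiv (quadricP g)) s"
 let ?x = "M *v aff s w v" and ?u = "M *v vec5 (2 * s * m') m' 0 0 (?f1 - v * ?g1)" and ?y = "M *v vec5 0 0 0 m' (2 * a * w - b * v)"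
 have p: "?p \<in> S" using on by (simp add: aff_in_S)
 have m0: "m' ~= 0" using m by (simp add: m'_def)
 have T: "?x \<in> tangent_cone S ?p" "?u \<in> tangent_cone S ?p" "?y \<in> tangent_cone S ?p"
  using tangent_base[OF p] tangent_lift[OF on m'_def m0, of 1 0] tangent_lift[OF on m'_def m0, of 0 1] by simp_all
 have dim: "vec.dim {?x, ?u, ?y} = 3"
  unfolding dim3_iff
 proof (intro allI impI)
  fix \<alpha> \<beta> \<gamma> assume "\<alpha> *s ?x + \<beta> *s ?u + \<gamma> *s ?y = 0"
  then have "M *v (\<alpha> *s aff s w v + \<beta> *s vec5 (2 * s * m') m' 0 0 (?f1 - v * ?g1) + \<gamma> *s vec5 0 0 0 m' (2 * a * w - b * v)) = 0"
   by (simp add: matrix_linear)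
  then have 0: "\<alpha> *s aff s w v + \<beta> *s vec5 (2 * s * m') m' 0 0 (?f1 - v * ?g1) + \<gamma> *s vec5 0 0 0 m' (2 * a * w - b * v) = 0"
   by (simp only: M_nonzero)
  have "\<alpha> = 0" using 0 by (simp add: vec5_eq_iff)
  then show "\<alpha> = 0 & \<beta> = 0 & \<gamma> = 0" using 0 m0 by (simp add: vec5_eq_iff)
 qed
 have "tangent_cone S ?p \<subseteq> vec.span {?x, ?u, ?y}" using tangent_span[OF on m] by (simp only: m'_def)
 then have "vec.dim (tangent_cone S ?p) \<le> vec.dim {?x, ?u, ?y}"
  using vec.dim_subset[of _ "vec.span {?x, ?u, ?y}"] by (simp add: vec.dim_span)
 moreover have "vec.dim {?x, ?u, ?y} \<le> vec.dim (tangent_cone S ?p)" using T by (intro vec.dim_subset) auto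
 ultimately show ?thesis using dim p by (simp add: smooth_locus_iff)
qed

lemma not_smoothI:
 assumes "M *v x \<in> tangent_cone S p" "M *v y \<in> tangent_cone S p" "M *v z \<in> tangent_cone S p" "M *v w \<in> tangent_cone S p"
  and ind: "!!\<alpha> \<beta> \<gamma> \<delta>. \<alpha> *s x + \<beta> *s y + \<gamma> *s z + \<delta> *s w = 0 ==> \<alpha> = 0 & \<beta> = 0 & \<gamma> = 0 & \<delta> = 0"
 shows "p \<notin> smooth_locus S"
proof -
 have "4 \<le> vec.dim (tangent_cone S p)"
 proof (rule four_independent[OF assms(1-4)])
  fix \<alpha> \<beta> \<gamma> \<delta> assume "\<alpha> *s (M *v x) + \<beta> *s (M *v y) + \<gamma> *s (M *v z) + \<delta> *s (M *v w) = 0"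
  then have "M *v (\<alpha> *s x + \<beta> *s y + \<gamma> *s z + \<delta> *s w) = 0"
   by (simp add: matrix_linear)
  then show "\<alpha> = 0 & \<beta> = 0 & \<gamma> = 0 & \<delta> = 0" by (intro ind) (simp only: M_nonzero)
 qed
 then show ?thesis by (simp add: smooth_locus_iff)
qed

text \<open>\<open>tangent_cone\<close> involves all forms vanishing on S, so vanishing gradients of
  two of them do not suffice; four independent velocities of curves on S are exhibited
  instead.\<close>

lemma not_smooth_affine:
 assumes on: "on_S s w v" and m: "b * w + poly (quadricP g) s = 0"
  and P: "2 * a * w - b * v = 0" and Q: "poly (pderiv (quarticP f)) s - v * poly (pderiv (quadricP g)) s = 0"
 shows "pt (M *v aff s w v) \<notin> smooth_locus S"
proof -
 let ?p = "pt (M *v aff s w v)"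
 have p: "?p \<in> S" using on by (simp add: aff_in_S)
 note T1 = tangent_base[OF p aff_nonzero] and T2 = tangent_vertical[OF on m, of 1]
 have n: "a * w ^ 2 + poly (quarticP f) s = 0" using on m by (simp add: on_S_def)
 have w0: "w = 0" using m P type by (auto simp: quadricP_def)
 then have fs: "poly (quarticP f) s = 0" using n by simp
 then obtain f1 where f1: "quarticP f = [:- s, 1:] * f1" using poly_root_factor by blast
 have f1': "poly (pderiv (quarticP f)) s = poly f1 s" unfolding f1 by (simp only: pderiv_mult) (simp add: pderiv_pCons)
 have fst: "poly (quarticP f) (s + t) = t * poly f1 (s + t)" for t unfolding f1 by (simp add: algebra_simps)
 show ?thesis
 proof (cases "a = 0")
  case True
  then have ab: "b = 1" "g = (%_. 0)" using type by auto
  have v0: "v = 0" using P by (simp add: ab True)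
  have T3: "M *v vec5 0 0 0 1 0 \<in> tangent_cone S ?p"
  proof (rule tangent_curve[of _ "%t. aff s t 0"])
   show "\<forall>\<^sub>F t in nhds 0. conic_form (aff s t 0) = 0 & bundle_form a b f g (aff s t 0) = 0"
    using fs by (simp add: bundle_aff True)
  qed (auto simp: forall_5 w0 v0 intro!: derivative_eq_intros)
  note d = poly_shift_DERIV[of f1 s]
  have d2: "((%t. (s + t) ^ 2) has_field_derivative 2 * s) (at 0)" by (auto intro!: derivative_eq_intros)
  \<comment> \<open>Since f(s + t) = t f1(s + t), the choice w = t gives v = f1(s + t).\<close>
  have T4: "M *v vec5 (2 * s) 1 0 1 (poly (pderiv f1) s) \<in> tangent_cone S ?p"
  proof (rule tangent_curve[of _ "%t. aff (s + t) t (poly f1 (s + t))"])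
   show "\<forall>\<^sub>F t in nhds 0. conic_form (aff (s + t) t (poly f1 (s + t))) = 0 & bundle_form a b f g (aff (s + t) t (poly f1 (s + t))) = 0"
    using fst by (simp add: bundle_aff True ab quadricP_def)
   have "poly f1 s = 0" using Q f1' by (simp add: v0)
   then show "aff (s + 0) 0 (poly f1 (s + 0)) = aff s w v" by (simp add: w0 v0)
  qed (use d d2 in \<open>auto simp: forall_5 intro!: derivative_eq_intros\<close>)
  show ?thesis
   by (rule not_smoothI[OF T1 T2 T3 T4]) (simp add: vec5_eq_iff)
 next
  case False
  then have ab: "a = 1" "b = 0" using type by auto
  have gs: "poly (quadricP g) s = 0" using m by (simp add: ab)
  then obtain g1 where g1: "quadricP g = [:- s, 1:] * g1" using poly_root_factor by blast
  have g1': "poly (pderiv (quadricP g)) s = poly g1 s" unfolding g1 by (simp only: pderiv_mult) (simp add: pderiv_pCons)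
  have gst: "poly (quadricP g) (s + t) = t * poly g1 (s + t)" for t unfolding g1 by (simp add: algebra_simps)
  \<comment> \<open>Otherwise s would be a double root of both g and f, and g would divide
    f.\<close>
  have g1s: "poly g1 s ~= 0"
  proof
   assume g0: "poly g1 s = 0"
   then have f0: "poly f1 s = 0" using Q f1' g1' by simp
   have G: "g 0 * s ^ 2 + g 1 * s + g 2 = 0" "2 * g 0 * s + g 1 = 0"
    using gs g0 g1' by (simp_all add: poly_quadricP poly_pderiv_quadricP)
   have F: "f 0 * s ^ 4 + f 1 * s ^ 3 + f 2 * s ^ 2 + f 3 * s + f 4 = 0" "4 * f 0 * s ^ 3 + 3 * f 1 * s ^ 2 + 2 * f 2 * s + f 3 = 0"
    using fs f0 f1' by (simp_all add: poly_quarticP poly_pderiv_quarticP)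
   have G0: "g 0 ~= 0"
   proof
    assume z: "g 0 = 0"
    then have "g 1 = 0" using G(2) by simp
    moreover have "g 2 = 0" using G(1) z \<open>g 1 = 0\<close> by simp
    ultimately show False using g_nonzero[OF ab(1)] z by blast
   qed
   have "quadric_divides g f"
    unfolding quadric_divides_def by (rule double_root_quotient[OF G F G0])
   then show False using not_divides[OF ab(1)] by blast
  qed
  have d2: "((%t. (s + t) ^ 2) has_field_derivative 2 * s) (at 0)" by (auto intro!: derivative_eq_intros)
  \<comment> \<open>On the curve w = c t the surface equation, divided by t, gives v = (c^2 t + f1)
    / g1; two values of c yield two independent velocities.\<close>
  have Tc: "EX d. M *v vec5 (2 * s) 1 0 c d \<in> tangent_cone S ?p" for c
  proof -
   have df: "((%t. poly h (s + t)) has_field_derivative poly (pderiv h) s) (at 0)" for h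
    by (rule poly_shift_DERIV)
   have "((%t. c ^ 2 * t + poly f1 (s + t)) has_field_derivative c ^ 2 + poly (pderiv f1) s) (at 0)"
    by (auto intro!: derivative_eq_intros df)
   from DERIV_divide[OF this df[of g1]] g1s obtain d where
    d: "((%t. (c ^ 2 * t + poly f1 (s + t)) / poly g1 (s + t)) has_field_derivative d) (at 0)" by auto
   have "isCont (%t. poly g1 (s + t)) 0" by (intro continuous_intros)
   then have "\<forall>\<^sub>F t in nhds 0. poly g1 (s + t) ~= 0" by (rule eventually_nonzero) (simp add: g1s)
   then have ev: "\<forall>\<^sub>F t in nhds 0. conic_form (aff (s + t) (c * t) ((c ^ 2 * t + poly f1 (s + t)) / poly g1 (s + t))) = 0 &
    bundle_form a b f g (aff (s + t) (c * t) ((c ^ 2 * t + poly f1 (s + t)) / poly g1 (s + t))) = 0"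
   proof eventually_elim
    case (elim t)
    then have "(c ^ 2 * t + poly f1 (s + t)) / poly g1 (s + t) * (t * poly g1 (s + t)) = t * (c ^ 2 * t + poly f1 (s + t))" by simp
    then show ?case unfolding bundle_aff gst fst ab by (simp add: alg_simps2)
   qed
   have "poly f1 s / poly g1 s = v" using Q f1' g1' g1s by (simp add: field_simps)
   then have "M *v vec5 (2 * s) 1 0 c d \<in> tangent_cone S ?p"
    by (intro tangent_curve[OF _ _ _ ev]) (use d d2 in \<open>auto simp: forall_5 w0 intro!: derivative_eq_intros\<close>)
   then show ?thesis by blast
  qed
  obtain d0 d1 where T: "M *v vec5 (2 * s) 1 0 0 d0 \<in> tangent_cone S ?p" "M *v vec5 (2 * s) 1 0 1 d1 \<in> tangent_cone S ?p"
   using Tc by blast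
  show ?thesis
   by (rule not_smoothI[OF T1 T2 T]) (auto simp: vec5_eq_iff)
 qed
qed

end

section \<open>Charts of the surface\<close>

lemma holomorphic2_onI:
 fixes \<psi> :: "complex \<times> complex => complex ^ 'n::finite"
 assumes "!!i. holo2 (%w. \<psi> w $ i) W"
 shows "holomorphic2_on \<psi> W"
 unfolding holomorphic2_on_def
proof
 fix w assume w: "w \<in> W"
 have "ALL i. EX ab. cdiff2 (%w. \<psi> w $ i) w (fst ab) (snd ab)"
  using assms w unfolding holo2_def by fastforce
 then obtain ab where "!!i. cdiff2 (%w. \<psi> w $ i) w (fst (ab i)) (snd (ab i))" by metis
 then have "(\<psi> has_derivative (%(s, t). s *s (\<chi> i. fst (ab i)) + t *s (\<chi> i. snd (ab i)))) (at w)"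
  by (intro has_derivative_components) simp
 then show "EX a b. (\<psi> has_derivative (%(s, t). s *s a + t *s b)) (at w)" by blast
qed

lemma holomorphic2_on_matrix:
 assumes "holomorphic2_on \<psi> W"
 shows "holomorphic2_on (%w. A *v \<psi> w) W"
 using assms unfolding holomorphic2_on_def by (blast intro: has_derivative_matrix)

lemma holomorphic2_on_nth: "holomorphic2_on \<psi> W ==> holo2 (%w. \<psi> w $ i) W"
 unfolding holomorphic2_on_def holo2_def by (blast intro: has_derivative_nth)

lemma dpair_5: "dpair (h :: complex ^ 5) x = h $ 0 * x $ 0 + h $ 1 * x $ 1 + h $ 2 * x $ 2 + h $ 3 * x $ 3 + h $ 4 * x $ 4"
 by (simp add: dpair_def sum_5)

text \<open>A smooth conic contains no line, so a linear image of the plane inside the cone y0 y2 =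
  y1^2 has dimension at most one.\<close>

lemma conic_direction:
 fixes a0 a1 a2 b0 b1 b2 :: complex
 assumes conic: "!!x y. (x * a0 + y * b0) * (x * a2 + y * b2) = (x * a1 + y * b1) ^ 2"
 shows "EX x y. (x ~= 0 | y ~= 0) & x * a0 + y * b0 = 0 & x * a1 + y * b1 = 0 & x * a2 + y * b2 = 0"
proof -
 have A: "a0 * a2 = a1 ^ 2" and B: "b0 * b2 = b1 ^ 2" using conic[of 1 0] conic[of 0 1] by simp_all
 have AB: "a0 * b2 + b0 * a2 = 2 * a1 * b1"
  using conic[of 1 1] A B by (simp add: alg_simps2)
 have e1: "b0 * a1 = a0 * b1" using conic[of b0 "- a0"] by (simp add: mult.commute)
 show ?thesis
 proof (cases "a0 = 0 & b0 = 0")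
  case True
  then have 0: "a1 = 0" "b1 = 0" using A B by simp_all
  show ?thesis
  proof (cases "a2 = 0 & b2 = 0")
   case True
   then show ?thesis using 0 \<open>a0 = 0 & b0 = 0\<close> by (intro exI[of _ 1] exI[of _ 0]) simp
  next
   case False
   then show ?thesis using 0 True by (intro exI[of _ b2] exI[of _ "- a2"]) (auto simp: mult.commute)
  qed
 next
  case False
  have "a0 * (b0 * a2 - a0 * b2) = 0"
  proof -
   have "a0 * (b0 * a2 - a0 * b2) = 2 * b0 * (a0 * a2) - a0 * (a0 * b2 + b0 * a2)" by (simp add: algebra_simps)
   also have "\<dots> = 2 * a1 * (b0 * a1 - a0 * b1)" unfolding A AB by (simp add: alg_simps2)
   finally show ?thesis by (simp add: e1)
  qed
  moreover have "b0 * (b0 * a2 - a0 * b2) = 0"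
  proof -
   have "b0 * (b0 * a2 - a0 * b2) = b0 * (a0 * b2 + b0 * a2) - 2 * a0 * (b0 * b2)" by (simp add: algebra_simps)
   also have "\<dots> = 2 * b1 * (b0 * a1 - a0 * b1)" unfolding B AB by (simp add: alg_simps2)
   finally show ?thesis by (simp add: e1)
  qed
  ultimately have "b0 * a2 - a0 * b2 = 0" using False by auto
  then show ?thesis using False e1 by (intro exI[of _ b0] exI[of _ "- a0"]) (auto simp: mult.commute)
 qed
qed

lemma cdiff2_linear: "cdiff2 (%w. x * fst w + y * snd w) z x y"
 using cdiff2_add[OF cdiff2_mult[OF cdiff2_const[of x] cdiff2_fst] cdiff2_mult[OF cdiff2_const[of y] cdiff2_snd]] by simp

context segre_form
begin

text \<open>Where the discriminant has a root of order exactly \<open>j\<close>, completing the square and extracting a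
  \<open>j\<close>-th root put the section into the normal form \<open>X\<^sup>2 = \<tau>\<^sup>j\<close>.\<close>

lemma section_chart:
 assumes on: "on_S s w v" and m: "b * w + poly (quadricP g) s ~= 0"
  and h: "h ~= 0" and kap: "kap a b (K h) ~= 0" "2 * kap a b (K h) * w + poly (polB b g (K h)) s = 0"
  and D: "discP a b f g (K h) = [:- s, 1:] ^ j * q" "poly q s ~= 0" "0 < j"
  and det: "x1 * t2 - x2 * t1 ~= 0"
 shows "section_has_local_equation S (pt (M *v aff s w v)) (pt h) (%u v. (x1 * u + x2 * v) ^ 2 - (t1 * u + t2 * v) ^ j)"
proof -
 obtain \<zeta> r where \<zeta>: "0 < r" "\<zeta> holomorphic_on ball 0 r" "\<zeta> 0 = s" "deriv \<zeta> 0 ~= 0"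
  "!!\<tau>. \<tau> \<in> ball 0 r ==> \<zeta> \<tau> \<in> UNIV & (\<zeta> \<tau> - s) ^ j * poly q (\<zeta> \<tau>) = \<tau> ^ j"
  by (rule local_root_coordinate[of "poly q" s j UNIV]) (use D(2,3) in \<open>auto intro: poly_holomorphic_on\<close>)
 define k where "k = K h"
 define \<kappa> where "\<kappa> = kap a b k"
 have \<kappa>: "\<kappa> ~= 0" using kap by (simp add: \<kappa>_def k_def)
 define T where "T z = t1 * fst z + t2 * snd z" for z :: "complex \<times> complex"
 define X where "X z = x1 * fst z + x2 * snd z" for z :: "complex \<times> complex"
 define \<sigma> where "\<sigma> z = \<zeta> (T z)" for z
 \<comment> \<open>Solved from the completed square: 2 \<kappa> \<omega> + B(\<sigma>) = X, while
   \<sigma> is chosen with D(\<sigma>) = T^j.\<close>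
 define \<omega> where "\<omega> z = (1 / (2 * \<kappa>)) * (X z - poly (polB b g k) (\<sigma> z))" for z
 define \<mu> where "\<mu> z = b * \<omega> z + poly (quadricP g) (\<sigma> z)" for z
 define \<nu> where "\<nu> z = a * (\<omega> z * \<omega> z) + poly (quarticP f) (\<sigma> z)" for z
 define W1 where "W1 = T -` ball 0 r"
 have dT: "cdiff2 T z t1 t2" and dX: "cdiff2 X z x1 x2" for z
  unfolding T_def X_def by (rule cdiff2_linear)+
 have hT: "holo2 T W" and hX: "holo2 X W" for W unfolding holo2_def using dT dX by blast+
 have contT: "continuous_on UNIV T" by (rule holo2_continuous_on[OF hT])
 have W1: "open W1" "0 \<in> W1"
  unfolding W1_def using contT \<zeta>(1) by (auto simp: T_def intro: open_vimage)
 have h\<sigma>: "holo2 \<sigma> W1"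
  unfolding \<sigma>_def by (rule holo2_compose[OF hT \<zeta>(2)]) (auto simp: W1_def)
 have h\<omega>: "holo2 \<omega> W1" unfolding \<omega>_def by (intro holo2_intros holo2_poly hX h\<sigma>)
 have h\<mu>: "holo2 \<mu> W1" unfolding \<mu>_def by (intro holo2_intros holo2_poly h\<omega> h\<sigma>)
 have h\<nu>: "holo2 \<nu> W1" unfolding \<nu>_def by (intro holo2_intros holo2_poly h\<omega> h\<sigma>)
 define W where "W = {z \<in> W1. \<mu> z ~= 0}"
 have "poly (polB b g k) s = - (2 * \<kappa> * w)" using kap(2) by (simp add: k_def \<kappa>_def eq_neg_iff_add_eq_0 add.commute)
 then have at0: "\<sigma> 0 = s" "\<omega> 0 = w" using \<zeta>(3) \<kappa> by (simp_all add: \<sigma>_def \<omega>_def T_def X_def)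
 define m0 where "m0 = b * w + poly (quadricP g) s"
 have m0: "m0 ~= 0" "\<mu> 0 = m0" "\<nu> 0 = v * m0"
  using m on at0 by (simp_all add: m0_def \<mu>_def \<nu>_def on_S_def power2_eq_square)
 have W: "open W" "0 \<in> W" unfolding W_def using open_nonzero[OF W1(1) h\<mu>] W1(2) m0 by auto
 have WW1: "W \<subseteq> W1" by (auto simp: W_def)
 \<comment> \<open>The lift is multiplied by 4 \<kappa> \<mu>. This absorbs the denominator of the
   last coordinate and the factor from completing the square, so the section becomes X^2 - T^j
   without a unit.\<close>
 define \<psi> where "\<psi> z = vec5 (4 * \<kappa> * \<mu> z * (\<sigma> z * \<sigma> z)) (4 * \<kappa> * \<mu> z * \<sigma> z) (4 * \<kappa> * \<mu> z) (4 * \<kappa> * \<mu> z * \<omega> z) (4 * \<kappa> * \<nu> z)" for z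
 have h\<psi>: "holo2 (%z. \<psi> z $ i) W" for i
 proof -
  have "ALL i. holo2 (%z. \<psi> z $ i) W1"
   unfolding forall_5 by (simp add: \<psi>_def) (intro conjI holo2_intros h\<mu> h\<sigma> h\<omega> h\<nu>)
  then show ?thesis using holo2_subset WW1 by blast
 qed
 have \<psi>0: "\<psi> 0 = (4 * \<kappa> * m0) *s aff s w v"
  by (simp add: vec5_eq_iff \<psi>_def at0 m0 power2_eq_square algebra_simps)
 have "(\<zeta> has_field_derivative deriv \<zeta> 0) (at 0)" by (rule holomorphic_derivI[OF \<zeta>(2)]) (use \<zeta>(1) in auto)
 then have "cdiff2 \<sigma> 0 (deriv \<zeta> 0 * t1) (deriv \<zeta> 0 * t2)"
  unfolding \<sigma>_def using cdiff2_compose[OF dT[of 0], of \<zeta> "deriv \<zeta> 0"] by (simp add: T_def)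
 then obtain \<sigma>u \<sigma>v where d\<sigma>: "cdiff2 \<sigma> 0 \<sigma>u \<sigma>v" "\<sigma>u = deriv \<zeta> 0 * t1" "\<sigma>v = deriv \<zeta> 0 * t2" by blast
 obtain \<omega>u \<omega>v where d\<omega>: "cdiff2 \<omega> 0 \<omega>u \<omega>v" using h\<omega> W1(2) unfolding holo2_def by blast
 obtain \<mu>u \<mu>v where d\<mu>: "cdiff2 \<mu> 0 \<mu>u \<mu>v" using h\<mu> W1(2) unfolding holo2_def by blast
 obtain \<nu>u \<nu>v where d\<nu>: "cdiff2 \<nu> 0 \<nu>u \<nu>v" using h\<nu> W1(2) unfolding holo2_def by blast
 define B1 where "B1 = poly (pderiv (polB b g k)) s"
 have \<omega>uv: "\<omega>u = (x1 - B1 * \<sigma>u) / (2 * \<kappa>)" "\<omega>v = (x2 - B1 * \<sigma>v) / (2 * \<kappa>)"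
 proof -
  have "cdiff2 \<omega> 0 (0 * (X 0 - poly (polB b g k) (\<sigma> 0)) + 1 / (2 * \<kappa>) * (x1 - B1 * \<sigma>u)) (0 * (X 0 - poly (polB b g k) (\<sigma> 0)) + 1 / (2 * \<kappa>) * (x2 - B1 * \<sigma>v))"
   unfolding \<omega>_def[abs_def] B1_def at0(1)[symmetric]
   by (rule cdiff2_mult[OF cdiff2_const cdiff2_diff[OF dX cdiff2_poly[OF d\<sigma>(1)]]])
  from cdiff2_unique[OF d\<omega> this] show "\<omega>u = (x1 - B1 * \<sigma>u) / (2 * \<kappa>)" "\<omega>v = (x2 - B1 * \<sigma>v) / (2 * \<kappa>)" by simp_all
 qed
 note d4 = cdiff2_mult[OF cdiff2_const[of "4 * \<kappa>"] d\<mu>]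
 define A where "A = vec5 (4 * \<kappa> * \<mu>u * s ^ 2 + 4 * \<kappa> * m0 * (2 * s * \<sigma>u)) (4 * \<kappa> * \<mu>u * s + 4 * \<kappa> * m0 * \<sigma>u) (4 * \<kappa> * \<mu>u) (4 * \<kappa> * \<mu>u * w + 4 * \<kappa> * m0 * \<omega>u) (4 * \<kappa> * \<nu>u)"
 define A' where "A' = vec5 (4 * \<kappa> * \<mu>v * s ^ 2 + 4 * \<kappa> * m0 * (2 * s * \<sigma>v)) (4 * \<kappa> * \<mu>v * s + 4 * \<kappa> * m0 * \<sigma>v) (4 * \<kappa> * \<mu>v) (4 * \<kappa> * \<mu>v * w + 4 * \<kappa> * m0 * \<omega>v) (4 * \<kappa> * \<nu>v)"
 have d\<psi>: "ALL i. cdiff2 (%z. \<psi> z $ i) 0 (A $ i) (A' $ i)"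
  unfolding forall_5
  using cdiff2_mult[OF d4 cdiff2_mult[OF d\<sigma>(1) d\<sigma>(1)]] cdiff2_mult[OF d4 d\<sigma>(1)] d4 cdiff2_mult[OF d4 d\<omega>]
   cdiff2_mult[OF cdiff2_const[of "4 * \<kappa>"] d\<nu>]
  by (simp add: \<psi>_def A_def A'_def at0 m0(2) power2_eq_square algebra_simps)
 have d\<phi>: "((%z. M *v \<psi> z) has_derivative (%(s, t). s *s (M *v A) + t *s (M *v A'))) (at 0)"
  by (rule has_derivative_matrix[OF has_derivative_components]) (use d\<psi> in blast)
 have dim: "vec.dim {M *v \<psi> 0, M *v A, M *v A'} = 3"
  unfolding dim3_iff
 proof (intro allI impI)
  fix \<alpha> \<beta> \<gamma> assume "\<alpha> *s (M *v \<psi> 0) + \<beta> *s (M *v A) + \<gamma> *s (M *v A') = 0"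
  then have "M *v (\<alpha> *s \<psi> 0 + \<beta> *s A + \<gamma> *s A') = 0"
   by (simp add: matrix_linear)
  then have 0: "\<alpha> *s \<psi> 0 + \<beta> *s A + \<gamma> *s A' = 0" by (simp only: M_nonzero)
  define c where "c = 4 * \<kappa> * m0"
  have c: "c ~= 0" using \<kappa> m0 by (simp add: c_def)
  define e where "e = \<alpha> * c + 4 * \<kappa> * (\<beta> * \<mu>u + \<gamma> * \<mu>v)"
  have e0: "e = 0" using 0 by (simp add: vec5_eq_iff \<psi>0 A_def A'_def e_def c_def algebra_simps)
  have "e * s + c * (\<beta> * \<sigma>u + \<gamma> * \<sigma>v) = (\<alpha> *s \<psi> 0 + \<beta> *s A + \<gamma> *s A') $ 1"
   by (simp add: \<psi>0 A_def A'_def e_def c_def algebra_simps)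
  then have "e * s + c * (\<beta> * \<sigma>u + \<gamma> * \<sigma>v) = 0" unfolding 0 by simp
  then have 1: "\<beta> * \<sigma>u + \<gamma> * \<sigma>v = 0" using e0 c by simp
  have "e * w + c * (\<beta> * \<omega>u + \<gamma> * \<omega>v) = (\<alpha> *s \<psi> 0 + \<beta> *s A + \<gamma> *s A') $ 3"
   by (simp add: \<psi>0 A_def A'_def e_def c_def algebra_simps)
  then have "e * w + c * (\<beta> * \<omega>u + \<gamma> * \<omega>v) = 0" unfolding 0 by simp
  then have 2: "\<beta> * \<omega>u + \<gamma> * \<omega>v = 0" using e0 c by simp
  have "\<beta> * x1 + \<gamma> * x2 = 2 * \<kappa> * (\<beta> * \<omega>u + \<gamma> * \<omega>v) + B1 * (\<beta> * \<sigma>u + \<gamma> * \<sigma>v)"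
   unfolding \<omega>uv using \<kappa> by (simp add: field_simps)
  then have x: "\<beta> * x1 + \<gamma> * x2 = 0" using 1 2 by simp
  have "deriv \<zeta> 0 * (\<beta> * t1 + \<gamma> * t2) = 0" using 1 by (simp add: d\<sigma> algebra_simps)
  then have t: "\<beta> * t1 + \<gamma> * t2 = 0" using \<zeta>(4) by simp
  have bg: "\<beta> = 0" "\<gamma> = 0" using det2_solve[OF _ x t] det by (simp_all add: mult.commute)
  then have "\<alpha> = 0" using e0 c by (simp add: e_def)
  then show "\<alpha> = 0 & \<beta> = 0 & \<gamma> = 0" using bg by simp
 qed
 have chart: "local_chart S (pt (M *v aff s w v)) W (%z. M *v \<psi> z)"
  unfolding local_chart_def
 proof (intro conjI W ballI)
  show "holomorphic2_on (%z. M *v \<psi> z) W" by (intro holomorphic2_on_matrix holomorphic2_onI h\<psi>)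
  fix z assume z: "z \<in> W"
  have "\<psi> z $ 2 ~= 0" using z \<kappa> by (simp add: \<psi>_def W_def)
  then show nz: "M *v \<psi> z ~= 0" by auto
  have "conic_form (\<psi> z) = 0" by (simp add: conic_form_def \<psi>_def power2_eq_square)
  moreover have "bundle_form a b f g (\<psi> z) = (4 * \<kappa>) ^ 2 * (\<nu> z * \<mu> z * \<mu> z - \<mu> z * \<mu> z * (a * (\<omega> z * \<omega> z) + poly (quarticP f) (\<sigma> z)))"
  proof -
   have m: "b * \<omega> z = \<mu> z - poly (quadricP g) (\<sigma> z)" by (simp add: \<mu>_def)
   have "bundle_form a b f g (\<psi> z) = (4 * \<kappa>) ^ 2 * (\<nu> z * (\<mu> z * (b * \<omega> z) + \<mu> z * poly (quadricP g) (\<sigma> z)) - \<mu> z * \<mu> z * (a * (\<omega> z * \<omega> z) + poly (quarticP f) (\<sigma> z)))"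
    unfolding bundle_form_def \<psi>_def vec5_nth poly_quadricP poly_quarticP
    by (simp add: alg_simps4)
   then show ?thesis unfolding m by (simp add: algebra_simps)
  qed
  ultimately show "pt (M *v \<psi> z) \<in> S" using mem[of "\<psi> z"] nz by (simp add: \<nu>_def)
 next
  have "M *v \<psi> 0 = (4 * \<kappa> * m0) *s (M *v aff s w v)" unfolding \<psi>0 by (rule vector_scalar_commute)
  then show "pt (M *v \<psi> 0) = pt (M *v aff s w v)"
   using pt_scale[of "M *v aff s w v" "4 * \<kappa> * m0"] \<kappa> m0 by simp
  show "EX a b. ((%z. M *v \<psi> z) has_derivative (%(s, t). s *s a + t *s b)) (at 0) & vec.dim {M *v \<psi> 0, a, b} = 3"
   using d\<phi> dim by blast
 qed
 have eq: "dpair h (M *v \<psi> z) = X z ^ 2 - T z ^ j" if z: "z \<in> W" for z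
 proof -
  have "T z \<in> ball 0 r" using z by (simp add: W_def W1_def)
  then have "(\<sigma> z - s) ^ j * poly q (\<sigma> z) = T z ^ j" using \<zeta>(5) by (simp add: \<sigma>_def)
  then have D': "poly (discP a b f g k) (\<sigma> z) = T z ^ j" using D(1) by (simp add: k_def)
  have X': "2 * kap a b k * \<omega> z + poly (polB b g k) (\<sigma> z) = X z" using \<kappa> by (simp add: \<omega>_def \<kappa>_def)
  have "dpair h (M *v \<psi> z) = 4 * \<kappa> * (\<mu> z * (poly (baseP k) (\<sigma> z) + k $ 3 * \<omega> z) + k $ 4 * \<nu> z)"
   unfolding dpair_M k_def[symmetric] unfolding dpair_5 \<psi>_def vec5_nth poly_baseP by (simp add: alg_simps2)
  also have "\<mu> z * (poly (baseP k) (\<sigma> z) + k $ 3 * \<omega> z) + k $ 4 * \<nu> z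
   = kap a b k * \<omega> z ^ 2 + poly (polB b g k) (\<sigma> z) * \<omega> z + poly (polC f g k) (\<sigma> z)"
   by (simp add: \<mu>_def \<nu>_def kap_def polB_def polC_def alg_simps2)
  also have "4 * \<kappa> * \<dots> = X z ^ 2 - T z ^ j" unfolding \<kappa>_def complete_square D' X' ..
  finally show ?thesis .
 qed
 have "h \<in> line_of (pt h)" using line_of_pt[OF h] by (auto intro: range_eqI[of _ _ 1])
 then show ?thesis
  unfolding section_has_local_equation_def
  by (intro exI[of _ W] exI[of _ "%z. M *v \<psi> z"] bexI[of _ h]) (use h chart eq in \<open>auto simp: X_def T_def\<close>)
qed

text \<open>Division by coordinate 2 passes from the lift to s, w1, w2, and immersivity into
  projective space becomes the rank condition of \<open>bundle_germ\<close>.\<close>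

lemma chart_germ:
 assumes chart: "local_chart S p W \<phi>" and p: "p = pt (M *v aff s0 w0 v0)"
 defines "\<zeta> \<equiv> %i w. (N *v \<phi> w) $ i"
 shows "EX W' su sv pu pv qu qv. W' \<subseteq> W & 0 \<in> W' & holo2 (\<zeta> 2) W' & (ALL w:W'. \<zeta> 2 w ~= 0) &
  \<zeta> 1 0 / \<zeta> 2 0 = s0 & \<zeta> 3 0 / \<zeta> 2 0 = w0 & \<zeta> 4 0 / \<zeta> 2 0 = v0 &
  bundle_germ a b f g W' (%w. \<zeta> 1 w / \<zeta> 2 w) (%w. \<zeta> 3 w / \<zeta> 2 w) (%w. \<zeta> 4 w / \<zeta> 2 w) su sv pu pv qu qv"
proof -
 from chart have W: "open W" "0 \<in> W" "holomorphic2_on \<phi> W" and onS: "ALL w:W. \<phi> w ~= 0 & pt (\<phi> w) \<in> S" and p0: "pt (\<phi> 0) = p"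
  unfolding local_chart_def by blast+
 from chart obtain A A' where d: "(\<phi> has_derivative (%(s, t). s *s A + t *s A')) (at 0)" and dim: "vec.dim {\<phi> 0, A, A'} = 3"
  unfolding local_chart_def by blast
 have h\<zeta>: "holo2 (\<zeta> i) W" for i
  unfolding \<zeta>_def by (rule holomorphic2_on_nth[OF holomorphic2_on_matrix[OF W(3)]])
 have d\<zeta>: "cdiff2 (\<zeta> i) 0 ((N *v A) $ i) ((N *v A') $ i)" for i
  unfolding \<zeta>_def by (rule has_derivative_nth[OF has_derivative_matrix[OF d]])
 have "\<phi> 0 ~= 0" using onS W(2) by blast
 then obtain c where c: "c ~= 0" "\<phi> 0 = c *s (M *v aff s0 w0 v0)"
  using pt_eq_iff[of "M *v aff s0 w0 v0" "\<phi> 0"] p0 p by auto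
 have "N *v \<phi> 0 = c *s aff s0 w0 v0" by (simp add: c vector_scalar_commute)
 then have \<zeta>0: "\<zeta> i 0 = c * aff s0 w0 v0 $ i" for i by (simp add: \<zeta>_def)
 define W' where "W' = {w \<in> W. \<zeta> 2 w ~= 0}"
 have W': "open W'" "0 \<in> W'" "W' \<subseteq> W" unfolding W'_def using open_nonzero[OF W(1) h\<zeta>] W(2) c(1) by (auto simp: \<zeta>0)
 have h': "holo2 (\<zeta> i) W'" for i using h\<zeta> W'(3) by (rule holo2_subset)
 have hq: "holo2 (%w. \<zeta> i w / \<zeta> 2 w) W'" for i
  by (intro holo2_divide h') (simp add: W'_def)
 obtain su sv where ds: "cdiff2 (%w. \<zeta> 1 w / \<zeta> 2 w) 0 su sv" using hq W'(2) unfolding holo2_def by blast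
 obtain pu pv where dp: "cdiff2 (%w. \<zeta> 3 w / \<zeta> 2 w) 0 pu pv" using hq W'(2) unfolding holo2_def by blast
 obtain qu qv where dq: "cdiff2 (%w. \<zeta> 4 w / \<zeta> 2 w) 0 qu qv" using hq W'(2) unfolding holo2_def by blast
 let ?A = "%i. (N *v A) $ i" and ?A' = "%i. (N *v A') $ i"
 have quot: "?A i = x * \<zeta> 2 0 + \<zeta> i 0 / \<zeta> 2 0 * ?A 2 & ?A' i = y * \<zeta> 2 0 + \<zeta> i 0 / \<zeta> 2 0 * ?A' 2"
  if "cdiff2 (%w. \<zeta> i w / \<zeta> 2 w) 0 x y" for i x y
 proof -
  have "cdiff2 (\<zeta> i) 0 (x * \<zeta> 2 0 + \<zeta> i 0 / \<zeta> 2 0 * ?A 2) (y * \<zeta> 2 0 + \<zeta> i 0 / \<zeta> 2 0 * ?A' 2)"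
   by (rule cdiff2_cong[OF cdiff2_mult[OF that d\<zeta>] W'(1,2)]) (simp add: W'_def)
  from cdiff2_unique[OF d\<zeta> this] show ?thesis by blast
 qed
 have conic: "\<zeta> 0 w * \<zeta> 2 w = \<zeta> 1 w * \<zeta> 1 w" if "w \<in> W" for w
 proof -
  have "conic_form (N *v \<phi> w) = 0" using onS that acone_S[of "\<phi> w"] by (simp add: acone_def)
  then show ?thesis by (simp add: conic_form_def \<zeta>_def power2_eq_square)
 qed
 have "cdiff2 (%w. \<zeta> 1 w * \<zeta> 1 w) 0 (?A 0 * \<zeta> 2 0 + \<zeta> 0 0 * ?A 2) (?A' 0 * \<zeta> 2 0 + \<zeta> 0 0 * ?A' 2)"
  by (rule cdiff2_cong[OF cdiff2_mult[OF d\<zeta> d\<zeta>] W(1,2)]) (rule conic)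
 from cdiff2_unique[OF this cdiff2_mult[OF d\<zeta>[of 1] d\<zeta>[of 1]]]
 have c0: "?A 0 * \<zeta> 2 0 + \<zeta> 0 0 * ?A 2 = 2 * \<zeta> 1 0 * ?A 1" "?A' 0 * \<zeta> 2 0 + \<zeta> 0 0 * ?A' 2 = 2 * \<zeta> 1 0 * ?A' 1"
  by (simp_all add: mult_ac)
 have rank: "x = 0 & y = 0" if xy: "x * su + y * sv = 0" "x * pu + y * pv = 0" "x * qu + y * qv = 0" for x y
 proof -
  \<comment> \<open>A direction that kills ds, dw1 and dw2 has a derivative proportional to the lift
    itself: the coordinates 1, 3, 4 by the quotient rule and coordinate 0 by the differentiated
    conic, with the factor t fixed by coordinate 2.\<close>
  define e where "e = x *s (N *v A) + y *s (N *v A')"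
  define t where "t = e $ 2 / c"
  have z2: "\<zeta> 2 0 = c" "\<zeta> 2 0 ~= 0" using c(1) by (simp_all add: \<zeta>0)
  have *: "e $ i = t * \<zeta> i 0" if q: "cdiff2 (%w. \<zeta> i w / \<zeta> 2 w) 0 u u'" "x * u + y * u' = 0" for i u u'
  proof -
   have "e $ i = x * ?A i + y * ?A' i" by (simp add: e_def)
   also have "\<dots> = x * (u * c + \<zeta> i 0 / c * ?A 2) + y * (u' * c + \<zeta> i 0 / c * ?A' 2)"
    using quot[OF q(1)] unfolding z2(1) by simp
   also have "\<dots> = c * (x * u + y * u') + \<zeta> i 0 / c * e $ 2" by (simp add: e_def algebra_simps)
   finally have "e $ i = c * (x * u + y * u') + \<zeta> i 0 / c * e $ 2" .
   then show ?thesis using q(2) by (simp add: t_def)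
  qed
  have e: "e $ 1 = t * \<zeta> 1 0" "e $ 3 = t * \<zeta> 3 0" "e $ 4 = t * \<zeta> 4 0" "e $ 2 = t * \<zeta> 2 0"
   using *[OF ds xy(1)] *[OF dp xy(2)] *[OF dq xy(3)] c(1) by (simp_all add: z2(1) t_def)
  have "e $ 0 * c + \<zeta> 0 0 * e $ 2 = 2 * \<zeta> 1 0 * e $ 1"
  proof -
   have "e $ 0 * c + \<zeta> 0 0 * e $ 2 = x * (?A 0 * \<zeta> 2 0 + \<zeta> 0 0 * ?A 2) + y * (?A' 0 * \<zeta> 2 0 + \<zeta> 0 0 * ?A' 2)"
    by (simp add: e_def z2(1) algebra_simps)
   also have "\<dots> = 2 * \<zeta> 1 0 * e $ 1" unfolding c0 by (simp add: e_def algebra_simps)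
   finally show ?thesis .
  qed
  then have "e $ 0 * c = t * \<zeta> 0 0 * c" by (simp add: e \<zeta>0 alg_simps2)
  then have "e $ 0 = t * \<zeta> 0 0" using c(1) by simp
  then have "e = t *s (N *v \<phi> 0)" using e by (simp add: vec5_eq_iff \<zeta>_def)
  then have "M *v e = t *s \<phi> 0" by (simp add: vector_scalar_commute)
  then have "x *s A + y *s A' = t *s \<phi> 0"
   by (simp add: e_def matrix_linear)
  moreover have "(- t) *s \<phi> 0 + x *s A + y *s A' = (x *s A + y *s A') - t *s \<phi> 0"
   by (simp add: cvec_eq_iff)
  ultimately have "(- t) *s \<phi> 0 + x *s A + y *s A' = 0" by simp
  then show ?thesis using dim unfolding dim3_iff by blast
 qed
 have "bundle_germ a b f g W' (%w. \<zeta> 1 w / \<zeta> 2 w) (%w. \<zeta> 3 w / \<zeta> 2 w) (%w. \<zeta> 4 w / \<zeta> 2 w) su sv pu pv qu qv"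
 proof
  show "a = 0 & b = 1 & g = (%_. 0) | a = 1 & b = 0" by (rule type)
  fix z assume "z \<in> W'"
  then have z: "z \<in> W" "(N *v \<phi> z) $ 2 ~= 0" by (simp_all add: W'_def \<zeta>_def)
  have "pt (M *v (N *v \<phi> z)) \<in> S" using onS z(1) by simp
  from affine_point(2)[OF this z(2)]
  show "\<zeta> 4 z / \<zeta> 2 z * (b * (\<zeta> 3 z / \<zeta> 2 z) + poly (quadricP g) (\<zeta> 1 z / \<zeta> 2 z))
   = a * (\<zeta> 3 z / \<zeta> 2 z) ^ 2 + poly (quarticP f) (\<zeta> 1 z / \<zeta> 2 z)" by (simp add: on_S_def \<zeta>_def)
 qed (use W' hq ds dp dq rank in blast)+
 moreover have "\<zeta> 1 0 / \<zeta> 2 0 = s0 & \<zeta> 3 0 / \<zeta> 2 0 = w0 & \<zeta> 4 0 / \<zeta> 2 0 = v0" using c(1) by (simp add: \<zeta>0)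
 moreover have "ALL w:W'. \<zeta> 2 w ~= 0" by (simp add: W'_def)
 ultimately show ?thesis using W' h' by blast
qed

lemma germ_section:
 assumes "(N *v x) $ 2 ~= 0" "(N *v x) $ 0 * (N *v x) $ 2 = (N *v x) $ 1 ^ 2"
 shows "poly (baseP (K h)) ((N *v x) $ 1 / (N *v x) $ 2) + K h $ 3 * ((N *v x) $ 3 / (N *v x) $ 2) + K h $ 4 * ((N *v x) $ 4 / (N *v x) $ 2)
  = inverse ((N *v x) $ 2) * dpair h x"
proof -
 have "dpair h x = dpair (K h) (N *v x)" using dpair_M[of h "N *v x"] by simp
 moreover have "(N *v x) $ 0 = (N *v x) $ 1 ^ 2 / (N *v x) $ 2" using assms by (simp add: field_simps)
 ultimately show ?thesis using assms(1) by (simp add: dpair_5 poly_baseP field_simps power2_eq_square)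
qed

end

lemma discP_smult: "discP a b f g (c *s k) = Polynomial.smult (c ^ 2) (discP a b f g k)"
 by (rule poly_same) (simp add: discP_def polB_def polC_def kap_def baseP_def alg_simps2)

lemma polB_smult: "polB b g (c *s k) = Polynomial.smult c (polB b g k)"
 by (rule poly_same) (simp add: polB_def baseP_def algebra_simps)

lemma kap_smult: "kap a b (c *s k) = c * kap a b k"
 by (simp add: kap_def algebra_simps)

context segre_surface_form
begin

text \<open>In affine coordinates the section differs from the cusp equation only by the unit 1 /
  z2. A cusp at m = 0 would make the gradient vanish and the point singular, so the triple root
  criterion applies.\<close>

lemma cusp_affine:
 assumes sm: "pt (M *v aff s w v) \<in> smooth_locus S" and cusp: "ordinary_cusp_at S (pt (M *v aff s w v)) H"
 shows "EX h. h ~= 0 & H = pt h & b * w + poly (quadricP g) s ~= 0 & kap a b (K h) ~= 0 & K h $ 4 ~= 0 &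
  2 * kap a b (K h) * w + poly (polB b g (K h)) s = 0 & [:- s, 1:] ^ 3 dvd discP a b f g (K h)"
proof -
 let ?p = "pt (M *v aff s w v)"
 obtain W \<phi> h where h: "h \<in> line_of H" "h ~= 0" and chart: "local_chart S ?p W \<phi>"
  and eq: "ALL (u, v):W. dpair h (\<phi> (u, v)) = u ^ 2 - v ^ 3"
  using cusp unfolding ordinary_cusp_at_def section_has_local_equation_def by blast
 have onS: "on_S s w v" using sm aff_in_S by (simp add: smooth_locus_iff)
 obtain W' su sv pu pv qu qv where G: "W' \<subseteq> W" "0 \<in> W'" "holo2 (%w. (N *v \<phi> w) $ 2) W'" "ALL w:W'. (N *v \<phi> w) $ 2 ~= 0"
  "(N *v \<phi> 0) $ 1 / (N *v \<phi> 0) $ 2 = s" "(N *v \<phi> 0) $ 3 / (N *v \<phi> 0) $ 2 = w" "(N *v \<phi> 0) $ 4 / (N *v \<phi> 0) $ 2 = v"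
  and germ: "bundle_germ a b f g W' (%w. (N *v \<phi> w) $ 1 / (N *v \<phi> w) $ 2) (%w. (N *v \<phi> w) $ 3 / (N *v \<phi> w) $ 2) (%w. (N *v \<phi> w) $ 4 / (N *v \<phi> w) $ 2) su sv pu pv qu qv"
  by (insert chart_germ[OF chart refl], elim exE conjE, rule that, assumption+)
 interpret G: bundle_germ a b f g "K h" W' "%w. (N *v \<phi> w) $ 1 / (N *v \<phi> w) $ 2" "%w. (N *v \<phi> w) $ 3 / (N *v \<phi> w) $ 2" "%w. (N *v \<phi> w) $ 4 / (N *v \<phi> w) $ 2" su sv pu pv qu qv
  by (rule germ)
 have sect: "G.sect z = inverse ((N *v \<phi> z) $ 2) * dpair h (\<phi> z)" if "z \<in> W'" for z
  unfolding G.sect_def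
 proof (rule germ_section)
  show "(N *v \<phi> z) $ 2 ~= 0" using G(4) that by blast
  have "\<phi> z \<in> acone S" using chart that G(1) unfolding local_chart_def acone_def by blast
  then show "(N *v \<phi> z) $ 0 * (N *v \<phi> z) $ 2 = (N *v \<phi> z) $ 1 ^ 2" by (simp add: acone_S conic_form_def)
 qed
 have c: "holo2 (%z. inverse ((N *v \<phi> z) $ 2)) W'" "inverse ((N *v \<phi> 0) $ 2) ~= 0"
  using holo2_inverse[OF G(3)] G(2,4) by auto
 have cusp': "G.sect (u, v) = inverse ((N *v \<phi> (u, v)) $ 2) * (u ^ 2 - v ^ 3)" if "(u, v) \<in> W'" for u v
  using sect[OF that] eq G(1) that by auto
 have m0: "G.mfun 0 = b * w + poly (quadricP g) s" by (simp add: G.mfun_def G)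
 have m: "G.mfun 0 ~= 0"
 proof
  assume m: "G.mfun 0 = 0"
  from G.cusp_at_zero_of_m[OF c cusp' m]
  have "b * v - 2 * a * w = 0" "v * poly (pderiv (quadricP g)) s - poly (pderiv (quarticP f)) s = 0" unfolding G by auto
  then have "2 * a * w - b * v = 0" "poly (pderiv (quarticP f)) s - v * poly (pderiv (quadricP g)) s = 0" by simp_all
  from not_smooth_affine[OF onS _ this] m m0 sm show False by simp
 qed
 from G.cusp_triple_root[OF c cusp' m] show ?thesis
  using m h(2) line_of_eq_pt[OF h] unfolding m0 G by blast
qed

lemma triple_root_not_node:
 assumes onS: "on_S s w v" and m: "b * w + poly (quadricP g) s ~= 0" and h: "h ~= 0" "kap a b (K h) ~= 0"
  "2 * kap a b (K h) * w + poly (polB b g (K h)) s = 0" "[:- s, 1:] ^ 3 dvd discP a b f g (K h)"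
 shows "\<not> ordinary_node_at S (pt (M *v aff s w v)) (pt h)"
proof
 let ?p = "pt (M *v aff s w v)"
 assume "ordinary_node_at S ?p (pt h)"
 then obtain W \<phi> h' where h': "h' \<in> line_of (pt h)" "h' ~= 0" and chart: "local_chart S ?p W \<phi>"
  and eq: "ALL (u, v):W. dpair h' (\<phi> (u, v)) = u * v"
  unfolding ordinary_node_at_def section_has_local_equation_def by blast
 obtain c where c: "h' = c *s h" using h'(1) line_of_pt[OF h(1)] by auto
 then have c0: "c ~= 0" using h'(2) by auto
 \<comment> \<open>The local equation may use any vector spanning the line of the hyperplane, so the
   conditions are transported by their homogeneity in h.\<close>
 have k: "kap a b (K h') ~= 0" "2 * kap a b (K h') * w + poly (polB b g (K h')) s = 0" "[:- s, 1:] ^ 3 dvd discP a b f g (K h')"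
 proof -
  show "kap a b (K h') ~= 0" using h(2) c0 by (simp add: c K_smult kap_smult)
  have "2 * kap a b (K h') * w + poly (polB b g (K h')) s = c * (2 * kap a b (K h) * w + poly (polB b g (K h)) s)"
   by (simp add: c K_smult kap_smult polB_smult algebra_simps)
  then show "2 * kap a b (K h') * w + poly (polB b g (K h')) s = 0" using h(3) by simp
  show "[:- s, 1:] ^ 3 dvd discP a b f g (K h')" unfolding c K_smult discP_smult by (rule dvd_smult[OF h(4)])
 qed
 obtain W' su sv pu pv qu qv where G: "W' \<subseteq> W" "0 \<in> W'" "holo2 (%w. (N *v \<phi> w) $ 2) W'" "ALL w:W'. (N *v \<phi> w) $ 2 ~= 0"
  "(N *v \<phi> 0) $ 1 / (N *v \<phi> 0) $ 2 = s" "(N *v \<phi> 0) $ 3 / (N *v \<phi> 0) $ 2 = w" "(N *v \<phi> 0) $ 4 / (N *v \<phi> 0) $ 2 = v"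
  and germ: "bundle_germ a b f g W' (%w. (N *v \<phi> w) $ 1 / (N *v \<phi> w) $ 2) (%w. (N *v \<phi> w) $ 3 / (N *v \<phi> w) $ 2) (%w. (N *v \<phi> w) $ 4 / (N *v \<phi> w) $ 2) su sv pu pv qu qv"
  by (insert chart_germ[OF chart refl], elim exE conjE, rule that, assumption+)
 interpret G: bundle_germ a b f g "K h'" W' "%w. (N *v \<phi> w) $ 1 / (N *v \<phi> w) $ 2" "%w. (N *v \<phi> w) $ 3 / (N *v \<phi> w) $ 2" "%w. (N *v \<phi> w) $ 4 / (N *v \<phi> w) $ 2" su sv pu pv qu qv
  by (rule germ)
 have sect: "G.sect z = inverse ((N *v \<phi> z) $ 2) * dpair h' (\<phi> z)" if "z \<in> W'" for z
  unfolding G.sect_def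
 proof (rule germ_section)
  show "(N *v \<phi> z) $ 2 ~= 0" using G(4) that by blast
  have "\<phi> z \<in> acone S" using chart that G(1) unfolding local_chart_def acone_def by blast
  then show "(N *v \<phi> z) $ 0 * (N *v \<phi> z) $ 2 = (N *v \<phi> z) $ 1 ^ 2" by (simp add: acone_S conic_form_def)
 qed
 have c: "holo2 (%z. inverse ((N *v \<phi> z) $ 2)) W'" "inverse ((N *v \<phi> 0) $ 2) ~= 0"
  using holo2_inverse[OF G(3)] G(2,4) by auto
 show False
 proof (rule G.triple_root_not_node[OF c])
  show "G.sect (u, v) = inverse ((N *v \<phi> (u, v)) $ 2) * (u * v)" if "(u, v) \<in> W'" for u v
   using sect[OF that] eq G(1) that by auto
  show "G.mfun 0 ~= 0" using m by (simp add: G.mfun_def G)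
 qed (use k in \<open>simp_all add: G\<close>)
qed

text \<open>At a point with y = 0 the linear parts of y0, y1, y2 along any line again satisfy y0 y2
  = y1^2, so some direction of the chart is tangent to y = 0.\<close>

lemma vertex_chart_direction:
 assumes chart: "local_chart S p W \<phi>" and p: "p = pt (M *v z)" and z: "z ~= 0" "z $ 0 = 0" "z $ 1 = 0" "z $ 2 = 0"
 defines "\<zeta> \<equiv> %i w. (N *v \<phi> w) $ i"
 obtains A A' c x y where "c ~= 0" "N *v \<phi> 0 = c *s z" "!!i. cdiff2 (\<zeta> i) 0 (A $ i) (A' $ i)" "!!i. holo2 (\<zeta> i) W"
  "!!\<alpha> \<beta> \<gamma>. \<alpha> *s z + \<beta> *s A + \<gamma> *s A' = 0 ==> \<alpha> = 0 & \<beta> = 0 & \<gamma> = 0"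
  "!!x y. (x * A $ 0 + y * A' $ 0) * (x * A $ 2 + y * A' $ 2) = (x * A $ 1 + y * A' $ 1) ^ 2"
  "x ~= 0 | y ~= 0" "x * A $ 0 + y * A' $ 0 = 0" "x * A $ 1 + y * A' $ 1 = 0" "x * A $ 2 + y * A' $ 2 = 0"
proof -
 from chart have W: "open W" "0 \<in> W" "holomorphic2_on \<phi> W" and onS: "ALL w:W. \<phi> w ~= 0 & pt (\<phi> w) \<in> S" and p0: "pt (\<phi> 0) = p"
  unfolding local_chart_def by blast+
 from chart obtain B B' where d: "(\<phi> has_derivative (%(s, t). s *s B + t *s B')) (at 0)" and dim: "vec.dim {\<phi> 0, B, B'} = 3"
  unfolding local_chart_def by blast
 define A A' where "A = N *v B" and "A' = N *v B'"
 have h\<zeta>: "holo2 (\<zeta> i) W" for i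
  unfolding \<zeta>_def by (rule holomorphic2_on_nth[OF holomorphic2_on_matrix[OF W(3)]])
 have d\<zeta>: "cdiff2 (\<zeta> i) 0 (A $ i) (A' $ i)" for i
  unfolding \<zeta>_def A_def A'_def by (rule has_derivative_nth[OF has_derivative_matrix[OF d]])
 have "\<phi> 0 ~= 0" using onS W(2) by blast
 then obtain c where c: "c ~= 0" "\<phi> 0 = c *s (M *v z)"
  using pt_eq_iff[of "M *v z" "\<phi> 0"] p0 p z(1) by auto
 have N0: "N *v \<phi> 0 = c *s z" by (simp add: c vector_scalar_commute)
 have ind: "\<alpha> = 0 & \<beta> = 0 & \<gamma> = 0" if 0: "\<alpha> *s z + \<beta> *s A + \<gamma> *s A' = 0" for \<alpha> \<beta> \<gamma>
 proof -
  have "M *v (\<alpha> *s z + \<beta> *s A + \<gamma> *s A') = 0" using 0 by simp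
  then have "\<alpha> *s (M *v z) + \<beta> *s B + \<gamma> *s B' = 0"
   by (simp add: matrix_linear A_def A'_def del: M_nonzero)
  then have "(\<alpha> / c) *s \<phi> 0 + \<beta> *s B + \<gamma> *s B' = 0" using c by simp
  then show ?thesis using dim c(1) unfolding dim3_iff by (metis divide_eq_0_iff)
 qed
 have \<zeta>0: "\<zeta> 0 0 = 0" "\<zeta> 1 0 = 0" "\<zeta> 2 0 = 0" using N0 z by (simp_all add: \<zeta>_def)
 have conic: "(x * A $ 0 + y * A' $ 0) * (x * A $ 2 + y * A' $ 2) = (x * A $ 1 + y * A' $ 1) ^ 2" for x y
 proof -
  let ?l = "%i \<tau>. \<zeta> i (\<tau> * x, \<tau> * y)"
  have ev: "\<forall>\<^sub>F \<tau> in at 0. ?l 0 \<tau> * ?l 2 \<tau> = ?l 1 \<tau> ^ 2"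
  proof (rule eventually_line[OF W(1,2), of "%w. \<zeta> 0 w * \<zeta> 2 w = \<zeta> 1 w ^ 2"])
   fix w assume "w \<in> W"
   then have "conic_form (N *v \<phi> w) = 0" using onS acone_S[of "\<phi> w"] by (simp add: acone_def)
   then show "\<zeta> 0 w * \<zeta> 2 w = \<zeta> 1 w ^ 2" by (simp add: conic_form_def \<zeta>_def)
  qed
  have 1: "((%\<tau>. (?l 0 \<tau> / \<tau>) * (?l 2 \<tau> / \<tau>)) \<longlongrightarrow> (x * A $ 0 + y * A' $ 0) * (x * A $ 2 + y * A' $ 2)) (at 0)"
   by (intro tendsto_intros line_tendsto d\<zeta> \<zeta>0)
  have 2: "((%\<tau>. (?l 1 \<tau> / \<tau>) ^ 2) \<longlongrightarrow> (x * A $ 1 + y * A' $ 1) ^ 2) (at 0)"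
   by (intro tendsto_intros line_tendsto d\<zeta> \<zeta>0)
  have "\<forall>\<^sub>F \<tau> in at 0. (?l 0 \<tau> / \<tau>) * (?l 2 \<tau> / \<tau>) = (?l 1 \<tau> / \<tau>) ^ 2"
   using ev by eventually_elim (simp add: power_divide power2_eq_square)
  from LIM_unique[OF Lim_transform_eventually[OF 1 this] 2] show ?thesis .
 qed
 have "EX x y. (x ~= 0 | y ~= 0) & x * A $ 0 + y * A' $ 0 = 0 & x * A $ 1 + y * A' $ 1 = 0 & x * A $ 2 + y * A' $ 2 = 0"
  by (rule conic_direction) (rule conic)
 then obtain x y where "x ~= 0 | y ~= 0" "x * A $ 0 + y * A' $ 0 = 0" "x * A $ 1 + y * A' $ 1 = 0" "x * A $ 2 + y * A' $ 2 = 0" by blast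
 then show ?thesis by (intro that[OF c(1) N0 d\<zeta> h\<zeta> ind conic])
qed

end

lemma quadric_double_factor:
 fixes g0 g1 g2 :: complex
 assumes "g1 ^ 2 = 4 * g0 * g2" "g0 ~= 0 | g1 ~= 0 | g2 ~= 0"
 shows "EX c p q. c ~= 0 & g0 = c * p ^ 2 & g1 = 2 * c * p * q & g2 = c * q ^ 2"
proof (cases "g0 = 0")
 case True
 then show ?thesis using assms by (intro exI[of _ g2] exI[of _ 0] exI[of _ 1]) auto
next
 case False
 then show ?thesis using assms(1)
  by (intro exI[of _ g0] exI[of _ 1] exI[of _ "g1 / (2 * g0)"]) (simp add: field_simps power2_eq_square)
qed

text \<open>g has two distinct zeros on the conic, one of them possibly at infinity. As they are
  simple and g does not divide f, one of them is not a zero of f; it is taken as c and the other as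
  d.\<close>

lemma quadric_distinct_points:
 fixes g0 g1 g2 f0 f1 f2 f3 f4 :: complex
 assumes disc: "g1 ^ 2 ~= 4 * g0 * g2"
  and nd: "!!p q r. \<not> (f0 = g0 * p & f1 = g0 * q + g1 * p & f2 = g0 * r + g1 * q + g2 * p & f3 = g1 * r + g2 * q & f4 = g2 * r)"
 shows "EX c0 c1 c2 d0 d1 d2. c0 * c2 = c1 ^ 2 & d0 * d2 = d1 ^ 2 & g0 * c0 + g1 * c1 + g2 * c2 = 0 & g0 * d0 + g1 * d1 + g2 * d2 = 0 &
  f0 * c0 ^ 2 + f1 * c0 * c1 + f2 * c1 ^ 2 + f3 * c1 * c2 + f4 * c2 ^ 2 ~= 0 &
  (ALL \<alpha> \<beta>. \<alpha> * c0 + \<beta> * d0 = 0 --> \<alpha> * c1 + \<beta> * d1 = 0 --> \<alpha> * c2 + \<beta> * d2 = 0 --> \<alpha> = 0 & \<beta> = 0)"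
proof (cases "g0 = 0")
 case True
 then have g1: "g1 ~= 0" using disc by auto
 define r where "r = - g2 / g1"
 have r: "g1 * r = - g2" using g1 by (simp add: r_def)
 show ?thesis
 proof (cases "f0 = 0")
  case False
  show ?thesis
   by (rule exI[of _ 1], rule exI[of _ 0], rule exI[of _ 0], rule exI[of _ "r ^ 2"], rule exI[of _ r], rule exI[of _ 1])
    (use False True r in \<open>auto simp: power2_eq_square algebra_simps\<close>)
 next
  case f0: True
  have F: "f0 * (r ^ 2) ^ 2 + f1 * r ^ 2 * r + f2 * r ^ 2 + f3 * r * 1 + f4 * 1 ^ 2 ~= 0"
  proof
   assume z: "f0 * (r ^ 2) ^ 2 + f1 * r ^ 2 * r + f2 * r ^ 2 + f3 * r * 1 + f4 * 1 ^ 2 = 0"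
   define p where "p = f1 / g1"
   define q where "q = (f2 - g2 * p) / g1"
   define t where "t = (f3 - g2 * q) / g1"
   have 1: "f1 = g1 * p" "f2 = g1 * q + g2 * p" "f3 = g1 * t + g2 * q" using g1 by (simp_all add: p_def q_def t_def)
   have "f1 * r ^ 2 * r + f2 * r ^ 2 + f3 * r + f4 = (g1 * r + g2) * (p * r ^ 2 + q * r + t) + (f4 - g2 * t)"
    unfolding 1 by (simp add: alg_simps2)
   moreover have "f1 * r ^ 2 * r + f2 * r ^ 2 + f3 * r + f4 = 0" using z f0 by simp
   moreover have "g1 * r + g2 = 0" using r by simp
   ultimately have "f4 = g2 * t" by simp
   then show False using nd[of p q t] 1 True f0 by simp
  qed
  show ?thesis
   by (rule exI[of _ "r ^ 2"], rule exI[of _ r], rule exI[of _ 1], rule exI[of _ 1], rule exI[of _ 0], rule exI[of _ 0])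
    (use F True r in \<open>auto simp: power2_eq_square algebra_simps\<close>)
 qed
next
 case False
 define d where "d = csqrt (g1 ^ 2 - 4 * g0 * g2)"
 have d: "d * d = g1 ^ 2 - 4 * g0 * g2" "d ~= 0" using disc by (simp_all add: d_def power2_eq_square[symmetric])
 define r where "r \<epsilon> = (- g1 + \<epsilon> * d) / (2 * g0)" for \<epsilon> :: complex
 have root: "g0 * r \<epsilon> ^ 2 + g1 * r \<epsilon> + g2 = 0" if "\<epsilon> * \<epsilon> = 1" for \<epsilon>
 proof -
  have "4 * g0 * (g0 * r \<epsilon> ^ 2 + g1 * r \<epsilon> + g2) = (2 * g0 * r \<epsilon> + g1) ^ 2 - (g1 ^ 2 - 4 * g0 * g2)"
   by (simp add: alg_simps2)
  also have "2 * g0 * r \<epsilon> + g1 = \<epsilon> * d" using False by (simp add: r_def)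
  also have "(\<epsilon> * d) ^ 2 = (\<epsilon> * \<epsilon>) * (d * d)" by (simp add: power2_eq_square mult_ac)
  finally show ?thesis using False that d(1) by simp
 qed
 have ne: "r 1 ~= r (- 1)" using d(2) False by (simp add: r_def)
 let ?F = "%r. f0 * (r ^ 2) ^ 2 + f1 * r ^ 2 * r + f2 * r ^ 2 + f3 * r * 1 + f4 * 1 ^ 2"
 have dj: "?F (r 1) ~= 0 | ?F (r (- 1)) ~= 0"
 proof (rule ccontr)
  assume z: "\<not> ?thesis"
  define p where "p = f0 / g0"
  define q where "q = (f1 - g1 * p) / g0"
  define t where "t = (f2 - g1 * q - g2 * p) / g0"
  have 1: "f0 = g0 * p" "f1 = g0 * q + g1 * p" "f2 = g0 * t + g1 * q + g2 * p" using False by (simp_all add: p_def q_def t_def)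
  have div: "?F r = (g0 * r ^ 2 + g1 * r + g2) * (p * r ^ 2 + q * r + t) + (f3 - g1 * t - g2 * q) * r + (f4 - g2 * t)" for r
   unfolding 1 by (simp add: alg_simps2)
  have lin: "(f3 - g1 * t - g2 * q) * r 1 + (f4 - g2 * t) = 0" "(f3 - g1 * t - g2 * q) * r (- 1) + (f4 - g2 * t) = 0"
   using z div[of "r 1"] div[of "r (- 1)"] root[of 1] root[of "- 1"] by simp_all
  have "(f3 - g1 * t - g2 * q) * (r 1 - r (- 1)) = ((f3 - g1 * t - g2 * q) * r 1 + (f4 - g2 * t)) - ((f3 - g1 * t - g2 * q) * r (- 1) + (f4 - g2 * t))"
   by (simp add: algebra_simps)
  then have 2: "f3 - g1 * t - g2 * q = 0" unfolding lin using ne by simp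
  then have "f4 - g2 * t = 0" using lin(1) by simp
  then have "f4 = g2 * t" "f3 = g1 * t + g2 * q" using 2 by (simp_all add: algebra_simps)
  then show False using nd[of p q t] 1 by blast
 qed
 have mk: "EX c0 c1 c2 d0 d1 d2. c0 * c2 = c1 ^ 2 & d0 * d2 = d1 ^ 2 & g0 * c0 + g1 * c1 + g2 * c2 = 0 & g0 * d0 + g1 * d1 + g2 * d2 = 0 &
  f0 * c0 ^ 2 + f1 * c0 * c1 + f2 * c1 ^ 2 + f3 * c1 * c2 + f4 * c2 ^ 2 ~= 0 &
  (ALL \<alpha> \<beta>. \<alpha> * c0 + \<beta> * d0 = 0 --> \<alpha> * c1 + \<beta> * d1 = 0 --> \<alpha> * c2 + \<beta> * d2 = 0 --> \<alpha> = 0 & \<beta> = 0)"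
  if uv: "?F u ~= 0" "g0 * u ^ 2 + g1 * u + g2 = 0" "g0 * v ^ 2 + g1 * v + g2 = 0" "u ~= v" for u v
 proof (rule exI[of _ "u ^ 2"], rule exI[of _ u], rule exI[of _ 1], rule exI[of _ "v ^ 2"], rule exI[of _ v], rule exI[of _ 1], intro conjI allI impI)
  fix \<alpha> \<beta> assume 0: "\<alpha> * u + \<beta> * v = 0" "\<alpha> * 1 + \<beta> * 1 = 0"
  have "\<alpha> * (u - v) = (\<alpha> * u + \<beta> * v) - v * (\<alpha> * 1 + \<beta> * 1)" by (simp add: algebra_simps)
  then have "\<alpha> = 0" unfolding 0 using uv(4) by simp
  then show "\<alpha> = 0" "\<beta> = 0" using 0(2) by simp_all
 qed (use uv in simp_all)
 from dj show ?thesis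
 proof
  assume "?F (r 1) ~= 0"
  then show ?thesis by (rule mk[OF _ root root ne]) simp_all
 next
  assume "?F (r (- 1)) ~= 0"
  then show ?thesis by (rule mk[OF _ root root ne[symmetric]]) simp_all
 qed
qed

context segre_surface_form
begin

text \<open>Over a zero c of g on the conic, S contains the lines through the vertex with w1^2 = -
  f(c). Since f(c) is nonzero, there are two over c; with one over d and the vertex itself they span
  four dimensions.\<close>

lemma vertex_not_smooth:
 assumes ab: "a = 1" "b = 0" and z: "z ~= 0" "z $ 0 = 0" "z $ 1 = 0" "z $ 2 = 0" "z $ 3 = 0" and disc: "g 1 ^ 2 ~= 4 * g 0 * g 2"
 shows "pt (M *v z) \<notin> smooth_locus S"
proof -
 have z4: "z $ 4 ~= 0" using z by (simp add: vec5_eq_iff)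
 have p: "pt (M *v z) \<in> S" using mem[OF z(1)] z ab by (simp add: conic_form_def bundle_form_def)
 note T0 = tangent_base[OF p z(1)]
 have T: "M *v vec5 c0 c1 c2 \<omega> 0 \<in> tangent_cone S (pt (M *v z))"
  if c: "c0 * c2 = c1 ^ 2" "g 0 * c0 + g 1 * c1 + g 2 * c2 = 0"
   "\<omega> ^ 2 = - (f 0 * c0 ^ 2 + f 1 * c0 * c1 + f 2 * c1 ^ 2 + f 3 * c1 * c2 + f 4 * c2 ^ 2)" for c0 c1 c2 \<omega>
 proof (rule tangent_curve[of _ "%t. z + t *s vec5 c0 c1 c2 \<omega> 0"])
  have "conic_form (z + t *s vec5 c0 c1 c2 \<omega> 0) = t ^ 2 * (c0 * c2 - c1 ^ 2)" for t
   by (simp add: conic_form_def z alg_simps2)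
  moreover have "bundle_form a b f g (z + t *s vec5 c0 c1 c2 \<omega> 0) = t * z $ 4 * (g 0 * c0 + g 1 * c1 + g 2 * c2)
   - t ^ 2 * (\<omega> ^ 2 + (f 0 * c0 ^ 2 + f 1 * c0 * c1 + f 2 * c1 ^ 2 + f 3 * c1 * c2 + f 4 * c2 ^ 2))" for t
   by (simp add: bundle_form_def z ab alg_simps2)
  ultimately show "\<forall>\<^sub>F t in nhds 0. conic_form (z + t *s vec5 c0 c1 c2 \<omega> 0) = 0 & bundle_form a b f g (z + t *s vec5 c0 c1 c2 \<omega> 0) = 0"
   using c by simp
 qed (use z in \<open>auto intro!: derivative_eq_intros\<close>)
 have nd: "\<not> (f 0 = g 0 * p & f 1 = g 0 * q + g 1 * p & f 2 = g 0 * r + g 1 * q + g 2 * p & f 3 = g 1 * r + g 2 * q & f 4 = g 2 * r)" for p q r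
  using not_divides[OF ab(1)] unfolding quadric_divides_def by blast
 obtain c0 c1 c2 d0 d1 d2 where cd: "c0 * c2 = c1 ^ 2" "d0 * d2 = d1 ^ 2" "g 0 * c0 + g 1 * c1 + g 2 * c2 = 0" "g 0 * d0 + g 1 * d1 + g 2 * d2 = 0"
  "f 0 * c0 ^ 2 + f 1 * c0 * c1 + f 2 * c1 ^ 2 + f 3 * c1 * c2 + f 4 * c2 ^ 2 ~= 0"
  and ind: "ALL \<alpha> \<beta>. \<alpha> * c0 + \<beta> * d0 = 0 --> \<alpha> * c1 + \<beta> * d1 = 0 --> \<alpha> * c2 + \<beta> * d2 = 0 --> \<alpha> = 0 & \<beta> = 0"
  by (insert quadric_distinct_points[OF disc nd], elim exE conjE, rule that, assumption+)
 define \<omega> where "\<omega> = csqrt (- (f 0 * c0 ^ 2 + f 1 * c0 * c1 + f 2 * c1 ^ 2 + f 3 * c1 * c2 + f 4 * c2 ^ 2))"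
 have \<omega>: "\<omega> ^ 2 = - (f 0 * c0 ^ 2 + f 1 * c0 * c1 + f 2 * c1 ^ 2 + f 3 * c1 * c2 + f 4 * c2 ^ 2)" "\<omega> ~= 0"
  using cd(5) by (simp_all only: \<omega>_def power2_csqrt csqrt_eq_0 neg_equal_0_iff_equal not_False_eq_True)
 have \<omega>': "(- \<omega>) ^ 2 = - (f 0 * c0 ^ 2 + f 1 * c0 * c1 + f 2 * c1 ^ 2 + f 3 * c1 * c2 + f 4 * c2 ^ 2)" using \<omega>(1) by simp
 show ?thesis
 proof (rule not_smoothI[OF T0 T[OF cd(1,3) \<omega>(1)] T[OF cd(1,3) \<omega>'] T[OF cd(2,4) power2_csqrt]])
  fix \<alpha> \<beta> \<gamma> \<delta> assume 0: "\<alpha> *s z + \<beta> *s vec5 c0 c1 c2 \<omega> 0 + \<gamma> *s vec5 c0 c1 c2 (- \<omega>) 0 +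
   \<delta> *s vec5 d0 d1 d2 (csqrt (- (f 0 * d0 ^ 2 + f 1 * d0 * d1 + f 2 * d1 ^ 2 + f 3 * d1 * d2 + f 4 * d2 ^ 2))) 0 = 0"
  have "(\<beta> + \<gamma>) * c0 + \<delta> * d0 = 0" "(\<beta> + \<gamma>) * c1 + \<delta> * d1 = 0" "(\<beta> + \<gamma>) * c2 + \<delta> * d2 = 0"
   using 0 by (simp_all add: vec5_eq_iff z algebra_simps)
  then have 1: "\<beta> + \<gamma> = 0" "\<delta> = 0" using ind by blast+
  have "\<omega> * (\<beta> - \<gamma>) = 0" using 0 1 by (simp add: vec5_eq_iff z algebra_simps)
  then have "\<beta> = \<gamma>" using \<omega>(2) by simp
  moreover have "\<alpha> = 0" using 0 z4 by (simp add: vec5_eq_iff)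
  ultimately show "\<alpha> = 0 & \<beta> = 0 & \<gamma> = 0 & \<delta> = 0" using 1 by simp
 qed
qed

text \<open>Some direction of the chart kills the derivatives of the first three coordinates. For a
  = 0 the linearized surface equation makes its derivative proportional to the vertex, against
  immersivity. For a = 1 the linear part only constrains the first three coordinates, and the
  surface equation is compared at third order.\<close>

lemma vertex_no_chart:
 assumes sm: "pt (M *v z) \<in> smooth_locus S" and z: "z ~= 0" "z $ 0 = 0" "z $ 1 = 0" "z $ 2 = 0"
 shows "\<not> local_chart S (pt (M *v z)) W \<phi>"
proof
 assume chart: "local_chart S (pt (M *v z)) W \<phi>"
 have pS: "pt (M *v z) \<in> S" using sm by (simp add: smooth_locus_iff)
 have z34: "b * z $ 3 * z $ 4 = a * z $ 3 ^ 2" using mem[OF z(1)] pS z by (simp add: bundle_form_def algebra_simps)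
 from chart have W: "open W" "0 \<in> W" and onS: "ALL w:W. \<phi> w ~= 0 & pt (\<phi> w) \<in> S"
  unfolding local_chart_def by blast+
 define \<zeta> where "\<zeta> = (%i w. (N *v \<phi> w) $ i)"
 obtain A A' c x y where c: "c ~= 0" "N *v \<phi> 0 = c *s z" and d\<zeta>: "!!i. cdiff2 (\<zeta> i) 0 (A $ i) (A' $ i)" and h\<zeta>: "!!i. holo2 (\<zeta> i) W"
  and ind: "!!\<alpha> \<beta> \<gamma>. \<alpha> *s z + \<beta> *s A + \<gamma> *s A' = 0 ==> \<alpha> = 0 & \<beta> = 0 & \<gamma> = 0"
  and con: "!!x y. (x * A $ 0 + y * A' $ 0) * (x * A $ 2 + y * A' $ 2) = (x * A $ 1 + y * A' $ 1) ^ 2"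
  and xy: "x ~= 0 | y ~= 0" "x * A $ 0 + y * A' $ 0 = 0" "x * A $ 1 + y * A' $ 1 = 0" "x * A $ 2 + y * A' $ 2 = 0"
  unfolding \<zeta>_def by (rule vertex_chart_direction[OF chart refl z]) (rule that[unfolded \<zeta>_def], assumption+)
 have \<zeta>0: "\<zeta> i 0 = c * z $ i" for i using c(2) by (simp add: \<zeta>_def)
 have ind2: False if "u ~= 0 | v ~= 0" "u * A $ 0 + v * A' $ 0 = 0" "u * A $ 1 + v * A' $ 1 = 0" "u * A $ 2 + v * A' $ 2 = 0"
  "u * A $ 3 + v * A' $ 3 = t * z $ 3" "u * A $ 4 + v * A' $ 4 = t * z $ 4" for u v t
 proof -
  have "(- t) *s z + u *s A + v *s A' = 0"
  proof -
   have "(- t) *s z + u *s A + v *s A' = (u *s A + v *s A') - t *s z"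
    by (simp add: cvec_eq_iff)
   moreover have "u *s A + v *s A' = t *s z" using that(2-) z by (simp add: vec5_eq_iff)
   ultimately show ?thesis by simp
  qed
  from ind[OF this] that(1) show False by blast
 qed
 define Qf where "Qf w = f 0 * (\<zeta> 0 w * \<zeta> 0 w) + f 1 * (\<zeta> 0 w * \<zeta> 1 w) + f 2 * (\<zeta> 1 w * \<zeta> 1 w) + f 3 * (\<zeta> 1 w * \<zeta> 2 w) + f 4 * (\<zeta> 2 w * \<zeta> 2 w)" for w
 define Gz where "Gz w = g 0 * \<zeta> 0 w + g 1 * \<zeta> 1 w + g 2 * \<zeta> 2 w" for w
 have S: "\<zeta> 0 w * \<zeta> 2 w = \<zeta> 1 w ^ 2" "\<zeta> 4 w * (b * \<zeta> 3 w + Gz w) = a * (\<zeta> 3 w * \<zeta> 3 w) + Qf w" if "w \<in> W" for w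
 proof -
  have "conic_form (N *v \<phi> w) = 0" "bundle_form a b f g (N *v \<phi> w) = 0" using onS that acone_S[of "\<phi> w"] by (simp_all add: acone_def)
  then show "\<zeta> 0 w * \<zeta> 2 w = \<zeta> 1 w ^ 2" "\<zeta> 4 w * (b * \<zeta> 3 w + Gz w) = a * (\<zeta> 3 w * \<zeta> 3 w) + Qf w"
   by (simp_all add: conic_form_def bundle_form_def \<zeta>_def Gz_def Qf_def power2_eq_square algebra_simps)
 qed
 note m0 = cdiff2_mult[OF cdiff2_const cdiff2_mult[OF d\<zeta> d\<zeta>]]
 have dQf: "cdiff2 Qf 0 0 0"
  using cdiff2_add[OF cdiff2_add[OF cdiff2_add[OF cdiff2_add[OF m0[of "f 0" 0 0] m0[of "f 1" 0 1]] m0[of "f 2" 1 1]] m0[of "f 3" 1 2]] m0[of "f 4" 2 2]]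
  unfolding Qf_def[abs_def] by (simp add: \<zeta>0 z)
 note l0 = cdiff2_mult[OF cdiff2_const d\<zeta>]
 have dGz: "cdiff2 Gz 0 (g 0 * A $ 0 + g 1 * A $ 1 + g 2 * A $ 2) (g 0 * A' $ 0 + g 1 * A' $ 1 + g 2 * A' $ 2)"
  using cdiff2_add[OF cdiff2_add[OF l0[of "g 0" 0] l0[of "g 1" 1]] l0[of "g 2" 2]] unfolding Gz_def[abs_def] by simp
 have L: "cdiff2 (%w. \<zeta> 4 w * (b * \<zeta> 3 w + Gz w)) 0 (a * (2 * (c * z $ 3) * A $ 3)) (a * (2 * (c * z $ 3) * A' $ 3))"
  by (rule cdiff2_cong[OF _ W, of "%w. a * (\<zeta> 3 w * \<zeta> 3 w) + Qf w"])
   (use cdiff2_add[OF m0[of a 3 3] dQf] S(2) in \<open>simp_all add: \<zeta>0 algebra_simps\<close>)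
 have G0: "Gz 0 = 0" by (simp add: Gz_def \<zeta>0 z)
 have lin: "z $ 4 * (b * A $ 3 + (g 0 * A $ 0 + g 1 * A $ 1 + g 2 * A $ 2)) + b * z $ 3 * A $ 4 = 2 * a * z $ 3 * A $ 3"
  "z $ 4 * (b * A' $ 3 + (g 0 * A' $ 0 + g 1 * A' $ 1 + g 2 * A' $ 2)) + b * z $ 3 * A' $ 4 = 2 * a * z $ 3 * A' $ 3"
 proof -
  from cdiff2_unique[OF L cdiff2_mult[OF d\<zeta>[of 4] cdiff2_add[OF l0[of b 3] dGz]]]
  have "c * (z $ 4 * (b * A $ 3 + (g 0 * A $ 0 + g 1 * A $ 1 + g 2 * A $ 2)) + b * z $ 3 * A $ 4) = c * (2 * a * z $ 3 * A $ 3)"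
   "c * (z $ 4 * (b * A' $ 3 + (g 0 * A' $ 0 + g 1 * A' $ 1 + g 2 * A' $ 2)) + b * z $ 3 * A' $ 4) = c * (2 * a * z $ 3 * A' $ 3)"
   by (simp_all add: \<zeta>0 G0 algebra_simps)
  then show "z $ 4 * (b * A $ 3 + (g 0 * A $ 0 + g 1 * A $ 1 + g 2 * A $ 2)) + b * z $ 3 * A $ 4 = 2 * a * z $ 3 * A $ 3"
   "z $ 4 * (b * A' $ 3 + (g 0 * A' $ 0 + g 1 * A' $ 1 + g 2 * A' $ 2)) + b * z $ 3 * A' $ 4 = 2 * a * z $ 3 * A' $ 3"
   using c(1) by simp_all
 qed
 show False
 proof (cases "a = 0")
  case True
  then have ab: "b = 1" "g = (%_. 0)" using type by auto
  have lin': "z $ 4 * (x * A $ 3 + y * A' $ 3) + z $ 3 * (x * A $ 4 + y * A' $ 4) = 0"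
  proof -
   have "z $ 4 * (x * A $ 3 + y * A' $ 3) + z $ 3 * (x * A $ 4 + y * A' $ 4)
    = x * (z $ 4 * A $ 3 + z $ 3 * A $ 4) + y * (z $ 4 * A' $ 3 + z $ 3 * A' $ 4)" by (simp add: algebra_simps)
   then show ?thesis using lin by (simp add: ab True)
  qed
  have "z $ 3 = 0 | z $ 4 = 0" using z34 by (simp add: ab True)
  then show False
  proof
   assume z3: "z $ 3 = 0"
   then have z4: "z $ 4 ~= 0" using z by (simp add: vec5_eq_iff)
   show False using ind2[OF xy, of "(x * A $ 4 + y * A' $ 4) / z $ 4"] lin' z3 z4 by simp
  next
   assume z4: "z $ 4 = 0"
   then have z3: "z $ 3 ~= 0" using z by (simp add: vec5_eq_iff)
   show False using ind2[OF xy, of "(x * A $ 3 + y * A' $ 3) / z $ 3"] lin' z3 z4 by simp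
  qed
 next
  case False
  then have ab: "a = 1" "b = 0" using type by auto
  have z3: "z $ 3 = 0" using z34 by (simp add: ab)
  then have z4: "z $ 4 ~= 0" using z by (simp add: vec5_eq_iff)
  \<comment> \<open>Two distinct zeros of g on the conic would make the vertex singular, so g
    restricted to the conic is a multiple of a square.\<close>
  have disc: "g 1 ^ 2 = 4 * g 0 * g 2" using vertex_not_smooth[OF ab z z3] sm by blast
  obtain \<kappa> p q where g: "\<kappa> ~= 0" "g 0 = \<kappa> * p ^ 2" "g 1 = 2 * \<kappa> * p * q" "g 2 = \<kappa> * q ^ 2"
   using quadric_double_factor[OF disc g_nonzero[OF ab(1)]] by blast
  have gA: "g 0 * A $ 0 + g 1 * A $ 1 + g 2 * A $ 2 = 0" "g 0 * A' $ 0 + g 1 * A' $ 1 + g 2 * A' $ 2 = 0"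
   using lin z4 by (simp_all add: ab z3)
  define e where "e u v i = u * A $ i + v * A' $ i" for u v i
  define fe where "fe u v = f 0 * (e u v 0 * e u v 0) + f 1 * (e u v 0 * e u v 1) + f 2 * (e u v 1 * e u v 1) + f 3 * (e u v 1 * e u v 2) + f 4 * (e u v 2 * e u v 2)" for u v
  have con': "e u v 0 * e u v 2 = e u v 1 ^ 2" for u v using con by (simp add: e_def)
  have ge: "p ^ 2 * e u v 0 + 2 * p * q * e u v 1 + q ^ 2 * e u v 2 = 0" for u v
  proof -
   have "\<kappa> * (p ^ 2 * e u v 0 + 2 * p * q * e u v 1 + q ^ 2 * e u v 2) = u * (g 0 * A $ 0 + g 1 * A $ 1 + g 2 * A $ 2) + v * (g 0 * A' $ 0 + g 1 * A' $ 1 + g 2 * A' $ 2)"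
    unfolding e_def g(2) g(3) g(4) by (simp add: algebra_simps)
   then show ?thesis using gA g(1) by simp
  qed
  \<comment> \<open>On the conic, g times y_j is \<kappa> H^2 with H linear in y. As the linear part
    of g vanishes, H vanishes to second order on every line through 0. So (w1^2 + f) y_j has order
    at least four, and its cubic part is zero.\<close>
  have key: "(e u v 3 * e u v 3 + fe u v) * e u v j = 0" if j: "j = 2 & r = p & s = q | j = 0 & r = q & s = p" for u v j r s
  proof -
   have "(r * e u v 1 + s * e u v j) ^ 2 = e u v j * (p ^ 2 * e u v 0 + 2 * p * q * e u v 1 + q ^ 2 * e u v 2)"
    using j con'[of u v] by (auto simp: power2_eq_square algebra_simps)
   then have H1: "r * e u v 1 + s * e u v j = 0" unfolding ge by simp
   let ?l = "%i \<tau>. \<zeta> i (\<tau> * u, \<tau> * v)"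
   define H where "H w = r * \<zeta> 1 w + s * \<zeta> j w" for w
   have hH: "holo2 H W" unfolding H_def by (intro holo2_intros h\<zeta>)
   have \<zeta>00: "\<zeta> 0 0 = 0" "\<zeta> 1 0 = 0" "\<zeta> 2 0 = 0" "\<zeta> 3 0 = 0" "\<zeta> j 0 = 0" using j by (auto simp: \<zeta>0 z z3)
   have dH: "cdiff2 H 0 (r * A $ 1 + s * A $ j) (r * A' $ 1 + s * A' $ j)"
    using cdiff2_add[OF l0[of r 1] l0[of s j]] unfolding H_def[abs_def] by simp
   have "cdiff2 H (0 * u, 0 * v) (r * A $ 1 + s * A $ j) (r * A' $ 1 + s * A' $ j)" using dH by (simp add: zero_prod_def)
   from cdiff2_line[OF this] have "((%\<tau>. H (\<tau> * u, \<tau> * v)) has_field_derivative 0) (at 0)"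
    using H1 by (simp add: e_def algebra_simps)
   moreover obtain R where "R > 0" "(%\<tau>. H (\<tau> * u, \<tau> * v)) holomorphic_on ball 0 R"
    by (rule holo2_line[OF W hH, of u v]) (rule that, assumption+)
   moreover have "H (0 * u, 0 * v) = 0" by (simp add: H_def \<zeta>00 zero_prod_def[symmetric])
   ultimately obtain Lm where Lm: "((%\<tau>. H (\<tau> * u, \<tau> * v) / \<tau> ^ 2) \<longlongrightarrow> Lm) (at 0)"
    using holomorphic_double_zero by blast
   have id: "(\<zeta> 3 w * \<zeta> 3 w + Qf w) * \<zeta> j w = \<zeta> 4 w * \<kappa> * H w ^ 2" if "w \<in> W" for w
   proof -
    have "\<zeta> 3 w * \<zeta> 3 w + Qf w = \<zeta> 4 w * Gz w" using S(2)[OF that] by (simp add: ab)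
    moreover have "Gz w * \<zeta> j w = \<kappa> * H w ^ 2"
     using j S(1)[OF that] unfolding Gz_def H_def g(2) g(3) g(4) by (auto simp: power2_eq_square algebra_simps)
    ultimately show ?thesis by (simp add: mult_ac)
   qed
   have t1: "((%\<tau>. ?l i \<tau> / \<tau>) \<longlongrightarrow> e u v i) (at 0)" if "\<zeta> i 0 = 0" for i
    unfolding e_def by (rule line_tendsto[OF d\<zeta> that])
   note t1' = t1[OF \<zeta>00(1)] t1[OF \<zeta>00(2)] t1[OF \<zeta>00(3)] t1[OF \<zeta>00(4)] t1[OF \<zeta>00(5)]
   have lim1: "((%\<tau>. ((?l 3 \<tau> / \<tau>) * (?l 3 \<tau> / \<tau>) + (f 0 * ((?l 0 \<tau> / \<tau>) * (?l 0 \<tau> / \<tau>)) + f 1 * ((?l 0 \<tau> / \<tau>) * (?l 1 \<tau> / \<tau>)) + f 2 * ((?l 1 \<tau> / \<tau>) * (?l 1 \<tau> / \<tau>))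
    + f 3 * ((?l 1 \<tau> / \<tau>) * (?l 2 \<tau> / \<tau>)) + f 4 * ((?l 2 \<tau> / \<tau>) * (?l 2 \<tau> / \<tau>)))) * (?l j \<tau> / \<tau>)) \<longlongrightarrow> (e u v 3 * e u v 3 + fe u v) * e u v j) (at 0)"
    unfolding fe_def by (intro tendsto_intros t1')
   have "isCont (\<zeta> 4) 0" using d\<zeta> by (rule cdiff2_continuous)
   then have lim2: "((%\<tau>. ?l 4 \<tau> * \<kappa> * (H (\<tau> * u, \<tau> * v) / \<tau> ^ 2) ^ 2 * \<tau>) \<longlongrightarrow> \<zeta> 4 0 * \<kappa> * Lm ^ 2 * 0) (at 0)"
    by (intro tendsto_intros continuous_line Lm)
   have ev: "\<forall>\<^sub>F \<tau> in at 0. (?l 3 \<tau> * ?l 3 \<tau> + Qf (\<tau> * u, \<tau> * v)) * ?l j \<tau> = ?l 4 \<tau> * \<kappa> * H (\<tau> * u, \<tau> * v) ^ 2"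
    by (rule eventually_line[OF W, of "%w. (\<zeta> 3 w * \<zeta> 3 w + Qf w) * \<zeta> j w = \<zeta> 4 w * \<kappa> * H w ^ 2"]) (rule id)
   have "\<forall>\<^sub>F \<tau> in at 0. ((?l 3 \<tau> / \<tau>) * (?l 3 \<tau> / \<tau>) + (f 0 * ((?l 0 \<tau> / \<tau>) * (?l 0 \<tau> / \<tau>)) + f 1 * ((?l 0 \<tau> / \<tau>) * (?l 1 \<tau> / \<tau>)) + f 2 * ((?l 1 \<tau> / \<tau>) * (?l 1 \<tau> / \<tau>))
    + f 3 * ((?l 1 \<tau> / \<tau>) * (?l 2 \<tau> / \<tau>)) + f 4 * ((?l 2 \<tau> / \<tau>) * (?l 2 \<tau> / \<tau>)))) * (?l j \<tau> / \<tau>)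
    = ?l 4 \<tau> * \<kappa> * (H (\<tau> * u, \<tau> * v) / \<tau> ^ 2) ^ 2 * \<tau>"
    using ev eventually_neq_at_within[of 0 0 UNIV]
   proof eventually_elim
    case (elim \<tau>)
    have "?l 4 \<tau> * \<kappa> * (H (\<tau> * u, \<tau> * v) / \<tau> ^ 2) ^ 2 * \<tau> = (?l 4 \<tau> * \<kappa> * H (\<tau> * u, \<tau> * v) ^ 2) / (\<tau> * \<tau> * \<tau>)"
     using elim(2) by (simp add: power2_eq_square mult.assoc)
    then have r: "?l 4 \<tau> * \<kappa> * (H (\<tau> * u, \<tau> * v) / \<tau> ^ 2) ^ 2 * \<tau> = ((?l 3 \<tau> * ?l 3 \<tau> + Qf (\<tau> * u, \<tau> * v)) * ?l j \<tau>) / (\<tau> * \<tau> * \<tau>)"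
     unfolding elim(1) using elim(2) by (simp add: power2_eq_square)
    then show ?case unfolding r Qf_def by (simp only: divide_inverse inverse_mult_distrib) (simp add: algebra_simps)
   qed
   from LIM_unique[OF Lim_transform_eventually[OF lim1 this] lim2] show ?thesis by simp
  qed
  have key2: "e u v 0 = 0 & e u v 2 = 0 | e u v 3 * e u v 3 + fe u v = 0" for u v
   using key[of 2 p q u v] key[of 0 q p u v] by auto
  have e3: "e x y 3 ~= 0"
  proof
   assume "e x y 3 = 0"
   then show False
    by (intro ind2[OF xy, of "e x y 4 / z $ 4"]) (use z4 z3 in \<open>simp_all add: e_def\<close>)
  qed
  have e0: "e x y 0 = 0" "e x y 1 = 0" "e x y 2 = 0" using xy by (simp_all add: e_def)
  obtain u v where uv: "x * v - y * u ~= 0"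
  proof (cases "x = 0")
   case True
   then show ?thesis using xy(1) that[of 0 1] by simp
  next
   case False
   then show ?thesis using that[of 1 0] by simp
  qed
  show False
  proof (cases "e u v 0 = 0 & e u v 2 = 0")
   case True
   then have e1: "e u v 1 = 0" using con'[of u v] by simp
   \<comment> \<open>The combination of the two directions whose w1-derivative vanishes too; its
     derivative is then a multiple of the vertex.\<close>
   let ?u = "e x y 3 * u - e u v 3 * x" and ?v = "e x y 3 * v - e u v 3 * y"
   have "x * ?v - y * ?u = e x y 3 * (x * v - y * u)" by (simp add: algebra_simps)
   then have nz: "?u ~= 0 | ?v ~= 0" using uv e3 by auto
   have comp: "?u * A $ i + ?v * A' $ i = e x y 3 * e u v i - e u v 3 * e x y i" for i by (simp add: e_def algebra_simps)
   show False using ind2[OF nz, of "(e x y 3 * e u v 4 - e u v 3 * e x y 4) / z $ 4"] unfolding comp using e0 e1 True z4 z3 by (simp add: mult.commute)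
  next
   case False
   have comp: "e (u + t * x) (v + t * y) i = e u v i + t * e x y i" for t i by (simp add: e_def algebra_simps)
   have f: "fe (u + t * x) (v + t * y) = fe u v" for t unfolding fe_def comp e0 by simp
   \<comment> \<open>Adding t times the direction (x, y) changes only \<open>e u v 3\<close> in the
     relation, which therefore holds for all t. The second difference over t = 1, -1, 0 isolates
     twice the square of \<open>e x y 3\<close>, which is nonzero.\<close>
   have q: "(e u v 3 + t * e x y 3) * (e u v 3 + t * e x y 3) + fe u v = 0" for t
    using key2[of "u + t * x" "v + t * y"] False unfolding comp f e0 by simp
   have "2 * (e x y 3 * e x y 3) = ((e u v 3 + 1 * e x y 3) * (e u v 3 + 1 * e x y 3) + fe u v) + ((e u v 3 + (- 1) * e x y 3) * (e u v 3 + (- 1) * e x y 3) + fe u v)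
    - 2 * ((e u v 3 + 0 * e x y 3) * (e u v 3 + 0 * e x y 3) + fe u v)" by (simp add: algebra_simps)
   then show False unfolding q using e3 by simp
  qed
 qed
qed

lemma cusp_not_vertex:
 assumes "pt (M *v z) \<in> smooth_locus S" "ordinary_cusp_at S (pt (M *v z)) H" "z ~= 0"
 shows "z $ 0 ~= 0 | z $ 1 ~= 0 | z $ 2 ~= 0"
 using vertex_no_chart[OF assms(1,3)] assms(2)
 unfolding ordinary_cusp_at_def section_has_local_equation_def by blast

end

section \<open>The hyperplane with a cusp at a given point\<close>

lemma cancel_diff: "c ~= 0 ==> c * (x - y) = 0 ==> x = (y :: complex)"
 by simp

abbreviation pd :: "complex poly => complex poly" where "pd \<equiv> pderiv"

lemma linear_factor_jets:
 assumes "p = [:- s, 1:] * (r :: complex poly)"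
 shows "poly p s = 0" "poly (pd p) s = poly r s" "poly (pd (pd p)) s = 2 * poly (pd r) s"
  "poly (pd (pd (pd p))) s = 3 * poly (pd (pd r)) s"
proof -
 have l: "pd ([:- s, 1:] * r) = r + [:- s, 1:] * pd r" for r
  by (simp only: pderiv_mult pderiv_pCons pderiv_0 pderiv_1) (simp add: algebra_simps)
 show "poly p s = 0" using assms by simp
 show "poly (pd p) s = poly r s" unfolding assms l by simp
 have 2: "pd (pd p) = 2 * pd r + [:- s, 1:] * pd (pd r)" unfolding assms l pderiv_add by (simp only: mult_2 add.assoc)
 then show "poly (pd (pd p)) s = 2 * poly (pd r) s" by simp
 have "pd (pd (pd p)) = 2 * pd (pd r) + (pd (pd r) + [:- s, 1:] * pd (pd (pd r)))"
  unfolding assms l pderiv_add by (simp only: mult_2 add.assoc)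
 then show "poly (pd (pd (pd p))) s = 3 * poly (pd (pd r)) s" by simp
qed

lemma triple_root_jets:
 assumes "[:- s, 1:] ^ 3 dvd (p :: complex poly)"
 shows "poly p s = 0" "poly (pd p) s = 0" "poly (pd (pd p)) s = 0"
proof -
 obtain q where "p = [:- s, 1:] ^ 3 * q" using assms by (auto simp: dvd_def)
 then have p: "p = [:- s, 1:] * ([:- s, 1:] * ([:- s, 1:] * q))" by (simp only: power3_eq_cube mult.assoc)
 note 1 = linear_factor_jets[OF p] and 2 = linear_factor_jets[OF refl, of s "[:- s, 1:] * q"]
 show "poly p s = 0" "poly (pd p) s = 0" "poly (pd (pd p)) s = 0" using 1(1-3) 2(1,2) by simp_all
qed

lemma triple_rootI:
 assumes "poly p s = 0" "poly (pd p) s = 0" "poly (pd (pd p)) s = 0"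
 shows "EX q. p = [:- s, 1:] ^ 3 * (q :: complex poly) & 6 * poly q s = poly (pd (pd (pd p))) s"
proof -
 obtain r where r: "p = [:- s, 1:] * r" using poly_root_factor[OF assms(1)] by blast
 note 1 = linear_factor_jets[OF r]
 have "poly r s = 0" using 1 assms by simp
 then obtain t where t: "r = [:- s, 1:] * t" using poly_root_factor by blast
 note 2 = linear_factor_jets[OF t]
 have "poly t s = 0" using 1 2 assms by simp
 then obtain q where q: "t = [:- s, 1:] * q" using poly_root_factor by blast
 note 3 = linear_factor_jets[OF q]
 show ?thesis
 proof (intro exI[of _ q] conjI)
  show "p = [:- s, 1:] ^ 3 * q" unfolding r t q by (simp only: power3_eq_cube mult.assoc)
  show "6 * poly q s = poly (pd (pd (pd p))) s" using 1 2 3 by simp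
 qed
qed

lemma pd3_quadratic [simp]: "pd (pd (pd (baseP k))) = 0" "pd (pd (pd (quadricP g))) = 0"
 by (simp_all add: baseP_def quadricP_def pderiv_pCons)

lemma disc_jets:
 fixes a b f g k s
 defines "A0 \<equiv> poly (baseP k) s" and "A1 \<equiv> poly (pd (baseP k)) s" and "A2 \<equiv> poly (pd (pd (baseP k))) s"
  and "G0 \<equiv> poly (quadricP g) s" and "G1 \<equiv> poly (pd (quadricP g)) s" and "G2 \<equiv> poly (pd (pd (quadricP g))) s"
  and "F0 \<equiv> poly (quarticP f) s" and "F1 \<equiv> poly (pd (quarticP f)) s" and "F2 \<equiv> poly (pd (pd (quarticP f))) s"
  and "F3 \<equiv> poly (pd (pd (pd (quarticP f)))) s" and "D \<equiv> discP a b f g k" and "\<kappa> \<equiv> kap a b k"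
 shows "poly (polB b g k) s = b * A0 + k $ 3 * G0"
  "poly D s = (b * A0 + k $ 3 * G0) ^ 2 - 4 * \<kappa> * (G0 * A0 + k $ 4 * F0)"
  "poly (pd D) s = 2 * (b * A0 + k $ 3 * G0) * (b * A1 + k $ 3 * G1) - 4 * \<kappa> * (G1 * A0 + G0 * A1 + k $ 4 * F1)"
  "poly (pd (pd D)) s = 2 * (b * A1 + k $ 3 * G1) ^ 2 + 2 * (b * A0 + k $ 3 * G0) * (b * A2 + k $ 3 * G2)
   - 4 * \<kappa> * (G2 * A0 + 2 * G1 * A1 + G0 * A2 + k $ 4 * F2)"
  "poly (pd (pd (pd D))) s = 6 * (b * A1 + k $ 3 * G1) * (b * A2 + k $ 3 * G2) - 4 * \<kappa> * (3 * G2 * A1 + 3 * G1 * A2 + k $ 4 * F3)"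
 unfolding assms discP_def polB_def polC_def power2_eq_square
 by (simp_all add: pderiv_diff pderiv_add pderiv_smult pderiv_mult algebra_simps)

lemma baseP_jets:
 "poly (baseP k) s = k $ 0 * s ^ 2 + k $ 1 * s + k $ 2" "poly (pd (baseP k)) s = 2 * k $ 0 * s + k $ 1"
 "poly (pd (pd (baseP k))) s = 2 * k $ 0"
 by (simp_all add: baseP_def pderiv_pCons alg_simps2)

text \<open>The base polynomial of this vector is \<alpha> + \<beta> (x - s) + \<gamma> (x - s)^2,
  so its value and derivatives at s can be prescribed.\<close>

definition kvec :: "complex => complex => complex => complex => complex => complex => complex ^ 5" where
 "kvec s \<alpha> \<beta> \<gamma> t u = vec5 \<gamma> (\<beta> - 2 * s * \<gamma>) (\<alpha> - \<beta> * s + \<gamma> * s ^ 2) t u"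

lemma kvec_jets:
 "poly (baseP (kvec s \<alpha> \<beta> \<gamma> t u)) s = \<alpha>" "poly (pd (baseP (kvec s \<alpha> \<beta> \<gamma> t u))) s = \<beta>"
 "poly (pd (pd (baseP (kvec s \<alpha> \<beta> \<gamma> t u)))) s = 2 * \<gamma>" "kvec s \<alpha> \<beta> \<gamma> t u $ 3 = t" "kvec s \<alpha> \<beta> \<gamma> t u $ 4 = u"
 by (simp_all add: baseP_jets kvec_def alg_simps2)

lemma kvec_eqI:
 assumes "poly (baseP k) s = c * \<alpha>" "poly (pd (baseP k)) s = c * \<beta>" "poly (pd (pd (baseP k))) s = c * (2 * \<gamma>)" "k $ 3 = c * t" "k $ 4 = c * u"
 shows "k = c *s kvec s \<alpha> \<beta> \<gamma> t u"
proof -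
 have 0: "k $ 0 = c * \<gamma>" using assms(3) by (simp add: baseP_jets)
 have 1: "k $ 1 = c * \<beta> - 2 * s * (c * \<gamma>)" using assms(2) by (simp add: baseP_jets 0 algebra_simps)
 have 2: "k $ 2 = c * \<alpha> - (c * \<gamma> * s ^ 2 + (c * \<beta> - 2 * s * (c * \<gamma>)) * s)" using assms(1) by (simp add: baseP_jets 0 1 algebra_simps)
 show ?thesis using assms(4,5) by (simp add: vec5_eq_iff kvec_def 0 1 2 alg_simps2)
qed

text \<open>The solution k, unique up to a factor, of B = - 2 \<kappa> w and D = D' = D'' = 0 at s,
  with denominators cleared so that it is polynomial in s and w.\<close>

definition Xi :: "complex => (nat => complex) => (nat => complex) => complex => complex => complex ^ 5" where
 "Xi a f g s w =
  (let F0 = poly (quarticP f) s; F1 = poly (pd (quarticP f)) s; F2 = poly (pd (pd (quarticP f))) s;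
    G0 = poly (quadricP g) s; G1 = poly (pd (quadricP g)) s; G2 = poly (pd (pd (quadricP g))) s
  in if a = 0 then kvec s (- 8 * F0 ^ 2 * w) (- 4 * F0 * F1 * w) ((F1 ^ 2 - 2 * F0 * F2) * w) (4 * F0 ^ 2) (4 * F0 * w ^ 2)
  else kvec s (2 * G0 ^ 2 * (w ^ 2 - F0)) (2 * G0 * (w ^ 2 * G1 - (F1 * G0 - F0 * G1)))
   (w ^ 2 * G0 * G2 - (F2 * G0 ^ 2 - 2 * F1 * G1 * G0 - F0 * G2 * G0 + 2 * F0 * G1 ^ 2)) (- 4 * w * G0 ^ 2) (2 * G0 ^ 3))"

text \<open>The exceptional values of \<open>s\<close>: up to powers of \<open>f\<close> and \<open>g\<close>, the second factor is the third derivative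
  of \<open>\<surd>f\<close> in the first case and of \<open>f / g\<close> in the second.\<close>

definition goodP :: "complex => (nat => complex) => (nat => complex) => complex poly" where
 "goodP a f g =
  (let F0 = quarticP f; F1 = pd F0; F2 = pd F1; F3 = pd F2; G0 = quadricP g; G1 = pd G0; G2 = pd G1
  in if a = 0 then F0 * (3 * F1 ^ 3 - 6 * F0 * F1 * F2 + 4 * F0 ^ 2 * F3)
  else G0 * (G0 ^ 3 * F3 - 3 * G0 ^ 2 * G1 * F2 + 6 * G0 * G1 ^ 2 * F1 + 6 * F0 * G0 * G1 * G2 - 6 * F0 * G1 ^ 3 - 3 * G0 ^ 2 * G2 * F1))"

lemma taylor_quartic:
 "poly (quarticP f) (s + t) = poly (quarticP f) s + poly (pd (quarticP f)) s * t + poly (pd (pd (quarticP f))) s / 2 * t ^ 2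
  + poly (pd (pd (pd (quarticP f)))) s / 6 * t ^ 3 + poly (pd (pd (pd (pd (quarticP f))))) s / 24 * t ^ 4"
 by (simp add: quarticP_def pderiv_pCons fld_simps4)

lemma taylor_quadric:
 "poly (quadricP g) (s + t) = poly (quadricP g) s + poly (pd (quadricP g)) s * t + poly (pd (pd (quadricP g))) s / 2 * t ^ 2"
 by (simp add: quadricP_def pderiv_pCons field_simps power2_eq_square)

lemma exists_nonroot:
 fixes p :: "complex poly"
 assumes "p ~= 0" obtains s where "poly p s ~= 0"
proof -
 have "EX s. poly p s ~= 0"
 proof (rule ccontr)
  assume "\<not> ?thesis"
  then have "p = 0" by (intro poly_same) simp
  then show False using assms by simp
 qed
 then show ?thesis using that by blast
qed

text \<open>The hypothesis is 8 f^(5/2) times the third derivative of the square root of f, so this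
  root is a quadratic polynomial. Its Taylor coefficients at a point with f nonzero are c, c1, c2;
  the hypothesis and its derivative give the third and fourth derivatives of f.\<close>

lemma square_quarticI:
 assumes T: "3 * pd (quarticP f) ^ 3 - 6 * quarticP f * pd (quarticP f) * pd (pd (quarticP f)) + 4 * quarticP f ^ 2 * pd (pd (pd (quarticP f))) = 0"
 shows "square_quartic f"
proof (cases "quarticP f = 0")
 case True
 then show ?thesis unfolding square_quartic_def
  by (intro exI[of _ 0]) (auto simp: quarticP_def)
next
 case False
 obtain s where s: "poly (quarticP f) s ~= 0" using exists_nonroot[OF False] by blast
 define c where "c = csqrt (poly (quarticP f) s)"
 define c1 where "c1 = poly (pd (quarticP f)) s / (2 * c)"
 define c2 where "c2 = (poly (pd (pd (quarticP f))) s - 2 * c1 ^ 2) / (4 * c)"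
 have c: "c ~= 0" using s by (simp add: c_def)
 have F: "poly (quarticP f) s = c ^ 2" "poly (pd (quarticP f)) s = 2 * c * c1" "poly (pd (pd (quarticP f))) s = 4 * c * c2 + 2 * c1 ^ 2"
  using c by (simp_all add: c_def c1_def c2_def)
 define F3 where "F3 = poly (pd (pd (pd (quarticP f)))) s"
 define F4 where "F4 = poly (pd (pd (pd (pd (quarticP f))))) s"
 have "3 * (2 * c * c1) ^ 3 - 6 * c ^ 2 * (2 * c * c1) * (4 * c * c2 + 2 * c1 ^ 2) + 4 * (c ^ 2) ^ 2 * F3 = 0"
  using arg_cong[OF T, of "%p. poly p s"] by (simp add: F F3_def)
 then have "4 * c ^ 4 * (F3 - 12 * c1 * c2) = 0" by (simp add: alg_simps4)
 then have F3: "F3 = 12 * c1 * c2" using c by simp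
 have "3 * (2 * c * c1) ^ 2 * (4 * c * c2 + 2 * c1 ^ 2) - 6 * c ^ 2 * (4 * c * c2 + 2 * c1 ^ 2) ^ 2 + 2 * c ^ 2 * (2 * c * c1) * F3 + 4 * (c ^ 2) ^ 2 * F4 = 0"
 proof -
  have "poly (pd (3 * pd (quarticP f) ^ 3 - 6 * quarticP f * pd (quarticP f) * pd (pd (quarticP f)) + 4 * quarticP f ^ 2 * pd (pd (pd (quarticP f))))) s = 0"
   unfolding T by simp
  then show ?thesis
   unfolding power3_eq_cube power2_eq_square
   by (simp add: pderiv_diff pderiv_add pderiv_mult F F3_def[symmetric] F4_def[symmetric] alg_simps2)
 qed
 then have "4 * c ^ 4 * (F4 - 24 * c2 ^ 2) = 0" unfolding F3 by (simp add: alg_simps4)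
 then have F4: "F4 = 24 * c2 ^ 2" using c by simp
 have "quarticP f = [:c - c1 * s + c2 * s ^ 2, c1 - 2 * c2 * s, c2:] ^ 2"
 proof (rule poly_same)
  fix x
  have "poly (quarticP f) (s + (x - s)) = (c + c1 * (x - s) + c2 * (x - s) ^ 2) ^ 2"
   unfolding taylor_quartic F F3_def[symmetric] F4_def[symmetric] F3 F4
   by (simp add: fld_simps4)
  then show "poly (quarticP f) x = poly ([:c - c1 * s + c2 * s ^ 2, c1 - 2 * c2 * s, c2:] ^ 2) x"
   by (simp add: alg_simps2)
 qed
 then have "[:f 4, f 3, f 2, f 1, f 0:] = [:c - c1 * s + c2 * s ^ 2, c1 - 2 * c2 * s, c2:] * [:c - c1 * s + c2 * s ^ 2, c1 - 2 * c2 * s, c2:]"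
  by (simp only: quarticP_def power2_eq_square)
 then show ?thesis
  unfolding square_quartic_def
  by (intro exI[of _ c2] exI[of _ "c1 - 2 * c2 * s"] exI[of _ "c - c1 * s + c2 * s ^ 2"]) (simp add: power2_eq_square algebra_simps)
qed

text \<open>The hypothesis is g^4 times the third derivative of f / g, so f / g is a quadratic
  polynomial; q0, q1, q2 are its value and first two derivatives at a point with g nonzero.\<close>

lemma quadric_dividesI:
 assumes g: "quadricP g ~= 0"
  and T: "quadricP g ^ 3 * pd (pd (pd (quarticP f))) - 3 * quadricP g ^ 2 * pd (quadricP g) * pd (pd (quarticP f)) + 6 * quadricP g * pd (quadricP g) ^ 2 * pd (quarticP f)
   + 6 * quarticP f * quadricP g * pd (quadricP g) * pd (pd (quadricP g)) - 6 * quarticP f * pd (quadricP g) ^ 3 - 3 * quadricP g ^ 2 * pd (pd (quadricP g)) * pd (quarticP f) = 0"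
   (is "?T = 0")
 shows "quadric_divides g f"
proof -
 obtain s where s: "poly (quadricP g) s ~= 0" using exists_nonroot[OF g] by blast
 define G0 where "G0 = poly (quadricP g) s"
 define G1 where "G1 = poly (pd (quadricP g)) s"
 define G2 where "G2 = poly (pd (pd (quadricP g))) s"
 define q0 where "q0 = poly (quarticP f) s / G0"
 define q1 where "q1 = (poly (pd (quarticP f)) s - q0 * G1) / G0"
 define q2 where "q2 = (poly (pd (pd (quarticP f))) s - 2 * q1 * G1 - q0 * G2) / G0"
 have G0: "G0 ~= 0" using s by (simp add: G0_def)
 have F: "poly (quarticP f) s = q0 * G0" "poly (pd (quarticP f)) s = q1 * G0 + q0 * G1" "poly (pd (pd (quarticP f))) s = q2 * G0 + 2 * q1 * G1 + q0 * G2"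
  using G0 by (simp_all add: q0_def q1_def q2_def)
 define F3 where "F3 = poly (pd (pd (pd (quarticP f)))) s"
 define F4 where "F4 = poly (pd (pd (pd (pd (quarticP f))))) s"
 note G = G0_def[symmetric] G1_def[symmetric] G2_def[symmetric]
 have "poly ?T s = G0 ^ 3 * (F3 - 3 * q2 * G1 - 3 * q1 * G2)"
  by (simp add: F G F3_def[symmetric] alg_simps3)
 then have "F3 - 3 * q2 * G1 - 3 * q1 * G2 = 0" unfolding T using G0 by simp
 then have F3: "F3 = 3 * q2 * G1 + 3 * q1 * G2" by (simp add: algebra_simps)
 have "poly (pd ?T) s = G0 ^ 3 * (F4 - 6 * q2 * G2)"
  unfolding power3_eq_cube power2_eq_square
  by (simp add: pderiv_diff pderiv_add pderiv_mult) (simp add: F G F3_def[symmetric] F4_def[symmetric] F3 algebra_simps)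
 then have "F4 - 6 * q2 * G2 = 0" unfolding T using G0 by simp
 then have F4: "F4 = 6 * q2 * G2" by simp
 have "quarticP f = quadricP g * [:q0 - q1 * s + q2 / 2 * s ^ 2, q1 - q2 * s, q2 / 2:]"
 proof (rule poly_same)
  fix x
  have "poly (quarticP f) (s + (x - s)) = poly (quadricP g) (s + (x - s)) * (q0 + q1 * (x - s) + q2 / 2 * (x - s) ^ 2)"
   unfolding taylor_quartic taylor_quadric F F3_def[symmetric] F4_def[symmetric] F3 F4 G
   by (simp add: fld_simps4)
  then have "poly (quarticP f) x = poly (quadricP g) x * (q0 + q1 * (x - s) + q2 / 2 * (x - s) ^ 2)" by simp
  also have "q0 + q1 * (x - s) + q2 / 2 * (x - s) ^ 2 = poly [:q0 - q1 * s + q2 / 2 * s ^ 2, q1 - q2 * s, q2 / 2:] x"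
   by (simp add: field_simps power2_eq_square)
  finally show "poly (quarticP f) x = poly (quadricP g * [:q0 - q1 * s + q2 / 2 * s ^ 2, q1 - q2 * s, q2 / 2:]) x"
   by (simp only: poly_mult)
 qed
 then have e: "[:f 4, f 3, f 2, f 1, f 0:] = [:g 2, g 1, g 0:] * [:q0 - q1 * s + q2 / 2 * s ^ 2, q1 - q2 * s, q2 / 2:]"
  by (simp only: quarticP_def quadricP_def)
 define p q r where "p = q2 / 2" and "q = q1 - q2 * s" and "r = q0 - q1 * s + q2 / 2 * s ^ 2"
 have "[:f 4, f 3, f 2, f 1, f 0:] = [:g 2, g 1, g 0:] * [:r, q, p:]" using e by (simp only: p_def q_def r_def)
 then show ?thesis
  unfolding quadric_divides_def by (intro exI[of _ p] exI[of _ q] exI[of _ r]) (simp add: algebra_simps)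
qed

text \<open>The inverse map reads the triple root of the discriminant off its Hessian covariant \<open>Y\<close>.\<close>

definition dco :: "complex => complex => (nat => complex) => (nat => complex) => nat => complex ^ 5 => complex" where
 "dco a b f g i k =
  (let e0 = b * k $ 0 + g 0 * k $ 3; e1 = b * k $ 1 + g 1 * k $ 3; e2 = b * k $ 2 + g 2 * k $ 3; \<kappa> = kap a b k
  in if i = 0 then e2 * e2 - 4 * (\<kappa> * (g 2 * k $ 2 + f 4 * k $ 4))
  else if i = 1 then 2 * (e1 * e2) - 4 * (\<kappa> * (g 2 * k $ 1 + g 1 * k $ 2 + f 3 * k $ 4))
  else if i = 2 then e1 * e1 + 2 * (e0 * e2) - 4 * (\<kappa> * (g 2 * k $ 0 + g 1 * k $ 1 + g 0 * k $ 2 + f 2 * k $ 4))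
  else if i = 3 then 2 * (e0 * e1) - 4 * (\<kappa> * (g 1 * k $ 0 + g 0 * k $ 1 + f 1 * k $ 4))
  else e0 * e0 - 4 * (\<kappa> * (g 0 * k $ 0 + f 0 * k $ 4)))"

lemma discP_dco: "discP a b f g k = [:dco a b f g 0 k, dco a b f g 1 k, dco a b f g 2 k, dco a b f g 3 k, dco a b f g 4 k:]"
 by (rule poly_same)
  (simp add: discP_def polB_def polC_def baseP_def quadricP_def quarticP_def dco_def Let_def alg_simps2)

text \<open>The coefficients of x^2 y^2, x^3 y and x^4 in the Hessian of the binary quartic, divided
  by 6, -4 and 1. For a triple root s the Hessian is a multiple of (x - s y)^4, so they become \<mu>
  s^2, \<mu> s and \<mu>.\<close>

definition hess :: "complex => complex => (nat => complex) => (nat => complex) => nat => complex ^ 5 => complex" where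
 "hess a b f g i k =
  (let d = (%j. dco a b f g j k)
  in if i = 0 then 24 * (d 4 * d 0) + 3 * (d 3 * d 1) - 2 * (d 2 * d 2)
  else if i = 1 then 3 * (d 3 * d 2) - 18 * (d 4 * d 1)
  else 24 * (d 4 * d 2) - 9 * (d 3 * d 3))"

text \<open>The point is recovered with y = Y, w1 = - B / (2 \<kappa>) from the completed square,
  and w2 from its incidence with the hyperplane; all of this is multiplied by 2 \<kappa> k4.\<close>

definition Gam :: "complex => complex => (nat => complex) => (nat => complex) => complex ^ 5 => complex ^ 5" where
 "Gam a b f g k =
  (let Y = (%i. hess a b f g i k); \<kappa> = kap a b k;
    A = k $ 0 * Y 0 + k $ 1 * Y 1 + k $ 2 * Y 2;
    B = b * A + k $ 3 * (g 0 * Y 0 + g 1 * Y 1 + g 2 * Y 2)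
  in vec5 (2 * (\<kappa> * (k $ 4 * Y 0))) (2 * (\<kappa> * (k $ 4 * Y 1))) (2 * (\<kappa> * (k $ 4 * Y 2))) (- 1 * (k $ 4 * B)) (k $ 3 * B - 2 * (\<kappa> * A)))"

lemma hess_triple:
 assumes "[:- s, 1:] ^ 3 dvd discP a b f g k"
 shows "EX \<mu>. hess a b f g 0 k = \<mu> * s ^ 2 & hess a b f g 1 k = \<mu> * s & hess a b f g 2 k = \<mu> &
  (poly (pd (pd (pd (discP a b f g k)))) s ~= 0 --> \<mu> ~= 0)"
proof -
 define d where "d i = dco a b f g i k" for i
 note J = triple_root_jets[OF assms, unfolded discP_dco d_def[symmetric]]
 \<comment> \<open>The three conditions of a triple root are solved for \<open>d 2\<close>,
   \<open>d 1\<close>, \<open>d 0\<close> in terms of \<open>d 3\<close>, \<open>d 4\<close> and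
   s.\<close>
 have d2: "d 2 = - 3 * d 3 * s - 6 * d 4 * s ^ 2"
 proof -
  have "2 * d 2 + 6 * d 3 * s + 12 * d 4 * s ^ 2 = 0" using J(3) by (simp add: pderiv_pCons alg_simps2)
  then have "2 * (d 2 - (- 3 * d 3 * s - 6 * d 4 * s ^ 2)) = 0" by (simp add: algebra_simps)
  then show ?thesis by (rule cancel_diff[rotated]) simp
 qed
 have d1: "d 1 = 3 * d 3 * s ^ 2 + 8 * d 4 * s ^ 3"
 proof -
  have "d 1 + 2 * d 2 * s + 3 * d 3 * s ^ 2 + 4 * d 4 * s ^ 3 = 0" using J(2) by (simp add: pderiv_pCons alg_simps3)
  then have "d 1 - (3 * d 3 * s ^ 2 + 8 * d 4 * s ^ 3) = 0" unfolding d2 by (simp add: alg_simps3)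
  then show ?thesis by simp
 qed
 have d0: "d 0 = - d 3 * s ^ 3 - 3 * d 4 * s ^ 4"
 proof -
  have "d 0 + d 1 * s + d 2 * s ^ 2 + d 3 * s ^ 3 + d 4 * s ^ 4 = 0" using J(1) by (simp add: alg_simps4)
  then have "d 0 - (- d 3 * s ^ 3 - 3 * d 4 * s ^ 4) = 0" unfolding d2 d1 by (simp add: alg_simps4)
  then show ?thesis by simp
 qed
 have D3: "poly (pd (pd (pd (discP a b f g k)))) s = 6 * (d 3 + 4 * s * d 4)"
  unfolding discP_dco d_def[symmetric] by (simp add: pderiv_pCons algebra_simps)
 show ?thesis
 proof (intro exI[of _ "- 9 * (d 3 + 4 * s * d 4) ^ 2"] conjI impI)
  show "hess a b f g 0 k = - 9 * (d 3 + 4 * s * d 4) ^ 2 * s ^ 2"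
   unfolding hess_def Let_def d_def[symmetric] d0 d1 d2 by (simp add: alg_simps4)
  show "hess a b f g 1 k = - 9 * (d 3 + 4 * s * d 4) ^ 2 * s"
   unfolding hess_def Let_def d_def[symmetric] d0 d1 d2 by (simp add: alg_simps4)
  show "hess a b f g 2 k = - 9 * (d 3 + 4 * s * d 4) ^ 2"
   unfolding hess_def Let_def d_def[symmetric] d0 d1 d2 by (simp add: alg_simps4)
  show "- 9 * (d 3 + 4 * s * d 4) ^ 2 ~= 0" if "poly (pd (pd (pd (discP a b f g k)))) s ~= 0"
  proof -
   have "d 3 + 4 * s * d 4 ~= 0" using that unfolding D3 by (metis mult_zero_right)
   moreover have "- 9 * x ^ 2 ~= 0" if "x ~= 0" for x :: complex using that by simp
   ultimately show ?thesis by blast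
  qed
 qed
qed

lemma Gam_triple:
 assumes tr: "[:- s, 1:] ^ 3 dvd discP a b f g k" and w: "2 * kap a b k * w + poly (polB b g k) s = 0"
  and v: "dpair k (aff s w v) = 0" and nz: "kap a b k ~= 0" "k $ 4 ~= 0" "poly (pd (pd (pd (discP a b f g k)))) s ~= 0"
 shows "EX c. c ~= 0 & Gam a b f g k = c *s aff s w v"
proof -
 obtain \<mu> where Y: "hess a b f g 0 k = \<mu> * s ^ 2" "hess a b f g 1 k = \<mu> * s" "hess a b f g 2 k = \<mu>" and \<mu>: "\<mu> ~= 0"
  using hess_triple[OF tr] nz(3) by blast
 have A: "k $ 0 * (\<mu> * s ^ 2) + k $ 1 * (\<mu> * s) + k $ 2 * \<mu> = \<mu> * poly (baseP k) s"
  by (simp add: baseP_jets algebra_simps)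
 have G: "g 0 * (\<mu> * s ^ 2) + g 1 * (\<mu> * s) + g 2 * \<mu> = \<mu> * poly (quadricP g) s"
  by (simp add: poly_quadricP algebra_simps)
 have "b * (\<mu> * poly (baseP k) s) + k $ 3 * (\<mu> * poly (quadricP g) s) = \<mu> * poly (polB b g k) s"
  by (simp add: disc_jets(1) algebra_simps)
 also have "poly (polB b g k) s = - (2 * kap a b k * w)" using w by (simp add: eq_neg_iff_add_eq_0 add.commute)
 finally have B: "b * (\<mu> * poly (baseP k) s) + k $ 3 * (\<mu> * poly (quadricP g) s) = - (2 * kap a b k * \<mu> * w)" by simp
 have A0: "poly (baseP k) s = - (k $ 3 * w + k $ 4 * v)"
 proof -
  have "poly (baseP k) s + (k $ 3 * w + k $ 4 * v) = 0" using v by (simp add: dpair_5 baseP_jets algebra_simps)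
  then show ?thesis by (simp only: eq_neg_iff_add_eq_0)
 qed
 have "Gam a b f g k = (2 * kap a b k * k $ 4 * \<mu>) *s aff s w v"
  unfolding Gam_def Let_def Y A G B unfolding A0
  by (simp add: vec5_eq_iff alg_simps2)
 then show ?thesis using nz \<mu> by (intro exI[of _ "2 * kap a b k * k $ 4 * \<mu>"]) simp
qed

context segre_form
begin

lemma good_nonzero: "goodP a f g ~= 0"
proof (cases "a = 0")
 case True
 have "quarticP f ~= 0"
 proof
  assume "quarticP f = 0"
  then have "square_quartic f" by (intro square_quarticI) simp
  then show False using not_square[OF True] by blast
 qed
 moreover have "3 * pd (quarticP f) ^ 3 - 6 * quarticP f * pd (quarticP f) * pd (pd (quarticP f)) + 4 * quarticP f ^ 2 * pd (pd (pd (quarticP f))) ~= 0"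
  using square_quarticI not_square[OF True] by blast
 ultimately show ?thesis using True by (simp only: goodP_def Let_def if_True mult_eq_0_iff not_False_eq_True simp_thms)
next
 case False
 then have a: "a = 1" using type by auto
 have g: "quadricP g ~= 0" using g_nonzero[OF a] by (auto simp: quadricP_def)
 show ?thesis using quadric_dividesI[OF g, of f] not_divides[OF a] g False
  by (simp only: goodP_def Let_def if_False mult_eq_0_iff) blast
qed

abbreviation "\<Xi> \<equiv> Xi a f g"
abbreviation "\<Gamma> \<equiv> Gam a b f g"

text \<open>The first condition makes the root exactly triple and the cusp ordinary; the second
  keeps the point where s and w are local coordinates.\<close>

definition generic :: "complex => complex => bool" where
 "generic s w \<longleftrightarrow> poly (goodP a f g) s ~= 0 & b * w + poly (quadricP g) s ~= 0"

text \<open>Substitution of the derivatives at s; the third derivative of D comes out as a nonzero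
  multiple of the second factor of \<open>goodP\<close>.\<close>

lemma Xi_triple:
 assumes "generic s w"
 shows "kap a b (\<Xi> s w) ~= 0" "\<Xi> s w $ 4 ~= 0" "2 * kap a b (\<Xi> s w) * w + poly (polB b g (\<Xi> s w)) s = 0"
  "EX q. discP a b f g (\<Xi> s w) = [:- s, 1:] ^ 3 * q & poly q s ~= 0" "poly (pd (pd (pd (discP a b f g (\<Xi> s w))))) s ~= 0"
proof -
 define F0 where "F0 = poly (quarticP f) s"
 define F1 where "F1 = poly (pd (quarticP f)) s"
 define F2 where "F2 = poly (pd (pd (quarticP f))) s"
 define F3 where "F3 = poly (pd (pd (pd (quarticP f)))) s"
 define G0 where "G0 = poly (quadricP g) s"
 define G1 where "G1 = poly (pd (quadricP g)) s"
 define G2 where "G2 = poly (pd (pd (quadricP g))) s"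
 note J = F0_def[symmetric] F1_def[symmetric] F2_def[symmetric] F3_def[symmetric] G0_def[symmetric] G1_def[symmetric] G2_def[symmetric]
 let ?D = "discP a b f g (\<Xi> s w)"
 have *: "kap a b (\<Xi> s w) ~= 0 & \<Xi> s w $ 4 ~= 0 & 2 * kap a b (\<Xi> s w) * w + poly (polB b g (\<Xi> s w)) s = 0 &
  poly ?D s = 0 & poly (pd ?D) s = 0 & poly (pd (pd ?D)) s = 0 & poly (pd (pd (pd ?D))) s ~= 0"
 proof (cases "a = 0")
  case True
  then have ab: "b = 1" "g = (%_. 0)" using type by auto
  have G: "quadricP g = 0" by (simp add: quadricP_def ab)
  have G': "G0 = 0" "G1 = 0" "G2 = 0" by (simp_all add: G0_def G1_def G2_def G)
  have w: "w ~= 0" using assms unfolding generic_def by (simp add: G ab(1))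
  have good: "F0 ~= 0" "3 * F1 ^ 3 - 6 * F0 * F1 * F2 + 4 * F0 ^ 2 * F3 ~= 0"
   using assms unfolding generic_def goodP_def Let_def by (simp_all add: True J)
  have k: "\<Xi> s w = kvec s (- 8 * F0 ^ 2 * w) (- 4 * F0 * F1 * w) ((F1 ^ 2 - 2 * F0 * F2) * w) (4 * F0 ^ 2) (4 * F0 * w ^ 2)"
   by (simp add: Xi_def Let_def True J)
  have D3: "poly (pd (pd (pd ?D))) s = - 16 * F0 * w ^ 2 * (3 * F1 ^ 3 - 6 * F0 * F1 * F2 + 4 * F0 ^ 2 * F3)"
   unfolding disc_jets unfolding k unfolding kvec_jets J kap_def unfolding G' ab(1) True by (simp add: alg_simps3)
  have nz: "poly (pd (pd (pd ?D))) s ~= 0" unfolding D3 using good w by simp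
  have "poly ?D s = 0" "poly (pd ?D) s = 0" "poly (pd (pd ?D)) s = 0" "2 * kap a b (\<Xi> s w) * w + poly (polB b g (\<Xi> s w)) s = 0"
   "kap a b (\<Xi> s w) ~= 0" "\<Xi> s w $ 4 ~= 0"
   unfolding disc_jets unfolding k unfolding kvec_jets J kap_def unfolding G' ab(1) True using good w by (simp_all add: alg_simps3)
  then show ?thesis using nz by blast
 next
  case False
  then have ab: "a = 1" "b = 0" using type by auto
  have good: "G0 ~= 0" "G0 ^ 3 * F3 - 3 * G0 ^ 2 * G1 * F2 + 6 * G0 * G1 ^ 2 * F1 + 6 * F0 * G0 * G1 * G2 - 6 * F0 * G1 ^ 3 - 3 * G0 ^ 2 * G2 * F1 ~= 0"
   using assms unfolding generic_def goodP_def Let_def by (simp_all add: False J)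
  have k: "\<Xi> s w = kvec s (2 * G0 ^ 2 * (w ^ 2 - F0)) (2 * G0 * (w ^ 2 * G1 - (F1 * G0 - F0 * G1)))
   (w ^ 2 * G0 * G2 - (F2 * G0 ^ 2 - 2 * F1 * G1 * G0 - F0 * G2 * G0 + 2 * F0 * G1 ^ 2)) (- 4 * w * G0 ^ 2) (2 * G0 ^ 3)"
   by (simp add: Xi_def Let_def False J)
  have D3: "poly (pd (pd (pd ?D))) s = - 16 * G0 ^ 3 * (G0 ^ 3 * F3 - 3 * G0 ^ 2 * G1 * F2 + 6 * G0 * G1 ^ 2 * F1 + 6 * F0 * G0 * G1 * G2 - 6 * F0 * G1 ^ 3 - 3 * G0 ^ 2 * G2 * F1)"
   unfolding disc_jets unfolding k unfolding kvec_jets J kap_def unfolding ab by (simp add: alg_simps3)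
  have nz: "poly (pd (pd (pd ?D))) s ~= 0" unfolding D3 using good by simp
  have "poly ?D s = 0" "poly (pd ?D) s = 0" "poly (pd (pd ?D)) s = 0" "2 * kap a b (\<Xi> s w) * w + poly (polB b g (\<Xi> s w)) s = 0"
   "kap a b (\<Xi> s w) ~= 0" "\<Xi> s w $ 4 ~= 0"
   unfolding disc_jets unfolding k unfolding kvec_jets J kap_def unfolding ab using good by (simp_all add: alg_simps3)
  then show ?thesis using nz by blast
 qed
 then show "kap a b (\<Xi> s w) ~= 0" "\<Xi> s w $ 4 ~= 0" "2 * kap a b (\<Xi> s w) * w + poly (polB b g (\<Xi> s w)) s = 0"
  "poly (pd (pd (pd ?D))) s ~= 0" by blast+
 show "EX q. ?D = [:- s, 1:] ^ 3 * q & poly q s ~= 0" using triple_rootI[of ?D s] * by (metis mult_zero_right)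
qed

text \<open>The equations for B, D, D', D'' at s are triangular: each determines one more of
  \<open>k $ 3\<close>, \<open>A0\<close>, \<open>A1\<close>, \<open>A2\<close>, with a nonzero
  factor in front. The scale c is read off from \<open>k $ 4\<close>.\<close>

lemma Xi_unique:
 assumes nz: "kap a b k ~= 0" "k $ 4 ~= 0" and m: "b * w + poly (quadricP g) s ~= 0"
  and B: "2 * kap a b k * w + poly (polB b g k) s = 0" and tr: "[:- s, 1:] ^ 3 dvd discP a b f g k"
 shows "EX c. c ~= 0 & k = c *s \<Xi> s w"
proof -
 define F0 where "F0 = poly (quarticP f) s"
 define F1 where "F1 = poly (pd (quarticP f)) s"
 define F2 where "F2 = poly (pd (pd (quarticP f))) s"
 define G0 where "G0 = poly (quadricP g) s"
 define G1 where "G1 = poly (pd (quadricP g)) s"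
 define G2 where "G2 = poly (pd (pd (quadricP g))) s"
 define A0 where "A0 = poly (baseP k) s"
 define A1 where "A1 = poly (pd (baseP k)) s"
 define A2 where "A2 = poly (pd (pd (baseP k))) s"
 note J = F0_def[symmetric] F1_def[symmetric] F2_def[symmetric] G0_def[symmetric] G1_def[symmetric] G2_def[symmetric]
  A0_def[symmetric] A1_def[symmetric] A2_def[symmetric]
 note D = triple_root_jets[OF tr, unfolded disc_jets(2-4) J] and B' = B[unfolded disc_jets(1) J]
 show ?thesis
 proof (cases "a = 0")
  case True
  then have ab: "b = 1" "g = (%_. 0)" using type by auto
  have G: "quadricP g = 0" by (simp add: quadricP_def ab)
  then have G': "G0 = 0" "G1 = 0" "G2 = 0" by (simp_all add: G0_def G1_def G2_def)
  have w: "w ~= 0" using m by (simp add: G ab(1))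
  have \<kappa>: "kap a b k = k $ 3" by (simp add: kap_def True ab)
  have k3: "k $ 3 ~= 0" using nz(1) unfolding \<kappa> .
  have A0: "A0 = - 2 * k $ 3 * w" using B' unfolding \<kappa> unfolding G' ab(1) by (simp add: eq_neg_iff_add_eq_0 add.commute)
  have "4 * k $ 3 * (k $ 3 * w ^ 2 - k $ 4 * F0) = 0" using D(1) unfolding \<kappa> unfolding G' ab(1) A0 by (simp add: alg_simps2)
  then have e0: "k $ 3 * w ^ 2 = k $ 4 * F0" using k3 by simp
  then have F0: "F0 ~= 0" using k3 w by auto
  have "2 * (1 * A0 + k $ 3 * 0) * (1 * A1 + k $ 3 * 0) - 4 * k $ 3 * (0 * A0 + 0 * A1 + k $ 4 * F1) = - 4 * k $ 3 * (w * A1 - (- (k $ 4 * F1)))"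
   unfolding A0 by (simp add: algebra_simps)
  then have "- 4 * k $ 3 * (w * A1 - (- (k $ 4 * F1))) = 0" using D(2)[unfolded \<kappa>, unfolded G' ab(1)] by simp
  then have e1: "w * A1 = - (k $ 4 * F1)" by (rule cancel_diff[rotated]) (simp add: k3)
  have "2 * (A1 ^ 2 - (2 * k $ 3 * w * A2 + 2 * k $ 3 * k $ 4 * F2)) = 0"
   using D(3) unfolding \<kappa> unfolding G' ab(1) A0 by (simp add: alg_simps2)
  then have e2: "A1 ^ 2 = 2 * k $ 3 * w * A2 + 2 * k $ 3 * k $ 4 * F2" by (rule cancel_diff[rotated]) simp
  define c where "c = k $ 4 / (4 * F0 * w ^ 2)"
  have c: "c ~= 0" using nz(2) F0 w by (simp add: c_def)
  have c4: "k $ 4 = c * (4 * F0 * w ^ 2)" using F0 w by (simp add: c_def)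
  have "w ^ 2 * (k $ 3 - c * (4 * F0 ^ 2)) = 0" using e0 unfolding c4 by (simp add: alg_simps2)
  then have c3: "k $ 3 = c * (4 * F0 ^ 2)" using w by simp
  have cA0: "A0 = c * (- 8 * F0 ^ 2 * w)" unfolding A0 c3 by simp
  have "w * (A1 - c * (- 4 * F0 * F1 * w)) = 0" using e1 unfolding c4 by (simp add: alg_simps2)
  then have cA1: "A1 = c * (- 4 * F0 * F1 * w)" by (rule cancel_diff[OF w])
  have "8 * c * F0 ^ 2 * w * (A2 - c * (2 * ((F1 ^ 2 - 2 * F0 * F2) * w))) = 0"
   using e2 unfolding c4 c3 cA1 by (simp add: alg_simps3)
  then have cA2: "A2 = c * (2 * ((F1 ^ 2 - 2 * F0 * F2) * w))" using c F0 w by simp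
  have "k = c *s kvec s (- 8 * F0 ^ 2 * w) (- 4 * F0 * F1 * w) ((F1 ^ 2 - 2 * F0 * F2) * w) (4 * F0 ^ 2) (4 * F0 * w ^ 2)"
   by (rule kvec_eqI) (use cA0 cA1 cA2 c3 c4 in \<open>simp_all only: A0_def A1_def A2_def\<close>)
  then show ?thesis using c by (intro exI[of _ c]) (simp add: Xi_def Let_def True J)
 next
  case False
  then have ab: "a = 1" "b = 0" using type by auto
  have G0: "G0 ~= 0" using m by (simp add: ab J)
  have \<kappa>: "kap a b k = k $ 4" by (simp add: kap_def ab)
  define c where "c = k $ 4 / (2 * G0 ^ 3)"
  have c: "c ~= 0" using nz(2) G0 by (simp add: c_def)
  have c4: "k $ 4 = c * (2 * G0 ^ 3)" using G0 by (simp add: c_def)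
  have "G0 * (k $ 3 - c * (- 4 * w * G0 ^ 2)) = 0" using B' unfolding \<kappa> unfolding ab c4 by (simp add: alg_simps3)
  then have c3: "k $ 3 = c * (- 4 * w * G0 ^ 2)" by (rule cancel_diff[OF G0])
  have nz': "c * c ~= 0" "c * G0 ^ 3 ~= 0" using c G0 by simp_all
  have "8 * (c * G0 ^ 3) * (G0 * (A0 - c * (2 * G0 ^ 2 * (w ^ 2 - F0)))) = 0"
   using D(1) unfolding \<kappa> unfolding ab c4 c3 by (simp add: alg_simps3)
  then have cA0: "A0 = c * (2 * G0 ^ 2 * (w ^ 2 - F0))" using nz'(2) G0 by simp
  have "8 * (c * G0 ^ 3) * (G0 * (A1 - c * (2 * G0 * (w ^ 2 * G1 - (F1 * G0 - F0 * G1))))) = 0"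
   using D(2) unfolding \<kappa> unfolding ab c4 c3 cA0 by (simp add: alg_simps3)
  then have cA1: "A1 = c * (2 * G0 * (w ^ 2 * G1 - (F1 * G0 - F0 * G1)))" using nz'(2) G0 by simp
  have "8 * (c * G0 ^ 3) * (G0 * (A2 - c * (2 * (w ^ 2 * G0 * G2 - (F2 * G0 ^ 2 - 2 * F1 * G1 * G0 - F0 * G2 * G0 + 2 * F0 * G1 ^ 2))))) = 0"
   using D(3) unfolding \<kappa> unfolding ab c4 c3 cA0 cA1 by (simp add: alg_simps3)
  then have cA2: "A2 = c * (2 * (w ^ 2 * G0 * G2 - (F2 * G0 ^ 2 - 2 * F1 * G1 * G0 - F0 * G2 * G0 + 2 * F0 * G1 ^ 2)))" using nz'(2) G0 by simp
  have "k = c *s kvec s (2 * G0 ^ 2 * (w ^ 2 - F0)) (2 * G0 * (w ^ 2 * G1 - (F1 * G0 - F0 * G1)))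
   (w ^ 2 * G0 * G2 - (F2 * G0 ^ 2 - 2 * F1 * G1 * G0 - F0 * G2 * G0 + 2 * F0 * G1 ^ 2)) (- 4 * w * G0 ^ 2) (2 * G0 ^ 3)"
   by (rule kvec_eqI) (use cA0 cA1 cA2 c3 c4 in \<open>simp_all only: A0_def A1_def A2_def\<close>)
  then show ?thesis using c by (intro exI[of _ c]) (simp add: Xi_def Let_def False J)
 qed
qed

end

section \<open>Closed conditions on the incidence variety\<close>

lemma bicoord_fst: "(%z. (A *v fst z) $ i) \<in> poly_fun bicoords"
 and bicoord_snd: "(%z. (B *v snd z) $ i) \<in> poly_fun bicoords"
 unfolding matrix_vector_mult_def
 by (simp_all, (intro poly_fun_sum poly_fun_cmult poly_fun.coord; blast)+)

lemma closedin_snd_preimage: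
 assumes "closedin zariski C"
 shows "closedin zariski_prod {(p :: 'n::finite cp, q :: 'm::finite cp). q \<in> C}"
 unfolding closedin_zariski_prod
proof (intro allI impI)
 fix x :: "complex ^ 'n" and y :: "complex ^ 'm"
 assume x: "x ~= 0" and y: "y ~= 0" and van: "ALL d e. ALL f:bihpoly d e. (ALL z:bicone {(p :: 'n cp, q :: 'm cp). q \<in> C}. f z = 0) --> f (x, y) = 0"
 show "(pt x, pt y) \<in> {(p, q). q \<in> C}"
 proof (rule ccontr)
  assume "\<not> ?thesis"
  then have "pt y \<notin> C" by simp
  then obtain d f where f: "f \<in> hpoly d" "!!y. y \<in> acone C ==> f y = 0" "f y ~= 0"
   using closedin_zariskiE[OF assms y] by metis
  have "(%z :: (complex ^ 'n) \<times> (complex ^ 'm). f (snd z)) \<in> poly_fun bicoords"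
   by (rule poly_fun_compose[OF hpoly_poly_fun[OF f(1)]]) (auto intro: poly_fun.coord)
  then have A: "(%z :: (complex ^ 'n) \<times> (complex ^ 'm). f (snd z)) \<in> bihpoly 0 d"
   using hpolyD[OF f(1)] by (simp add: bihpoly_def)
  have B: "f (snd z) = 0" if "z \<in> bicone {(p :: 'n cp, q :: 'm cp). q \<in> C}" for z
   using f(2) that by (auto simp: bicone_def acone_def)
  show False using van[rule_format, OF A B] f(3) by simp
 qed
qed

lemma openin_nonzero: "f \<in> hpoly d ==> openin zariski {p. EX x:line_of p. f x ~= 0}"
 unfolding zariski_def by (rule topology_generated_by_Basis) blast

lemma pt_nonzero: "f \<in> hpoly d ==> x ~= 0 ==> pt x \<in> {p. EX x:line_of p. f x ~= 0} \<longleftrightarrow> f x ~= 0"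
 using hpoly_line by blast

lemma hpoly_mult': "f \<in> hpoly d ==> g \<in> hpoly e ==> d + e = n ==> (%x. f x * g x) \<in> hpoly n"
 using hpoly_mult by blast

text \<open>Value and partial derivatives of the section times m are expressed by the pairings of
  the hyperplane with the point and with tangent vectors. This links tangency to double roots of the
  discriminant.\<close>

lemma section_jets:
 fixes a b f g k s w v
 defines "m \<equiv> b * w + poly (quadricP g) s"
 assumes on: "v * m = a * w ^ 2 + poly (quarticP f) s"
 shows "kap a b k * w ^ 2 + poly (polB b g k) s * w + poly (polC f g k) s = m * dpair k (aff s w v)"
  "2 * kap a b k * w + poly (polB b g k) s = k $ 3 * m + k $ 4 * (2 * a * w - b * v) + b * dpair k (aff s w v)"
  "poly (pd (polB b g k)) s * w + poly (pd (polC f g k)) s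
   = poly (pd (baseP k)) s * m + k $ 4 * (poly (pd (quarticP f)) s - v * poly (pd (quadricP g)) s) + poly (pd (quadricP g)) s * dpair k (aff s w v)"
proof -
 have d: "dpair k (aff s w v) = poly (baseP k) s + k $ 3 * w + k $ 4 * v" by (simp add: dpair_5 baseP_jets)
 have "m * dpair k (aff s w v) = m * (poly (baseP k) s + k $ 3 * w) + k $ 4 * (v * m)" unfolding d by (simp add: algebra_simps)
 then show "kap a b k * w ^ 2 + poly (polB b g k) s * w + poly (polC f g k) s = m * dpair k (aff s w v)"
  unfolding on by (simp add: m_def kap_def polB_def polC_def alg_simps2)
 show "2 * kap a b k * w + poly (polB b g k) s = k $ 3 * m + k $ 4 * (2 * a * w - b * v) + b * dpair k (aff s w v)"
  unfolding d by (simp add: m_def kap_def polB_def algebra_simps)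
 show "poly (pd (polB b g k)) s * w + poly (pd (polC f g k)) s
   = poly (pd (baseP k)) s * m + k $ 4 * (poly (pd (quarticP f)) s - v * poly (pd (quadricP g)) s) + poly (pd (quadricP g)) s * dpair k (aff s w v)"
  unfolding d m_def polB_def polC_def by (simp add: pderiv_add pderiv_smult pderiv_mult algebra_simps)
qed

context segre_surface_form
begin

text \<open>The pairing with the tangent vector in direction w, written homogeneously. The factor
  \<open>n $ 2\<close> makes it vanish outside the chart, so that the condition makes sense on all
  of S.\<close>

definition cond_vertical :: "complex ^ 5 => complex ^ 5 => complex" where
 "cond_vertical n k = n $ 2 * (k $ 3 * (b * n $ 3 + g 0 * n $ 0 + g 1 * n $ 1 + g 2 * n $ 2) + k $ 4 * (2 * a * n $ 3 - b * n $ 4))"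

definition cond_horizontal :: "complex ^ 5 => complex ^ 5 => complex" where
 "cond_horizontal n k = n $ 2 * ((2 * k $ 0 * n $ 1 + k $ 1 * n $ 2) * (b * n $ 3 + g 0 * n $ 0 + g 1 * n $ 1 + g 2 * n $ 2)
  + k $ 4 * (4 * f 0 * n $ 0 * n $ 1 + f 1 * (n $ 0 * n $ 2 + 2 * n $ 1 * n $ 1) + 2 * f 2 * n $ 1 * n $ 2 + f 3 * n $ 2 * n $ 2
   - n $ 4 * (2 * g 0 * n $ 1 + g 1 * n $ 2)))"

lemma N_smult: "N *v (c *s x) = c *s (N *v x)"
 by (rule vector_scalar_commute)

lemma cond_bihpoly:
 "(%z. dpair (K (snd z)) (N *v fst z)) \<in> bihpoly 1 1"
 "(%z. cond_vertical (N *v fst z) (K (snd z))) \<in> bihpoly 2 1"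
 "(%z. cond_horizontal (N *v fst z) (K (snd z))) \<in> bihpoly 3 1"
proof -
 note B = poly_fun.const poly_fun.add poly_fun.mult poly_fun_diff bicoord_fst[of N] bicoord_snd[of "transpose M"]
 show "(%z. dpair (K (snd z)) (N *v fst z)) \<in> bihpoly 1 1"
  unfolding bihpoly_def
 proof (intro CollectI conjI allI)
  show "(%z. dpair (K (snd z)) (N *v fst z)) \<in> poly_fun bicoords"
   unfolding dpair_5 K_def by (intro B)
 qed (simp add: dpair_5 N_smult K_smult algebra_simps)
 show "(%z. cond_vertical (N *v fst z) (K (snd z))) \<in> bihpoly 2 1"
  unfolding bihpoly_def
 proof (intro CollectI conjI allI)
  show "(%z. cond_vertical (N *v fst z) (K (snd z))) \<in> poly_fun bicoords"
   unfolding cond_vertical_def K_def by (intro B)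
 qed (simp add: cond_vertical_def N_smult K_smult alg_simps2)
 show "(%z. cond_horizontal (N *v fst z) (K (snd z))) \<in> bihpoly 3 1"
  unfolding bihpoly_def
 proof (intro CollectI conjI allI)
  show "(%z. cond_horizontal (N *v fst z) (K (snd z))) \<in> poly_fun bicoords"
   unfolding cond_horizontal_def K_def by (intro B)
 qed (simp add: cond_horizontal_def N_smult K_smult algebra_simps power3_eq_cube)
qed

lemma cond_aff:
 "cond_vertical (aff s w v) k = k $ 3 * (b * w + poly (quadricP g) s) + k $ 4 * (2 * a * w - b * v)"
 "cond_horizontal (aff s w v) k = poly (pd (baseP k)) s * (b * w + poly (quadricP g) s)
  + k $ 4 * (poly (pd (quarticP f)) s - v * poly (pd (quadricP g)) s)"
 by (simp_all add: cond_vertical_def cond_horizontal_def poly_quadricP poly_pderiv_quarticP poly_pderiv_quadricP baseP_jets algebra_simps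
   pow_simps3)

lemma cond_smult:
 "cond_vertical (c *s n) k = c ^ 2 * cond_vertical n k" "cond_horizontal (c *s n) k = c ^ 3 * cond_horizontal n k"
 by (simp_all add: cond_vertical_def cond_horizontal_def alg_simps3)

lemma tangent_conditions:
 assumes x: "x ~= 0" "pt x \<in> S" and h: "h ~= 0" and tan: "tangent_hyperplane S (pt x) (pt h)"
 shows "dpair (K h) (N *v x) = 0" "cond_vertical (N *v x) (K h) = 0" "cond_horizontal (N *v x) (K h) = 0"
proof -
 have hl: "h \<in> line_of (pt h)" using line_of_pt[OF h] by (auto intro: range_eqI[of _ _ 1])
 have T: "dpair (K h) v = 0" if "M *v v \<in> tangent_cone S (pt x)" for v
  using tan that hl unfolding tangent_hyperplane_def by (metis dpair_M)
 define z where "z = N *v x"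
 have xz: "x = M *v z" by (simp add: z_def)
 have z0: "z ~= 0" using x(1) xz by auto
 show "dpair (K h) (N *v x) = 0"
  using T[of z] tangent_base[of z] x z0 unfolding xz by simp
 show "cond_vertical (N *v x) (K h) = 0" "cond_horizontal (N *v x) (K h) = 0"
 proof -
  have "cond_vertical z (K h) = 0 & cond_horizontal z (K h) = 0"
  proof (cases "z $ 2 = 0")
   case True
   then show ?thesis by (simp add: cond_vertical_def cond_horizontal_def)
  next
   case False
   define s w v where "s = z $ 1 / z $ 2" and "w = z $ 3 / z $ 2" and "v = z $ 4 / z $ 2"
   have S: "pt (M *v z) \<in> S" using x xz by simp
   note P = affine_point[OF S False, folded s_def w_def v_def]
   have p: "pt x = pt (M *v aff s w v)" using P(3) xz by simp
   let ?m = "b * w + poly (quadricP g) s"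
   have "cond_vertical (aff s w v) (K h) = 0 & cond_horizontal (aff s w v) (K h) = 0"
   proof (cases "?m = 0")
    case True
    have "dpair (K h) (vec5 0 0 0 0 1) = 0"
     by (rule T) (use tangent_vertical[OF P(2) True] p in simp)
    then have "K h $ 4 = 0" by (simp add: dpair_5)
    then show ?thesis unfolding cond_aff True by simp
   next
    case m: False
    let ?c = "%x y. vec5 (2 * s * (x * ?m)) (x * ?m) 0 (y * ?m) (y * (2 * a * w - b * v) + x * (poly (pderiv (quarticP f)) s - v * poly (pderiv (quadricP g)) s))"
    have "dpair (K h) (?c x y) = 0" for x y
     by (rule T) (use tangent_lift[OF P(2) refl m, of x y] p in simp)
    from this[of 1 0] this[of 0 1] show ?thesis
     unfolding cond_aff baseP_jets by (simp add: dpair_5 algebra_simps)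
   qed
   then show ?thesis by (subst (1 2) P(1)) (simp add: cond_smult)
  qed
  then show "cond_vertical (N *v x) (K h) = 0" "cond_horizontal (N *v x) (K h) = 0" by (simp_all add: z_def)
 qed
qed

text \<open>The three conditions are bihomogeneous equations that hold over the smooth locus, so
  they persist on the closure.\<close>

lemma incidence_conditions:
 assumes "x ~= 0" "h ~= 0" "(pt x, pt h) \<in> incidence_variety S"
 shows "dpair (K h) (N *v x) = 0" "cond_vertical (N *v x) (K h) = 0" "cond_horizontal (N *v x) (K h) = 0"
proof -
 let ?W = "{(p, H). p \<in> smooth_locus S & tangent_hyperplane S p H}"
 have W: "dpair (K (snd z)) (N *v fst z) = 0 & cond_vertical (N *v fst z) (K (snd z)) = 0 & cond_horizontal (N *v fst z) (K (snd z)) = 0"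
  if "z \<in> bicone ?W" for z
 proof -
  obtain y k where z: "z = (y, k)" by (metis surj_pair)
  then have yk: "y ~= 0" "k ~= 0" "pt y \<in> smooth_locus S" "tangent_hyperplane S (pt y) (pt k)" using that by (simp_all add: bicone_def)
  then have "pt y \<in> S" by (simp add: smooth_locus_iff)
  from tangent_conditions[OF yk(1) this yk(2,4)] show ?thesis by (simp add: z)
 qed
 have cl: "ALL d e. ALL f:bihpoly d e. (ALL z:bicone ?W. f z = 0) --> f (x, h) = 0"
  using assms(3) unfolding incidence_variety_def zariski_prod_closure_pt[OF assms(1,2)] .
 show "dpair (K h) (N *v x) = 0" using cl[rule_format, OF cond_bihpoly(1)] W by simp
 show "cond_vertical (N *v x) (K h) = 0" using cl[rule_format, OF cond_bihpoly(2)] W by simp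
 show "cond_horizontal (N *v x) (K h) = 0" using cl[rule_format, OF cond_bihpoly(3)] W by simp
qed

text \<open>With \<kappa> and k4 nonzero, m = 0 would make the gradient of the surface equation
  vanish. A root of order exactly two would give a node, so the root is triple and determines the
  hyperplane.\<close>

lemma not_node_unique:
 assumes sm: "pt (M *v aff s w v) \<in> smooth_locus S" and inc: "(pt (M *v aff s w v), pt h) \<in> incidence_variety S" and h: "h ~= 0"
  and node: "\<not> ordinary_node_at S (pt (M *v aff s w v)) (pt h)" and nz: "kap a b (K h) ~= 0" "K h $ 4 ~= 0"
 shows "EX c. c ~= 0 & K h = c *s \<Xi> s w"
proof -
 have onS: "on_S s w v" using sm aff_in_S by (simp add: smooth_locus_iff)
 have x: "M *v aff s w v ~= 0" by simp
 note E = incidence_conditions[OF x h inc, simplified, unfolded cond_aff]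
 have m: "b * w + poly (quadricP g) s ~= 0"
 proof
  assume m: "b * w + poly (quadricP g) s = 0"
  have "2 * a * w - b * v = 0" "poly (pderiv (quarticP f)) s - v * poly (pderiv (quadricP g)) s = 0"
   using E(2,3) nz(2) unfolding m by simp_all
  then show False using not_smooth_affine[OF onS m] sm by blast
 qed
 note J = section_jets[OF onS[unfolded on_S_def], of "K h"]
 have c: "kap a b (K h) * w ^ 2 + poly (polB b g (K h)) s * w + poly (polC f g (K h)) s = 0"
  "2 * kap a b (K h) * w + poly (polB b g (K h)) s = 0"
  "poly (pd (polB b g (K h))) s * w + poly (pd (polC f g (K h))) s = 0"
  unfolding J using E by simp_all
 obtain q where q: "discP a b f g (K h) = [:- s, 1:] ^ 2 * q" using disc_double_root[OF c] by blast
 have "poly q s = 0"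
 proof (rule ccontr)
  assume q0: "poly q s ~= 0"
  \<comment> \<open>X = (u + v) / 2 and T = (v - u) / 2 turn X^2 - T^2 into u v.\<close>
  have "section_has_local_equation S (pt (M *v aff s w v)) (pt h) (%u v. (1 / 2 * u + 1 / 2 * v) ^ 2 - (- 1 / 2 * u + 1 / 2 * v) ^ 2)"
   by (rule section_chart[OF onS m h nz(1) c(2) q q0]) simp_all
  moreover have "(%u v :: complex. (1 / 2 * u + 1 / 2 * v) ^ 2 - (- 1 / 2 * u + 1 / 2 * v) ^ 2) = (%u v. u * v)"
   by (simp add: fun_eq_iff field_simps power2_eq_square)
  ultimately show False using node unfolding ordinary_node_at_def by simp
 qed
 then obtain r where r: "q = [:- s, 1:] * r" using poly_root_factor by blast
 have "discP a b f g (K h) = [:- s, 1:] ^ 3 * r" unfolding q r by (simp only: power3_eq_cube power2_eq_square mult.assoc)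
 then have "[:- s, 1:] ^ 3 dvd discP a b f g (K h)" by (rule dvdI)
 from Xi_unique[OF nz m c(2) this] show ?thesis .
qed

lemma cusp_unique:
 assumes sm: "pt (M *v aff s w v) \<in> smooth_locus S" and cusp: "ordinary_cusp_at S (pt (M *v aff s w v)) H"
 shows "EX h c. h ~= 0 & H = pt h & c ~= 0 & h = c *s L (\<Xi> s w) & kap a b (K h) ~= 0 & K h $ 4 ~= 0"
proof -
 obtain h where h: "h ~= 0" "H = pt h" and m: "b * w + poly (quadricP g) s ~= 0" and nz: "kap a b (K h) ~= 0" "K h $ 4 ~= 0"
  and B: "2 * kap a b (K h) * w + poly (polB b g (K h)) s = 0" and tr: "[:- s, 1:] ^ 3 dvd discP a b f g (K h)"
  using cusp_affine[OF assms] by blast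
 obtain c where c: "c ~= 0" "K h = c *s \<Xi> s w" using Xi_unique[OF nz m B tr] by blast
 have "h = c *s L (\<Xi> s w)" using arg_cong[OF c(2), of L] by (simp add: L_smult)
 then show ?thesis using h c nz by blast
qed

definition fib :: "complex => complex => complex" where
 "fib s w = (a * w ^ 2 + poly (quarticP f) s) / (b * w + poly (quadricP g) s)"

lemma on_S_fib: "b * w + poly (quadricP g) s ~= 0 ==> on_S s w v \<longleftrightarrow> v = fib s w"
 by (auto simp: on_S_def fib_def field_simps)

text \<open>The triple root gives back the critical equations, and these are the pairings of the
  hyperplane with the vectors spanning the tangent space.\<close>

lemma generic_Xi:
 assumes gen: "generic s w" and on: "on_S s w v"
 shows "dpair (\<Xi> s w) (aff s w v) = 0" "tangent_hyperplane S (pt (M *v aff s w v)) (pt (L (\<Xi> s w)))"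
  "\<Xi> s w ~= 0" "EX c. c ~= 0 & \<Gamma> (\<Xi> s w) = c *s aff s w v"
proof -
 let ?k = "\<Xi> s w"
 have m: "b * w + poly (quadricP g) s ~= 0" using gen by (simp add: generic_def)
 note X = Xi_triple[OF gen]
 show nz: "\<Xi> s w ~= 0" using X(2) by auto
 have tr: "[:- s, 1:] ^ 3 dvd discP a b f g ?k" using X(4) by (metis dvdI)
 note R = triple_root_jets[OF tr]
 have B: "poly (polB b g ?k) s = - (2 * kap a b ?k * w)" using X(3) by (simp add: eq_neg_iff_add_eq_0 add.commute)
 have C: "kap a b ?k * w ^ 2 + poly (polB b g ?k) s * w + poly (polC f g ?k) s = 0"
  using complete_square[of a b ?k w g s f] X(1) unfolding X(3) R(1) by simp
 note J = section_jets[OF on[unfolded on_S_def], of ?k]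
 show d: "dpair ?k (aff s w v) = 0" using C m unfolding J(1) by simp
 have "poly (pd (discP a b f g ?k)) s = 2 * poly (polB b g ?k) s * poly (pd (polB b g ?k)) s - 4 * kap a b ?k * poly (pd (polC f g ?k)) s"
  by (simp add: discP_def pderiv_diff pderiv_smult power2_eq_square pderiv_mult)
 also have "\<dots> = - 4 * kap a b ?k * (poly (pd (polB b g ?k)) s * w + poly (pd (polC f g ?k)) s)" unfolding B by (simp add: algebra_simps)
 finally have C1: "poly (pd (polB b g ?k)) s * w + poly (pd (polC f g ?k)) s = 0" using R(2) X(1) by simp
 show "EX c. c ~= 0 & \<Gamma> ?k = c *s aff s w v" by (rule Gam_triple[OF tr X(3) d X(1,2,5)])
 have e: "?k $ 3 * (b * w + poly (quadricP g) s) + ?k $ 4 * (2 * a * w - b * v) = 0"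
  "poly (pd (baseP ?k)) s * (b * w + poly (quadricP g) s) + ?k $ 4 * (poly (pd (quarticP f)) s - v * poly (pd (quadricP g)) s) = 0"
  using X(3) C1 unfolding J(2,3) d by simp_all
 have dL: "dpair (L ?k) (M *v y) = dpair ?k y" for y by (simp add: dpair_M)
 define m where "m = b * w + poly (quadricP g) s"
 show "tangent_hyperplane S (pt (M *v aff s w v)) (pt (L ?k))"
  unfolding tangent_hyperplane_def
 proof (intro ballI)
  fix y h assume y: "y \<in> tangent_cone S (pt (M *v aff s w v))" and "h \<in> line_of (pt (L ?k))"
  then obtain c where h: "h = c *s L ?k" using line_of_pt[of "L ?k"] nz by auto
  have "y \<in> vec.span {M *v aff s w v, M *v vec5 (2 * s * m) m 0 0 (poly (pd (quarticP f)) s - v * poly (pd (quadricP g)) s), M *v vec5 0 0 0 m (2 * a * w - b * v)}"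
   using y tangent_span[OF on m] unfolding m_def by blast
  moreover have "vec.subspace {y. dpair (L ?k) y = 0}"
   by (simp add: vec.subspace_def dpair_add dpair_smult)
  moreover have "{M *v aff s w v, M *v vec5 (2 * s * m) m 0 0 (poly (pd (quarticP f)) s - v * poly (pd (quadricP g)) s), M *v vec5 0 0 0 m (2 * a * w - b * v)} \<subseteq> {y. dpair (L ?k) y = 0}"
   using d e unfolding m_def[symmetric] by (simp add: dL dpair_5[of _ "vec5 _ _ _ _ _"] baseP_jets algebra_simps)
  ultimately have "y \<in> {y. dpair (L ?k) y = 0}" using vec.span_minimal by blast
  then show "dpair h y = 0" by (simp add: h dpair_smult)
 qed
qed

lemma generic_cusp:
 assumes gen: "generic s w" and on: "on_S s w v"
 defines "p \<equiv> pt (M *v aff s w v)" and "H \<equiv> pt (L (\<Xi> s w))"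
 shows "p \<in> smooth_locus S" "(p, H) \<in> incidence_variety S" "ordinary_cusp_at S p H" "\<not> ordinary_node_at S p H"
proof -
 have m: "b * w + poly (quadricP g) s ~= 0" using gen by (simp add: generic_def)
 note X = Xi_triple[OF gen] and Y = generic_Xi[OF gen on]
 have h: "L (\<Xi> s w) ~= 0" using Y(3) by simp
 show sm: "p \<in> smooth_locus S" unfolding p_def by (rule smooth_affine[OF on m])
 have "{(p, H). p \<in> smooth_locus S & tangent_hyperplane S p H} \<subseteq> incidence_variety S"
  unfolding incidence_variety_def by (rule closure_of_subset) simp
 then show "(p, H) \<in> incidence_variety S" using sm Y(2) by (auto simp: p_def H_def)
 obtain q where q: "discP a b f g (\<Xi> s w) = [:- s, 1:] ^ 3 * q" "poly q s ~= 0" using X(4) by blast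
 have "section_has_local_equation S p H (%u v. (1 * u + 0 * v) ^ 2 - (0 * u + 1 * v) ^ 3)"
  unfolding p_def H_def by (rule section_chart[OF on m h, unfolded KL, OF X(1,3) q]) simp_all
 then show "ordinary_cusp_at S p H" by (simp add: ordinary_cusp_at_def)
 have "[:- s, 1:] ^ 3 dvd discP a b f g (K (L (\<Xi> s w)))" using q(1) by simp
 then show "\<not> ordinary_node_at S p H"
  unfolding p_def H_def using X by (intro triple_root_not_node[OF on m h]) simp_all
qed

end

section \<open>Homogenization\<close>

definition bip :: "(complex \<times> complex => complex) => bool" where
 "bip u \<longleftrightarrow> (EX N. bipoly N u)"

lemma bipoly_mono: "bipoly N u ==> N \<le> M ==> bipoly M u"
proof -
 assume u: "bipoly N u" and le: "N \<le> M"
 have "bipoly (M - N) (%(s, w). 1 * s ^ 0 * w ^ 0)" by (rule bipoly_monomial) simp_all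
 from bipoly_mult[OF this u] show ?thesis using le by (simp add: case_prod_beta)
qed

lemma bip_const: "bip (%_. c)"
proof -
 have "bipoly 0 (%(s, w). c * s ^ 0 * w ^ 0)" by (rule bipoly_monomial) simp_all
 moreover have "(%(s :: complex, w :: complex). c * s ^ 0 * w ^ 0) = (%_. c)" by auto
 ultimately show ?thesis unfolding bip_def by metis
qed

lemma bip_snd: "bip snd"
proof -
 have "bipoly 1 (%(s, w). 1 * s ^ 0 * w ^ 1)" by (rule bipoly_monomial) simp_all
 moreover have "(%(s :: complex, w :: complex). 1 * s ^ 0 * w ^ 1) = snd" by auto
 ultimately show ?thesis unfolding bip_def by metis
qed

lemma bip_fst: "bip fst"
proof -
 have "bipoly 1 (%(s, w). 1 * s ^ 1 * w ^ 0)" by (rule bipoly_monomial) simp_all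
 moreover have "(%(s :: complex, w :: complex). 1 * s ^ 1 * w ^ 0) = fst" by auto
 ultimately show ?thesis unfolding bip_def by metis
qed

lemma bip_mult: "bip u ==> bip v ==> bip (%z. u z * v z)"
 unfolding bip_def using bipoly_mult by blast

lemma bip_add: "bip u ==> bip v ==> bip (%z. u z + v z)"
 unfolding bip_def using bipoly_add bipoly_mono by (metis max.cobounded1 max.cobounded2)

lemma bip_diff: "bip u ==> bip v ==> bip (%z. u z - v z)"
 using bip_add[OF _ bip_mult[OF bip_const[of "- 1"]], of u v] by simp

lemma bip_power: "bip u ==> bip (%z. u z ^ n)"
 by (induction n) (auto intro: bip_mult bip_const)

lemma bip_poly: "bip (%z. poly p (fst z))"
proof (induction p)
 case 0
 show ?case by (simp add: bip_const)
next
 case (pCons c p)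
 have "bip (%z. c + fst z * poly p (fst z))" by (intro bip_add bip_mult bip_const bip_fst pCons.IH)
 then show ?case by simp
qed

lemma bip_sum: "(!!i. i \<in> I ==> bip (u i)) ==> bip (%z. \<Sum>i\<in>I. u i z)"
 by (induction I rule: infinite_finite_induct) (auto intro: bip_const bip_add)

lemmas bip_intros = bip_const bip_snd bip_fst bip_mult bip_add bip_diff bip_power bip_poly bip_sum

lemma bip_fiber: "bip u ==> EX p. ALL w. u (s, w) = poly p w"
proof -
 assume "bip u"
 then obtain N c where u: "!!s w. u (s, w) = (\<Sum>(i, j)\<in>{..N} \<times> {..N}. c i j * s ^ i * w ^ j)" unfolding bip_def bipoly_def by blast
 show ?thesis
  by (intro exI[of _ "\<Sum>(i, j)\<in>{..N} \<times> {..N}. Polynomial.monom (c i j * s ^ i) j"] allI)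
   (simp add: u poly_sum poly_monom case_prod_beta)
qed

text \<open>A factor \<open>x 2\<close> is included so that homogenizations vanish at infinity.\<close>

lemma homogenize:
 assumes "bipoly N u"
 shows "EX f:hpoly (2 * N + 1). (ALL x :: complex ^ 5. x $ 2 ~= 0 --> f x = x $ 2 ^ (2 * N + 1) * u (x $ 1 / x $ 2, x $ 3 / x $ 2)) &
  (ALL x. x $ 2 = 0 --> f x = 0)"
proof -
 obtain c where u: "!!s w. u (s, w) = (\<Sum>(i, j)\<in>{..N} \<times> {..N}. c i j * s ^ i * w ^ j)" using assms unfolding bipoly_def by blast
 define f where "f x = (\<Sum>z\<in>{..N} \<times> {..N}. c (fst z) (snd z) * (x $ 1 ^ fst z * (x $ 3 ^ snd z * x $ 2 ^ (2 * N + 1 - fst z - snd z))))" for x :: "complex ^ 5"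
 have "f \<in> hpoly (2 * N + 1)"
  unfolding f_def
 proof (rule hpoly_sum)
  fix z assume z: "z \<in> {..N} \<times> {..N}"
  have "(%x :: complex ^ 5. x $ 1 ^ fst z * (x $ 3 ^ snd z * x $ 2 ^ (2 * N + 1 - fst z - snd z)))
   \<in> hpoly (fst z * 1 + (snd z * 1 + (2 * N + 1 - fst z - snd z) * 1))"
   by (intro hpoly_mult hpoly_power hpoly_coord)
  moreover have "fst z * 1 + (snd z * 1 + (2 * N + 1 - fst z - snd z) * 1) = 2 * N + 1" using z by auto
  ultimately show "(%x :: complex ^ 5. c (fst z) (snd z) * (x $ 1 ^ fst z * (x $ 3 ^ snd z * x $ 2 ^ (2 * N + 1 - fst z - snd z)))) \<in> hpoly (2 * N + 1)"
   by (intro hpoly_cmult) simp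
 qed
 moreover have "f x = x $ 2 ^ (2 * N + 1) * u (x $ 1 / x $ 2, x $ 3 / x $ 2)" if "x $ 2 ~= 0" for x
  unfolding f_def u sum_distrib_left case_prod_beta
 proof (rule sum.cong[OF refl])
  fix z assume z: "z \<in> {..N} \<times> {..N}"
  then have "2 * N + 1 = fst z + (snd z + (2 * N + 1 - fst z - snd z))" by auto
  then have "x $ 2 ^ (2 * N + 1) = x $ 2 ^ fst z * (x $ 2 ^ snd z * x $ 2 ^ (2 * N + 1 - fst z - snd z))" by (metis power_add)
  then show "c (fst z) (snd z) * (x $ 1 ^ fst z * (x $ 3 ^ snd z * x $ 2 ^ (2 * N + 1 - fst z - snd z))) =
   x $ 2 ^ (2 * N + 1) * (c (fst z) (snd z) * (x $ 1 / x $ 2) ^ fst z * (x $ 3 / x $ 2) ^ snd z)"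
   using that by (simp only:) (simp add: power_divide)
 qed
 moreover have "f x = 0" if "x $ 2 = 0" for x
  unfolding f_def using that by (intro sum.neutral) (auto simp: power_0_left)
 ultimately show ?thesis by blast
qed

lemma bip_uniform:
 fixes u :: "'i::finite => complex \<times> complex => complex"
 assumes "!!i. bip (u i)"
 shows "EX N. ALL i. bipoly N (u i)"
proof -
 obtain n where n: "!!i. bipoly (n i) (u i)" using assms unfolding bip_def by metis
 have "bipoly (Max (range n)) (u i)" for i by (rule bipoly_mono[OF n]) simp
 then show ?thesis by blast
qed

lemma bip_Xi: "bip (%z. Xi a f g (fst z) (snd z) $ i)"
proof -
 have "ALL i. bip (%z. Xi a f g (fst z) (snd z) $ i)"
 proof (cases "a = 0")
  case True
  show ?thesis unfolding Xi_def Let_def kvec_def forall_5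
   by (simp only: True refl if_True vec5_nth) (intro conjI bip_intros)
 next
  case False
  show ?thesis unfolding Xi_def Let_def kvec_def forall_5
   by (simp only: False if_False vec5_nth) (intro conjI bip_intros)
 qed
 then show ?thesis by blast
qed

context segre_surface_form
begin

lemma exists_map: "EX F D. (ALL i. (%x. F x $ i) \<in> hpoly D) &
  (ALL z. z $ 2 ~= 0 --> F (M *v z) = z $ 2 ^ D *s L (\<Xi> (z $ 1 / z $ 2) (z $ 3 / z $ 2))) & (ALL z. z $ 2 = 0 --> F (M *v z) = 0)"
proof -
 obtain B where B: "!!i :: 5. bipoly B (%z. \<Xi> (fst z) (snd z) $ i)" using bip_uniform[of "%i z. \<Xi> (fst z) (snd z) $ i", OF bip_Xi] by blast
 have "ALL i. EX h. h \<in> hpoly (2 * B + 1) & (ALL x :: complex ^ 5. x $ 2 ~= 0 --> h x = x $ 2 ^ (2 * B + 1) * \<Xi> (x $ 1 / x $ 2) (x $ 3 / x $ 2) $ i) & (ALL x. x $ 2 = 0 --> h x = 0)"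
  using homogenize[OF B] by fastforce
 then obtain h :: "5 => complex ^ 5 => complex" where h: "!!i. h i \<in> hpoly (2 * B + 1)"
  "!!i x. x $ 2 ~= 0 ==> h i x = x $ 2 ^ (2 * B + 1) * \<Xi> (x $ 1 / x $ 2) (x $ 3 / x $ 2) $ i" "!!i x. x $ 2 = 0 ==> h i x = 0"
  by metis
 define F where "F x = L (\<chi> i. h i (N *v x))" for x
 have "(%x. h i (N *v x)) \<in> hpoly ((2 * B + 1) * 1)" for i by (rule hpoly_compose[OF h(1) hpoly_matrix])
 then have "(%x. F x $ i) \<in> hpoly (2 * B + 1)" for i
  unfolding F_def L_def matrix_vector_mult_def by (simp, intro hpoly_sum hpoly_cmult) simp
 moreover have "F (M *v z) = z $ 2 ^ (2 * B + 1) *s L (\<Xi> (z $ 1 / z $ 2) (z $ 3 / z $ 2))" if "z $ 2 ~= 0" for z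
 proof -
  have "(\<chi> i. h i z) = z $ 2 ^ (2 * B + 1) *s \<Xi> (z $ 1 / z $ 2) (z $ 3 / z $ 2)"
   by (simp add: cvec_eq_iff h(2)[OF that])
  then show ?thesis by (simp add: F_def L_smult)
 qed
 moreover have "F (M *v z) = 0" if "z $ 2 = 0" for z
 proof -
  have "(\<chi> i. h i z) = (0 :: complex ^ 5)" by (simp add: cvec_eq_iff h(3)[OF that])
  then show ?thesis by (simp add: F_def)
 qed
 ultimately show ?thesis by blast
qed

lemma exists_form: "EX f e. f \<in> hpoly e & 0 < e & (ALL z. f (M *v z) ~= 0 \<longleftrightarrow> z $ 2 ~= 0 & generic (z $ 1 / z $ 2) (z $ 3 / z $ 2))"
proof -
 have "bip (%z. poly (goodP a f g) (fst z) * (b * snd z + poly (quadricP g) (fst z)))" by (intro bip_intros)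
 then obtain B where B: "bipoly B (%z. poly (goodP a f g) (fst z) * (b * snd z + poly (quadricP g) (fst z)))" unfolding bip_def by blast
 obtain h :: "complex ^ 5 => complex" where h: "h \<in> hpoly (2 * B + 1)" "!!x :: complex ^ 5. x $ 2 ~= 0 ==> h x = x $ 2 ^ (2 * B + 1) * (poly (goodP a f g) (x $ 1 / x $ 2) * (b * (x $ 3 / x $ 2) + poly (quadricP g) (x $ 1 / x $ 2)))"
  "!!x. x $ 2 = 0 ==> h x = 0"
  using homogenize[OF B] by auto
 have "(%x. h (N *v x)) \<in> hpoly ((2 * B + 1) * 1)" by (rule hpoly_compose[OF h(1) hpoly_matrix])
 moreover have "h (N *v (M *v z)) ~= 0 \<longleftrightarrow> z $ 2 ~= 0 & generic (z $ 1 / z $ 2) (z $ 3 / z $ 2)" for z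
  using h(2,3)[of z] by (cases "z $ 2 = 0") (auto simp: generic_def)
 ultimately show ?thesis by (intro exI[of _ "%x. h (N *v x)"] exI[of _ "(2 * B + 1) * 1"]) simp
qed

end

lemma hpoly_kap: "(%k. kap a b k) \<in> hpoly 1"
 unfolding kap_def by (intro hpoly_add hpoly_cmult hpoly_coord)

lemma hpoly_dco: "(%k. dco a b f g i k) \<in> hpoly 2"
proof -
 have e: "(%k :: complex ^ 5. b * k $ i + c * k $ j) \<in> hpoly 1" for b c i j by (intro hpoly_add hpoly_cmult hpoly_coord)
 have l: "(%k :: complex ^ 5. c * k $ i + d * k $ j + e * k $ l + f * k $ m) \<in> hpoly 1" "(%k :: complex ^ 5. c * k $ i + d * k $ j + e * k $ l) \<in> hpoly 1" for c d e f i j l m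
  by (intro hpoly_add hpoly_cmult hpoly_coord)+
 show ?thesis
  unfolding dco_def Let_def
  by (cases "i = 0"; cases "i = 1"; cases "i = 2"; cases "i = 3"; simp;
   intro hpoly_add hpoly_diff hpoly_cmult hpoly_mult'[OF e e] hpoly_mult'[OF hpoly_kap e] hpoly_mult'[OF hpoly_kap l(1)] hpoly_mult'[OF hpoly_kap l(2)]; simp)
qed

lemma hpoly_hess: "(%k. hess a b f g i k) \<in> hpoly 4"
 unfolding hess_def Let_def
 by (cases "i = 0"; cases "i = 1"; simp; intro hpoly_add hpoly_diff hpoly_cmult hpoly_mult'[OF hpoly_dco hpoly_dco]; simp)

lemma hpoly_Gam: "(%k. Gam a b f g k $ i) \<in> hpoly 6"
proof -
 have ky: "(%k :: complex ^ 5. k $ i * hess a b f g j k) \<in> hpoly 5" for i j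
  by (rule hpoly_mult'[OF hpoly_coord hpoly_hess]) simp
 have A: "(%k. k $ 0 * hess a b f g 0 k + k $ 1 * hess a b f g 1 k + k $ 2 * hess a b f g 2 k) \<in> hpoly 5"
  by (intro hpoly_add ky)
 have "(%k. g 0 * hess a b f g 0 k + g 1 * hess a b f g 1 k + g 2 * hess a b f g 2 k) \<in> hpoly 4"
  by (intro hpoly_add hpoly_cmult hpoly_hess)
 then have "(%k :: complex ^ 5. k $ 3 * (g 0 * hess a b f g 0 k + g 1 * hess a b f g 1 k + g 2 * hess a b f g 2 k)) \<in> hpoly 5"
  by (rule hpoly_mult'[OF hpoly_coord]) simp
 then have B: "(%k. b * (k $ 0 * hess a b f g 0 k + k $ 1 * hess a b f g 1 k + k $ 2 * hess a b f g 2 k) +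
   k $ 3 * (g 0 * hess a b f g 0 k + g 1 * hess a b f g 1 k + g 2 * hess a b f g 2 k)) \<in> hpoly 5"
  by (intro hpoly_add hpoly_cmult A)
 have "ALL i. (%k. Gam a b f g k $ i) \<in> hpoly 6"
  unfolding Gam_def Let_def forall_5 vec5_nth
  by (intro conjI hpoly_diff hpoly_cmult hpoly_mult'[OF hpoly_kap ky] hpoly_mult'[OF hpoly_kap A] hpoly_mult'[OF hpoly_coord B]; simp)
 then show ?thesis by blast
qed

section \<open>The cuspidal map and its inverse\<close>

context segre_surface_form
begin

definition is_map :: "(complex ^ 5 => complex ^ 5) => nat => bool" where
 "is_map F D \<longleftrightarrow> (ALL i. (%x. F x $ i) \<in> hpoly D) &
  (ALL z. z $ 2 ~= 0 --> F (M *v z) = z $ 2 ^ D *s L (\<Xi> (z $ 1 / z $ 2) (z $ 3 / z $ 2))) & (ALL z. z $ 2 = 0 --> F (M *v z) = 0)"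

definition is_form :: "(complex ^ 5 => complex) => nat => bool" where
 "is_form q e \<longleftrightarrow> q \<in> hpoly e & 0 < e & (ALL z. q (M *v z) ~= 0 \<longleftrightarrow> z $ 2 ~= 0 & generic (z $ 1 / z $ 2) (z $ 3 / z $ 2))"

text \<open>The homogenization of the cuspidal map is fixed by choice, and likewise the form
  \<open>chi\<close> that vanishes at the non-generic points.\<close>

definition FF where "FF = (SOME F. EX D. is_map F D)"
definition dF where "dF = (SOME D. is_map FF D)"
definition chi where "chi = (SOME q. EX e. is_form q e)"
definition dchi where "dchi = (SOME e. is_form chi e)"

lemma FF_map: "is_map FF dF" and chi_form: "is_form chi dchi"
proof -
 have "EX F D. is_map F D" unfolding is_map_def by (rule exists_map)
 then have "EX D. is_map FF D" unfolding FF_def by (rule someI_ex)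
 then show "is_map FF dF" unfolding dF_def by (rule someI_ex)
 have "EX q e. is_form q e" unfolding is_form_def by (rule exists_form)
 then have "EX e. is_form chi e" unfolding chi_def by (rule someI_ex)
 then show "is_form chi dchi" unfolding dchi_def by (rule someI_ex)
qed

lemma hpoly_FF: "(%x. FF x $ i) \<in> hpoly dF" and FF_affine: "z $ 2 ~= 0 ==> FF (M *v z) = z $ 2 ^ dF *s L (\<Xi> (z $ 1 / z $ 2) (z $ 3 / z $ 2))"
 using FF_map unfolding is_map_def by blast+

lemma hpoly_chi: "chi \<in> hpoly dchi" and chi_zero: "chi 0 = 0" and chi_iff: "chi (M *v z) ~= 0 \<longleftrightarrow> z $ 2 ~= 0 & generic (z $ 1 / z $ 2) (z $ 3 / z $ 2)"
 using chi_form hpoly_at_0 unfolding is_form_def by blast+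

lemma FF_scale: "FF (c *s x) = c ^ dF *s FF x"
 by (rule homogeneous_map_scale[OF hpoly_FF])

definition GG :: "complex ^ 5 => complex ^ 5" where
 "GG h = M *v \<Gamma> (K h)"

lemma hpoly_GG: "(%h. GG h $ i) \<in> hpoly 6"
proof -
 have "(%h. K h $ i) \<in> hpoly 1" for i unfolding K_def by (rule hpoly_matrix)
 from hpoly_compose[OF hpoly_Gam this] have "(%h. \<Gamma> (K h) $ i) \<in> hpoly 6" for i by simp
 then show ?thesis unfolding GG_def matrix_vector_mult_def by (simp, intro hpoly_sum hpoly_cmult) simp
qed

lemma GG_scale: "GG (c *s h) = c ^ 6 *s GG h"
 by (rule homogeneous_map_scale[OF hpoly_GG])

lemma FF_affine_point: "FF (M *v aff s w v) = L (\<Xi> s w)"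
 by (subst FF_affine) simp_all

lemma chi_affine_point: "chi (M *v aff s w v) ~= 0 \<longleftrightarrow> generic s w"
 by (subst chi_iff) simp

lemma generic_denominator: "generic s w ==> b * w + poly (quadricP g) s ~= 0"
 by (simp add: generic_def)

lemma generic_point:
 assumes "generic s w"
 shows "M *v aff s w (fib s w) \<in> acone S" "chi (M *v aff s w (fib s w)) ~= 0" "FF (M *v aff s w (fib s w)) = L (\<Xi> s w)"
  "L (\<Xi> s w) ~= 0" "EX c. c ~= 0 & GG (L (\<Xi> s w)) = c *s (M *v aff s w (fib s w))"
proof -
 have on: "on_S s w (fib s w)" using on_S_fib[OF generic_denominator[OF assms]] by simp
 then show "M *v aff s w (fib s w) \<in> acone S" using aff_in_S by (simp add: acone_def)
 show "chi (M *v aff s w (fib s w)) ~= 0" "FF (M *v aff s w (fib s w)) = L (\<Xi> s w)"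
  using assms by (simp_all add: chi_affine_point FF_affine_point)
 note X = generic_Xi[OF assms on]
 show "L (\<Xi> s w) ~= 0" using X(3) by simp
 show "EX c. c ~= 0 & GG (L (\<Xi> s w)) = c *s (M *v aff s w (fib s w))"
  using X(4) by (auto simp: GG_def vector_scalar_commute)
qed

lemma generic_cases:
 assumes "x \<in> acone S" "chi x ~= 0"
 shows "EX c s w. c ~= 0 & generic s w & x = c *s (M *v aff s w (fib s w))"
proof -
 define z where "z = N *v x"
 have x: "x = M *v z" by (simp add: z_def)
 have z: "z $ 2 ~= 0" "generic (z $ 1 / z $ 2) (z $ 3 / z $ 2)" using assms(2) chi_iff x by auto
 have "pt (M *v z) \<in> S" using assms(1) x by (simp add: acone_def)
 note P = affine_point[OF this z(1)]
 have v: "z $ 4 / z $ 2 = fib (z $ 1 / z $ 2) (z $ 3 / z $ 2)" using P(2) on_S_fib[OF generic_denominator[OF z(2)]] by simp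
 have "x = z $ 2 *s (M *v aff (z $ 1 / z $ 2) (z $ 3 / z $ 2) (z $ 4 / z $ 2))"
  by (subst x, subst P(1)) (rule vector_scalar_commute)
 then show ?thesis using z v by metis
qed

lemma generic_FG:
 assumes "x \<in> acone S" "chi x ~= 0"
 shows "FF x ~= 0" "EX c. c ~= 0 & GG (FF x) = c *s x"
proof -
 obtain c s w where x: "c ~= 0" "generic s w" "x = c *s (M *v aff s w (fib s w))" using generic_cases[OF assms] by blast
 note P = generic_point[OF x(2)]
 have F: "FF x = c ^ dF *s L (\<Xi> s w)" by (simp add: x(3) FF_scale P(3))
 then show "FF x ~= 0" using P(4) x(1) by simp
 obtain e where e: "e ~= 0" "GG (L (\<Xi> s w)) = e *s (M *v aff s w (fib s w))" using P(5) by blast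
 have "GG (FF x) = ((c ^ dF) ^ 6 * e / c) *s x"
 proof -
  have "GG (FF x) = (c ^ dF) ^ 6 *s (e *s (M *v aff s w (fib s w)))" unfolding F GG_scale e(2) ..
  then show ?thesis using x(1) by (simp add: x(3))
 qed
 then show "EX c. c ~= 0 & GG (FF x) = c *s x" using x(1) e(1) by (intro exI[of _ "(c ^ dF) ^ 6 * e / c"]) simp
qed

section \<open>The closure of the image of the cuspidal map\<close>

definition YY :: "5 cp set" where "YY = {pt (FF x) | x. x \<in> acone S & FF x ~= 0}"
definition ZZ :: "5 cp set" where "ZZ = zariski closure_of YY"

lemma YY_ZZ: "YY \<subseteq> ZZ"
 unfolding ZZ_def by (rule closure_of_subset) simp

lemma closed_ZZ: "closedin zariski ZZ"
 unfolding ZZ_def by simp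

lemma FF_in_ZZ: "x \<in> acone S ==> FF x ~= 0 ==> pt (FF x) \<in> ZZ"
 using YY_ZZ unfolding YY_def by blast

lemma exists_good: obtains s where "poly (goodP a f g) s ~= 0"
 using exists_nonroot[OF good_nonzero] by blast

lemma infinite_generic:
 assumes "poly (goodP a f g) s ~= 0"
 shows "infinite {w. generic s w}"
proof -
 have "finite {w. b * w + poly (quadricP g) s = 0}"
 proof (cases "b = 0")
  case True
  then have a: "a ~= 0" using type by auto
  have "poly (quadricP g) s ~= 0" using assms a by (simp add: goodP_def Let_def)
  then show ?thesis by (simp add: True)
 next
  case False
  then have "{w. b * w + poly (quadricP g) s = 0} \<subseteq> {- poly (quadricP g) s / b}" by (auto simp: field_simps eq_neg_iff_add_eq_0)
  then show ?thesis by (rule finite_subset) simp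
 qed
 then have "infinite (- {w. b * w + poly (quadricP g) s = 0})" using infinite_UNIV_char_0[where 'a = complex] finite_compl by blast
 moreover have "- {w. b * w + poly (quadricP g) s = 0} = {w. generic s w}" using assms by (auto simp: generic_def)
 ultimately show ?thesis by simp
qed

lemma exists_generic: "poly (goodP a f g) s ~= 0 ==> EX w. generic s w"
 using infinite_generic infinite_imp_nonempty by blast

lemma generic_exists: "EX x. x \<in> acone S & chi x ~= 0"
proof -
 obtain s where "poly (goodP a f g) s ~= 0" by (rule exists_good) (rule that)
 then obtain w where "generic s w" using exists_generic by blast
 then show ?thesis using generic_point(1,2) by blast
qed

lemma irred_ZZ: "irred_in zariski ZZ"
proof -
 obtain x where "x \<in> acone S" "chi x ~= 0" using generic_exists by blast
 then show ?thesis unfolding ZZ_def YY_def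
  using irred_in_closure[OF irred_in_image[OF irred_S hpoly_FF _ generic_FG(1)]] by blast
qed

text \<open>Generic points suffice: the irreducibility of S extends the equation to all points where
  \<open>FF\<close> is defined, and the closure extends it to \<open>ZZ\<close>.\<close>

lemma ZZ_vanish:
 assumes f: "q \<in> hpoly d" and van: "!!x. x \<in> acone S ==> chi x ~= 0 ==> q (FF x) = 0" and h: "h \<in> acone ZZ"
 shows "q h = 0"
proof -
 obtain x0 where x0: "x0 \<in> acone S" "chi x0 ~= 0" using generic_exists by blast
 have all: "q (FF x) = 0" if "x \<in> acone S" for x
  by (rule irred_in_zariskiD[OF irred_S hpoly_chi hpoly_compose[OF f hpoly_FF] van x0 that])
 have "q y = 0" if y: "y \<in> acone YY" for y
 proof -
  have y0: "y ~= 0" "pt y \<in> YY" using y by (simp_all add: acone_def)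
  then obtain x where x: "x \<in> acone S" "FF x ~= 0" "pt y = pt (FF x)" unfolding YY_def by blast
  then obtain c where "y = c *s FF x" using pt_eq_iff[OF x(2) y0(1)] by metis
  then show ?thesis using all[OF x(1)] hpolyD[OF f] by simp
 qed
 then show ?thesis using vanish_closure[OF f _ h[unfolded ZZ_def]] by blast
qed

definition EE :: "5 cp set" where "EE = {H. ALL h:line_of H. K h $ 4 * kap a b (K h) = 0}"

lemma hpoly_EE: "(%h. K h $ 4 * kap a b (K h)) \<in> hpoly 2"
proof -
 have k: "(%h. K h $ i) \<in> hpoly 1" for i unfolding K_def by (rule hpoly_matrix)
 have "(%h. kap a b (K h)) \<in> hpoly 1" unfolding kap_def by (intro hpoly_add hpoly_cmult k)
 then show ?thesis by (rule hpoly_mult'[OF k]) simp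
qed

lemma pt_EE: "h ~= 0 ==> pt h \<in> EE \<longleftrightarrow> K h $ 4 * kap a b (K h) = 0"
 using hpoly_line[OF hpoly_EE, of h] unfolding EE_def by blast

lemma closed_EE: "closedin zariski EE"
proof -
 have "closedin zariski {p. ALL f:{%h. K h $ 4 * kap a b (K h)}. ALL x:line_of p. f x = 0}"
  by (rule closedin_zero_set) (use hpoly_EE in blast)
 then show ?thesis by (simp add: EE_def)
qed

lemma ZZ_not_EE: "\<not> ZZ \<subseteq> EE"
proof
 assume sub: "ZZ \<subseteq> EE"
 obtain s where "poly (goodP a f g) s ~= 0" by (rule exists_good) (rule that)
 then obtain w where g: "generic s w" using exists_generic by blast
 note P = generic_point[OF g] and X = Xi_triple[OF g]
 have "pt (L (\<Xi> s w)) \<in> ZZ" using FF_in_ZZ[OF P(1)] P(3,4) by simp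
 then have "pt (L (\<Xi> s w)) \<in> EE" using sub by blast
 then show False using pt_EE[OF P(4)] X(1,2) by simp
qed

section \<open>The chart at the other end of the conic\<close>

definition Mr :: "complex ^ 5 ^ 5" where
 "Mr = (\<chi> i. vec5 (M $ i $ 2) (M $ i $ 1) (M $ i $ 0) (M $ i $ 3) (M $ i $ 4))"

definition rv :: "complex ^ 5 => complex ^ 5" where
 "rv z = vec5 (z $ 2) (z $ 1) (z $ 0) (z $ 3) (z $ 4)"

lemma rv_rv [simp]: "rv (rv z) = z" and rv_eq_0 [simp]: "rv z = 0 \<longleftrightarrow> z = 0"
 by (auto simp: rv_def vec5_eq_iff)

lemma Mr_mult: "Mr *v z = M *v rv z"
 by (simp add: cvec_eq_iff matrix_vector_mult_def Mr_def rv_def sum_5)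

text \<open>Exchanging the two ends of the conic exchanges the charts \<open>y\<^sub>2 \<noteq> 0\<close> and \<open>y\<^sub>0 \<noteq> 0\<close>.\<close>

lemma reversed: "segre_surface_form S Mr a b (%i. f (4 - i)) (%i. g (2 - i))"
proof
 show "z = 0" if "Mr *v z = 0" for z using that by (simp add: Mr_mult)
 show "a = 0 & b = 1 & (%i. g (2 - i)) = (%_. 0) | a = 1 & b = 0" using type by auto
 have bf: "bundle_form a b f g (rv z) = bundle_form a b (%i. f (4 - i)) (%i. g (2 - i)) z" "conic_form (rv z) = conic_form z" for z
  by (simp_all add: bundle_form_def conic_form_def rv_def algebra_simps)
 show "pt (Mr *v z) \<in> S \<longleftrightarrow> conic_form z = 0 & bundle_form a b (%i. f (4 - i)) (%i. g (2 - i)) z = 0" if "z ~= 0" for z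
  using mem[of "rv z"] that by (simp add: Mr_mult bf)
 show "\<not> square_quartic (%i. f (4 - i))" if "a = 0"
 proof
  assume "square_quartic (%i. f (4 - i))"
  then obtain p q r where "f 4 = p ^ 2 & f 3 = 2 * p * q & f 2 = q ^ 2 + 2 * p * r & f 1 = 2 * q * r & f 0 = r ^ 2"
   unfolding square_quartic_def by auto
  then have "square_quartic f" unfolding square_quartic_def
   by (intro exI[of _ r] exI[of _ q] exI[of _ p]) (simp add: mult_ac)
  then show False using not_square[OF that] by blast
 qed
 show "\<not> quadric_divides (%i. g (2 - i)) (%i. f (4 - i))" if "a = 1"
 proof
  assume "quadric_divides (%i. g (2 - i)) (%i. f (4 - i))"
  then obtain p q r where "f 4 = g 2 * p & f 3 = g 2 * q + g 1 * p & f 2 = g 2 * r + g 1 * q + g 0 * p & f 1 = g 1 * r + g 0 * q & f 0 = g 0 * r"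
   unfolding quadric_divides_def by auto
  then have "quadric_divides g f" unfolding quadric_divides_def
   by (intro exI[of _ r] exI[of _ q] exI[of _ p]) simp
  then show False using not_divides[OF that] by blast
 qed
 show "g (2 - 0) ~= 0 | g (2 - 1) ~= 0 | g (2 - 2) ~= 0" if "a = 1" using g_nonzero[OF that] by auto
 show "irreducible_variety S 2" by (rule irr)
qed

lemma K_reversed: "segre_form.K Mr h = rv (K h)"
proof -
 interpret R: segre_surface_form S Mr a b "%i. f (4 - i)" "%i. g (2 - i)" by (rule reversed)
 show ?thesis unfolding R.K_def K_def vec5_eq_iff
  by (simp add: rv_def matrix_vector_mult_def Finite_Cartesian_Product.transpose_def Mr_def)
qed

lemma EE_reversed: "segre_surface_form.EE Mr a b = EE"
proof -
 interpret R: segre_surface_form S Mr a b "%i. f (4 - i)" "%i. g (2 - i)" by (rule reversed)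
 show ?thesis unfolding R.EE_def EE_def K_reversed by (simp add: rv_def kap_def)
qed

text \<open>At a point generic for both charts, both maps give the hyperplane with a cusp there,
  which is unique by \<open>cusp_unique\<close>. Irreducibility of S spreads the comparison to the
  closures.\<close>

lemma ZZ_reversed: "segre_surface_form.ZZ S Mr a (%i. f (4 - i)) (%i. g (2 - i)) \<subseteq> ZZ"
proof
 interpret R: segre_surface_form S Mr a b "%i. f (4 - i)" "%i. g (2 - i)" by (rule reversed)
 fix H assume H: "H \<in> R.ZZ"
 obtain h where h: "h ~= 0" "H = pt h" using pt_exhaust[of H] by metis
 have hZ: "h \<in> acone R.ZZ" using H h by (simp add: acone_def)
 obtain x0 where x0: "x0 \<in> acone S" "chi x0 ~= 0" using generic_exists by blast
 have "pt h \<in> zariski closure_of YY"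
  unfolding zariski_closure_pt[OF h(1)]
 proof (intro allI ballI impI)
  fix d q assume q: "q \<in> hpoly d" and van: "ALL y:acone YY. q y = 0"
  \<comment> \<open>The factor \<open>R.chi\<close> discards the points that are not generic in the
    reversed chart, where the two maps are not compared.\<close>
  have key: "R.chi x * q (R.FF x) = 0" if x: "x \<in> acone S" "chi x ~= 0" for x
  proof (cases "R.chi x = 0")
   case False
   obtain c s w where c: "c ~= 0" "generic s w" "x = c *s (M *v aff s w (fib s w))" using generic_cases[OF x] by blast
   obtain c' s' w' where c': "c' ~= 0" "R.generic s' w'" "x = c' *s (Mr *v aff s' w' (R.fib s' w'))" using R.generic_cases[OF x(1) False] by blast
   have p: "pt x = pt (M *v aff s w (fib s w))" using pt_scale[of "M *v aff s w (fib s w)" c] c by simp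
   have p': "pt x = pt (Mr *v aff s' w' (R.fib s' w'))" using pt_scale[of "Mr *v aff s' w' (R.fib s' w')" c'] c' by simp
   have on': "R.on_S s' w' (R.fib s' w')" using R.on_S_fib[OF R.generic_denominator[OF c'(2)]] by simp
   note C = R.generic_cusp[OF c'(2) on', folded p', unfolded p]
   obtain h' e where h': "h' ~= 0" "pt (R.L (R.\<Xi> s' w')) = pt h'" "e ~= 0" "h' = e *s L (\<Xi> s w)" using cusp_unique[OF C(1,3)] by blast
   note P = generic_point[OF c(2)] and P' = R.generic_point[OF c'(2)]
   have "pt h' = pt (FF (M *v aff s w (fib s w)))" unfolding P(3) h'(4) using pt_scale[OF P(4) h'(3)] .
   moreover have "pt (FF (M *v aff s w (fib s w))) \<in> YY"
    unfolding YY_def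
    by (rule CollectI, rule exI[of _ "M *v aff s w (fib s w)"]) (simp only: P(1,3,4) simp_thms not_False_eq_True)
   ultimately have "h' \<in> acone YY" using h'(1) by (simp only: acone_def mem_Collect_eq simp_thms)
   then have "q h' = 0" using van by blast
   moreover obtain t where "R.L (R.\<Xi> s' w') = t *s h'" using pt_eq_iff[OF h'(1) P'(4)] h'(2) by metis
   ultimately have "q (R.L (R.\<Xi> s' w')) = 0" using hpolyD[OF q] by simp
   then have "q (R.FF x) = 0" unfolding c'(3) R.FF_scale P'(3) using hpolyD[OF q] by simp
   then show ?thesis by simp
  qed simp
  have all: "R.chi x * q (R.FF x) = 0" if "x \<in> acone S" for x
   by (rule irred_in_zariskiD[OF irred_S hpoly_chi hpoly_mult[OF R.hpoly_chi hpoly_compose[OF q R.hpoly_FF]] key x0 that])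
  show "q h = 0"
   by (rule R.ZZ_vanish[OF q _ hZ]) (use all in auto)
 qed
 then show "H \<in> ZZ" by (simp add: h ZZ_def)
qed

lemma not_node_affine:
 assumes x: "x ~= 0" "(N *v x) $ 2 ~= 0" and sm: "pt x \<in> smooth_locus S" and inc: "(pt x, H) \<in> incidence_variety S"
  and node: "\<not> ordinary_node_at S (pt x) H"
 shows "H \<in> ZZ \<union> EE"
proof -
 obtain h where h: "h ~= 0" "H = pt h" using pt_exhaust[of H] by metis
 define z where "z = N *v x"
 have xz: "x = M *v z" by (simp add: z_def)
 have S: "pt (M *v z) \<in> S" using sm xz by (simp add: smooth_locus_iff)
 define s w v where "s = z $ 1 / z $ 2" and "w = z $ 3 / z $ 2" and "v = z $ 4 / z $ 2"
 have z2: "z $ 2 ~= 0" using x by (simp add: z_def)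
 note P = affine_point[OF S z2, folded s_def w_def v_def]
 have p: "pt x = pt (M *v aff s w v)" using P(3) xz by simp
 show ?thesis
 proof (cases "pt h \<in> EE")
  case False
  then have nz: "kap a b (K h) ~= 0" "K h $ 4 ~= 0" using pt_EE[OF h(1)] by auto
  obtain c where c: "c ~= 0" "K h = c *s \<Xi> s w"
   using not_node_unique[OF sm[unfolded p] inc[unfolded p h(2)] h(1) node[unfolded p h(2)] nz] by blast
  have hL: "h = c *s L (\<Xi> s w)" using arg_cong[OF c(2), of L] by (simp add: L_smult)
  have L0: "L (\<Xi> s w) ~= 0" using hL h(1) by auto
  have "M *v aff s w v \<in> acone S" using P(2) aff_in_S by (simp add: acone_def)
  then have "pt (FF (M *v aff s w v)) \<in> ZZ" by (rule FF_in_ZZ) (simp only: FF_affine_point L0 not_False_eq_True)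
  then have "pt h \<in> ZZ" unfolding FF_affine_point hL using pt_scale[OF L0 c(1)] by simp
  then show ?thesis using h by simp
 qed (use h in simp)
qed

lemma cone_cases:
 assumes x: "x ~= 0" "pt x \<in> S" and z2: "(N *v x) $ 2 = 0"
 shows "(N *v x) $ 1 = 0" "b * (N *v x) $ 3 * (N *v x) $ 4 = a * (N *v x) $ 3 ^ 2 | (N *v x) $ 0 ~= 0"
proof -
 have "x \<in> acone S" using x by (simp add: acone_def)
 then have c: "conic_form (N *v x) = 0" "bundle_form a b f g (N *v x) = 0" by (simp_all add: acone_S)
 show 1: "(N *v x) $ 1 = 0" using c(1) z2 by (simp add: conic_form_def)
 show "b * (N *v x) $ 3 * (N *v x) $ 4 = a * (N *v x) $ 3 ^ 2 | (N *v x) $ 0 ~= 0"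
  using c(2) z2 1 by (auto simp: bundle_form_def algebra_simps)
qed

lemma N_reversed: "segre_form.N Mr *v x = rv (N *v x)"
proof -
 interpret R: segre_surface_form S Mr a b "%i. f (4 - i)" "%i. g (2 - i)" by (rule reversed)
 have "Mr *v rv (N *v x) = x" by (simp add: Mr_mult)
 then have "R.N *v x = R.N *v (Mr *v rv (N *v x))" by simp
 then show ?thesis by simp
qed

text \<open>Either y2 is nonzero, or y0 is and the reversed chart applies, or y = 0.\<close>

lemma not_node_ZZ:
 assumes x: "x ~= 0" and sm: "pt x \<in> smooth_locus S" and inc: "(pt x, H) \<in> incidence_variety S"
  and node: "\<not> ordinary_node_at S (pt x) H"
 shows "H \<in> ZZ \<union> EE"
proof (cases "(N *v x) $ 2 = 0")
 case z2: True
 have S: "pt x \<in> S" using sm by (simp add: smooth_locus_iff)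
 note C = cone_cases[OF x S z2]
 show ?thesis
 proof (cases "(N *v x) $ 0 = 0")
  case True
  obtain h where h: "h ~= 0" "H = pt h" using pt_exhaust[of H] by metis
  have d: "K h $ 3 * (N *v x) $ 3 + K h $ 4 * (N *v x) $ 4 = 0"
   using incidence_conditions(1)[OF x h(1) inc[unfolded h(2)]] z2 C(1) True by (simp add: dpair_5)
  have nz: "(N *v x) $ 3 ~= 0 | (N *v x) $ 4 ~= 0"
  proof (rule ccontr)
   assume "\<not> ?thesis"
   then have "N *v x = 0" using z2 C(1) True by (simp add: vec5_eq_iff)
   then have "M *v (N *v x) = 0" by (simp only: M_nonzero)
   then show False using x by simp
  qed
  \<comment> \<open>At y = 0 the surface equation leaves only coordinate points of the last two
    coordinates, and incidence then forces k4 = 0 or \<kappa> = 0.\<close>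
  have "K h $ 4 * kap a b (K h) = 0"
   using type C(2) True d nz by (auto simp: kap_def)
  then show ?thesis using pt_EE[OF h(1)] h(2) by simp
 next
  case False
  interpret R: segre_surface_form S Mr a b "%i. f (4 - i)" "%i. g (2 - i)" by (rule reversed)
  have "(R.N *v x) $ 2 ~= 0" using False by (simp add: N_reversed rv_def)
  from R.not_node_affine[OF x this sm inc node] show ?thesis using ZZ_reversed EE_reversed by auto
 qed
qed (use not_node_affine[OF x _ sm inc node] in blast)

lemma cusp_affine_not_EE:
 assumes x: "x ~= 0" "(N *v x) $ 2 ~= 0" and sm: "pt x \<in> smooth_locus S" and cusp: "ordinary_cusp_at S (pt x) H"
 shows "H \<notin> EE"
proof -
 define z where "z = N *v x"
 have xz: "x = M *v z" by (simp add: z_def)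
 have S: "pt (M *v z) \<in> S" using sm xz by (simp add: smooth_locus_iff)
 have z2: "z $ 2 ~= 0" using x by (simp add: z_def)
 have p: "pt x = pt (M *v aff (z $ 1 / z $ 2) (z $ 3 / z $ 2) (z $ 4 / z $ 2))" using affine_point(3)[OF S z2] xz by simp
 obtain h where "h ~= 0" "H = pt h" "kap a b (K h) ~= 0" "K h $ 4 ~= 0"
  using cusp_unique[OF sm[unfolded p] cusp[unfolded p]] by blast
 then show ?thesis using pt_EE by simp
qed

text \<open>In the two affine charts a cusp at a smooth point has \<kappa> and k4 nonzero, and at y
  = 0 such a point admits no chart, hence no cusp.\<close>

lemma cusp_not_EE:
 assumes sm: "p \<in> smooth_locus S" and cusp: "ordinary_cusp_at S p H"
 shows "H \<notin> EE"
proof -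
 obtain x where x: "x ~= 0" "p = pt x" using pt_exhaust[of p] by metis
 have S: "pt x \<in> S" using sm x by (simp add: smooth_locus_iff)
 show ?thesis
 proof (cases "(N *v x) $ 2 = 0")
  case False
  then show ?thesis using cusp_affine_not_EE[OF x(1)] sm cusp x(2) by simp
 next
  case z2: True
  have xM: "x = M *v (N *v x)" by simp
  then have nz: "N *v x ~= 0" using x(1) by (metis M_nonzero)
  have "(N *v x) $ 0 ~= 0"
   using cusp_not_vertex[of "N *v x" H] sm cusp nz z2 cone_cases(1)[OF x(1) S z2] x(2) by simp
  then show ?thesis
  proof -
   interpret R: segre_surface_form S Mr a b "%i. f (4 - i)" "%i. g (2 - i)" by (rule reversed)
   assume "(N *v x) $ 0 ~= 0"
   then have "(R.N *v x) $ 2 ~= 0" by (simp add: N_reversed rv_def)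
   from R.cusp_affine_not_EE[OF x(1) this] show ?thesis using sm cusp x(2) EE_reversed by simp
  qed
 qed
qed

section \<open>The cuspidal locus\<close>

lemma dual_cusp_eq: "dual_cusp S = snd ` (incidence_variety S \<inter>
  zariski_prod closure_of {(p, H) \<in> incidence_variety S. p \<in> smooth_locus S & \<not> ordinary_node_at S p H})"
proof -
 have "incidence_variety S \<inter> {(p, H) \<in> incidence_variety S. p \<in> smooth_locus S & \<not> ordinary_node_at S p H}
  = {(p, H) \<in> incidence_variety S. p \<in> smooth_locus S & \<not> ordinary_node_at S p H}" by auto
 then show ?thesis unfolding dual_cusp_def closure_of_subtopology by simp
qed

lemma closed_dual_cusp: "closedin zariski (dual_cusp S)"
 unfolding dual_cusp_eq by (rule closedin_snd_image) (auto simp: incidence_variety_def)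

lemma dual_cuspI:
 assumes "p \<in> smooth_locus S" "(p, H) \<in> incidence_variety S" "\<not> ordinary_node_at S p H"
 shows "H \<in> dual_cusp S"
proof -
 let ?A = "{(p, H) \<in> incidence_variety S. p \<in> smooth_locus S & \<not> ordinary_node_at S p H}"
 have "?A \<subseteq> zariski_prod closure_of ?A" by (rule closure_of_subset) simp
 then have "(p, H) \<in> incidence_variety S \<inter> zariski_prod closure_of ?A" using assms by auto
 then show ?thesis unfolding dual_cusp_eq by force
qed

lemma generic_cusp_point:
 assumes "x \<in> acone S" "chi x ~= 0"
 shows "pt x \<in> smooth_locus S" "ordinary_cusp_at S (pt x) (pt (FF x))" "pt (FF x) \<in> dual_cusp S"
proof -
 obtain c s w where x: "c ~= 0" "generic s w" "x = c *s (M *v aff s w (fib s w))" using generic_cases[OF assms] by blast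
 note P = generic_point[OF x(2)]
 have on: "on_S s w (fib s w)" using on_S_fib[OF generic_denominator[OF x(2)]] by simp
 have p: "pt x = pt (M *v aff s w (fib s w))" using pt_scale[of "M *v aff s w (fib s w)" c] x by simp
 have F: "pt (FF x) = pt (L (\<Xi> s w))" unfolding x(3) FF_scale P(3) by (rule pt_scale[OF P(4)]) (use x(1) in simp)
 note C = generic_cusp[OF x(2) on, folded p F]
 show "pt x \<in> smooth_locus S" "ordinary_cusp_at S (pt x) (pt (FF x))" by (rule C)+
 show "pt (FF x) \<in> dual_cusp S" by (rule dual_cuspI[OF C(1,2,4)])
qed

text \<open>Generic points of \<open>ZZ\<close> are hyperplanes with a cusp, and
  \<open>dual_cusp S\<close> is closed by completeness.\<close>

lemma ZZ_dual_cusp: "ZZ \<subseteq> dual_cusp S"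
proof
 fix H assume H: "H \<in> ZZ"
 obtain h where h: "h ~= 0" "H = pt h" using pt_exhaust[of H] by metis
 show "H \<in> dual_cusp S"
 proof (rule ccontr)
  assume "H \<notin> dual_cusp S"
  then obtain d q where q: "q \<in> hpoly d" "!!y. y \<in> acone (dual_cusp S) ==> q y = 0" "q h ~= 0"
   using closedin_zariskiE[OF closed_dual_cusp h(1)] h(2) by metis
  have "q h = 0"
  proof (rule ZZ_vanish[OF q(1)])
   show "h \<in> acone ZZ" using H h by (simp add: acone_def)
   fix x assume x: "x \<in> acone S" "chi x ~= 0"
   show "q (FF x) = 0" by (rule q(2)) (use generic_cusp_point(3)[OF x] generic_FG(1)[OF x] in \<open>simp add: acone_def\<close>)
  qed
  then show False using q(3) by simp
 qed
qed

lemma dual_cusp_subset: "dual_cusp S \<subseteq> ZZ \<union> EE"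
proof -
 let ?A = "{(p, H) \<in> incidence_variety S. p \<in> smooth_locus S & \<not> ordinary_node_at S p H}"
 have "?A \<subseteq> {(p, H). H \<in> ZZ \<union> EE}"
 proof clarify
  fix p H assume *: "(p, H) \<in> incidence_variety S" "p \<in> smooth_locus S" "\<not> ordinary_node_at S p H" "H \<notin> EE"
  obtain x where x: "x ~= 0" "p = pt x" using pt_exhaust[of p] by metis
  show "H \<in> ZZ" using not_node_ZZ[OF x(1)] * x(2) by blast
 qed
 then have "zariski_prod closure_of ?A \<subseteq> {(p, H). H \<in> ZZ \<union> EE}"
  by (rule closure_of_minimal) (intro closedin_snd_preimage closedin_Un closed_ZZ closed_EE)
 then show ?thesis unfolding dual_cusp_eq by auto
qed

lemma irred_cases:
 assumes "irred_in zariski Z" "Z \<subseteq> dual_cusp S"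
 shows "Z \<subseteq> ZZ | Z \<subseteq> EE"
 using assms dual_cusp_subset closed_ZZ closed_EE unfolding irred_in_def by blast

text \<open>For generic points of S, \<open>GG\<close> inverts \<open>FF\<close> up to a factor.
  This is encoded in polynomial identities, the equations of S at \<open>GG h\<close> and the 2 by 2
  minors of h and \<open>FF (GG h)\<close>, which extend to \<open>ZZ\<close>.\<close>

lemma GG_generic:
 assumes h: "h \<in> acone ZZ" and chi: "chi (GG h) ~= 0"
 shows "GG h \<in> acone S" "pt (FF (GG h)) = pt h"
proof -
 have G0: "GG h ~= 0" using chi chi_zero by auto
 have NG: "(%h. (N *v GG h) $ i) \<in> hpoly 6" for i
  using hpoly_compose[OF hpoly_matrix[of N i] hpoly_GG] by simp
 have q: "(%h. conic_form (N *v GG h)) \<in> hpoly (2 * 6)" "(%h. bundle_form a b f g (N *v GG h)) \<in> hpoly (2 * 6)"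
  by (rule hpoly_compose[OF hpoly_conic NG] hpoly_compose[OF hpoly_bundle NG])+
 have gen: "conic_form (N *v GG (FF x)) = 0" "bundle_form a b f g (N *v GG (FF x)) = 0" if x: "x \<in> acone S" "chi x ~= 0" for x
 proof -
  obtain c where c: "GG (FF x) = c *s x" using generic_FG(2)[OF x] by blast
  show "conic_form (N *v GG (FF x)) = 0" "bundle_form a b f g (N *v GG (FF x)) = 0"
   using x(1) unfolding c N_smult conic_form_smult bundle_form_smult by (simp_all add: acone_S)
 qed
 show "GG h \<in> acone S"
  using ZZ_vanish[OF q(1) gen(1) h] ZZ_vanish[OF q(2) gen(2) h] G0 by (simp add: acone_S)
 then have F0: "FF (GG h) ~= 0" using generic_FG(1) chi by blast
 have minor: "h $ i * FF (GG h) $ j - h $ j * FF (GG h) $ i = 0" for i j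
 proof (rule ZZ_vanish[OF _ _ h])
  have FG: "(%h. FF (GG h) $ i) \<in> hpoly (dF * 6)" for i by (rule hpoly_compose[OF hpoly_FF hpoly_GG])
  show "(%h. h $ i * FF (GG h) $ j - h $ j * FF (GG h) $ i) \<in> hpoly (1 + dF * 6)"
   by (intro hpoly_diff hpoly_mult hpoly_coord FG)
  fix x assume x: "x \<in> acone S" "chi x ~= 0"
  obtain c where c: "GG (FF x) = c *s x" using generic_FG(2)[OF x] by blast
  show "FF x $ i * FF (GG (FF x)) $ j - FF x $ j * FF (GG (FF x)) $ i = 0" unfolding c FF_scale by simp
 qed
 obtain i where i: "FF (GG h) $ i ~= 0" using vec_nonzero[OF F0] by blast
 have h0: "h ~= 0" using h by (simp add: acone_def)
 have e: "h = (h $ i / FF (GG h) $ i) *s FF (GG h)"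
  using minor[of _ i] i by (simp add: cvec_eq_iff field_simps)
 then have "h $ i / FF (GG h) $ i ~= 0" using h0 by (metis vector_smult_lzero)
 then show "pt (FF (GG h)) = pt h" using pt_scale[OF F0] e by metis
qed

lemma hpoly_chi_GG: "(%h. chi (GG h)) \<in> hpoly (dchi * 6)"
 by (rule hpoly_compose[OF hpoly_chi hpoly_GG])

lemma chi_GG_FF: "x \<in> acone S ==> chi x ~= 0 ==> chi (GG (FF x)) ~= 0"
 using generic_FG(2) hpolyD[OF hpoly_chi] by fastforce

text \<open>An irreducible component of \<open>dual_cusp S\<close> is \<open>ZZ\<close> or lies in
  \<open>EE\<close>. No hyperplane in \<open>EE\<close> has a cusp at a smooth point, while a
  generic one in \<open>ZZ\<close> has.\<close>

lemma cuspidal_locus_eq: "cuspidal_locus S = ZZ"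
proof -
 let ?cusp = "%Z. EX U. openin (subtopology zariski Z) U & U ~= {} & (ALL H:U. EX p:smooth_locus S. ordinary_cusp_at S p H)"
 have comp: "ZZ \<in> irred_components zariski (dual_cusp S)"
  unfolding irred_components_def
 proof (intro CollectI conjI allI impI)
  show "ZZ \<subseteq> dual_cusp S" "irred_in zariski ZZ" by (rule ZZ_dual_cusp irred_ZZ)+
  fix Z' assume Z': "ZZ \<subseteq> Z' & Z' \<subseteq> dual_cusp S & irred_in zariski Z'"
  then have "Z' \<subseteq> ZZ | Z' \<subseteq> EE" using irred_cases by blast
  then show "Z' = ZZ" using Z' ZZ_not_EE by blast
 qed
 have gen: "?cusp ZZ"
 proof (intro exI conjI ballI)
  \<comment> \<open>Where \<open>chi (GG h)\<close> is nonzero, h is the cuspidal hyperplane of the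
    generic point \<open>GG h\<close>.\<close>
  let ?O = "{p. EX x:line_of p. chi (GG x) ~= 0}"
  show "openin (subtopology zariski ZZ) (?O \<inter> ZZ)"
   using openin_nonzero[OF hpoly_chi_GG] unfolding openin_subtopology by blast
  obtain x where x: "x \<in> acone S" "chi x ~= 0" using generic_exists by blast
  have "pt (FF x) \<in> ?O \<inter> ZZ"
   using pt_nonzero[OF hpoly_chi_GG generic_FG(1)[OF x]] chi_GG_FF[OF x] FF_in_ZZ[OF x(1) generic_FG(1)[OF x]] by blast
  then show "?O \<inter> ZZ ~= {}" by blast
  fix H assume H: "H \<in> ?O \<inter> ZZ"
  obtain h where h: "h ~= 0" "H = pt h" using pt_exhaust[of H] by metis
  have hZ: "h \<in> acone ZZ" "chi (GG h) ~= 0"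
   using H h pt_nonzero[OF hpoly_chi_GG h(1)] by (auto simp: acone_def)
  note G = GG_generic[OF hZ]
  show "EX p:smooth_locus S. ordinary_cusp_at S p H"
   using generic_cusp_point(1,2)[OF G(1) hZ(2)] G(2) h(2) by auto
 qed
 have "Z = ZZ" if Z: "Z \<in> irred_components zariski (dual_cusp S)" "?cusp Z" for Z
 proof -
  have Z': "Z \<subseteq> dual_cusp S" "irred_in zariski Z" using Z(1) by (simp_all add: irred_components_def)
  have "\<not> Z \<subseteq> EE"
  proof
   assume EE: "Z \<subseteq> EE"
   obtain U where U: "openin (subtopology zariski Z) U" "U ~= {}" "ALL H:U. EX p:smooth_locus S. ordinary_cusp_at S p H" using Z(2) by blast
   obtain H where H: "H \<in> U" using U(2) by blast
   have "H \<in> Z" using H openin_subset[OF U(1)] by auto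
   then show False using EE U(3) H cusp_not_EE by blast
  qed
  then have "Z \<subseteq> ZZ" using irred_cases[OF Z'(2,1)] by blast
  then show ?thesis using Z(1) ZZ_dual_cusp irred_ZZ unfolding irred_components_def by blast
 qed
 then have "{Z \<in> irred_components zariski (dual_cusp S). ?cusp Z} = {ZZ}" using comp gen by blast
 then show ?thesis unfolding cuspidal_locus_def by simp
qed

lemma birational_ZZ: "birational S ZZ"
 unfolding birational_def
proof (intro exI conjI)
 let ?U = "{p. EX x:line_of p. chi x ~= 0} \<inter> S" and ?V = "{p. EX x:line_of p. chi (GG x) ~= 0} \<inter> ZZ"
 show "openin (subtopology zariski S) ?U" "openin (subtopology zariski ZZ) ?V"
  using openin_nonzero[OF hpoly_chi] openin_nonzero[OF hpoly_chi_GG] unfolding openin_subtopology by blast+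
 have U: "pt x \<in> ?U \<longleftrightarrow> x \<in> acone S & chi x ~= 0" if "x ~= 0" for x
  using pt_nonzero[OF hpoly_chi that] that by (auto simp: acone_def)
 have V: "pt h \<in> ?V \<longleftrightarrow> h \<in> acone ZZ & chi (GG h) ~= 0" if "h ~= 0" for h
  using pt_nonzero[OF hpoly_chi_GG that] that by (auto simp: acone_def)
 have FV: "pt (FF x) \<in> ?V" if x: "x \<in> acone S" "chi x ~= 0" for x
  using V[OF generic_FG(1)[OF x]] chi_GG_FF[OF x] FF_in_ZZ[OF x(1) generic_FG(1)[OF x]] generic_FG(1)[OF x] by (simp add: acone_def)
 obtain x0 where x0: "x0 \<in> acone S" "chi x0 ~= 0" using generic_exists by blast
 then have "pt x0 \<in> ?U" using U by (auto simp: acone_def)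
 then show "?U ~= {}" by blast
 show "?V ~= {}" using FV[OF x0] by blast
 show "homogeneous_map FF" "homogeneous_map GG" unfolding homogeneous_map_def using hpoly_FF hpoly_GG by blast+
 show "ALL p:?U. ALL x:line_of p. x ~= 0 --> FF x ~= 0 & pt (FF x) \<in> ?V & pt (GG (FF x)) = p"
 proof (intro ballI impI)
  fix p x assume p: "p \<in> ?U" "x \<in> line_of p" "x ~= 0"
  then have px: "p = pt x" using line_of_eq_pt by blast
  then have x: "x \<in> acone S" "chi x ~= 0" using U[OF p(3)] p(1) by auto
  obtain c where "c ~= 0" "GG (FF x) = c *s x" using generic_FG(2)[OF x] by blast
  then show "FF x ~= 0 & pt (FF x) \<in> ?V & pt (GG (FF x)) = p"
   using generic_FG(1)[OF x] FV[OF x] pt_scale[OF p(3)] px by simp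
 qed
 show "ALL q:?V. ALL y:line_of q. y ~= 0 --> GG y ~= 0 & pt (GG y) \<in> ?U & pt (FF (GG y)) = q"
 proof (intro ballI impI)
  fix q y assume q: "q \<in> ?V" "y \<in> line_of q" "y ~= 0"
  then have qy: "q = pt y" using line_of_eq_pt by blast
  then have y: "y \<in> acone ZZ" "chi (GG y) ~= 0" using V[OF q(3)] q(1) by auto
  note G = GG_generic[OF y]
  have "GG y ~= 0" using y(2) chi_zero by auto
  then show "GG y ~= 0 & pt (GG y) \<in> ?U & pt (FF (GG y)) = q" using U G y(2) qy by simp
 qed
qed

section \<open>Dimension of the cuspidal locus\<close>

lemma no_long_chain: "\<not> irred_chain zariski ZZ (Suc 2)"
proof -
 have "bip (%z. L (\<Xi> (fst z) (snd z)) $ i)" for i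
  unfolding L_def matrix_vector_mult_def by (simp, intro bip_sum bip_mult bip_const bip_Xi)
 then obtain B where B: "!!i. bipoly B (%z. L (\<Xi> (fst z) (snd z)) $ i)"
  using bip_uniform[of "%i z. L (\<Xi> (fst z) (snd z)) $ i"] by blast
 have "forms_bound ZZ 2 ((B + 1) ^ 2)"
 proof (rule forms_bound_parametrized[OF B])
  fix d q x assume q: "q \<in> hpoly d" and van: "!!z. q (L (\<Xi> (fst z) (snd z))) = 0" and x: "x \<in> acone ZZ"
  show "q x = 0"
  proof (rule ZZ_vanish[OF q _ x])
   fix y assume "y \<in> acone S" "chi y ~= 0"
   then obtain c s w where y: "c ~= 0" "generic s w" "y = c *s (M *v aff s w (fib s w))" using generic_cases by blast
   show "q (FF y) = 0" unfolding y(3) FF_scale generic_point(3)[OF y(2)] using van[of "(s, w)"] hpolyD[OF q] by simp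
  qed
 qed
 then show ?thesis by (rule no_irred_chain_3)
qed

text \<open>The inverse map \<open>GG\<close> recovers the point, and with it s and w.\<close>

lemma FF_injective:
 assumes "generic s w" "generic s' w'" "pt (L (\<Xi> s w)) = pt (L (\<Xi> s' w'))"
 shows "s = s'" "w = w'"
proof -
 note P = generic_point[OF assms(1)] and P' = generic_point[OF assms(2)]
 obtain t where t: "t ~= 0" "L (\<Xi> s' w') = t *s L (\<Xi> s w)" using pt_eq_iff[OF P(4) P'(4)] assms(3) by blast
 obtain c where c: "c ~= 0" "GG (L (\<Xi> s w)) = c *s (M *v aff s w (fib s w))" using P(5) by blast
 obtain c' where c': "c' ~= 0" "GG (L (\<Xi> s' w')) = c' *s (M *v aff s' w' (fib s' w'))" using P'(5) by blast
 have "c' *s (M *v aff s' w' (fib s' w')) = (t ^ 6 * c) *s (M *v aff s w (fib s w))"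
  using c'(2) unfolding t(2) GG_scale c(2) by simp
 then have "N *v (c' *s (M *v aff s' w' (fib s' w'))) = N *v ((t ^ 6 * c) *s (M *v aff s w (fib s w)))" by simp
 then have e: "c' *s aff s' w' (fib s' w') = (t ^ 6 * c) *s aff s w (fib s w)" by (simp only: N_smult NM)
 have "c' = t ^ 6 * c" using arg_cong[OF e, of "%v. v $ 2"] by simp
 then have "c' *s aff s' w' (fib s' w') = c' *s aff s w (fib s w)" using e by simp
 then have e': "c' * aff s' w' (fib s' w') $ i = c' * aff s w (fib s w) $ i" for i by (metis vector_smult_component)
 show "s = s'" "w = w'" using e'[of 1] e'[of 3] c'(1) by simp_all
qed

text \<open>Point, curve, surface: the curve is the closure of the hyperplanes that belong to one
  fibre s = s0 of the conic bundle.\<close>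

lemma chain_ZZ: "irred_chain zariski ZZ 2"
proof -
 obtain s0 where s0: "poly (goodP a f g) s0 ~= 0" by (rule exists_good) (rule that)
 define T where "T = {w. generic s0 w}"
 have T: "infinite T" unfolding T_def by (rule infinite_generic[OF s0])
 define C0 where "C0 = {pt (L (\<Xi> s0 w)) | w. w \<in> T}"
 have "bip (%z. L (\<Xi> (fst z) (snd z)) $ i)" for i
  unfolding L_def matrix_vector_mult_def by (simp, intro bip_sum bip_mult bip_const bip_Xi)
 then have par: "EX p. ALL w. L (\<Xi> s0 w) $ i = poly p w" for i
  using bip_fiber[of "%z. L (\<Xi> (fst z) (snd z)) $ i" s0] by simp
 have irrC0: "irred_in zariski C0"
  unfolding C0_def by (rule irred_in_param_curve[OF par T]) (use generic_point(4) T_def in blast)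
 define C where "C = zariski closure_of C0"
 have C: "closedin zariski C" "irred_in zariski C" "C0 \<subseteq> C"
  unfolding C_def using irred_in_closure[OF irrC0] closure_of_subset[of C0 zariski] by simp_all
 have C0Z: "pt (L (\<Xi> s w)) \<in> ZZ" if "generic s w" for s w
  using FF_in_ZZ[OF generic_point(1)[OF that]] generic_point(3,4)[OF that] by simp
 then have "C0 \<subseteq> ZZ" by (auto simp: C0_def T_def)
 then have CZ: "C \<subseteq> ZZ" unfolding C_def by (rule closure_of_minimal[OF _ closed_ZZ])
 obtain w0 where w0: "w0 \<in> T" using T infinite_imp_nonempty by blast
 define H0 where "H0 = pt (L (\<Xi> s0 w0))"
 have H0: "H0 \<in> C" using C(3) w0 by (auto simp: C0_def H0_def)
 have "infinite (T - {w0})" using T by simp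
 then obtain w1 where w1: "w1 \<in> T" "w1 ~= w0" using infinite_imp_nonempty by blast
 have H1: "pt (L (\<Xi> s0 w1)) \<in> C" "pt (L (\<Xi> s0 w1)) ~= H0"
  using C(3) w1 w0 FF_injective(2) unfolding C0_def H0_def T_def by blast+
 have "C ~= ZZ"
 proof
  assume CZ: "C = ZZ"
  have "goodP a f g * [:- s0, 1:] ~= 0" using good_nonzero by (simp only: mult_eq_0_iff) simp
  then obtain s1 where "poly (goodP a f g * [:- s0, 1:]) s1 ~= 0" using exists_nonroot by blast
  then have s1: "poly (goodP a f g) s1 ~= 0" "s1 ~= s0" by auto
  obtain w where w: "generic s1 w" using exists_generic[OF s1(1)] by blast
  \<comment> \<open>The pullback along \<open>GG\<close> of the linear form y1 - s0 y2; it vanishes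
    on the curve but at no generic hyperplane with another value of s.\<close>
  define q where "q h = (N *v GG h) $ 1 - s0 * (N *v GG h) $ 2" for h
  have NG: "(%h. (N *v GG h) $ i) \<in> hpoly 6" for i
   using hpoly_compose[OF hpoly_matrix[of N i] hpoly_GG] by simp
  have q: "q \<in> hpoly 6" unfolding q_def by (intro hpoly_diff hpoly_cmult NG)
  have qv: "EX c. c ~= 0 & q (L (\<Xi> s w)) = c * (s - s0)" if g: "generic s w" for s w
  proof -
   obtain c where c: "c ~= 0" "GG (L (\<Xi> s w)) = c *s (M *v aff s w (fib s w))" using generic_point(5)[OF g] by blast
   have "q (L (\<Xi> s w)) = c * (s - s0)" unfolding q_def c N_smult NM by (simp add: algebra_simps)
   then show ?thesis using c(1) by blast
  qed
  have "q y = 0" if y: "y \<in> acone C0" for y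
  proof -
   have y0: "y ~= 0" using y by (simp add: acone_def)
   obtain w' where w': "generic s0 w'" "pt y = pt (L (\<Xi> s0 w'))" using y unfolding acone_def C0_def T_def by blast
   obtain c where "y = c *s L (\<Xi> s0 w')" using pt_eq_iff[OF generic_point(4)[OF w'(1)] y0] w'(2) by metis
   then show ?thesis using qv[OF w'(1)] hpolyD[OF q] by auto
  qed
  moreover have "L (\<Xi> s1 w) \<in> acone C" using C0Z[OF w] generic_point(4)[OF w] by (simp add: CZ acone_def)
  ultimately have "q (L (\<Xi> s1 w)) = 0" unfolding C_def using vanish_closure[OF q] by blast
  then show False using qv[OF w] s1(2) by auto
 qed
 then have strict: "{H0} \<subset> C" "C \<subset> ZZ" using H0 H1 CZ by blast+
 define W where "W i = (if i = 0 then {H0} else if i = 1 then C else ZZ)" for i :: nat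
 show ?thesis
  unfolding irred_chain_def
 proof (intro exI[of _ W] conjI allI impI)
  show "closedin zariski (W i)" "irred_in zariski (W i)" "W i \<subseteq> ZZ" for i
   using closedin_point irred_in_point C closed_ZZ irred_ZZ strict by (auto simp: W_def)
  fix i :: nat assume "i < 2"
  then have "i = 0 | i = 1" by linarith
  then show "W i \<subset> W (Suc i)" using strict by (auto simp: W_def)
 qed
qed

theorem cuspidal_locus_surface: "irreducible_variety (cuspidal_locus S) 2 & birational S (cuspidal_locus S)"
 unfolding cuspidal_locus_eq irreducible_variety_def has_dim_def
 using closed_ZZ irred_ZZ chain_ZZ no_long_chain birational_ZZ by blast

end

theorem corollary3p17:
  fixes S :: "5 cp set"
  assumes "segre_surface S"
    and "has_segre_symbol S \<sigma>"
    and "\<sigma> \<in> {segre_symbol [[1], [1], [1], [1, 1]], segre_symbol [[1], [2], [1, 1]],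
              segre_symbol [[1], [1], [1, 2]], segre_symbol [[1], [1, 3]],
              segre_symbol [[1, 1], [3]], segre_symbol [[1, 2], [2]], segre_symbol [[1, 4]]}"
  shows "irreducible_variety (cuspidal_locus S) 2 \<and> birational S (cuspidal_locus S)"
proof -
 \<comment> \<open>Each symbol has one parenthesized pair containing a 1; the other entry is k, and
   all remaining eigenvalues have single blocks.\<close>
 have "EX k \<tau>. 1 \<le> k & \<sigma> = add_mset {#1, k#} \<tau> & (ALL \<rho>. \<rho> \<in># \<tau> --> size \<rho> = 1)"
 proof -
  have "segre_symbol [[1], [1], [1], [1, 1]] = add_mset {#1, 1#} {#{#1#}, {#1#}, {#1#}#}"
   "segre_symbol [[1], [2], [1, 1]] = add_mset {#1, 1#} {#{#1#}, {#2#}#}"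
   "segre_symbol [[1], [1], [1, 2]] = add_mset {#1, 2#} {#{#1#}, {#1#}#}"
   "segre_symbol [[1], [1, 3]] = add_mset {#1, 3#} {#{#1#}#}"
   "segre_symbol [[1, 1], [3]] = add_mset {#1, 1#} {#{#3#}#}"
   "segre_symbol [[1, 2], [2]] = add_mset {#1, 2#} {#{#2#}#}"
   "segre_symbol [[1, 4]] = add_mset {#1, 4#} {#}"
   by (simp_all add: segre_symbol_def add_mset_commute)
  note E = this
  have P: "EX k \<tau>'. 1 \<le> k & \<sigma> = add_mset {#1, k#} \<tau>' & (ALL \<rho>. \<rho> \<in># \<tau>' --> size \<rho> = 1)"
   if "\<sigma> = add_mset {#1, k#} \<tau>" "1 \<le> k" "ALL \<rho>. \<rho> \<in># \<tau> --> size \<rho> = 1" for k \<tau>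
   using that by blast
  show ?thesis
   by (insert assms(3), unfold E, elim insertE emptyE; (rule P, assumption, simp, force))
 qed
 then obtain k \<tau> where k: "1 \<le> k" "\<sigma> = add_mset {#1, k#} \<tau>" "!!\<rho>. \<rho> \<in># \<tau> ==> size \<rho> = 1" by blast
 obtain M a b f g where "segre_form S M a b f g"
  by (rule segre_normal_form[OF assms(2)[unfolded k(2)] k(1,3)]) (assumption, rule that)
 moreover have "irreducible_variety S 2" using assms(1) by (simp add: segre_surface_def)
 ultimately interpret segre_surface_form S M a b f g
  by (simp add: segre_surface_form_def segre_surface_form_axioms_def)
 show ?thesis by (rule cuspidal_locus_surface)
qed

end
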